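(* Let $a,b\in\{0,1,t\}$ with $a\neq b$. (1) For $p\in\{a,b\}$ let $M'^{(p)}$ be the monodromy matrix along the cycle $\gamma_p$ with respect to some fixed basis of solutions of $D_{y_1}(\theta_0,\theta_1,\theta_t,\theta_\infty;\lambda,\mu)$, and let $M^{(p)}$ be the monodromy matrix along $\gamma_p$ with respect to some fixed basis of solutions of $D_{y_1}(\tilde\theta_0,\tilde\theta_1,\tilde\theta_t,\tilde\theta_\infty;\tilde\lambda,\tilde\mu)$. Then for all $n\in\mathbb{Z}$ $$\mathrm{tr}\big((M^{(a)}M^{(b)})^n\big)=e^{2\pi\sqrt{-1}\,n\kappa_2}\,\mathrm{tr}\big((M'^{(a)}M'^{(b)})^n\big).$$ (2) For $p\in\{a,b\}$ let $M'^{(p)}$ be the monodromy matrix along $\gamma_p$ with respect to some fixed basis of solutions of Heun's equation $(\mathrm{He}')$, and let $M^{(p)}$ be the monodromy matrix along $\gamma_p$ with respect to some fixed basis of solutions of Heun's equation $(\mathrm{He})$. Then for all $n\in\mathbb{Z}$ $$\mathrm{tr}\big((M^{(a)}M^{(b)})^n\big)=e^{-2\pi\sqrt{-1}\,n\eta}\,\mathrm{tr}\big((M'^{(a)}M'^{(b)})^n\big).$$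
   Context: Fix $t\in\mathbb{C}\setminus\{0,1\}$. The equation $D_{y_1}$. For complex $\theta_0,\theta_1,\theta_t,\theta_\infty,\mu$ and $\lambda\notin\{0,1,t,\infty\}$ put $\kappa_1=(\theta_\infty-\theta_0-\theta_1-\theta_t)/2$, $\kappa_2=-(\theta_\infty+\theta_0+\theta_1+\theta_t)/2$, $$H=\tfrac{1}{t(t-1)}\big\{\lambda(\lambda-1)(\lambda-t)\mu^2-\{\theta_0(\lambda-1)(\lambda-t)+\theta_1\lambda(\lambda-t)+(\theta_t-1)\lambda(\lambda-1)\}\mu+\kappa_1(\kappa_2+1)(\lambda-t)\big\},$$ and let $D_{y_1}(\theta_0,\theta_1,\theta_t,\theta_\infty;\lambda,\mu)$ be the differential equation $$y''+\Big(\tfrac{1-\theta_0}{z}+\tfrac{1-\theta_1}{z-1}+\tfrac{1-\theta_t}{z-t}-\tfrac{1}{z-\lambda}\Big)y'+\Big(\tfrac{\kappa_1(\kappa_2+1)}{z(z-1)}+\tfrac{\lambda(\lambda-1)\mu}{z(z-1)(z-\lambda)}-\tfrac{t(t-1)H}{z(z-1)(z-t)}\Big)y=0$$ (the singularity $z=\lambda$ has trivial monodromy). Put $\tilde\theta_p=\kappa_2+\theta_p$ ($p=0,1,t,\infty$), $$\tilde\lambda=\lambda-\frac{\kappa_2}{\mu-\frac{\theta_0}{\lambda}-\frac{\theta_1}{\lambda-1}-\frac{\theta_t}{\lambda-t}},\qquad \tilde\mu=\frac{\kappa_2+\theta_0}{\tilde\lambda}+\frac{\kappa_2+\theta_1}{\tilde\lambda-1}+\frac{\kappa_2+\theta_t}{\tilde\lambda-t}+\frac{\kappa_2}{\lambda-\tilde\lambda};$$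 it is assumed that these expressions are defined and $\tilde\lambda\notin\{0,1,t,\infty\}$. The Heun pair. Let $\alpha,\beta,\epsilon_0,\epsilon_1,\epsilon_t,q\in\mathbb{C}$ with $\epsilon_0+\epsilon_1+\epsilon_t=\alpha+\beta+1$, let $\eta\in\{\alpha,\beta\}$, $\epsilon_p'=\epsilon_p-\eta+1$ ($p=0,1,t$), $\{\alpha',\beta'\}=\{2-\eta,\alpha+\beta-2\eta+1\}$, $q'=q+(1-\eta)(\epsilon_t+\epsilon_1t+(\epsilon_0-\eta)(t+1))$. The equations are $(\mathrm{He})$: $y''+\big(\frac{\epsilon_0}{z}+\frac{\epsilon_1}{z-1}+\frac{\epsilon_t}{z-t}\big)y'+\frac{\alpha\beta z-q}{z(z-1)(z-t)}y=0$; $(\mathrm{He}')$: $v''+\big(\frac{\epsilon_0'}{w}+\frac{\epsilon_1'}{w-1}+\frac{\epsilon_t'}{w-t}\big)v'+\frac{\alpha'\beta'w-q'}{w(w-1)(w-t)}v=0$. Monodromy. Fix a base point $o$. $\gamma_p$ is the loop starting and ending at $o$ and going once counterclockwise around $p$; the same loops are used for both equations of a pair. For a basis $(y,y^{(2)})$ of solutions near $o$ and $\gamma$ a loop, the monodromy matrix $M$ along $\gamma$ is defined by $(y^\gamma,y^{(2)\gamma})=(y,y^{(2)})M$, where $y^\gamma$ is the analytic continuation of $y$ along $\gamma$. For a given equation the same basis is used for $p=a$ and $p=b$. *)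

theory Defs
  imports "HOL-Complex_Analysis.Complex_Analysis"
begin

section \<open>Second order linear differential equations, as germs\<close>

text \<open>A function represents its germ at the point under consideration; its values away from
  that point are irrelevant.  The equation is \<open>y'' + P y' + Q y = 0\<close>.\<close>

definition ode_solution_at ::
    "(complex \<Rightarrow> complex) \<Rightarrow> (complex \<Rightarrow> complex) \<Rightarrow> complex \<Rightarrow> (complex \<Rightarrow> complex) \<Rightarrow> bool" where
  "ode_solution_at P Q x0 y \<longleftrightarrow>
     y analytic_on {x0} \<and>
     (\<forall>\<^sub>F z in nhds x0. deriv (deriv y) z + P z * deriv y z + Q z * y z = 0)"

definition ode_basis_at ::
    "(complex \<Rightarrow> complex) \<Rightarrow> (complex \<Rightarrow> complex) \<Rightarrow> complex \<Rightarrow>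
     (complex \<Rightarrow> complex) \<Rightarrow> (complex \<Rightarrow> complex) \<Rightarrow> bool" where
  "ode_basis_at P Q x0 y1 y2 \<longleftrightarrow>
     ode_solution_at P Q x0 y1 \<and> ode_solution_at P Q x0 y2 \<and>
     (\<forall>c1 c2. (\<forall>\<^sub>F z in nhds x0. c1 * y1 z + c2 * y2 z = 0) \<longrightarrow> c1 = 0 \<and> c2 = 0) \<and>
     (\<forall>y. ode_solution_at P Q x0 y \<longrightarrow>
        (\<exists>c1 c2. \<forall>\<^sub>F z in nhds x0. y z = c1 * y1 z + c2 * y2 z))"


section \<open>Analytic continuation and monodromy matrices\<close>

text \<open>\<open>g\<close> is obtained from \<open>f\<close> by analytic continuation along \<open>\<gamma>\<close>: there is a family of
  germs \<open>F s\<close> of analytic functions at \<open>\<gamma> s\<close> such that, for \<open>s'\<close> near \<open>s\<close>, the germs of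
  \<open>F s'\<close> and \<open>F s\<close> at \<open>\<gamma> s'\<close> coincide.\<close>

definition continuation_along ::
    "(real \<Rightarrow> complex) \<Rightarrow> (complex \<Rightarrow> complex) \<Rightarrow> (complex \<Rightarrow> complex) \<Rightarrow> bool" where
  "continuation_along \<gamma> f g \<longleftrightarrow>
     (\<exists>F. F 0 = f \<and> F 1 = g \<and>
        (\<forall>s\<in>{0..1}. F s analytic_on {\<gamma> s} \<and>
           (\<forall>\<^sub>F s' in at s within {0..1}. \<forall>\<^sub>F z in nhds (\<gamma> s'). F s' z = F s z)))"

text \<open>The matrix acts from the right on the row of basis functions, so the coefficients of the
  continuation of \<open>y\<^sub>j\<close> form the \<open>j\<close>-th column.\<close>

definition monodromy_matrix ::
    "(real \<Rightarrow> complex) \<Rightarrow> (complex \<Rightarrow> complex) \<Rightarrow> (complex \<Rightarrow> complex) \<Rightarrow> complex^2^2 \<Rightarrow> bool" where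
  "monodromy_matrix \<gamma> y1 y2 M \<longleftrightarrow>
     (\<exists>g1 g2. continuation_along \<gamma> y1 g1 \<and> continuation_along \<gamma> y2 g2 \<and>
        (\<forall>\<^sub>F z in nhds (pathfinish \<gamma>).
           (vector [g1 z, g2 z] :: complex^2) = vector [y1 z, y2 z] v* M))"

definition matrix_power_int :: "complex^2^2 \<Rightarrow> int \<Rightarrow> complex^2^2" where
  "matrix_power_int A n =
     (if n \<ge> 0 then (((**) A) ^^ nat n) (mat 1)
      else (((**) (matrix_inv A)) ^^ nat (- n)) (mat 1))"


section \<open>The loops\<close>

text \<open>\<open>S\<close> is the set of punctures.  Winding numbers alone do not determine a loop going once
  around \<open>p\<close>.\<close>

definition simple_loop_around :: "complex set \<Rightarrow> complex \<Rightarrow> complex \<Rightarrow> (real \<Rightarrow> complex) \<Rightarrow> bool" where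
  "simple_loop_around S x0 p \<sigma> \<longleftrightarrow>
     simple_path \<sigma> \<and> pathstart \<sigma> = x0 \<and> pathfinish \<sigma> = x0 \<and> path_image \<sigma> \<inter> S = {} \<and>
     winding_number \<sigma> p = 1 \<and> (\<forall>q\<in>S - {p}. winding_number \<sigma> q = 0)"

text \<open>The loops \<open>\<gamma> p\<close>, \<open>p \<in> A\<close>, are the usual generators of the fundamental group of the
  complement of \<open>S\<close>: up to homotopy with fixed base point they are simultaneously realised by
  simple loops, each going once counterclockwise around its own puncture and around no other,
  that meet only at the base point.  (The homotopy admits loops such as those that follow a
  segment, run around a small circle and return.)  Without the condition that they meet only at
  the base point, the free homotopy class of a product of two of them would not be that of a
  simple curve around two punctures.\<close>

definition loop_system :: "complex set \<Rightarrow> complex set \<Rightarrow> complex \<Rightarrow> (complex \<Rightarrow> real \<Rightarrow> complex) \<Rightarrow> bool"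
  where
  "loop_system S A x0 \<gamma> \<longleftrightarrow>
     (\<exists>\<sigma>. (\<forall>p\<in>A. simple_loop_around S x0 p (\<sigma> p) \<and> homotopic_paths (- S) (\<gamma> p) (\<sigma> p)) \<and>
          (\<forall>p\<in>A. \<forall>q\<in>A. p \<noteq> q \<longrightarrow> path_image (\<sigma> p) \<inter> path_image (\<sigma> q) = {x0}))"


section \<open>The equation with an apparent singularity\<close>

text \<open>The arguments \<open>h0 h1 ht hi\<close> stand for \<open>\<theta>\<^sub>0, \<theta>\<^sub>1, \<theta>\<^sub>t, \<theta>\<^sub>\<infinity>\<close>, and \<open>l m\<close> for
  \<open>\<lambda>, \<mu>\<close>.\<close>

definition kappa1 :: "complex \<Rightarrow> complex \<Rightarrow> complex \<Rightarrow> complex \<Rightarrow> complex" where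
  "kappa1 h0 h1 ht hi = (hi - h0 - h1 - ht) / 2"

definition kappa2 :: "complex \<Rightarrow> complex \<Rightarrow> complex \<Rightarrow> complex \<Rightarrow> complex" where
  "kappa2 h0 h1 ht hi = - (hi + h0 + h1 + ht) / 2"

definition Dy1_H ::
    "complex \<Rightarrow> complex \<Rightarrow> complex \<Rightarrow> complex \<Rightarrow> complex \<Rightarrow> complex \<Rightarrow> complex \<Rightarrow> complex" where
  "Dy1_H t h0 h1 ht hi l m =
     1 / (t * (t - 1)) *
       (l * (l - 1) * (l - t) * m^2
        - (h0 * (l - 1) * (l - t) + h1 * l * (l - t) + (ht - 1) * l * (l - 1)) * m
        + kappa1 h0 h1 ht hi * (kappa2 h0 h1 ht hi + 1) * (l - t))"

definition Dy1_P ::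
    "complex \<Rightarrow> complex \<Rightarrow> complex \<Rightarrow> complex \<Rightarrow> complex \<Rightarrow> complex \<Rightarrow> complex" where
  "Dy1_P t h0 h1 ht l z =
     (1 - h0) / z + (1 - h1) / (z - 1) + (1 - ht) / (z - t) - 1 / (z - l)"

definition Dy1_Q ::
    "complex \<Rightarrow> complex \<Rightarrow> complex \<Rightarrow> complex \<Rightarrow> complex \<Rightarrow> complex \<Rightarrow> complex \<Rightarrow> complex \<Rightarrow> complex" where
  "Dy1_Q t h0 h1 ht hi l m z =
     kappa1 h0 h1 ht hi * (kappa2 h0 h1 ht hi + 1) / (z * (z - 1))
     + l * (l - 1) * m / (z * (z - 1) * (z - l))
     - t * (t - 1) * Dy1_H t h0 h1 ht hi l m / (z * (z - 1) * (z - t))"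

definition Dy1_basis_at ::
    "complex \<Rightarrow> complex \<Rightarrow> complex \<Rightarrow> complex \<Rightarrow> complex \<Rightarrow> complex \<Rightarrow> complex \<Rightarrow>
     complex \<Rightarrow> (complex \<Rightarrow> complex) \<Rightarrow> (complex \<Rightarrow> complex) \<Rightarrow> bool" where
  "Dy1_basis_at t h0 h1 ht hi l m x0 y1 y2 \<longleftrightarrow>
     ode_basis_at (Dy1_P t h0 h1 ht l) (Dy1_Q t h0 h1 ht hi l m) x0 y1 y2"


section \<open>Heun's equation\<close>

definition Heun_P :: "complex \<Rightarrow> complex \<Rightarrow> complex \<Rightarrow> complex \<Rightarrow> complex \<Rightarrow> complex" where
  "Heun_P t e0 e1 et z = e0 / z + e1 / (z - 1) + et / (z - t)"

definition Heun_Q :: "complex \<Rightarrow> complex \<Rightarrow> complex \<Rightarrow> complex \<Rightarrow> complex \<Rightarrow> complex" where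
  "Heun_Q t \<alpha> \<beta> q z = (\<alpha> * \<beta> * z - q) / (z * (z - 1) * (z - t))"

definition Heun_basis_at ::
    "complex \<Rightarrow> complex \<Rightarrow> complex \<Rightarrow> complex \<Rightarrow> complex \<Rightarrow> complex \<Rightarrow> complex \<Rightarrow>
     complex \<Rightarrow> (complex \<Rightarrow> complex) \<Rightarrow> (complex \<Rightarrow> complex) \<Rightarrow> bool" where
  "Heun_basis_at t e0 e1 et \<alpha> \<beta> q x0 y1 y2 \<longleftrightarrow>
     ode_basis_at (Heun_P t e0 e1 et) (Heun_Q t \<alpha> \<beta> q) x0 y1 y2"

end

theory Submission
  imports Defs
begin

text \<open>Both equations of a pair are satisfied by the first components of the solutions of Fuchsian systems
  \<open>Y' = (\<Sum>p. b\<^sub>p c\<^sub>p / (z - p)) Y\<close> with residues of rank one at \<open>0, 1, t\<close>.  The data of the two systems are related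
  by \<open>c'\<^sub>p \<bullet> b'\<^sub>q = c\<^sub>p \<bullet> b\<^sub>q + \<kappa> \<delta>\<^sub>p\<^sub>q\<close>, where \<open>\<kappa>\<close> is \<open>\<kappa>\<^sub>2\<close> respectively \<open>1 - \<eta>\<close>, so that the Euler
  transform \<open>\<integral> c\<^sub>p \<bullet> Y(w) / (w - p) (z - w)\<^sup>\<kappa> dw\<close> maps solutions of one to solutions of the other.

  The product of the two loops is freely homotopic to the image of a circle under a conformal map of the unit
  disc whose image contains \<open>a\<close> and \<open>b\<close> but not the third puncture.  Integrating once around this annulus from
  \<open>z\<close> back to \<open>z\<close>, the path of integration moves along with \<open>z\<close>, and continuation of \<open>z\<close> around the annulus
  multiplies the kernel by \<open>exp (2 \<pi> \<i> \<kappa>)\<close>.  Hence the transform intertwines one product of monodromies with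
  \<open>exp (2 \<pi> \<i> \<kappa>)\<close> times the other.  As their determinants are known, the Cayley-Hamilton theorem yields the
  relation of the traces as soon as the transform does not vanish.  This is seen directly for \<open>\<kappa> = 2\<close>, when the
  kernel is a polynomial; the general case follows by analytic continuation in the parameters, along a line that
  reaches \<open>\<kappa> = 2\<close>.\<close>

no_notation fps_nth (infixl "$" 75)

section \<open>Fundamental matrices of Fuchsian systems\<close>

text \<open>Only the conjugacy class of the product of the two monodromies enters, so the Euler
  transform need not be taken around single punctures: one turn of an annulus that encloses
  \<open>a\<close> and \<open>b\<close> suffices, whatever the local exponents. The intertwiner that
  it yields may be singular; in rank two a nonzero one is enough once the determinants are known. If
  it vanishes at \<kappa> = 2, the product G satisfies (G - 1)^2 = 0 and has determinant 1. Hence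
  the reference point is chosen with residues of trace 1/4, where the product of two loops has
  determinant -1.

  Continuation in the parameters needs both systems in one entire family. With \<mu> as a parameter
  the new position \<lambda>' would have moving poles; so \<lambda> and \<lambda>' are kept fixed,
  \<mu> is expressed through them, and the vectors b and c become affine in \<theta> and \<kappa>.
  The two systems are then exchanged by (\<theta>, \<kappa>, \<lambda>, \<lambda>') -> (\<theta> +
  \<kappa>, -\<kappa>, \<lambda>', \<lambda>).\<close>

definition fuchs :: "complex set \<Rightarrow> (complex \<Rightarrow> complex^'n^'n) \<Rightarrow> complex \<Rightarrow> complex^'n^'n" where
  "fuchs S R z = (\<chi> i j. \<Sum>p\<in>S. R p $ i $ j / (z - p))"

text \<open>Taylor coefficients of \<open>fuchs S R\<close> at \<open>z0\<close>: the geometric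
  series of 1/(z - p) is minus the sum of (z - z0)^k / (p - z0)^(k+1), whence the sign and the
  exponent \<open>Suc k\<close>.\<close>

definition fuchs_coeff :: "complex set \<Rightarrow> (complex \<Rightarrow> complex^'n^'n) \<Rightarrow> complex \<Rightarrow> nat \<Rightarrow> complex^'n^'n" where
  "fuchs_coeff S R z0 k = (\<chi> i j. - (\<Sum>p\<in>S. R p $ i $ j / (p - z0) ^ Suc k))"

text \<open>Comparison of coefficients in Y' = A Y with Y(z0) = 1. The recursion is kept explicit
  because every coefficient is visibly a polynomial in the residues; holomorphic dependence on
  parameters rests on this.\<close>

fun fund_coeff :: "complex set \<Rightarrow> (complex \<Rightarrow> complex^'n^'n) \<Rightarrow> complex \<Rightarrow> nat \<Rightarrow> complex^'n^'n" where
  "fund_coeff S R z0 0 = mat 1"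
| "fund_coeff S R z0 (Suc m) =
     (\<chi> i j. (\<Sum>k\<le>m. (fuchs_coeff S R z0 k ** fund_coeff S R z0 (m - k)) $ i $ j) / of_nat (Suc m))"

definition fund :: "complex set \<Rightarrow> (complex \<Rightarrow> complex^'n^'n) \<Rightarrow> complex \<Rightarrow> complex \<Rightarrow> complex^'n^'n" where
  "fund S R z0 z = (\<chi> i j. \<Sum>m. fund_coeff S R z0 m $ i $ j * (z - z0) ^ m)"

definition res_bound :: "complex set \<Rightarrow> (complex \<Rightarrow> complex^'n^'n) \<Rightarrow> real" where
  "res_bound S R = (\<Sum>p\<in>S. \<Sum>i\<in>UNIV. \<Sum>j\<in>UNIV. norm (R p $ i $ j))"

lemma res_bound_nonneg: "0 \<le> res_bound S R"
  unfolding res_bound_def by (intro sum_nonneg norm_ge_zero)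

lemma norm_fuchs_coeff_le:
  fixes R :: "complex \<Rightarrow> complex^'n^'n"
  assumes "finite S" "0 < d" "\<And>p. p \<in> S \<Longrightarrow> d \<le> dist p z0"
  shows "norm (fuchs_coeff S R z0 k $ i $ j) \<le> res_bound S R / d ^ Suc k"
proof -
  have "norm (fuchs_coeff S R z0 k $ i $ j) \<le> (\<Sum>p\<in>S. norm (R p $ i $ j / (p - z0) ^ Suc k))"
    unfolding fuchs_coeff_def by (simp add: norm_sum del: power_Suc)
  also have "\<dots> \<le> (\<Sum>p\<in>S. norm (R p $ i $ j) / d ^ Suc k)"
  proof (intro sum_mono)
    fix p assume "p \<in> S"
    then have "d \<le> norm (p - z0)" using assms(3) by (simp add: dist_norm)
    then have "d ^ Suc k \<le> norm (p - z0) ^ Suc k" using assms(2) by (intro power_mono) auto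
    then show "norm (R p $ i $ j / (p - z0) ^ Suc k) \<le> norm (R p $ i $ j) / d ^ Suc k"
      using assms(2) unfolding norm_divide norm_power by (intro divide_left_mono mult_pos_pos zero_less_power \<open>0 < d\<close>)
       (use \<open>d \<le> norm (p - z0)\<close> in \<open>auto intro: less_le_trans\<close>)
  qed
  also have "\<dots> \<le> (\<Sum>p\<in>S. (\<Sum>i\<in>UNIV. \<Sum>j\<in>UNIV. norm (R p $ i $ j)) / d ^ Suc k)"
  proof (intro sum_mono divide_right_mono)
    fix p
    have "norm (R p $ i $ j) \<le> (\<Sum>j\<in>UNIV. norm (R p $ i $ j))"
      by (rule member_le_sum) auto
    also have "\<dots> \<le> (\<Sum>i\<in>UNIV. \<Sum>j\<in>UNIV. norm (R p $ i $ j))"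
      by (rule member_le_sum[of i]) (auto intro!: sum_nonneg)
    finally show "norm (R p $ i $ j) \<le> (\<Sum>i\<in>UNIV. \<Sum>j\<in>UNIV. norm (R p $ i $ j))" .
  qed (use assms in auto)
  finally show ?thesis by (simp add: res_bound_def sum_divide_distrib)
qed

text \<open>Coefficients of (1 - x)^(-a) * (1 - x)^(-1) = (1 - x)^(-(a + 1)).\<close>

lemma sum_pochhammer_over_fact:
  "(\<Sum>j\<le>m. pochhammer a j / fact j) = pochhammer (a + 1) m / (fact m :: real)"
proof (induction m)
  case (Suc m)
  have "pochhammer a (Suc m) = a * pochhammer (a + 1) m" by (simp add: pochhammer_rec)
  moreover have "pochhammer (a + 1) (Suc m) = (a + 1 + m) * pochhammer (a + 1) m"
    by (simp add: pochhammer_Suc)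
  ultimately have "pochhammer (a + 1) m / fact m + pochhammer a (Suc m) / fact (Suc m)
      = pochhammer (a + 1) (Suc m) / (fact (Suc m) :: real)"
    by (simp add: divide_simps) (simp add: algebra_simps)
  then show ?case using Suc by simp
qed simp

text \<open>Majorant method: the recursion is dominated by that of the scalar equation y' = a / (d -
  x) * y, whose solution (1 - x/d)^(-a) has the coefficients on the right. The residues enter
  through \<open>M\<close> only, so the bound is uniform over compact parameter sets.\<close>

lemma norm_fund_coeff_le:
  fixes R :: "complex \<Rightarrow> complex^'n^'n" and M :: real
  assumes "finite S" "0 < d" "\<And>p. p \<in> S \<Longrightarrow> d \<le> dist p z0" "res_bound S R \<le> M"
  shows "norm (fund_coeff S R z0 m $ i $ j) \<le> pochhammer (1 + CARD('n) * M) m / fact m / d ^ m"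
proof (induction m arbitrary: i j rule: less_induct)
  case (less m)
  define a where "a = 1 + CARD('n) * M"
  have M: "0 \<le> M" using res_bound_nonneg assms(4) order_trans by blast
  then have a: "1 \<le> a" "CARD('n) * M \<le> a" by (auto simp: a_def)
  have pp: "0 \<le> pochhammer a n" for n
    using a by (intro pochhammer_nonneg) auto
  show ?case
  proof (cases m)
    case 0
    then show ?thesis by (simp add: mat_def)
  next
    case (Suc n)
    have "norm ((fuchs_coeff S R z0 k ** fund_coeff S R z0 (n - k)) $ i $ j)
        \<le> (a / d ^ Suc n) * (pochhammer a (n - k) / fact (n - k))" if "k \<le> n" for k
    proof -
      have "norm ((fuchs_coeff S R z0 k ** fund_coeff S R z0 (n - k)) $ i $ j)
         \<le> (\<Sum>l\<in>UNIV. norm (fuchs_coeff S R z0 k $ i $ l) * norm (fund_coeff S R z0 (n - k) $ l $ j))"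
        unfolding matrix_matrix_mult_def
        by (simp add: sum_norm_le norm_mult)
      also have "\<dots> \<le> (\<Sum>l\<in>(UNIV::'n set). (M / d ^ Suc k) * (pochhammer a (n - k) / fact (n - k) / d ^ (n - k)))"
      proof (intro sum_mono mult_mono)
        fix l
        show "norm (fuchs_coeff S R z0 k $ i $ l) \<le> M / d ^ Suc k"
          by (rule order_trans[OF norm_fuchs_coeff_le[OF assms(1-3)]])
            (use assms(2,4) in \<open>auto intro!: divide_right_mono\<close>)
        show "norm (fund_coeff S R z0 (n - k) $ l $ j) \<le> pochhammer a (n - k) / fact (n - k) / d ^ (n - k)"
          using less[of "n - k" l j] Suc by (auto simp: a_def)
      qed (use M assms in auto)
      also have "\<dots> = (CARD('n) * M / (d ^ Suc k * d ^ (n - k))) * (pochhammer a (n - k) / fact (n - k))"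
        by (simp add: mult_ac)
      also have "d ^ Suc k * d ^ (n - k) = d ^ Suc n"
        using that by (simp flip: power_add)
      also have "(CARD('n) * M / d ^ Suc n) * (pochhammer a (n - k) / fact (n - k))
         \<le> (a / d ^ Suc n) * (pochhammer a (n - k) / fact (n - k))"
        using a pp assms(2) by (intro mult_right_mono divide_right_mono divide_nonneg_nonneg) auto
      finally show ?thesis .
    qed
    then have "norm (\<Sum>k\<le>n. (fuchs_coeff S R z0 k ** fund_coeff S R z0 (n - k)) $ i $ j)
        \<le> (\<Sum>k\<le>n. (a / d ^ Suc n) * (pochhammer a (n - k) / fact (n - k)))"
      by (intro sum_norm_le) auto
    also have "\<dots> = (a / d ^ Suc n) * (\<Sum>k\<le>n. pochhammer a k / fact k)"
      unfolding sum_distrib_left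
      by (rule sum.reindex_bij_witness[of _ "\<lambda>k. n - k" "\<lambda>k. n - k"]) auto
    also have "\<dots> = (pochhammer a (Suc n) / d ^ Suc n) / fact n"
      by (simp add: sum_pochhammer_over_fact pochhammer_rec)
    finally have "norm (\<Sum>k\<le>n. (fuchs_coeff S R z0 k ** fund_coeff S R z0 (n - k)) $ i $ j) / Suc n
         \<le> (pochhammer a (Suc n) / d ^ Suc n) / fact n / Suc n"
      by (intro divide_right_mono) auto
    then show ?thesis
      unfolding Suc fund_coeff.simps(2) vec_lambda_beta norm_divide norm_of_nat a_def[symmetric]
      by (simp add: mult_ac del: of_nat_Suc)
  qed
qed

lemma summable_pochhammer_over_fact:
  fixes x :: real
  assumes "0 \<le> x" "x < 1"
  shows "summable (\<lambda>m. pochhammer a m / fact m * x ^ m)"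
proof -
  define c where "c = (1 + x) / 2"
  have c: "x < c" "c < 1" using assms by (auto simp: c_def)
  have "(\<lambda>m. \<bar>a + real m\<bar> / real (Suc m) * x) \<longlonglongrightarrow> 1 * x"
  proof (intro tendsto_mult tendsto_const)
    have "(\<lambda>m. \<bar>(a - 1) / real (Suc m) + 1\<bar>) \<longlonglongrightarrow> \<bar>0 + 1\<bar>"
      by (intro tendsto_intros LIMSEQ_Suc[OF lim_const_over_n])
    moreover have "\<bar>(a - 1) / real (Suc m) + 1\<bar> = \<bar>a + real m\<bar> / real (Suc m)" for m
    proof -
      have "(a - 1) / real (Suc m) + 1 = (a + real m) / real (Suc m)"
        by (simp add: field_simps)
      then show ?thesis by (simp only: abs_divide abs_of_nat)
    qed
    ultimately show "(\<lambda>m. \<bar>a + real m\<bar> / real (Suc m)) \<longlonglongrightarrow> 1" by simp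
  qed
  then have "\<forall>\<^sub>F m in sequentially. \<bar>a + real m\<bar> / real (Suc m) * x < c"
    using c by (intro order_tendstoD) auto
  then obtain N where N: "\<And>m. m \<ge> N \<Longrightarrow> \<bar>a + real m\<bar> / real (Suc m) * x < c"
    by (auto simp: eventually_sequentially)
  show ?thesis
  proof (rule summable_ratio_test[OF c(2)])
    fix m assume "m \<ge> N"
    have "norm (pochhammer a (Suc m) / fact (Suc m) * x ^ Suc m)
       = (\<bar>a + real m\<bar> / real (Suc m) * x) * norm (pochhammer a m / fact m * x ^ m)"
      using assms unfolding pochhammer_Suc fact_Suc power_Suc real_norm_def abs_mult abs_divide
      by (simp add: mult_ac add_ac)
    also have "\<dots> \<le> c * norm (pochhammer a m / fact m * x ^ m)"
      using N[OF \<open>m \<ge> N\<close>] by (intro mult_right_mono) auto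
    finally show "norm (pochhammer a (Suc m) / fact (Suc m) * x ^ Suc m) \<le> c * norm (pochhammer a m / fact m * x ^ m)" .
  qed
qed

lemma summable_fund_coeff:
  fixes R :: "complex \<Rightarrow> complex^'n^'n"
  assumes "finite S" "\<And>p. p \<in> S \<Longrightarrow> d \<le> dist p z0" "norm h < d"
  shows "summable (\<lambda>m. norm (fund_coeff S R z0 m $ i $ j * h ^ m))"
proof (rule summable_comparison_test')
  have d: "0 < d" using assms(3) norm_ge_zero[of h] by linarith
  show "summable (\<lambda>m. pochhammer (1 + CARD('n) * res_bound S R) m / fact m * (norm h / d) ^ m)"
    using d assms(3) by (intro summable_pochhammer_over_fact) auto
  fix m :: nat assume "m \<ge> 0"
  have "norm (fund_coeff S R z0 m $ i $ j) * norm h ^ m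
      \<le> pochhammer (1 + CARD('n) * res_bound S R) m / fact m / d ^ m * norm h ^ m"
    using norm_fund_coeff_le[OF assms(1) d assms(2) order_refl] by (intro mult_right_mono) auto
  then show "norm (norm (fund_coeff S R z0 m $ i $ j * h ^ m)) \<le>
     pochhammer (1 + CARD('n) * res_bound S R) m / fact m * (norm h / d) ^ m"
    by (simp add: norm_mult norm_power power_divide)
qed

lemma fuchs_coeff_sums:
  fixes R :: "complex \<Rightarrow> complex^'n^'n"
  assumes "finite S" "\<And>p. p \<in> S \<Longrightarrow> d \<le> dist p z0" "norm (z - z0) < d"
  shows "(\<lambda>k. fuchs_coeff S R z0 k $ i $ j * (z - z0) ^ k) sums (fuchs S R z $ i $ j)"
    and "summable (\<lambda>k. norm (fuchs_coeff S R z0 k $ i $ j * (z - z0) ^ k))"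
proof -
  have *: "(\<lambda>k. - (R p $ i $ j / (p - z0) ^ Suc k) * (z - z0) ^ k) sums (R p $ i $ j / (z - p))" if "p \<in> S" for p
  proof -
    have "d \<le> norm (p - z0)" using assms(2)[OF that] by (simp add: dist_norm)
    with assms(3) have lt: "norm (z - z0) < norm (p - z0)" by linarith
    then have ne: "p - z0 \<noteq> 0" by auto
    have "norm ((z - z0) / (p - z0)) < 1" using lt ne by (simp add: norm_divide divide_simps)
    then have "(\<lambda>k. ((z - z0) / (p - z0)) ^ k) sums (1 / (1 - (z - z0) / (p - z0)))"
      by (rule geometric_sums)
    then have "(\<lambda>k. (- R p $ i $ j / (p - z0)) * ((z - z0) / (p - z0)) ^ k) sums
          ((- R p $ i $ j / (p - z0)) * (1 / (1 - (z - z0) / (p - z0))))"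
      by (rule sums_mult)
    moreover have "(- R p $ i $ j / (p - z0)) * ((z - z0) / (p - z0)) ^ k = - (R p $ i $ j / (p - z0) ^ Suc k) * (z - z0) ^ k" for k
      by (simp add: power_divide)
    moreover have "(- R p $ i $ j / (p - z0)) * (1 / (1 - (z - z0) / (p - z0))) = R p $ i $ j / (z - p)"
    proof -
      have "p \<noteq> z" using lt by auto
      have e: "1 - (z - z0) / (p - z0) = (p - z) / (p - z0)" using ne by (simp add: field_simps)
      show ?thesis unfolding e using ne \<open>p \<noteq> z\<close> by (simp add: divide_simps) (simp add: algebra_simps)
    qed
    ultimately show ?thesis by simp
  qed
  have "(\<lambda>k. \<Sum>p\<in>S. - (R p $ i $ j / (p - z0) ^ Suc k) * (z - z0) ^ k) sums (\<Sum>p\<in>S. R p $ i $ j / (z - p))"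
    by (intro sums_sum *)
  then show "(\<lambda>k. fuchs_coeff S R z0 k $ i $ j * (z - z0) ^ k) sums (fuchs S R z $ i $ j)"
    by (simp add: fuchs_coeff_def fuchs_def sum_negf sum_distrib_right del: power_Suc)
  have d: "0 < d" using assms(3) norm_ge_zero[of "z - z0"] by linarith
  show "summable (\<lambda>k. norm (fuchs_coeff S R z0 k $ i $ j * (z - z0) ^ k))"
  proof (rule summable_comparison_test')
    show "summable (\<lambda>k. res_bound S R / d * (norm (z - z0) / d) ^ k)"
      using assms(3) d by (intro summable_mult summable_geometric) auto
    fix k :: nat assume "k \<ge> 0"
    have "norm (fuchs_coeff S R z0 k $ i $ j) * norm (z - z0) ^ k \<le> res_bound S R / d ^ Suc k * norm (z - z0) ^ k"
      using norm_fuchs_coeff_le[OF assms(1) d assms(2)] by (intro mult_right_mono) auto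
    then show "norm (norm (fuchs_coeff S R z0 k $ i $ j * (z - z0) ^ k)) \<le> res_bound S R / d * (norm (z - z0) / d) ^ k"
      by (simp add: norm_mult norm_power power_divide)
  qed
qed

definition fuchs_sol :: "complex set \<Rightarrow> (complex \<Rightarrow> complex^'n^'n) \<Rightarrow> complex set \<Rightarrow> (complex \<Rightarrow> complex^'n^'n) \<Rightarrow> bool" where
  "fuchs_sol S R U Y \<longleftrightarrow>
     (\<forall>z\<in>U. \<forall>i j. ((\<lambda>z. Y z $ i $ j) has_field_derivative (fuchs S R z ** Y z) $ i $ j) (at z))"

lemma fund_at_base [simp]: "fund S R z0 z0 = mat 1"
  by (simp add: fund_def vec_eq_iff)

theorem fuchs_sol_fund:
  fixes R :: "complex \<Rightarrow> complex^'n^'n"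
  assumes "finite S" "\<And>p. p \<in> S \<Longrightarrow> d \<le> dist p z0"
  shows "fuchs_sol S R (ball z0 d) (fund S R z0)"
  unfolding fuchs_sol_def
proof (intro ballI allI)
  fix z i j assume z: "z \<in> ball z0 d"
  then have zd: "norm (z - z0) < d" by (simp add: dist_norm norm_minus_commute)
  let ?c = "\<lambda>m. fund_coeff S R z0 m $ i $ j"
  have summ: "summable (\<lambda>m. ?c m * h ^ m)" if "norm h < d" for h
    using summable_norm_cancel[OF summable_fund_coeff[OF assms that]] by simp
  obtain K where K: "norm (z - z0) < K" "K < d" using dense[OF zd] by auto
  have K0: "0 < K" using K(1) norm_ge_zero[of "z - z0"] by linarith
  have "((\<lambda>h. \<Sum>m. ?c m * h ^ m) has_field_derivative (\<Sum>m. diffs ?c m * (z - z0) ^ m)) (at (z - z0))"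
    by (rule termdiffs_strong[where K = "of_real K"]) (use K K0 summ[of "of_real K"] in auto)
  then have der: "((\<lambda>z. fund S R z0 z $ i $ j) has_field_derivative (\<Sum>m. diffs ?c m * (z - z0) ^ m)) (at z)"
    unfolding fund_def using DERIV_shift[of "\<lambda>h. \<Sum>m. ?c m * h ^ m" _ z "- z0"] by simp
  have prod: "(\<lambda>m. \<Sum>k\<le>m. (fuchs_coeff S R z0 k $ i $ l * (z - z0) ^ k) *
            (fund_coeff S R z0 (m - k) $ l $ j * (z - z0) ^ (m - k))) sums
      (fuchs S R z $ i $ l * fund S R z0 z $ l $ j)" for l
    using Cauchy_product_sums[OF fuchs_coeff_sums(2)[OF assms zd, of R i l] summable_fund_coeff[OF assms zd, of R l j]]
      sums_unique[OF fuchs_coeff_sums(1)[OF assms zd, of R i l]]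
    by (simp add: fund_def)
  have "(\<lambda>m. \<Sum>l\<in>UNIV. \<Sum>k\<le>m. (fuchs_coeff S R z0 k $ i $ l * (z - z0) ^ k) *
            (fund_coeff S R z0 (m - k) $ l $ j * (z - z0) ^ (m - k))) sums
      (\<Sum>l\<in>UNIV. fuchs S R z $ i $ l * fund S R z0 z $ l $ j)"
    by (intro sums_sum prod)
  moreover have "(\<Sum>l\<in>UNIV. \<Sum>k\<le>m. (fuchs_coeff S R z0 k $ i $ l * (z - z0) ^ k) *
            (fund_coeff S R z0 (m - k) $ l $ j * (z - z0) ^ (m - k))) = diffs ?c m * (z - z0) ^ m" for m
  proof -
    have "(\<Sum>l\<in>UNIV. \<Sum>k\<le>m. (fuchs_coeff S R z0 k $ i $ l * (z - z0) ^ k) *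
            (fund_coeff S R z0 (m - k) $ l $ j * (z - z0) ^ (m - k)))
       = (\<Sum>l\<in>UNIV. \<Sum>k\<le>m. (fuchs_coeff S R z0 k $ i $ l *
            fund_coeff S R z0 (m - k) $ l $ j) * (z - z0) ^ m)"
    proof (intro sum.cong refl)
      fix l k assume "k \<in> {..m}"
      then have "(z - z0) ^ m = (z - z0) ^ k * (z - z0) ^ (m - k)" by (simp flip: power_add)
      then show "fuchs_coeff S R z0 k $ i $ l * (z - z0) ^ k * (fund_coeff S R z0 (m - k) $ l $ j * (z - z0) ^ (m - k)) =
           fuchs_coeff S R z0 k $ i $ l * fund_coeff S R z0 (m - k) $ l $ j * (z - z0) ^ m"
        by simp
    qed
    also have "\<dots> = (\<Sum>k\<le>m. (fuchs_coeff S R z0 k ** fund_coeff S R z0 (m - k)) $ i $ j) * (z - z0) ^ m"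
      by (subst sum.swap) (simp add: matrix_matrix_mult_def sum_distrib_right)
    also have "(\<Sum>k\<le>m. (fuchs_coeff S R z0 k ** fund_coeff S R z0 (m - k)) $ i $ j) = diffs ?c m"
      by (simp only: diffs_def fund_coeff.simps(2) vec_lambda_beta nonzero_mult_div_cancel_left
          of_nat_neq_0 times_divide_eq_right not_False_eq_True)
    finally show ?thesis .
  qed
  ultimately have sm: "(\<lambda>m. diffs ?c m * (z - z0) ^ m) sums (fuchs S R z ** fund S R z0 z) $ i $ j"
    by (simp add: matrix_matrix_mult_def)
  show "((\<lambda>z. fund S R z0 z $ i $ j) has_field_derivative (fuchs S R z ** fund S R z0 z) $ i $ j) (at z)"
    using der unfolding sums_unique[OF sm] .
qed

section \<open>Uniqueness of solutions and the cocycle property\<close>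

lemma fuchs_sol_subset: "fuchs_sol S R U Y \<Longrightarrow> V \<subseteq> U \<Longrightarrow> fuchs_sol S R V Y"
  unfolding fuchs_sol_def by blast

lemma fuchs_sol_mult_const:
  assumes "fuchs_sol S R U Y"
  shows "fuchs_sol S R U (\<lambda>z. Y z ** C)"
  unfolding fuchs_sol_def
proof (intro ballI allI)
  fix z i j assume "z \<in> U"
  then have "((\<lambda>z. \<Sum>k\<in>UNIV. Y z $ i $ k * C $ k $ j) has_field_derivative
      (\<Sum>k\<in>UNIV. (fuchs S R z ** Y z) $ i $ k * C $ k $ j)) (at z)"
    using assms unfolding fuchs_sol_def by (intro DERIV_sum DERIV_cmult_right) auto
  moreover have "(\<Sum>k\<in>UNIV. (fuchs S R z ** Y z) $ i $ k * C $ k $ j) = (fuchs S R z ** (Y z ** C)) $ i $ j"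
    unfolding matrix_mul_assoc by (simp add: matrix_matrix_mult_def[of _ C])
  ultimately show "((\<lambda>z. (Y z ** C) $ i $ j) has_field_derivative (fuchs S R z ** (Y z ** C)) $ i $ j) (at z)"
    by (simp add: matrix_matrix_mult_def[of "Y _" C])
qed

lemma ball_infdist_finite:
  assumes "p \<in> S"
  shows "infdist z S \<le> dist p z"
  using infdist_le[OF assms, of z] by (simp add: dist_commute)

text \<open>\<open>P\<close> solves the adjoint equation P' = - P A, so P X is constant for every
  solution X. Applied to Y this shows that P is the inverse of Y, and applied to X it gives the
  claim.\<close>

lemma linear_ode_unique:
  fixes A P Y X :: "complex \<Rightarrow> complex^'n^'n"
  assumes U: "convex U" "z0 \<in> U" "z \<in> U"
    and P: "\<And>z i j. z \<in> U \<Longrightarrow> ((\<lambda>z. P z $ i $ j) has_field_derivative - (P z ** A z) $ i $ j) (at z)"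
    and Y: "\<And>z i j. z \<in> U \<Longrightarrow> ((\<lambda>z. Y z $ i $ j) has_field_derivative (A z ** Y z) $ i $ j) (at z)"
    and X: "\<And>z i j. z \<in> U \<Longrightarrow> ((\<lambda>z. X z $ i $ j) has_field_derivative (A z ** X z) $ i $ j) (at z)"
    and init: "P z0 = mat 1" "Y z0 = mat 1"
  shows "X z = Y z ** X z0"
proof -
  have const: "P z ** X z = P z0 ** X z0"
    if X: "\<And>z i j. z \<in> U \<Longrightarrow> ((\<lambda>z. X z $ i $ j) has_field_derivative (A z ** X z) $ i $ j) (at z)" for X
  proof -
    have "((\<lambda>z. (P z ** X z) $ i $ j) has_field_derivative 0) (at z within U)" if "z \<in> U" for z i j
    proof -
      have "((\<lambda>z. \<Sum>k\<in>UNIV. P z $ i $ k * X z $ k $ j) has_field_derivative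
         (\<Sum>k\<in>UNIV. - (P z ** A z) $ i $ k * X z $ k $ j + (A z ** X z) $ k $ j * P z $ i $ k)) (at z)"
        using that by (intro DERIV_sum DERIV_mult P X)
      moreover have "(\<Sum>k\<in>UNIV. - (P z ** A z) $ i $ k * X z $ k $ j + (A z ** X z) $ k $ j * P z $ i $ k)
         = - (P z ** A z ** X z) $ i $ j + (P z ** (A z ** X z)) $ i $ j"
      proof -
        have "(\<Sum>k\<in>UNIV. - (P z ** A z) $ i $ k * X z $ k $ j + (A z ** X z) $ k $ j * P z $ i $ k)
          = (\<Sum>k\<in>UNIV. - ((P z ** A z) $ i $ k * X z $ k $ j) + P z $ i $ k * (A z ** X z) $ k $ j)"
          by (intro sum.cong refl) simp
        also have "\<dots> = - (\<Sum>k\<in>UNIV. (P z ** A z) $ i $ k * X z $ k $ j) + (\<Sum>k\<in>UNIV. P z $ i $ k * (A z ** X z) $ k $ j)"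
          by (simp only: sum.distrib sum_negf)
        finally show ?thesis
          by (simp only: matrix_matrix_mult_def[of "P z ** A z" "X z"]
            matrix_matrix_mult_def[of "P z" "A z ** X z"] vec_lambda_beta)
      qed
      ultimately have "((\<lambda>z. \<Sum>k\<in>UNIV. P z $ i $ k * X z $ k $ j) has_field_derivative 0) (at z)"
        by (simp add: matrix_mul_assoc)
      then have "((\<lambda>z. (P z ** X z) $ i $ j) has_field_derivative 0) (at z)"
        by (simp only: matrix_matrix_mult_def vec_lambda_beta)
      then show ?thesis by (rule has_field_derivative_at_within)
    qed
    then have "\<exists>c. \<forall>z\<in>U. (P z ** X z) $ i $ j = c" for i j
      by (rule has_field_derivative_zero_constant[OF U(1)])
    then have "(P z ** X z) $ i $ j = (P z0 ** X z0) $ i $ j" for i j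
      using bspec[of U _ z] bspec[of U _ z0] U by (metis (lifting))
    then show ?thesis by (simp add: vec_eq_iff)
  qed
  have "P z ** Y z = mat 1" using const[OF Y] init by (simp add: matrix_mul_rid)
  then have inv: "Y z ** P z = mat 1" by (simp add: matrix_left_right_inverse)
  have "X z = (Y z ** P z) ** X z" by (simp add: inv)
  also have "\<dots> = Y z ** X z0" using const[OF X] init by (simp flip: matrix_mul_assoc)
  finally show ?thesis .
qed

text \<open>The adjoint of a Fuchsian system is, after transposition, the Fuchsian system with
  residues - R^T, so the existence theorem also supplies the inverse that the uniqueness argument
  asks for.\<close>

theorem fuchs_sol_unique:
  fixes R :: "complex \<Rightarrow> complex^'n^'n"
  assumes S: "finite S" and Y: "fuchs_sol S R U Y"
    and U: "convex U" "z0 \<in> U" "U \<subseteq> ball z0 (infdist z0 S)" and z: "z \<in> U"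
  shows "Y z = fund S R z0 z ** Y z0"
proof (rule linear_ode_unique[OF U(1,2) z])
  define Q where "Q = (\<lambda>p. - transpose (R p))"
  let ?P = "\<lambda>z. transpose (fund S Q z0 z)"
  have sol: "fuchs_sol S R U (fund S R z0)" for R :: "complex \<Rightarrow> complex^'n^'n"
    using fuchs_sol_fund[OF S ball_infdist_finite] U(3) by (rule fuchs_sol_subset)
  fix z i j assume "z \<in> U"
  then have "((\<lambda>z. fund S Q z0 z $ j $ i) has_field_derivative (fuchs S Q z ** fund S Q z0 z) $ j $ i) (at z)"
    using sol unfolding fuchs_sol_def by blast
  moreover have "(fuchs S Q z ** fund S Q z0 z) $ j $ i = - (?P z ** fuchs S R z) $ i $ j"
    by (simp add: matrix_matrix_mult_def fuchs_def Q_def transpose_def sum_negf mult.commute)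
  ultimately show "((\<lambda>z. ?P z $ i $ j) has_field_derivative - (?P z ** fuchs S R z) $ i $ j) (at z)"
    by (simp add: transpose_def)
  show "((\<lambda>z. fund S R z0 z $ i $ j) has_field_derivative (fuchs S R z ** fund S R z0 z) $ i $ j) (at z)"
    "((\<lambda>z. Y z $ i $ j) has_field_derivative (fuchs S R z ** Y z) $ i $ j) (at z)"
    using sol[of R] Y \<open>z \<in> U\<close> unfolding fuchs_sol_def by blast+
qed (simp_all add: transpose_mat)

text \<open>Uniqueness is applied on the intersection of the two discs of convergence, which is
  convex and contains both \<open>z1\<close> and \<open>z2\<close>.\<close>

lemma fund_cocycle:
  fixes R :: "complex \<Rightarrow> complex^'n^'n"
  assumes S: "finite S" and "dist z0 z1 < infdist z0 S" "dist z0 z2 < infdist z0 S" "dist z1 z2 < infdist z1 S"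
  shows "fund S R z1 z2 ** fund S R z0 z1 = fund S R z0 z2"
proof -
  let ?U = "ball z0 (infdist z0 S) \<inter> ball z1 (infdist z1 S)"
  have "0 < infdist z1 S" using assms(4) zero_le_dist[of z1 z2] by linarith
  then show ?thesis
    by (intro fuchs_sol_unique[of S R ?U "fund S R z0", symmetric] S
        fuchs_sol_subset[OF fuchs_sol_fund[OF S ball_infdist_finite]] convex_Int) (use assms in auto)
qed

section \<open>Holomorphic dependence on parameters\<close>

definition holo_res :: "complex set \<Rightarrow> (complex \<Rightarrow> complex \<Rightarrow> complex^'n^'n) \<Rightarrow> bool" where
  "holo_res S R \<longleftrightarrow> (\<forall>p\<in>S. \<forall>i j. (\<lambda>\<tau>. R \<tau> p $ i $ j) holomorphic_on UNIV)"

lemma holomorphic_fund_coeff: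
  assumes "holo_res S R"
  shows "(\<lambda>\<tau>. fund_coeff S (R \<tau>) z0 m $ i $ j) holomorphic_on UNIV"
proof (induction m arbitrary: i j rule: less_induct)
  case (less m)
  show ?case
  proof (cases m)
    case (Suc n)
    have 1: "(\<lambda>\<tau>. fuchs_coeff S (R \<tau>) z0 k $ i $ j) holomorphic_on UNIV" for k i j
    proof -
      have "(\<lambda>\<tau>. - (\<Sum>p\<in>S. inverse ((p - z0) ^ Suc k) * R \<tau> p $ i $ j)) holomorphic_on UNIV"
        using assms unfolding holo_res_def by (intro holomorphic_intros) auto
      then show ?thesis by (simp add: fuchs_coeff_def field_simps)
    qed
    have 2: "(\<lambda>\<tau>. fund_coeff S (R \<tau>) z0 (n - k) $ i $ j) holomorphic_on UNIV" for k i j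
      using less Suc by auto
    have "(\<lambda>\<tau>. inverse (of_nat (Suc n)) * (\<Sum>k\<le>n. (\<Sum>l\<in>UNIV. fuchs_coeff S (R \<tau>) z0 k $ i $ l * fund_coeff S (R \<tau>) z0 (n - k) $ l $ j)) :: complex) holomorphic_on UNIV"
      by (intro holomorphic_intros 1 2)
    then show ?thesis unfolding Suc by (simp add: matrix_matrix_mult_def field_simps del: of_nat_Suc)
  qed simp
qed

text \<open>Compactness of \<open>K\<close> bounds the residues, and a single majorant then serves
  all parameters and all points of the smaller disc. Uniformity in both variables together gives
  joint continuity as well as holomorphy in \<tau>.\<close>

lemma uniform_limit_fund:
  fixes R :: "complex \<Rightarrow> complex \<Rightarrow> complex^'n^'n"
  assumes S: "finite S" and R: "holo_res S R" and \<rho>: "\<rho> < infdist z0 S" "0 < infdist z0 S" and K: "compact K"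
  shows "uniform_limit (K \<times> cball z0 \<rho>) (\<lambda>N (\<tau>, z). \<Sum>m<N. fund_coeff S (R \<tau>) z0 m $ i $ j * (z - z0) ^ m)
           (\<lambda>(\<tau>, z). fund S (R \<tau>) z0 z $ i $ j) sequentially"
proof (cases "\<rho> < 0")
  case True
  then show ?thesis by simp
next
  case False
  have "continuous_on K (\<lambda>\<tau>. res_bound S (R \<tau>))"
    unfolding res_bound_def
  proof (intro continuous_on_sum continuous_on_norm)
    fix p and i j :: 'n assume "p \<in> S"
    then show "continuous_on K (\<lambda>\<tau>. R \<tau> p $ i $ j)"
      using R unfolding holo_res_def by (meson continuous_on_subset holomorphic_on_imp_continuous_on subset_UNIV)
  qed
  then have "bounded ((\<lambda>\<tau>. res_bound S (R \<tau>)) ` K)"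
    using K by (intro compact_imp_bounded compact_continuous_image)
  then obtain M where M: "\<And>\<tau>. \<tau> \<in> K \<Longrightarrow> res_bound S (R \<tau>) \<le> M"
    unfolding bounded_iff by (metis abs_le_D1 image_eqI real_norm_def)
  let ?d = "infdist z0 S"
  let ?B = "\<lambda>m. pochhammer (1 + CARD('n) * M) m / fact m / ?d ^ m * \<rho> ^ m"
  have "uniform_limit (K \<times> cball z0 \<rho>) (\<lambda>N x. \<Sum>m<N. fund_coeff S (R (fst x)) z0 m $ i $ j * (snd x - z0) ^ m)
           (\<lambda>x. \<Sum>m. fund_coeff S (R (fst x)) z0 m $ i $ j * (snd x - z0) ^ m) sequentially"
  proof (rule Weierstrass_m_test)
    have "summable (\<lambda>m. pochhammer (1 + CARD('n) * M) m / fact m * (\<rho> / ?d) ^ m)"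
      using \<rho> False by (intro summable_pochhammer_over_fact) auto
    then show "summable ?B" by (simp add: power_divide)
    fix m x assume "x \<in> K \<times> cball z0 \<rho>"
    then have x: "fst x \<in> K" "norm (snd x - z0) \<le> \<rho>" by (auto simp: dist_norm norm_minus_commute)
    have "norm (fund_coeff S (R (fst x)) z0 m $ i $ j) \<le> pochhammer (1 + CARD('n) * M) m / fact m / ?d ^ m"
      by (rule norm_fund_coeff_le[OF S \<rho>(2) ball_infdist_finite M[OF x(1)]])
    then have "norm (fund_coeff S (R (fst x)) z0 m $ i $ j) * norm (snd x - z0) ^ m \<le> ?B m"
      using x(2) False by (intro mult_mono power_mono) (auto intro: order_trans[OF norm_ge_zero])
    then show "norm (fund_coeff S (R (fst x)) z0 m $ i $ j * (snd x - z0) ^ m) \<le> ?B m"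
      by (simp add: norm_mult norm_power)
  qed
  then show ?thesis by (simp add: fund_def case_prod_beta')
qed

lemma holomorphic_fund:
  assumes S: "finite S" and R: "holo_res S R" and z: "dist z0 z < infdist z0 S"
  shows "(\<lambda>\<tau>. fund S (R \<tau>) z0 z $ i $ j) holomorphic_on UNIV"
proof (rule holomorphic_uniform_sequence)
  show "(\<lambda>\<tau>. \<Sum>m<N. fund_coeff S (R \<tau>) z0 m $ i $ j * (z - z0) ^ m) holomorphic_on UNIV" for N
    by (intro holomorphic_intros holomorphic_fund_coeff[OF R])
  fix x :: complex
  have pos: "0 < infdist z0 S" using z zero_le_dist[of z0 z] by linarith
  have "uniform_limit (cball x 1) (\<lambda>N \<tau>. \<Sum>m<N. fund_coeff S (R \<tau>) z0 m $ i $ j * (z - z0) ^ m) (\<lambda>\<tau>. fund S (R \<tau>) z0 z $ i $ j) sequentially"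
    using uniform_limit_compose'[OF uniform_limit_fund[OF S R z pos compact_cball[of x 1], of i j], of "\<lambda>\<tau>. (\<tau>, z)" "cball x 1"]
    by (simp add: Pi_iff mem_Times_iff)
  then show "\<exists>d>0. cball x d \<subseteq> UNIV \<and> uniform_limit (cball x d) (\<lambda>N \<tau>. \<Sum>m<N. fund_coeff S (R \<tau>) z0 m $ i $ j * (z - z0) ^ m) (\<lambda>\<tau>. fund S (R \<tau>) z0 z $ i $ j) sequentially"
    by (intro exI[of _ 1]) auto
qed auto

lemma continuous_on_fund:
  fixes R :: "complex \<Rightarrow> complex \<Rightarrow> complex^'n^'n"
  assumes S: "finite S" and R: "holo_res S R"
  shows "continuous_on (UNIV \<times> ball z0 (infdist z0 S)) (\<lambda>(\<tau>, z). fund S (R \<tau>) z0 z $ i $ j)"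
proof (rule continuous_at_imp_continuous_on, rule ballI)
  fix x :: "complex \<times> complex" assume x: "x \<in> UNIV \<times> ball z0 (infdist z0 S)"
  obtain \<tau> z where [simp]: "x = (\<tau>, z)" by force
  have z: "dist z0 z < infdist z0 S" using x by auto
  obtain \<rho> where \<rho>: "dist z0 z < \<rho>" "\<rho> < infdist z0 S" using dense[OF z] by auto
  have pos: "0 < infdist z0 S" using z zero_le_dist[of z0 z] by linarith
  have "continuous_on (cball \<tau> 1 \<times> cball z0 \<rho>) (\<lambda>(\<tau>, z). fund S (R \<tau>) z0 z $ i $ j)"
  proof (rule uniform_limit_theorem[OF _ uniform_limit_fund[OF S R \<rho>(2) pos compact_cball]])
    have "continuous_on UNIV (\<lambda>\<tau>. fund_coeff S (R \<tau>) z0 m $ i $ j)" for m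
      by (intro holomorphic_on_imp_continuous_on holomorphic_fund_coeff[OF R])
    then have c: "continuous_on A (\<lambda>x. fund_coeff S (R (fst x)) z0 m $ i $ j)" for m and A :: "(complex \<times> complex) set"
      by (rule continuous_on_compose2) (auto intro: continuous_on_fst)
    show "\<forall>\<^sub>F N in sequentially. continuous_on (cball \<tau> 1 \<times> cball z0 \<rho>) (\<lambda>(\<tau>, z). \<Sum>m<N. fund_coeff S (R \<tau>) z0 m $ i $ j * (z - z0) ^ m)"
      unfolding case_prod_beta'
      by (intro always_eventually allI continuous_on_sum continuous_on_mult c)
        (intro continuous_intros)
  qed auto
  then have "continuous_on (ball \<tau> 1 \<times> ball z0 \<rho>) (\<lambda>(\<tau>, z). fund S (R \<tau>) z0 z $ i $ j)"
    by (rule continuous_on_subset) auto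
  moreover have "open (ball \<tau> 1 \<times> ball z0 \<rho>)" by (intro open_Times open_ball)
  ultimately show "isCont (\<lambda>(\<tau>, z). fund S (R \<tau>) z0 z $ i $ j) x"
    using \<rho> by (simp add: continuous_on_eq_continuous_at)
qed

section \<open>Parallel transport\<close>

text \<open>Continuation is encoded through the discs of convergence and not through a derivative
  along the path, so that paths need only be continuous. The uniform step \<eta> plays the part of a
  Lebesgue number and replaces a partition of the interval.\<close>

definition horizontal ::
    "complex set \<Rightarrow> (complex \<Rightarrow> complex^'n^'n) \<Rightarrow> (real \<Rightarrow> complex) \<Rightarrow> (real \<Rightarrow> complex^'n^'n) \<Rightarrow> bool" where
  "horizontal S R \<gamma> G \<longleftrightarrow>
     (\<exists>\<eta>>0. \<forall>s\<in>{0..1}. \<forall>s'\<in>{0..1}. \<bar>s' - s\<bar> < \<eta> \<longrightarrow>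
        dist (\<gamma> s) (\<gamma> s') < infdist (\<gamma> s) S \<and> G s' = fund S R (\<gamma> s) (\<gamma> s') ** G s)"

definition transport :: "complex set \<Rightarrow> (complex \<Rightarrow> complex^'n^'n) \<Rightarrow> (real \<Rightarrow> complex) \<Rightarrow> complex^'n^'n" where
  "transport S R \<gamma> = (SOME G. horizontal S R \<gamma> G \<and> G 0 = mat 1) 1"

lemma horizontalE:
  assumes "horizontal S R \<gamma> G"
  obtains \<eta> where "0 < \<eta>"
    "\<And>s s'. \<lbrakk>s \<in> {0..1}; s' \<in> {0..1}; \<bar>s' - s\<bar> < \<eta>\<rbrakk> \<Longrightarrow> dist (\<gamma> s) (\<gamma> s') < infdist (\<gamma> s) S"
    "\<And>s s'. \<lbrakk>s \<in> {0..1}; s' \<in> {0..1}; \<bar>s' - s\<bar> < \<eta>\<rbrakk> \<Longrightarrow> G s' = fund S R (\<gamma> s) (\<gamma> s') ** G s"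
proof -
  from assms obtain \<eta> where \<eta>: "0 < \<eta>" "\<forall>s\<in>{0..1}. \<forall>s'\<in>{0..1}. \<bar>s' - s\<bar> < \<eta> \<longrightarrow>
        dist (\<gamma> s) (\<gamma> s') < infdist (\<gamma> s) S \<and> G s' = fund S R (\<gamma> s) (\<gamma> s') ** G s"
    unfolding horizontal_def by (elim exE conjE)
  show ?thesis by (rule that[OF \<eta>(1)]; use \<eta>(2) in blast)
qed

lemma infdist_pos_notin: "finite S \<Longrightarrow> S \<noteq> {} \<Longrightarrow> z \<notin> S \<Longrightarrow> 0 < infdist z S"
  by (metis in_closed_iff_infdist_zero finite_imp_closed infdist_nonneg less_eq_real_def)

lemma infdist_lower_bound_on_compact:
  assumes "finite S" "S \<noteq> {}" "compact K" "K \<inter> S = {}"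
  obtains m where "0 < m" "\<And>z. z \<in> K \<Longrightarrow> m \<le> infdist z S"
proof (cases "K = {}")
  case False
  have "continuous_on K (\<lambda>z. infdist z S)" by (intro continuous_intros)
  then obtain z where "z \<in> K" "\<And>w. w \<in> K \<Longrightarrow> infdist z S \<le> infdist w S"
    using continuous_attains_inf[OF assms(3) False] by blast
  then show ?thesis
    using that[of "infdist z S"] infdist_pos_notin[OF assms(1,2)] assms(4) by blast
qed (use that[of 1] in auto)

lemma path_fine:
  assumes "finite S" "S \<noteq> {}" "path \<gamma>" "path_image \<gamma> \<inter> S = {}" "0 < c"
  obtains \<eta> where "0 < \<eta>" "\<And>s s'. \<lbrakk>s \<in> {0..1}; s' \<in> {0..1}; \<bar>s' - s\<bar> < \<eta>\<rbrakk> \<Longrightarrow> dist (\<gamma> s) (\<gamma> s') < c * infdist (\<gamma> s) S"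
proof -
  obtain m where m: "0 < m" "\<And>z. z \<in> path_image \<gamma> \<Longrightarrow> m \<le> infdist z S"
    using infdist_lower_bound_on_compact[OF assms(1,2) compact_path_image[OF assms(3)] assms(4)] by blast
  have "uniformly_continuous_on {0..1} \<gamma>"
    using assms(3) by (intro compact_uniformly_continuous) (auto simp: path_def)
  then obtain \<eta> where \<eta>: "0 < \<eta>" "\<And>s s'. \<lbrakk>s \<in> {0..1}; s' \<in> {0..1}; dist s' s < \<eta>\<rbrakk> \<Longrightarrow> dist (\<gamma> s') (\<gamma> s) < c * m"
    unfolding uniformly_continuous_on_def using mult_pos_pos[OF assms(5) m(1)] by blast
  show ?thesis
  proof (rule that[OF \<eta>(1)])
    fix s s' :: real assume s: "s \<in> {0..1}" "s' \<in> {0..1}" "\<bar>s' - s\<bar> < \<eta>"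
    then have "dist (\<gamma> s) (\<gamma> s') < c * m" using \<eta>(2)[of s s'] by (simp add: dist_real_def dist_commute)
    also have "\<dots> \<le> c * infdist (\<gamma> s) S" using m(2) s assms(5) by (simp add: path_image_def)
    finally show "dist (\<gamma> s) (\<gamma> s') < c * infdist (\<gamma> s) S" .
  qed
qed

lemma locally_constant_on_unit_interval:
  fixes P :: "real \<Rightarrow> bool"
  assumes "0 < \<eta>" "\<And>s s'. \<lbrakk>s \<in> {0..1}; s' \<in> {0..1}; \<bar>s' - s\<bar> < \<eta>; P s\<rbrakk> \<Longrightarrow> P s'"
    and "P s0" "s0 \<in> {0..1}" "s \<in> {0..1}"
  shows "P s"
proof -
  have *: "P s" if "s \<in> {0..1}" "\<bar>s - s0\<bar> \<le> real n * (\<eta> / 2)" for n s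
    using that
  proof (induction n arbitrary: s)
    case 0
    then show ?case using assms(3) by simp
  next
    case (Suc n)
    show ?case
    proof (cases "\<bar>s - s0\<bar> \<le> real n * (\<eta> / 2)")
      case False
      define s' where "s' = (if s0 \<le> s then s - \<eta> / 2 else s + \<eta> / 2)"
      have n: "0 \<le> real n * (\<eta> / 2)" using assms(1) by simp
      have suc: "real (Suc n) * (\<eta> / 2) = real n * (\<eta> / 2) + \<eta> / 2" by (simp add: algebra_simps)
      show ?thesis
      proof (cases "\<bar>s - s0\<bar> < \<eta>")
        case True
        then show ?thesis using assms(2)[of s0 s] assms(3,4) Suc.prems by simp
      next
        case False
        then have "s' \<in> {0..1}" "\<bar>s - s'\<bar> < \<eta>" "\<bar>s' - s0\<bar> \<le> real n * (\<eta> / 2)"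
          using Suc.prems assms(1,4) unfolding suc s'_def by auto
        then show ?thesis using Suc.IH[of s'] Suc.prems assms(2)[of s' s] by simp
      qed
    qed (use Suc in auto)
  qed
  obtain n where "\<bar>s - s0\<bar> / (\<eta> / 2) \<le> real n" using real_arch_simple by blast
  then show ?thesis using *[of s n] assms(1,5) by (simp add: field_simps)
qed

lemma horizontal_unique:
  assumes "horizontal S R \<gamma> G" "horizontal S R \<gamma> G'" "G s0 = G' s0" "s0 \<in> {0..1}" "s \<in> {0..1}"
  shows "G s = G' s"
proof -
  obtain \<eta> where \<eta>: "0 < \<eta>"
    and G: "\<And>s s'. \<lbrakk>s \<in> {0..1}; s' \<in> {0..1}; \<bar>s' - s\<bar> < \<eta>\<rbrakk> \<Longrightarrow> G s' = fund S R (\<gamma> s) (\<gamma> s') ** G s"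
    using horizontalE[OF assms(1)] by metis
  obtain \<eta>' where \<eta>': "0 < \<eta>'"
    and G': "\<And>s s'. \<lbrakk>s \<in> {0..1}; s' \<in> {0..1}; \<bar>s' - s\<bar> < \<eta>'\<rbrakk> \<Longrightarrow> G' s' = fund S R (\<gamma> s) (\<gamma> s') ** G' s"
    using horizontalE[OF assms(2)] by metis
  show ?thesis
  proof (rule locally_constant_on_unit_interval[of "min \<eta> \<eta>'" "\<lambda>s. G s = G' s"])
    fix s s' assume "s \<in> {0..1}" "s' \<in> {0..1}" "\<bar>s' - s\<bar> < min \<eta> \<eta>'" "G s = G' s"
    then show "G s' = G' s'" using G[of s s'] G'[of s s'] by simp
  qed (use assms(3-5) \<eta> \<eta>' in auto)
qed

lemma horizontal_mult_const:
  assumes "horizontal S R \<gamma> G" shows "horizontal S R \<gamma> (\<lambda>s. G s ** C)"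
  using assms unfolding horizontal_def by (metis matrix_mul_assoc)

text \<open>The matrices are extended by steps of length \<eta> / 2 for all parameters at once. The
  step is determined by the path and the punctures alone, so after finitely many stages each entry
  is a finite sum of products of entire functions of \<tau>.\<close>

lemma horizontal_exists_family:
  fixes R :: "complex \<Rightarrow> complex \<Rightarrow> complex^'n^'n"
  assumes S: "finite S" "S \<noteq> {}" and R: "holo_res S R" and \<gamma>: "path \<gamma>" "path_image \<gamma> \<inter> S = {}"
  obtains G where "\<And>\<tau>. horizontal S (R \<tau>) \<gamma> (G \<tau>)" "\<And>\<tau>. G \<tau> 0 = mat 1"
    "\<And>s i j. s \<in> {0..1} \<Longrightarrow> (\<lambda>\<tau>. G \<tau> s $ i $ j) holomorphic_on UNIV"
proof -
  obtain \<eta> where \<eta>: "0 < \<eta>" "\<And>s s'. \<lbrakk>s \<in> {0..1}; s' \<in> {0..1}; \<bar>s' - s\<bar> < \<eta>\<rbrakk> \<Longrightarrow> dist (\<gamma> s) (\<gamma> s') < 1 * infdist (\<gamma> s) S"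
    using path_fine[OF S \<gamma>, of 1] by auto
  let ?ok = "\<lambda>G c. (\<forall>\<tau>. G \<tau> 0 = mat 1) \<and>
      (\<forall>\<tau>. \<forall>s\<in>{0..1}. \<forall>s'\<in>{0..1}. s \<le> c \<longrightarrow> s' \<le> c \<longrightarrow> \<bar>s' - s\<bar> < \<eta> \<longrightarrow> G \<tau> s' = fund S (R \<tau>) (\<gamma> s) (\<gamma> s') ** G \<tau> s) \<and>
      (\<forall>s\<in>{0..1}. s \<le> c \<longrightarrow> (\<forall>i j. (\<lambda>\<tau>. G \<tau> s $ i $ j) holomorphic_on UNIV))"
  have ex: "\<exists>G. ?ok G (min 1 (real n * (\<eta> / 2)))" for n
  proof (induction n)
    case 0
    have "s = 0" if "s \<in> {0..1}" "s \<le> min 1 (real 0 * (\<eta> / 2))" for s :: real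
      using that by simp
    then have "?ok (\<lambda>_ _. mat 1) (min 1 (real 0 * (\<eta> / 2)))"
      by (intro conjI allI ballI impI refl holomorphic_on_const) (metis fund_at_base matrix_mul_lid)
    then show ?case by (intro exI[of _ "\<lambda>_ _. mat 1"])
  next
    case (Suc n)
    define c where "c = min 1 (real n * (\<eta> / 2))"
    define c' where "c' = min 1 (real (Suc n) * (\<eta> / 2))"
    have c: "c \<in> {0..1}" "c \<le> c'" "c' \<le> c + \<eta> / 2" using \<eta>(1) by (auto simp: c_def c'_def min_def field_simps)
    obtain G where "?ok G c" using Suc.IH unfolding c_def by (elim exE)
    then have G0: "\<And>\<tau>. G \<tau> 0 = mat 1"
      and G1: "\<And>\<tau> s s'. \<lbrakk>s \<in> {0..1}; s' \<in> {0..1}; s \<le> c; s' \<le> c; \<bar>s' - s\<bar> < \<eta>\<rbrakk> \<Longrightarrow> G \<tau> s' = fund S (R \<tau>) (\<gamma> s) (\<gamma> s') ** G \<tau> s"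
      and G2: "\<And>s i j. \<lbrakk>s \<in> {0..1}; s \<le> c\<rbrakk> \<Longrightarrow> (\<lambda>\<tau>. G \<tau> s $ i $ j) holomorphic_on UNIV"
      by (elim conjE; blast)+
    define G' where "G' = (\<lambda>\<tau> s. if s \<le> c then G \<tau> s else fund S (R \<tau>) (\<gamma> c) (\<gamma> s) ** G \<tau> c)"
    have G'c: "G' \<tau> s = fund S (R \<tau>) (\<gamma> c) (\<gamma> s) ** G \<tau> c" if "s \<in> {0..1}" "\<bar>s - c\<bar> < \<eta>" for s \<tau>
      using G1[of c s \<tau>] c(1) that unfolding G'_def by auto
    have "G' \<tau> s' = fund S (R \<tau>) (\<gamma> s) (\<gamma> s') ** G' \<tau> s"
      if s: "s \<in> {0..1}" "s' \<in> {0..1}" "s \<le> c'" "s' \<le> c'" "\<bar>s' - s\<bar> < \<eta>" for s s' \<tau>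
    proof (cases "\<bar>s - c\<bar> < \<eta> \<and> \<bar>s' - c\<bar> < \<eta>")
      case True
      have "fund S (R \<tau>) (\<gamma> s) (\<gamma> s') ** fund S (R \<tau>) (\<gamma> c) (\<gamma> s) = fund S (R \<tau>) (\<gamma> c) (\<gamma> s')"
        using \<eta>(2)[of c s] \<eta>(2)[of c s'] \<eta>(2)[of s s'] s c True by (intro fund_cocycle S) auto
      then show ?thesis using G'c[of s \<tau>] G'c[of s' \<tau>] True s by (simp add: matrix_mul_assoc)
    next
      case False
      \<comment> \<open>Both points are at most c + \<eta> / 2. One at distance \<eta> or more from
        \<open>c\<close> therefore lies at or below c - \<eta>, and the other, less than \<eta> away
        from it, lies below \<open>c\<close>.\<close>
      then have "s \<le> c" "s' \<le> c" using s c \<eta>(1) by auto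
      then show ?thesis using G1[of s s' \<tau>] s unfolding G'_def by simp
    qed
    moreover have "(\<lambda>\<tau>. G' \<tau> s $ i $ j) holomorphic_on UNIV" if "s \<in> {0..1}" "s \<le> c'" for s i j
    proof (cases "s \<le> c")
      case True
      then show ?thesis using G2[of s i j] that unfolding G'_def by simp
    next
      case False
      have 1: "(\<lambda>\<tau>. fund S (R \<tau>) (\<gamma> c) (\<gamma> s) $ i $ k) holomorphic_on UNIV" for k
        using \<eta>(2)[of c s] c that False \<eta>(1) by (intro holomorphic_fund S R) auto
      have 2: "(\<lambda>\<tau>. G \<tau> c $ k $ j) holomorphic_on UNIV" for k
        using G2[of c] c by simp
      show ?thesis
        using False unfolding G'_def matrix_matrix_mult_def by (simp, intro holomorphic_intros 1 2)
    qed
    moreover have "G' \<tau> 0 = mat 1" for \<tau> using G0 c(1) by (simp add: G'_def)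
    ultimately have "?ok G' c'" by (intro conjI allI ballI impI)
    then show ?case unfolding c'_def by (intro exI[of _ G'])
  qed
  obtain n where "1 / (\<eta> / 2) \<le> real n" using real_arch_simple by blast
  then have "min 1 (real n * (\<eta> / 2)) = 1" using \<eta>(1) by (simp add: field_simps)
  then obtain G where G: "?ok G 1" using ex[of n] by auto
  show ?thesis
  proof (rule that[of G])
    show "horizontal S (R \<tau>) \<gamma> (G \<tau>)" for \<tau>
      unfolding horizontal_def
    proof (intro exI[of _ \<eta>] conjI ballI impI \<eta>(1))
      fix s s' :: real assume s: "s \<in> {0..1}" "s' \<in> {0..1}" "\<bar>s' - s\<bar> < \<eta>"
      show "dist (\<gamma> s) (\<gamma> s') < infdist (\<gamma> s) S" using \<eta>(2)[OF s] by simp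
      have "s \<le> 1" "s' \<le> 1" using s by auto
      then show "G \<tau> s' = fund S (R \<tau>) (\<gamma> s) (\<gamma> s') ** G \<tau> s" using G s by blast
    qed
    show "(\<lambda>\<tau>. G \<tau> s $ i $ j) holomorphic_on UNIV" if "s \<in> {0..1}" for s i j
      using G that by (meson atLeastAtMost_iff)
  qed (use G in blast)
qed

lemma holo_res_const [simp]: "holo_res S (\<lambda>_. R)"
  unfolding holo_res_def by auto

lemma horizontal_exists:
  fixes R :: "complex \<Rightarrow> complex^'n^'n"
  assumes "finite S" "S \<noteq> {}" "path \<gamma>" "path_image \<gamma> \<inter> S = {}"
  obtains G where "horizontal S R \<gamma> G" "G 0 = mat 1"
proof (rule horizontal_exists_family[OF assms(1,2) holo_res_const assms(3,4), of R])
  fix G :: "complex \<Rightarrow> real \<Rightarrow> complex^'n^'n"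
  assume "\<And>\<tau>. horizontal S R \<gamma> (G \<tau>)" "\<And>\<tau>. G \<tau> 0 = mat 1"
  then show ?thesis by (rule that)
qed

lemma horizontal_transport:
  assumes "horizontal S R \<gamma> G" "finite S" "S \<noteq> {}" "path \<gamma>" "path_image \<gamma> \<inter> S = {}"
  shows "G 1 = transport S R \<gamma> ** G 0"
proof -
  obtain G0 where "horizontal S R \<gamma> G0 \<and> G0 0 = mat 1"
    using horizontal_exists[OF assms(2-5), of R] by blast
  then have G': "horizontal S R \<gamma> (SOME G. horizontal S R \<gamma> G \<and> G 0 = mat 1) \<and>
      (SOME G. horizontal S R \<gamma> G \<and> G 0 = mat 1) 0 = mat 1"
    by (rule someI[where P = "\<lambda>G. horizontal S R \<gamma> G \<and> G 0 = mat 1"])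
  define G1 where "G1 = (SOME G. horizontal S R \<gamma> G \<and> G 0 = mat 1)"
  have "G 1 = (\<lambda>s. G1 s ** G 0) 1"
  proof (rule horizontal_unique[OF assms(1) horizontal_mult_const, where ?s0.0 = 0])
    show "horizontal S R \<gamma> G1" using G' unfolding G1_def by (rule conjunct1)
    show "G 0 = G1 0 ** G 0" using conjunct2[OF G'] unfolding G1_def by (simp add: matrix_mul_lid)
  qed simp_all
  then have "G 1 = (SOME G. horizontal S R \<gamma> G \<and> G 0 = mat 1) 1 ** G 0" by (simp add: G1_def)
  then show ?thesis by (simp add: transport_def)
qed

lemma transport_eq:
  assumes "horizontal S R \<gamma> G" "G 0 = mat 1" "finite S" "S \<noteq> {}" "path \<gamma>" "path_image \<gamma> \<inter> S = {}"
  shows "transport S R \<gamma> = G 1"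
  using horizontal_transport[OF assms(1,3-6)] assms(2) by (simp add: matrix_mul_rid)

lemma holomorphic_transport:
  fixes R :: "complex \<Rightarrow> complex \<Rightarrow> complex^'n^'n"
  assumes "finite S" "S \<noteq> {}" "holo_res S R" "path \<gamma>" "path_image \<gamma> \<inter> S = {}"
  shows "(\<lambda>\<tau>. transport S (R \<tau>) \<gamma> $ i $ j) holomorphic_on UNIV"
proof -
  obtain G where G: "\<And>\<tau>. horizontal S (R \<tau>) \<gamma> (G \<tau>)" "\<And>\<tau>. G \<tau> 0 = mat 1"
    "\<And>s i j. s \<in> {0..1} \<Longrightarrow> (\<lambda>\<tau>. G \<tau> s $ i $ j) holomorphic_on UNIV"
    using horizontal_exists_family[OF assms] by metis
  then show ?thesis using transport_eq[OF G(1,2) assms(1,2,4,5)] by simp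
qed

lemma horizontal_reparametrize:
  assumes "horizontal S R \<gamma> G" "\<And>s. s \<in> {0..1} \<Longrightarrow> f s \<in> {0..1}"
    and "\<And>s s'. \<lbrakk>s \<in> {0..1}; s' \<in> {0..1}\<rbrakk> \<Longrightarrow> \<bar>f s' - f s\<bar> \<le> \<bar>s' - s\<bar>"
  shows "horizontal S R (\<gamma> \<circ> f) (G \<circ> f)"
  using assms unfolding horizontal_def comp_def by (meson order_le_less_trans)

lemma transport_join:
  assumes "finite S" "S \<noteq> {}" "path \<gamma>1" "path \<gamma>2" "pathfinish \<gamma>1 = pathstart \<gamma>2"
    "path_image \<gamma>1 \<inter> S = {}" "path_image \<gamma>2 \<inter> S = {}"
  shows "transport S R (\<gamma>1 +++ \<gamma>2) = transport S R \<gamma>2 ** transport S R \<gamma>1"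
proof -
  have p: "path (\<gamma>1 +++ \<gamma>2)" "path_image (\<gamma>1 +++ \<gamma>2) \<inter> S = {}"
    using assms by (auto simp: path_image_join)
  obtain G where G: "horizontal S R (\<gamma>1 +++ \<gamma>2) G" "G 0 = mat 1"
    using horizontal_exists[OF assms(1,2) p] by blast
  have "horizontal S R ((\<gamma>1 +++ \<gamma>2) \<circ> (\<lambda>s. s / 2)) (G \<circ> (\<lambda>s. s / 2))"
    by (rule horizontal_reparametrize[OF G(1)]) (auto simp flip: diff_divide_distrib)
  moreover have "((\<gamma>1 +++ \<gamma>2) \<circ> (\<lambda>s. s / 2)) s = \<gamma>1 s" if "s \<in> {0..1}" for s
    using that by (simp add: joinpaths_def)
  ultimately have h1: "horizontal S R \<gamma>1 (G \<circ> (\<lambda>s. s / 2))" unfolding horizontal_def by auto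
  have "horizontal S R ((\<gamma>1 +++ \<gamma>2) \<circ> (\<lambda>s. (s + 1) / 2)) (G \<circ> (\<lambda>s. (s + 1) / 2))"
    by (rule horizontal_reparametrize[OF G(1)]) (auto simp flip: diff_divide_distrib)
  moreover have "((\<gamma>1 +++ \<gamma>2) \<circ> (\<lambda>s. (s + 1) / 2)) s = \<gamma>2 s" if "s \<in> {0..1}" for s
  proof (cases "s = 0")
    case True
    then show ?thesis using assms(5) by (simp add: joinpaths_def pathfinish_def pathstart_def)
  qed (use that in \<open>simp add: joinpaths_def field_simps\<close>)
  ultimately have h2: "horizontal S R \<gamma>2 (G \<circ> (\<lambda>s. (s + 1) / 2))" unfolding horizontal_def by auto
  show ?thesis
    using horizontal_transport[OF h1 assms(1-3,6)] horizontal_transport[OF h2 assms(1,2,4,7)]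
      transport_eq[OF G assms(1,2) p] G(2) by (simp add: matrix_mul_rid)
qed

lemma transport_reversepath:
  assumes "finite S" "S \<noteq> {}" "path \<gamma>" "path_image \<gamma> \<inter> S = {}"
  shows "transport S R (reversepath \<gamma>) ** transport S R \<gamma> = mat 1"
proof -
  obtain G where G: "horizontal S R \<gamma> G" "G 0 = mat 1"
    using horizontal_exists[OF assms] by blast
  have "horizontal S R (\<gamma> \<circ> (\<lambda>s. 1 - s)) (G \<circ> (\<lambda>s. 1 - s))"
    by (rule horizontal_reparametrize[OF G(1)]) auto
  then have "horizontal S R (reversepath \<gamma>) (G \<circ> (\<lambda>s. 1 - s))"
    by (simp add: reversepath_def comp_def)
  from horizontal_transport[OF this assms(1,2)] assms(3,4) G(2) transport_eq[OF G assms]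
  show ?thesis by simp
qed

lemma transport_inverse:
  assumes "finite S" "S \<noteq> {}" "path \<gamma>" "path_image \<gamma> \<inter> S = {}"
  shows "transport S R \<gamma> ** transport S R (reversepath \<gamma>) = mat 1"
  using transport_reversepath[OF assms] matrix_left_right_inverse by blast

text \<open>By uniform continuity, neighbouring paths of the homotopy stay within common discs of
  convergence. Composing a horizontal family with the short crossing from one path to the next
  gives, by the cocycle property, a horizontal family on the next path; the crossing is trivial at
  both ends because the end points are fixed.\<close>

theorem transport_homotopic:
  fixes R :: "complex \<Rightarrow> complex^'n^'n"
  assumes S: "finite S" "S \<noteq> {}" and hom: "homotopic_paths (- S) p q"
  shows "transport S R p = transport S R q"
proof -
  obtain h :: "real \<times> real \<Rightarrow> complex" where "continuous_on ({0..1} \<times> {0..1}) h \<and> h \<in> ({0..1} \<times> {0..1}) \<rightarrow> - S \<and>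
    (\<forall>x\<in>{0..1}. h (0, x) = p x) \<and> (\<forall>x\<in>{0..1}. h (1, x) = q x) \<and>
    (\<forall>t\<in>{0..1}. pathstart (h \<circ> Pair t) = pathstart p \<and> pathfinish (h \<circ> Pair t) = pathfinish p)"
    using hom unfolding homotopic_paths by blast
  then have h: "continuous_on ({0..1} \<times> {0..1}) h" "h \<in> ({0..1} \<times> {0..1}) \<rightarrow> - S"
    "\<And>x. x \<in> {0..1} \<Longrightarrow> h (0, x) = p x" "\<And>x. x \<in> {0..1} \<Longrightarrow> h (1, x) = q x"
    "\<And>t. t \<in> {0..1} \<Longrightarrow> h (t, 0) = p 0" "\<And>t. t \<in> {0..1} \<Longrightarrow> h (t, 1) = p 1"
    by (simp_all add: pathstart_def pathfinish_def)
  let ?I = "{0..1::real} \<times> {0..1::real}"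
  have "compact (h ` ?I)" using h(1) by (intro compact_continuous_image compact_Times) auto
  moreover have "h ` ?I \<inter> S = {}" using h(2) by auto
  ultimately obtain m where m: "0 < m" "\<And>z. z \<in> h ` ?I \<Longrightarrow> m \<le> infdist z S"
    using infdist_lower_bound_on_compact[OF S] by blast
  have "uniformly_continuous_on ?I h"
    using h(1) by (intro compact_uniformly_continuous compact_Times) auto
  then obtain d where d: "0 < d" "\<And>x x'. \<lbrakk>x \<in> ?I; x' \<in> ?I; dist x' x < d\<rbrakk> \<Longrightarrow> dist (h x') (h x) < m"
    unfolding uniformly_continuous_on_def using m(1) by meson
  define \<eta> where "\<eta> = d / 2"
  have close: "dist (h (t, s)) (h (t', s')) < infdist (h (t, s)) S"
    if "t \<in> {0..1}" "t' \<in> {0..1}" "s \<in> {0..1}" "s' \<in> {0..1}" "\<bar>t' - t\<bar> < \<eta>" "\<bar>s' - s\<bar> < \<eta>" for s s' t t'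
  proof -
    have "dist (t', s') (t, s) \<le> \<bar>t' - t\<bar> + \<bar>s' - s\<bar>"
      unfolding dist_Pair_Pair dist_real_def using sqrt_sum_squares_le_sum_abs[of "t' - t" "s' - s"] by simp
    also have "\<dots> < d" using that by (simp add: \<eta>_def)
    finally have "dist (h (t', s')) (h (t, s)) < m" using d(2)[of "(t, s)" "(t', s')"] that by auto
    also have "m \<le> infdist (h (t, s)) S" using m(2) that by auto
    finally show ?thesis by (simp add: dist_commute)
  qed
  have \<eta>: "0 < \<eta>" using d by (simp add: \<eta>_def)
  have ph: "path (\<lambda>s. h (t, s))" "path_image (\<lambda>s. h (t, s)) \<inter> S = {}" if "t \<in> {0..1}" for t
  proof -
    show "path (\<lambda>s. h (t, s))"
      unfolding path_def using that by (intro continuous_on_compose2[OF h(1)] continuous_intros) auto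
    show "path_image (\<lambda>s. h (t, s)) \<inter> S = {}" using that h(2) by (auto simp: path_image_def)
  qed
  have step: "transport S R (\<lambda>s. h (t', s)) = transport S R (\<lambda>s. h (t, s))"
    if t: "t \<in> {0..1}" "t' \<in> {0..1}" "\<bar>t' - t\<bar> < \<eta>" for t t'
  proof -
    obtain G where G: "horizontal S R (\<lambda>s. h (t, s)) G" "G 0 = mat 1"
      using horizontal_exists[OF S ph[OF t(1)]] by blast
    obtain \<eta>' where \<eta>': "0 < \<eta>'" "\<And>s s'. \<lbrakk>s \<in> {0..1}; s' \<in> {0..1}; \<bar>s' - s\<bar> < \<eta>'\<rbrakk> \<Longrightarrow> G s' = fund S R (h (t, s)) (h (t, s')) ** G s"
      using horizontalE[OF G(1)] by metis
    define K where "K = (\<lambda>s. fund S R (h (t, s)) (h (t', s)) ** G s)"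
    have "horizontal S R (\<lambda>s. h (t', s)) K"
      unfolding horizontal_def
    proof (intro exI[of _ "min \<eta> \<eta>'"] conjI ballI impI)
      fix s s' :: real assume s: "s \<in> {0..1}" "s' \<in> {0..1}" "\<bar>s' - s\<bar> < min \<eta> \<eta>'"
      show "dist (h (t', s)) (h (t', s')) < infdist (h (t', s)) S"
        using s t \<eta> by (intro close) auto
      have "K s' = fund S R (h (t, s')) (h (t', s')) ** fund S R (h (t, s)) (h (t, s')) ** G s"
        using \<eta>'(2)[of s s'] s by (simp add: K_def matrix_mul_assoc)
      also have "fund S R (h (t, s')) (h (t', s')) ** fund S R (h (t, s)) (h (t, s')) = fund S R (h (t, s)) (h (t', s'))"
        using s t \<eta> by (intro fund_cocycle S close) auto
      also have "\<dots> = fund S R (h (t', s)) (h (t', s')) ** fund S R (h (t, s)) (h (t', s))"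
        using s t \<eta> by (intro fund_cocycle[symmetric] S close) auto
      finally show "K s' = fund S R (h (t', s)) (h (t', s')) ** K s"
        by (simp add: K_def matrix_mul_assoc)
    qed (use \<eta> \<eta>' in auto)
    moreover have "K 0 = mat 1" using t h(5) G(2) by (simp add: K_def matrix_mul_rid)
    ultimately have "transport S R (\<lambda>s. h (t', s)) = K 1"
      using transport_eq S ph t by blast
    also have "K 1 = G 1" using t h(6) by (simp add: K_def matrix_mul_lid)
    also have "G 1 = transport S R (\<lambda>s. h (t, s))" using transport_eq[OF G S] ph t by simp
    finally show ?thesis .
  qed
  have "transport S R (\<lambda>s. h (1, s)) = transport S R (\<lambda>s. h (0, s))"
  proof (rule locally_constant_on_unit_interval[OF \<eta>, where P = "\<lambda>t. transport S R (\<lambda>s. h (t, s)) = transport S R (\<lambda>s. h (0, s))" and ?s0.0 = 0])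
    fix s s' assume "s \<in> {0..1}" "s' \<in> {0..1}" "\<bar>s' - s\<bar> < \<eta>" "transport S R (\<lambda>sa. h (s, sa)) = transport S R (\<lambda>s. h (0, s))"
    then show "transport S R (\<lambda>sa. h (s', sa)) = transport S R (\<lambda>s. h (0, s))" using step[of s s'] by simp
  qed auto
  moreover have "transport S R \<gamma> = transport S R \<gamma>'" if "\<And>s. s \<in> {0..1} \<Longrightarrow> \<gamma> s = \<gamma>' s" for \<gamma> \<gamma>'
  proof -
    have "horizontal S R \<gamma> = horizontal S R \<gamma>'"
      using that unfolding horizontal_def fun_eq_iff by auto
    then show ?thesis by (simp add: transport_def)
  qed
  ultimately show ?thesis using h(3,4) by metis
qed

lemma transport_in_ball:
  assumes S: "finite S" "S \<noteq> {}" and \<gamma>: "path \<gamma>" "path_image \<gamma> \<subseteq> ball (\<gamma> 0) (infdist (\<gamma> 0) S)"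
  shows "transport S R \<gamma> = fund S R (\<gamma> 0) (\<gamma> 1)"
proof -
  have im: "path_image \<gamma> \<inter> S = {}"
    using \<gamma>(2) infdist_le[of _ S "\<gamma> 0"] by force
  obtain \<eta> where \<eta>: "0 < \<eta>" "\<And>s s'. \<lbrakk>s \<in> {0..1}; s' \<in> {0..1}; \<bar>s' - s\<bar> < \<eta>\<rbrakk> \<Longrightarrow> dist (\<gamma> s) (\<gamma> s') < 1 * infdist (\<gamma> s) S"
    using path_fine[OF S \<gamma>(1) im, of 1] by auto
  have "horizontal S R \<gamma> (\<lambda>s. fund S R (\<gamma> 0) (\<gamma> s))"
    unfolding horizontal_def
  proof (intro exI[of _ \<eta>] conjI ballI impI \<eta>(1))
    fix s s' :: real assume s: "s \<in> {0..1}" "s' \<in> {0..1}" "\<bar>s' - s\<bar> < \<eta>"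
    show "dist (\<gamma> s) (\<gamma> s') < infdist (\<gamma> s) S" using \<eta>(2)[OF s] by simp
    have "\<gamma> s \<in> path_image \<gamma>" "\<gamma> s' \<in> path_image \<gamma>" using s by (auto simp: path_image_def)
    then show "fund S R (\<gamma> 0) (\<gamma> s') = fund S R (\<gamma> s) (\<gamma> s') ** fund S R (\<gamma> 0) (\<gamma> s)"
      using \<gamma>(2) \<eta>(2)[OF s] by (intro fund_cocycle[symmetric] S) auto
  qed
  from transport_eq[OF this _ S \<gamma>(1) im] show ?thesis by simp
qed

section \<open>Traces and determinants\<close>

text \<open>Liouville's formula. The principal logarithm is legitimate because on the disc the
  quotient (z - p) / (z0 - p) differs from 1 by less than 1 and so has positive real part.\<close>

lemma det_fund:
  fixes R :: "complex \<Rightarrow> complex^2^2"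
  assumes S: "finite S" and z: "dist z0 z < infdist z0 S"
  shows "det (fund S R z0 z) = exp (\<Sum>p\<in>S. trace (R p) * Ln ((z - p) / (z0 - p)))"
proof -
  let ?U = "ball z0 (infdist z0 S)"
  define L where "L = (\<lambda>z. \<Sum>p\<in>S. trace (R p) * Ln ((z - p) / (z0 - p)))"
  let ?Y = "fund S R z0"
  let ?A = "fuchs S R"
  have tr: "trace (?A z) = (\<Sum>p\<in>S. trace (R p) / (z - p))" for z
    by (simp add: fuchs_def trace_def sum_2 sum.distrib add_divide_distrib)
  have der: "((\<lambda>z. det (?Y z) * exp (- L z)) has_field_derivative 0) (at z within ?U)" if z: "z \<in> ?U" for z
  proof -
    have d: "((\<lambda>z. ?Y z $ i $ j) has_field_derivative (?A z ** ?Y z) $ i $ j) (at z)" for i j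
      using fuchs_sol_fund[OF S ball_infdist_finite, of S R z0] z unfolding fuchs_sol_def by blast
    have D: "((\<lambda>z. det (?Y z)) has_field_derivative trace (?A z) * det (?Y z)) (at z)"
      unfolding det_2
      by (rule derivative_eq_intros d refl)+
        (simp add: trace_def sum_2 matrix_matrix_mult_def algebra_simps)
    have "(L has_field_derivative trace (?A z)) (at z)"
      unfolding L_def tr
    proof (intro DERIV_sum)
      fix p assume p: "p \<in> S"
      have lt: "norm (z - z0) < norm (z0 - p)"
        using z infdist_le[OF p, of z0] by (simp add: dist_norm norm_minus_commute)
      then have ne: "z0 - p \<noteq> 0" "z - p \<noteq> 0" by (auto simp: norm_minus_commute)
      have "norm ((z - p) / (z0 - p) - 1) < 1"
      proof -
        have "(z - p) / (z0 - p) - 1 = (z - z0) / (z0 - p)" using ne by (simp add: field_simps)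
        then show ?thesis using lt ne by (simp add: norm_divide)
      qed
      then have "0 < Re ((z - p) / (z0 - p))"
        using abs_Re_le_cmod[of "(z - p) / (z0 - p) - 1"] by auto
      then have nn: "(z - p) / (z0 - p) \<notin> \<real>\<^sub>\<le>\<^sub>0" by (auto simp: complex_nonpos_Reals_iff)
      show "((\<lambda>z. trace (R p) * Ln ((z - p) / (z0 - p))) has_field_derivative trace (R p) / (z - p)) (at z)"
        using ne nn by (auto intro!: derivative_eq_intros)
    qed
    then have "((\<lambda>z. det (?Y z) * exp (- L z)) has_field_derivative
        trace (?A z) * det (?Y z) * exp (- L z) + (exp (- L z) * - trace (?A z)) * det (?Y z)) (at z)"
      by (intro DERIV_mult D DERIV_chain2[where f = exp] DERIV_exp DERIV_minus)
    then show ?thesis by (simp add: has_field_derivative_at_within)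
  qed
  have "\<exists>c. \<forall>z\<in>?U. det (?Y z) * exp (- L z) = c"
    by (rule has_field_derivative_zero_constant[OF convex_ball der])
  then obtain c where c: "\<And>z. z \<in> ?U \<Longrightarrow> det (?Y z) * exp (- L z) = c" by (auto simp del: mem_ball)
  have zU: "z \<in> ?U" "z0 \<in> ?U" using z by (auto intro: le_less_trans[OF zero_le_dist])
  have "z0 - p \<noteq> 0" if "p \<in> S" for p
    using zU(2) infdist_le[OF that, of z0] by auto
  then have "L z0 = 0" by (simp add: L_def)
  then have "det (?Y z) * exp (- L z) = 1" using c[OF zU(1)] c[OF zU(2)] by simp
  then have "det (?Y z) = exp (L z)" by (simp add: exp_minus field_simps)
  then show ?thesis by (simp add: L_def)
qed

text \<open>Continuous logarithms \<open>q p\<close> of \<gamma> - p turn the local factors of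
  Liouville's formula into increments: on steps so short that an increment has modulus below pi, it
  is the principal logarithm of the quotient. The increments add up to 2 \<pi> \<i> times the
  winding number.\<close>

theorem det_transport:
  fixes R :: "complex \<Rightarrow> complex^2^2"
  assumes S: "finite S" "S \<noteq> {}" and \<gamma>: "path \<gamma>" "path_image \<gamma> \<inter> S = {}"
  shows "det (transport S R \<gamma>) = exp (2 * of_real pi * \<i> * (\<Sum>p\<in>S. trace (R p) * winding_number \<gamma> p))"
proof -
  have "\<forall>p\<in>S. \<exists>q. path q \<and> pathfinish q - pathstart q = 2 * of_real pi * \<i> * winding_number \<gamma> p \<and>
      (\<forall>t\<in>{0..1}. \<gamma> t = p + exp (q t))"
  proof
    fix p assume "p \<in> S"
    then have "p \<notin> path_image \<gamma>" using \<gamma>(2) by auto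
    then obtain q where "path q" "pathfinish q - pathstart q = 2 * of_real pi * \<i> * winding_number \<gamma> p"
      "\<And>t. t \<in> {0..1} \<Longrightarrow> \<gamma> t = p + exp (q t)"
      using winding_number_as_continuous_log[OF \<gamma>(1)] by blast
    then show "\<exists>q. path q \<and> pathfinish q - pathstart q = 2 * of_real pi * \<i> * winding_number \<gamma> p \<and>
      (\<forall>t\<in>{0..1}. \<gamma> t = p + exp (q t))" by blast
  qed
  then obtain q where "\<forall>p\<in>S. path (q p) \<and> pathfinish (q p) - pathstart (q p) = 2 * of_real pi * \<i> * winding_number \<gamma> p \<and>
      (\<forall>t\<in>{0..1}. \<gamma> t = p + exp (q p t))"
    by (rule bchoice[THEN exE])
  then have q: "\<And>p. p \<in> S \<Longrightarrow> path (q p)"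
    "\<And>p. p \<in> S \<Longrightarrow> q p 1 - q p 0 = 2 * of_real pi * \<i> * winding_number \<gamma> p"
    "\<And>p t. p \<in> S \<Longrightarrow> t \<in> {0..1} \<Longrightarrow> \<gamma> t = p + exp (q p t)"
    by (auto simp: pathfinish_def pathstart_def)
  have "\<exists>e>0. \<forall>p\<in>S. \<forall>s\<in>{0..1}. \<forall>s'\<in>{0..1}. \<bar>s' - s\<bar> < e \<longrightarrow> norm (q p s' - q p s) < pi"
    using S(1) q(1)
  proof (induction S rule: finite_induct)
    case (insert p S)
    then obtain e where e: "0 < e" "\<forall>p\<in>S. \<forall>s\<in>{0..1}. \<forall>s'\<in>{0..1}. \<bar>s' - s\<bar> < e \<longrightarrow> norm (q p s' - q p s) < pi"
      by auto
    have "uniformly_continuous_on {0..1} (q p)"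
      using insert.prems[of p] by (intro compact_uniformly_continuous) (auto simp: path_def)
    then obtain e' where e': "0 < e'" "\<forall>s\<in>{0..1}. \<forall>s'\<in>{0..1}. dist s' s < e' \<longrightarrow> dist (q p s') (q p s) < pi"
      unfolding uniformly_continuous_on_def using pi_gt_zero by metis
    show ?case
      by (rule exI[of _ "min e e'"]) (use e e' in \<open>auto simp: dist_norm\<close>)
  qed (auto intro: exI[of _ 1])
  then obtain e where e: "0 < e" "\<And>p s s'. \<lbrakk>p \<in> S; s \<in> {0..1}; s' \<in> {0..1}; \<bar>s' - s\<bar> < e\<rbrakk> \<Longrightarrow> norm (q p s' - q p s) < pi"
    by blast
  obtain G where G: "horizontal S R \<gamma> G" "G 0 = mat 1" using horizontal_exists[OF S \<gamma>] by blast
  obtain \<eta> where \<eta>: "0 < \<eta>"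
    "\<And>s s'. \<lbrakk>s \<in> {0..1}; s' \<in> {0..1}; \<bar>s' - s\<bar> < \<eta>\<rbrakk> \<Longrightarrow> dist (\<gamma> s) (\<gamma> s') < infdist (\<gamma> s) S"
    "\<And>s s'. \<lbrakk>s \<in> {0..1}; s' \<in> {0..1}; \<bar>s' - s\<bar> < \<eta>\<rbrakk> \<Longrightarrow> G s' = fund S R (\<gamma> s) (\<gamma> s') ** G s"
    using horizontalE[OF G(1)] by metis
  define P where "P = (\<lambda>s. det (G s) = exp (\<Sum>p\<in>S. trace (R p) * (q p s - q p 0)))"
  have "P 1"
  proof (rule locally_constant_on_unit_interval[of "min e \<eta>" P 0])
    fix s s' :: real assume s: "s \<in> {0..1}" "s' \<in> {0..1}" "\<bar>s' - s\<bar> < min e \<eta>" and P: "P s"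
    have "Ln ((\<gamma> s' - p) / (\<gamma> s - p)) = q p s' - q p s" if p: "p \<in> S" for p
    proof -
      have "(\<gamma> s' - p) / (\<gamma> s - p) = exp (q p s' - q p s)"
        using q(3)[OF p s(1)] q(3)[OF p s(2)] by (simp add: exp_diff)
      moreover have "\<bar>Im (q p s' - q p s)\<bar> < pi"
        using e(2)[of p s s'] p s abs_Im_le_cmod[of "q p s' - q p s"] by (auto intro: le_less_trans)
      ultimately show ?thesis by (auto intro!: Ln_exp)
    qed
    then have "det (fund S R (\<gamma> s) (\<gamma> s')) = exp (\<Sum>p\<in>S. trace (R p) * (q p s' - q p s))"
      using det_fund[OF S(1), of "\<gamma> s" "\<gamma> s'" R] \<eta>(2)[of s s'] s by simp
    moreover have "det (G s') = det (fund S R (\<gamma> s) (\<gamma> s')) * det (G s)"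
      using \<eta>(3)[of s s'] s by (simp add: det_mul)
    ultimately have "det (G s') = exp ((\<Sum>p\<in>S. trace (R p) * (q p s' - q p s)) + (\<Sum>p\<in>S. trace (R p) * (q p s - q p 0)))"
      using P by (simp add: P_def exp_add)
    then show "P s'" by (simp add: P_def algebra_simps flip: sum.distrib)
  qed (use e(1) \<eta>(1) G(2) in \<open>auto simp: P_def\<close>)
  then have "det (G 1) = exp (\<Sum>p\<in>S. trace (R p) * (2 * of_real pi * \<i> * winding_number \<gamma> p))"
    using q(2) by (simp add: P_def)
  then show ?thesis
    using transport_eq[OF G S \<gamma>] by (simp add: sum_distrib_left mult_ac)
qed

subsection \<open>Traces of powers\<close>

text \<open>The Cayley-Hamilton identity for A, multiplied by B. With B a power of A it is the
  recurrence for the traces of powers; with B the inverse of A it yields the trace of the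
  inverse.\<close>

lemma trace_cayley_hamilton:
  fixes A B :: "complex^2^2"
  shows "trace (A ** (A ** B)) = trace A * trace (A ** B) - det A * trace B"
  by (simp add: trace_def det_2 sum_2 matrix_matrix_mult_def algebra_simps)

text \<open>The traces of the powers obey a two-term recurrence whose coefficients are the trace and
  the determinant. Thus the claim for all exponents reduces to one relation of traces and one of
  determinants.\<close>

lemma trace_funpow_scale:
  fixes A B :: "complex^2^2"
  assumes "trace A = c * trace B" "det A = c\<^sup>2 * det B"
  shows "trace ((((**) A) ^^ k) (mat 1)) = c ^ k * trace ((((**) B) ^^ k) (mat 1))"
proof (induction k rule: induct_nat_012)
  case (ge2 k)
  then show ?case
    by (simp add: trace_cayley_hamilton assms power2_eq_square algebra_simps)
qed (use assms in \<open>simp_all add: matrix_mul_rid\<close>)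

lemma matrix_inv_nonsingular:
  fixes A :: "complex^'n^'n"
  assumes "det A \<noteq> 0"
  shows "A ** matrix_inv A = mat 1"
proof -
  have "invertible A" using assms by (simp add: invertible_det_nz)
  then have "A ** matrix_inv A = mat 1 \<and> matrix_inv A ** A = mat 1"
    unfolding invertible_def matrix_inv_def by (rule someI_ex)
  then show ?thesis by simp
qed

lemma trace_matrix_inv:
  fixes A :: "complex^2^2"
  assumes "det A \<noteq> 0"
  shows "trace (matrix_inv A) = trace A / det A" "det (matrix_inv A) = 1 / det A"
proof -
  have inv: "A ** matrix_inv A = mat 1"
    by (rule matrix_inv_nonsingular[OF assms])
  have "trace (A ** (A ** matrix_inv A)) = trace A * trace (A ** matrix_inv A) - det A * trace (matrix_inv A)"
    by (rule trace_cayley_hamilton)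
  then have "trace A = 2 * trace A - det A * trace (matrix_inv A)"
    unfolding inv matrix_mul_rid by (simp add: trace_def mat_def sum_2)
  then show "trace (matrix_inv A) = trace A / det A" using assms by (simp add: field_simps)
  have "det A * det (matrix_inv A) = 1" using inv det_mul[of A "matrix_inv A"] by simp
  then show "det (matrix_inv A) = 1 / det A" using assms by (simp add: field_simps)
qed

lemma trace_matrix_power_int:
  fixes A B :: "complex^2^2"
  assumes "trace A = exp w * trace B" "det A = exp w ^ 2 * det B" "det B \<noteq> 0"
  shows "trace (matrix_power_int A n) = exp (of_int n * w) * trace (matrix_power_int B n)"
proof (cases "n \<ge> 0")
  case True
  have "exp w ^ nat n = exp (of_int n * w)"
    using True by (simp flip: exp_of_nat_mult)
  then show ?thesis
    using True trace_funpow_scale[OF assms(1,2), of "nat n"] by (simp add: matrix_power_int_def)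
next
  case False
  have nz: "det A \<noteq> 0" using assms by simp
  have "trace (matrix_inv A) = exp (- w) * trace (matrix_inv B)"
    "det (matrix_inv A) = exp (- w) ^ 2 * det (matrix_inv B)"
    using assms nz by (simp_all add: trace_matrix_inv exp_minus field_simps power2_eq_square)
  from trace_funpow_scale[OF this, of "nat (- n)"]
  have "trace ((((**) (matrix_inv A)) ^^ nat (- n)) (mat 1)) = exp (- w) ^ nat (- n) * trace ((((**) (matrix_inv B)) ^^ nat (- n)) (mat 1))" .
  moreover have "exp (- w) ^ nat (- n) = exp (of_int n * w)"
    using False by (simp flip: exp_of_nat_mult)
  ultimately show ?thesis using False by (simp add: matrix_power_int_def)
qed

lemma trace_det_similar:
  fixes A B C :: "complex^'n^'n"
  assumes "A ** C = C ** B" "det C \<noteq> 0"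
  shows "trace A = trace B" "det A = det B"
proof -
  have inv: "C ** matrix_inv C = mat 1"
    by (rule matrix_inv_nonsingular[OF assms(2)])
  then have inv': "matrix_inv C ** C = mat 1" by (simp add: matrix_left_right_inverse)
  have A: "A = C ** B ** matrix_inv C"
    using assms(1) inv by (metis matrix_mul_assoc matrix_mul_rid)
  have "trace A = trace (C ** (B ** matrix_inv C))" by (simp add: A matrix_mul_assoc)
  also have "\<dots> = trace (B ** (matrix_inv C ** C))"
    by (subst trace_mul_sym) (simp add: matrix_mul_assoc)
  finally show "trace A = trace B" by (simp add: inv' matrix_mul_rid)
  have "det A * det C = det C * det B" using assms(1) by (metis det_mul)
  then show "det A = det B" using assms(2) by simp
qed

section \<open>Scalar equations and their systems\<close>

lemma DERIV_fuchs:
  assumes "finite S" "z \<notin> S"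
  shows "((\<lambda>z. fuchs S R z $ i $ j) has_field_derivative - (\<Sum>p\<in>S. R p $ i $ j / (z - p)\<^sup>2)) (at z)"
proof -
  have "((\<lambda>z. \<Sum>p\<in>S. R p $ i $ j / (z - p)) has_field_derivative (\<Sum>p\<in>S. - (R p $ i $ j / (z - p)\<^sup>2))) (at z)"
  proof (intro DERIV_sum)
    fix p assume "p \<in> S"
    then have "z - p \<noteq> 0" using assms by auto
    then show "((\<lambda>z. R p $ i $ j / (z - p)) has_field_derivative - (R p $ i $ j / (z - p)\<^sup>2)) (at z)"
      by (auto intro!: derivative_eq_intros simp: power2_eq_square)
  qed
  then show ?thesis by (simp add: fuchs_def sum_negf)
qed

lemma eventually_eq_on_ball:
  assumes "f holomorphic_on ball z0 r" "g holomorphic_on ball z0 r" "w \<in> ball z0 r"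
    and "\<forall>\<^sub>F z in nhds w. f z = g z" and "z \<in> ball z0 r"
  shows "f z = g z"
proof -
  obtain T where T: "open T" "w \<in> T" "\<And>z. z \<in> T \<Longrightarrow> f z = g z"
    using assms(4) unfolding eventually_nhds by blast
  show ?thesis
    by (rule analytic_continuation_open[of "T \<inter> ball z0 r" "ball z0 r"]) (use assms T in auto)
qed

lemma fund_component_holomorphic:
  fixes R :: "complex \<Rightarrow> complex^'n^'n" and B :: "complex^'n^'n"
  assumes "finite S"
  shows "(\<lambda>z. (fund S R z0 z ** B) $ i $ j) holomorphic_on ball z0 (infdist z0 S)"
proof -
  have "(\<lambda>z. (fund S R z0 z ** B) $ i $ j) field_differentiable at z" if "z \<in> ball z0 (infdist z0 S)" for z
    using fuchs_sol_mult_const[OF fuchs_sol_fund[OF assms ball_infdist_finite], of S R z0 B] that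
    unfolding fuchs_sol_def field_differentiable_def by blast
  then show ?thesis by (simp add: holomorphic_on_def field_differentiable_at_within)
qed

text \<open>The family of germs in \<open>continuation_along\<close> comes without a uniform step,
  so the comparison with the transported germ runs by connectedness of the interval. Two holomorphic
  functions that agree near one point of a disc agree on the disc; this turns agreement at
  \<open>s'\<close> into a condition that does not mention \<open>s'\<close>, so it spreads to all
  nearby parameters.\<close>

theorem continuation_along_horizontal:
  fixes R :: "complex \<Rightarrow> complex^'n^'n" and B :: "complex^'n^'n"
  assumes S: "finite S" "S \<noteq> {}" and \<gamma>: "path \<gamma>" "path_image \<gamma> \<inter> S = {}"
    and fg: "continuation_along \<gamma> f g"
    and f: "\<forall>\<^sub>F z in nhds (\<gamma> 0). f z = (fund S R (\<gamma> 0) z ** B) $ i $ j"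
  shows "\<forall>\<^sub>F z in nhds (\<gamma> 1). g z = (fund S R (\<gamma> 1) z ** (transport S R \<gamma> ** B)) $ i $ j"
proof -
  obtain F where F: "F 0 = f" "F 1 = g"
    "\<And>s. s \<in> {0..1} \<Longrightarrow> F s analytic_on {\<gamma> s}"
    "\<And>s. s \<in> {0..1} \<Longrightarrow> \<forall>\<^sub>F s' in at s within {0..1}. \<forall>\<^sub>F z in nhds (\<gamma> s'). F s' z = F s z"
    using fg unfolding continuation_along_def by blast
  obtain G where G: "horizontal S R \<gamma> G" "G 0 = mat 1" using horizontal_exists[OF S \<gamma>] by blast
  obtain \<eta> where \<eta>: "0 < \<eta>"
    "\<And>s s'. \<lbrakk>s \<in> {0..1}; s' \<in> {0..1}; \<bar>s' - s\<bar> < \<eta>\<rbrakk> \<Longrightarrow> dist (\<gamma> s) (\<gamma> s') < infdist (\<gamma> s) S"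
    "\<And>s s'. \<lbrakk>s \<in> {0..1}; s' \<in> {0..1}; \<bar>s' - s\<bar> < \<eta>\<rbrakk> \<Longrightarrow> G s' = fund S R (\<gamma> s) (\<gamma> s') ** G s"
    using horizontalE[OF G(1)] by metis
  define H where "H = (\<lambda>s z. (fund S R (\<gamma> s) z ** (G s ** B)) $ i $ j)"
  define P where "P = (\<lambda>s. \<forall>\<^sub>F z in nhds (\<gamma> s). F s z = H s z)"
  have "P 1"
  proof (rule connected_induction_simple[where S = "{0..1::real}" and P = P and a = 0])
    fix s :: real assume s: "s \<in> {0..1}"
    have Hs: "H s holomorphic_on ball (\<gamma> s) (infdist (\<gamma> s) S)"
      unfolding H_def by (rule fund_component_holomorphic[OF S(1)])
    have pos: "0 < infdist (\<gamma> s) S" using \<eta>(2)[of s s] s \<eta>(1) by simp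
    obtain r0 where r0: "0 < r0" "F s holomorphic_on ball (\<gamma> s) r0"
      using F(3)[OF s] unfolding analytic_on_def by auto
    define r where "r = min r0 (infdist (\<gamma> s) S)"
    have r: "0 < r" "F s holomorphic_on ball (\<gamma> s) r" "H s holomorphic_on ball (\<gamma> s) r"
      using r0 Hs pos unfolding r_def by (auto elim!: holomorphic_on_subset)
    have "continuous (at s within {0..1}) \<gamma>"
      using \<gamma>(1) s by (simp add: path_def continuous_on_eq_continuous_within)
    then have "\<forall>\<^sub>F s' in at s within {0..1}. dist (\<gamma> s') (\<gamma> s) < r"
      using r(1) unfolding continuous_within tendsto_iff by auto
    moreover have "\<forall>\<^sub>F s' in at s within {0..1}. \<bar>s' - s\<bar> < \<eta>"
      unfolding eventually_at using \<eta>(1) by (intro exI[of _ \<eta>]) (auto simp: dist_real_def)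
    ultimately have "\<forall>\<^sub>F s' in at s within {0..1}. dist (\<gamma> s') (\<gamma> s) < r \<and> \<bar>s' - s\<bar> < \<eta> \<and>
        (\<forall>\<^sub>F z in nhds (\<gamma> s'). F s' z = F s z)"
      using F(4)[OF s] by (intro eventually_conj)
    then obtain d where d: "0 < d" "\<And>s'. \<lbrakk>s' \<in> {0..1}; s' \<noteq> s; dist s' s < d\<rbrakk> \<Longrightarrow>
        dist (\<gamma> s') (\<gamma> s) < r \<and> \<bar>s' - s\<bar> < \<eta> \<and> (\<forall>\<^sub>F z in nhds (\<gamma> s'). F s' z = F s z)"
      unfolding eventually_at by blast
    have key: "P s' \<longleftrightarrow> (\<forall>z\<in>ball (\<gamma> s) r. F s z = H s z)" if s': "s' \<in> {0..1}" "dist s' s < d" for s'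
    proof -
      have c: "dist (\<gamma> s') (\<gamma> s) < r" "\<bar>s' - s\<bar> < \<eta>" "\<forall>\<^sub>F z in nhds (\<gamma> s'). F s' z = F s z"
        using d(2)[of s'] s' r(1) \<eta>(1) by (cases "s' = s"; simp)+
      have H: "\<forall>\<^sub>F z in nhds (\<gamma> s'). H s' z = H s z"
      proof -
        have d1: "dist (\<gamma> s) (\<gamma> s') < infdist (\<gamma> s) S" "dist (\<gamma> s') (\<gamma> s') < infdist (\<gamma> s') S"
          using \<eta>(2)[of s s'] \<eta>(2)[of s' s'] s s' c(2) \<eta>(1) by auto
        let ?T = "ball (\<gamma> s) (infdist (\<gamma> s) S) \<inter> ball (\<gamma> s') (infdist (\<gamma> s') S)"
        have "\<forall>\<^sub>F z in nhds (\<gamma> s'). z \<in> ?T"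
          using d1 by (intro eventually_nhds_in_open) auto
        then show ?thesis
        proof eventually_elim
          case (elim z)
          have "fund S R (\<gamma> s') z ** fund S R (\<gamma> s) (\<gamma> s') = fund S R (\<gamma> s) z"
            using d1 elim by (intro fund_cocycle S(1)) auto
          moreover have "G s' = fund S R (\<gamma> s) (\<gamma> s') ** G s" using \<eta>(3)[of s s'] s s' c(2) by simp
          ultimately show ?case unfolding H_def by (metis matrix_mul_assoc)
        qed
      qed
      have iff: "P s' \<longleftrightarrow> (\<forall>\<^sub>F z in nhds (\<gamma> s'). F s z = H s z)"
        unfolding P_def
      proof
          assume "\<forall>\<^sub>F z in nhds (\<gamma> s'). F s' z = H s' z"
          then show "\<forall>\<^sub>F z in nhds (\<gamma> s'). F s z = H s z"
            using c(3) H by eventually_elim simp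
      next
          assume "\<forall>\<^sub>F z in nhds (\<gamma> s'). F s z = H s z"
          then show "\<forall>\<^sub>F z in nhds (\<gamma> s'). F s' z = H s' z"
            using c(3) H by eventually_elim simp
      qed
      show ?thesis
      proof
        assume "P s'"
        then have "\<forall>\<^sub>F z in nhds (\<gamma> s'). F s z = H s z" using iff by simp
        then show "\<forall>z\<in>ball (\<gamma> s) r. F s z = H s z"
          using eventually_eq_on_ball[OF r(2,3), of "\<gamma> s'"] c(1) by (auto simp: dist_commute)
      next
        assume *: "\<forall>z\<in>ball (\<gamma> s) r. F s z = H s z"
        have "\<forall>\<^sub>F z in nhds (\<gamma> s'). z \<in> ball (\<gamma> s) r"
          using c(1) by (intro eventually_nhds_in_open) (auto simp: dist_commute)
        then show "P s'" unfolding iff by eventually_elim (use * in blast)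
      qed
    qed
    show "\<exists>T. openin (top_of_set {0..1}) T \<and> s \<in> T \<and> (\<forall>x\<in>T. \<forall>y\<in>T. P x \<longrightarrow> P y)"
    proof (intro exI[of _ "{0..1} \<inter> ball s d"] conjI ballI impI)
      show "openin (top_of_set {0..1}) ({0..1} \<inter> ball s d)" by (intro openin_open_Int open_ball)
      show "s \<in> {0..1} \<inter> ball s d" using s d(1) by auto
      fix x y assume xy: "x \<in> {0..1} \<inter> ball s d" "y \<in> {0..1} \<inter> ball s d" "P x"
      then show "P y" using key[of x] key[of y] by (auto simp: dist_commute)
    qed
  next
    show "P 0" using f G(2) F(1) unfolding P_def H_def by (simp add: matrix_mul_lid)
  qed auto
  then show ?thesis unfolding P_def H_def F(2) transport_eq[OF G S \<gamma>] .
qed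

text \<open>Elimination of the second component from Y' = A Y. Where A12 is nonzero, Y2 = (Y1' - A11
  Y1) / A12, and Y1 solves the scalar equation with P = - tr A - A12' / A12 and Q = det A - A11' +
  A11 A12' / A12. The hypotheses are these formulas multiplied by A12, with A' written out; they are
  asked for near \<open>x0\<close> only, since the system takes over along the loop. The matrix
  \<open>C\<close> is the value at \<open>x0\<close> of the matrix solution built from the
  basis.\<close>

theorem monodromy_matrix_transport:
  fixes R :: "complex \<Rightarrow> complex^2^2"
  assumes S: "finite S" "S \<noteq> {}" and x0: "x0 \<notin> S"
    and nz: "\<forall>\<^sub>F z in nhds x0. fuchs S R z $ 1 $ 2 \<noteq> 0"
    and P: "\<forall>\<^sub>F z in nhds x0. P z * fuchs S R z $ 1 $ 2 =
       - trace (fuchs S R z) * fuchs S R z $ 1 $ 2 + (\<Sum>p\<in>S. R p $ 1 $ 2 / (z - p)\<^sup>2)"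
    and Q: "\<forall>\<^sub>F z in nhds x0. Q z * fuchs S R z $ 1 $ 2 =
       det (fuchs S R z) * fuchs S R z $ 1 $ 2
         + (\<Sum>p\<in>S. R p $ 1 $ 1 / (z - p)\<^sup>2) * fuchs S R z $ 1 $ 2
         - fuchs S R z $ 1 $ 1 * (\<Sum>p\<in>S. R p $ 1 $ 2 / (z - p)\<^sup>2)"
    and basis: "ode_basis_at P Q x0 y1 y2"
  obtains C where "det C \<noteq> 0"
    "\<And>\<gamma> M. \<lbrakk>path \<gamma>; path_image \<gamma> \<inter> S = {}; pathstart \<gamma> = x0; pathfinish \<gamma> = x0;
        monodromy_matrix \<gamma> y1 y2 M\<rbrakk> \<Longrightarrow> transport S R \<gamma> ** C = C ** M"
proof -
  let ?A = "fuchs S R"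
  have pos: "0 < infdist x0 S" by (rule infdist_pos_notin[OF S x0])
  have sol: "ode_solution_at P Q x0 y1" "ode_solution_at P Q x0 y2"
    and indep: "\<And>c1 c2. \<forall>\<^sub>F z in nhds x0. c1 * y1 z + c2 * y2 z = 0 \<Longrightarrow> c1 = 0 \<and> c2 = 0"
    using basis unfolding ode_basis_at_def by blast+
  obtain r1 where r1: "0 < r1" "y1 holomorphic_on ball x0 r1"
    using sol(1) unfolding ode_solution_at_def analytic_on_def by auto
  obtain r2 where r2: "0 < r2" "y2 holomorphic_on ball x0 r2"
    using sol(2) unfolding ode_solution_at_def analytic_on_def by auto
  have "\<forall>\<^sub>F z in nhds x0. z \<in> ball x0 (min (min r1 r2) (infdist x0 S)) \<and> ?A z $ 1 $ 2 \<noteq> 0 \<and>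
     (P z * ?A z $ 1 $ 2 = - trace (?A z) * ?A z $ 1 $ 2 + (\<Sum>p\<in>S. R p $ 1 $ 2 / (z - p)\<^sup>2)) \<and>
     (Q z * ?A z $ 1 $ 2 = det (?A z) * ?A z $ 1 $ 2
         + (\<Sum>p\<in>S. R p $ 1 $ 1 / (z - p)\<^sup>2) * ?A z $ 1 $ 2 - ?A z $ 1 $ 1 * (\<Sum>p\<in>S. R p $ 1 $ 2 / (z - p)\<^sup>2)) \<and>
     deriv (deriv y1) z + P z * deriv y1 z + Q z * y1 z = 0 \<and>
     deriv (deriv y2) z + P z * deriv y2 z + Q z * y2 z = 0"
    using nz P Q sol pos r1(1) r2(1) unfolding ode_solution_at_def
    by (intro eventually_conj eventually_nhds_in_open) auto
  then obtain r where r: "0 < r" and rP: "\<And>z. z \<in> ball x0 r \<Longrightarrow> z \<in> ball x0 (min (min r1 r2) (infdist x0 S)) \<and> ?A z $ 1 $ 2 \<noteq> 0 \<and>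
     (P z * ?A z $ 1 $ 2 = - trace (?A z) * ?A z $ 1 $ 2 + (\<Sum>p\<in>S. R p $ 1 $ 2 / (z - p)\<^sup>2)) \<and>
     (Q z * ?A z $ 1 $ 2 = det (?A z) * ?A z $ 1 $ 2
         + (\<Sum>p\<in>S. R p $ 1 $ 1 / (z - p)\<^sup>2) * ?A z $ 1 $ 2 - ?A z $ 1 $ 1 * (\<Sum>p\<in>S. R p $ 1 $ 2 / (z - p)\<^sup>2)) \<and>
     deriv (deriv y1) z + P z * deriv y1 z + Q z * y1 z = 0 \<and>
     deriv (deriv y2) z + P z * deriv y2 z + Q z * y2 z = 0"
    unfolding eventually_nhds_metric by (auto simp: dist_commute)
  define U where "U = ball x0 r"
  have U: "open U" "convex U" "x0 \<in> U" "U \<subseteq> ball x0 (infdist x0 S)"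
    using r rP unfolding U_def by auto
  define y where "y = (\<lambda>j::2. if j = 1 then y1 else y2)"
  have hol: "y j holomorphic_on U" for j
  proof -
    have "U \<subseteq> ball x0 r1" "U \<subseteq> ball x0 r2" using rP unfolding U_def by auto
    then show ?thesis using r1(2) r2(2) unfolding y_def by (auto elim: holomorphic_on_subset)
  qed
  \<comment> \<open>The second row is the one that the first equation of the system
    prescribes.\<close>
  define V where "V = (\<lambda>z. (\<chi> i j. if i = 1 then y j z else (deriv (y j) z - ?A z $ 1 $ 1 * y j z) / ?A z $ 1 $ 2) :: complex^2^2)"
  have V1: "V z $ 1 $ j = y j z" and V2: "V z $ 2 $ j = (deriv (y j) z - ?A z $ 1 $ 1 * y j z) / ?A z $ 1 $ 2" for z j
    by (simp_all add: V_def)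
  have Vsol: "fuchs_sol S R U V"
    unfolding fuchs_sol_def
  proof (intro ballI allI)
    fix z and i j :: 2 assume z: "z \<in> U"
    have zS: "z \<notin> S" using z U(4) infdist_le[of z S x0] by auto
    have nz: "?A z $ 1 $ 2 \<noteq> 0" using rP z by (auto simp: U_def)
    have d1: "(y j has_field_derivative deriv (y j) z) (at z)"
      using holomorphic_derivI[OF hol U(1) z] .
    have d2: "(deriv (y j) has_field_derivative deriv (deriv (y j)) z) (at z)"
      by (rule holomorphic_derivI[OF holomorphic_deriv[OF hol U(1)] U(1) z])
    define s11 where "s11 = (\<Sum>p\<in>S. R p $ 1 $ 1 / (z - p)\<^sup>2)"
    define s12 where "s12 = (\<Sum>p\<in>S. R p $ 1 $ 2 / (z - p)\<^sup>2)"
    have a11: "((\<lambda>z. ?A z $ 1 $ 1) has_field_derivative - s11) (at z)"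
      and a12: "((\<lambda>z. ?A z $ 1 $ 2) has_field_derivative - s12) (at z)"
      using DERIV_fuchs[OF S(1) zS, of R 1 1] DERIV_fuchs[OF S(1) zS, of R 1 2]
      unfolding s11_def s12_def by simp_all
    have ode: "deriv (deriv (y j)) z + P z * deriv (y j) z + Q z * y j z = 0"
      using rP z by (auto simp: U_def y_def)
    have PP: "P z = - trace (?A z) + s12 / ?A z $ 1 $ 2" "Q z = det (?A z) + s11 - ?A z $ 1 $ 1 * s12 / ?A z $ 1 $ 2"
      using rP[of z] z nz unfolding U_def s11_def[symmetric] s12_def[symmetric] by (simp_all add: field_simps)
    have row1: "(?A z ** V z) $ 1 $ j = deriv (y j) z"
      using nz by (simp add: matrix_matrix_mult_def sum_2 V1 V2)
    show "((\<lambda>z. V z $ i $ j) has_field_derivative (?A z ** V z) $ i $ j) (at z)"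
    proof (cases "i = 1")
      case True
      then show ?thesis using d1 row1 by (simp add: V1)
    next
      case False
      then have i: "i = 2" using exhaust_2 by blast
      have "((\<lambda>z. (deriv (y j) z - ?A z $ 1 $ 1 * y j z) / ?A z $ 1 $ 2) has_field_derivative
        ((deriv (deriv (y j)) z - (- s11 * y j z + deriv (y j) z * ?A z $ 1 $ 1)) * ?A z $ 1 $ 2
          - (deriv (y j) z - ?A z $ 1 $ 1 * y j z) * - s12) / (?A z $ 1 $ 2 * ?A z $ 1 $ 2)) (at z)"
        by (intro DERIV_divide DERIV_diff DERIV_mult a11 a12 d1 d2 nz)
      moreover have "((deriv (deriv (y j)) z - (- s11 * y j z + deriv (y j) z * ?A z $ 1 $ 1)) * ?A z $ 1 $ 2
          - (deriv (y j) z - ?A z $ 1 $ 1 * y j z) * - s12) / (?A z $ 1 $ 2 * ?A z $ 1 $ 2) = (?A z ** V z) $ 2 $ j"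
      proof -
        have e: "deriv (deriv (y j)) z = - (P z * deriv (y j) z) - Q z * y j z"
          using ode by (simp add: algebra_simps eq_neg_iff_add_eq_0)
        show ?thesis
          unfolding e PP using nz
          by (simp add: matrix_matrix_mult_def sum_2 V1 V2 det_2 trace_def divide_simps) (simp add: algebra_simps power2_eq_square)
      qed
      ultimately show ?thesis by (simp add: i V2)
    qed
  qed
  define C where "C = V x0"
  have VC: "V z = fund S R x0 z ** C" if "z \<in> U" for z
    unfolding C_def by (rule fuchs_sol_unique[OF S(1) Vsol U(2-4) that])
  have evU: "\<forall>\<^sub>F z in nhds x0. z \<in> U" using U by (intro eventually_nhds_in_open) auto
  have ev: "\<forall>\<^sub>F z in nhds x0. y j z = (fund S R x0 z ** C) $ 1 $ j" for j
    using evU by eventually_elim (use VC V1 in metis)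
  have "det C \<noteq> 0"
  proof
    assume "det C = 0"
    then obtain x where x: "x \<noteq> 0" "C *v x = 0"
      by (metis invertible_det_nz invertible_left_inverse matrix_left_invertible_ker)
    have "\<forall>\<^sub>F z in nhds x0. x $ 1 * y1 z + x $ 2 * y2 z = 0"
      using evU
    proof eventually_elim
      case (elim z)
      have "(V z *v x) $ 1 = 0" using VC[OF elim] x(2) by (simp flip: matrix_vector_mul_assoc)
      then show ?case by (simp add: matrix_vector_mult_def sum_2 V1 y_def mult.commute)
    qed
    then have "x $ 1 = 0 \<and> x $ 2 = 0" by (rule indep)
    then show False using x(1) by (simp add: vec_eq_iff forall_2)
  qed
  moreover have "transport S R \<gamma> ** C = C ** M"
    if \<gamma>: "path \<gamma>" "path_image \<gamma> \<inter> S = {}" "pathstart \<gamma> = x0" "pathfinish \<gamma> = x0"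
      and M: "monodromy_matrix \<gamma> y1 y2 M" for \<gamma> M
  proof -
    have g01: "\<gamma> 0 = x0" "\<gamma> 1 = x0" using \<gamma>(3,4) by (auto simp: pathstart_def pathfinish_def)
    obtain g1 g2 where g: "continuation_along \<gamma> y1 g1" "continuation_along \<gamma> y2 g2"
      and gM: "\<forall>\<^sub>F z in nhds x0. (vector [g1 z, g2 z] :: complex^2) = vector [y1 z, y2 z] v* M"
      using M \<gamma>(4) unfolding monodromy_matrix_def by auto
    let ?T = "transport S R \<gamma>"
    have G: "\<forall>\<^sub>F z in nhds x0. g1 z = (fund S R x0 z ** (?T ** C)) $ 1 $ 1"
      "\<forall>\<^sub>F z in nhds x0. g2 z = (fund S R x0 z ** (?T ** C)) $ 1 $ 2"
      using continuation_along_horizontal[OF S \<gamma>(1,2) g(1), of R C 1 1]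
        continuation_along_horizontal[OF S \<gamma>(1,2) g(2), of R C 1 2] ev[of 1] ev[of 2]
      unfolding g01 by (simp_all add: y_def)
    \<comment> \<open>\<open>E\<close> measures the failure of the relation. The first row of
      \<open>fund S R x0 z ** E\<close> vanishes near \<open>x0\<close>, hence also its derivative
      at \<open>x0\<close>; as A12 is nonzero there, both rows of \<open>E\<close> vanish.\<close>
    define E where "E = ?T ** C - C ** M"
    have fsolE: "fuchs_sol S R (ball x0 (infdist x0 S)) (\<lambda>z. fund S R x0 z ** E)"
      by (rule fuchs_sol_mult_const[OF fuchs_sol_fund[OF S(1) ball_infdist_finite]])
    have "\<forall>\<^sub>F z in nhds x0. (fund S R x0 z ** E) $ 1 $ 1 = 0 \<and> (fund S R x0 z ** E) $ 1 $ 2 = 0"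
      using G gM evU
    proof eventually_elim
      case (elim z)
      have "(V z ** M) $ 1 $ 1 = g1 z" "(V z ** M) $ 1 $ 2 = g2 z"
        using elim(3) by (simp_all add: vec_eq_iff forall_2 vector_matrix_mult_def matrix_matrix_mult_def sum_2 V1 y_def mult.commute)
      moreover have "fund S R x0 z ** E = fund S R x0 z ** (?T ** C) - V z ** M"
        unfolding E_def VC[OF elim(4)]
        by (simp add: matrix_matrix_mult_def vec_eq_iff sum_2 forall_2 algebra_simps)
      ultimately show ?case using elim(1,2) by simp
    qed
    then obtain W where W: "open W" "x0 \<in> W" "\<And>z. z \<in> W \<Longrightarrow> (fund S R x0 z ** E) $ 1 $ 1 = 0 \<and> (fund S R x0 z ** E) $ 1 $ 2 = 0"
      unfolding eventually_nhds by blast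
    have row1: "(fund S R x0 z ** E) $ 1 $ j = 0" if "z \<in> W" for z j
      using W(3)[OF that] exhaust_2[of j] by auto
    have "(?A x0 ** (fund S R x0 x0 ** E)) $ 1 $ j = 0" for j
    proof -
      have d: "((\<lambda>z. (fund S R x0 z ** E) $ 1 $ j) has_field_derivative (?A x0 ** (fund S R x0 x0 ** E)) $ 1 $ j) (at x0)"
        using pos by (intro fsolE[unfolded fuchs_sol_def, rule_format]) simp
      have "((\<lambda>z. (fund S R x0 z ** E) $ 1 $ j) has_field_derivative 0) (at x0)"
        by (rule has_field_derivative_transform_within_open[of "\<lambda>_. 0" 0 x0 W]) (use W row1 in auto)
      then show ?thesis using d DERIV_unique by blast
    qed
    then have "?A x0 $ 1 $ 1 * E $ 1 $ j + ?A x0 $ 1 $ 2 * E $ 2 $ j = 0" for j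
      by (simp add: matrix_mul_lid) (simp add: matrix_matrix_mult_def sum_2)
    moreover have E1: "E $ 1 $ j = 0" for j using row1[OF W(2), of j] by (simp add: matrix_mul_lid)
    moreover have "?A x0 $ 1 $ 2 \<noteq> 0" using rP[of x0] r by simp
    ultimately have E2: "E $ 2 $ j = 0" for j by simp
    have "E = 0" using E1 E2 by (simp add: vec_eq_iff forall_2)
    then show ?thesis by (simp add: E_def)
  qed
  ultimately show ?thesis by (rule that)
qed

section \<open>Planar topology of loops\<close>

lemma in_outsideI:
  assumes "connected E" "z \<in> E" "\<not> bounded E" "E \<inter> K = {}"
  shows "z \<in> outside K"
proof -
  have "E \<subseteq> connected_component_set (- K) z"
    using assms by (intro connected_component_maximal) auto
  then show ?thesis
    using assms bounded_subset unfolding outside_def by blast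
qed

text \<open>Every point off \<open>C\<close> is joined to infinity outside \<open>C\<close>: a point
  of another component by the closure of that component, which reaches the frontier of
  \<open>W\<close>, followed by an unbounded connected set that starts there. So no loop in
  \<open>C\<close> winds around it.\<close>

lemma simply_connected_componentI:
  fixes W :: "complex set"
  assumes W: "open W" and compl: "\<And>z. z \<notin> W \<Longrightarrow> \<exists>E. connected E \<and> z \<in> E \<and> \<not> bounded E \<and> E \<inter> W = {}"
    and C: "C \<in> components W"
  shows "simply_connected C"
proof -
  have oC: "open C" using open_components[OF W C] .
  have CW: "C \<subseteq> W" "C \<noteq> {}" "connected C"
    using C in_components_subset in_components_nonempty in_components_connected by blast+
  have unb: "\<exists>E. connected E \<and> z \<in> E \<and> \<not> bounded E \<and> E \<inter> C = {}" if z: "z \<notin> C" for z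
  proof (cases "z \<in> W")
    case False
    then show ?thesis using compl[OF False] CW by blast
  next
    case True
    define D where "D = connected_component_set W z"
    have D: "D \<in> components W" "z \<in> D" using True unfolding D_def by (auto simp: components_def)
    then have disj: "C \<inter> D = {}" using components_nonoverlap[OF C D(1)] z by blast
    have oD: "open D" using open_components[OF W D(1)] .
    have "D \<noteq> UNIV" using disj CW(2) by auto
    then have "frontier D \<noteq> {}" using D(2) frontier_not_empty by blast
    then obtain w where w: "w \<in> frontier D" by blast
    then have "w \<in> frontier W" using frontier_of_components_subset[OF D(1)] by blast
    then have "w \<notin> W" using W by (simp add: frontier_def interior_open)
    then obtain E where E: "connected E" "w \<in> E" "\<not> bounded E" "E \<inter> W = {}" using compl by blast
    have wD: "w \<in> closure D" using w by (simp add: frontier_def)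
    have "connected (closure D \<union> E)"
      using E wD in_components_connected[OF D(1)] by (intro connected_Un connected_imp_connected_closure) auto
    moreover have "z \<in> closure D \<union> E" using D(2) closure_subset by blast
    moreover have "\<not> bounded (closure D \<union> E)" using E(3) by (simp add: bounded_Un)
    moreover have "(closure D \<union> E) \<inter> C = {}"
      using open_Int_closure_eq_empty[OF oC, of D] disj E(4) CW(1) by blast
    ultimately show ?thesis by blast
  qed
  have "winding_number g z = 0"
    if "path g" "path_image g \<subseteq> C" "pathfinish g = pathstart g" "z \<notin> C" for g z
  proof -
    obtain E where E: "connected E" "z \<in> E" "\<not> bounded E" "E \<inter> C = {}"
      using unb[OF \<open>z \<notin> C\<close>] by blast
    then have "z \<in> outside (path_image g)" using that by (intro in_outsideI[of E]) auto
    then show ?thesis using winding_number_zero_in_outside[OF that(1,3)] by blast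
  qed
  then show ?thesis unfolding simply_connected_eq_winding_number_zero[OF oC] using CW(3) by blast
qed

text \<open>The universal cover of the complement of a continuum: \<open>\<zeta> \<mapsto> a + exp \<zeta>\<close> turns the
  winding number around the continuum into the displacement of the lifted path.\<close>

lemma exp_preimage_unbounded:
  fixes \<pi>' :: "real \<Rightarrow> complex"
  assumes p: "path \<pi>'" "pathstart \<pi>' = a + exp \<zeta>" "pathfinish \<pi>' = a"
  obtains E where "connected E" "\<zeta> \<in> E" "\<not> bounded E" "(\<lambda>\<zeta>. a + exp \<zeta>) ` E \<subseteq> path_image \<pi>'"
proof -
  have cont: "continuous_on {0..1} \<pi>'" using p(1) by (simp add: path_def)
  let ?T = "{t \<in> {0..1}. \<pi>' t = a}"
  have "closed ?T" using continuous_closed_preimage_constant[OF cont, of a] by simp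
  moreover have "?T \<subseteq> {0..1}" by auto
  ultimately have "compact ?T" using compact_Int_closed[of "{0..1::real}" ?T] by (simp add: Int_absorb1)
  moreover have "1 \<in> ?T" using p(3) by (simp add: pathfinish_def)
  \<comment> \<open>\<open>u\<close> is the first time at which the path reaches \<open>a\<close>.
    Up to \<open>u\<close> a continuous logarithm exists, and it must be unbounded, since its
    exponential tends to 0.\<close>
  ultimately obtain u where u: "u \<in> ?T" "\<And>t. t \<in> ?T \<Longrightarrow> u \<le> t"
    using compact_attains_inf[of ?T] by blast
  have p0: "\<pi>' 0 = a + exp \<zeta>" using p(2) by (simp add: pathstart_def)
  have "u \<noteq> 0" using u(1) p0 by auto
  then have u0: "0 < u" "u \<le> 1" "\<pi>' u = a" using u(1) by auto
  have "continuous_on {0..<u} (\<lambda>t. \<pi>' t - a)"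
    using cont u0 by (intro continuous_intros) (auto elim: continuous_on_subset)
  moreover have "contractible {0..<u}" by (simp add: convex_imp_contractible)
  moreover have "\<pi>' t - a \<noteq> 0" if "t \<in> {0..<u}" for t
    using u(2)[of t] that u0 by auto
  ultimately obtain g where g: "continuous_on {0..<u} g" "\<And>t. t \<in> {0..<u} \<Longrightarrow> \<pi>' t - a = exp (g t)"
    using continuous_logarithm_on_contractible by blast
  define G where "G = (\<lambda>t. g t + (\<zeta> - g 0))"
  have "exp (g 0) = exp \<zeta>" using g(2)[of 0] u0 p0 by simp
  then have expG: "exp (G t) = \<pi>' t - a" if "t \<in> {0..<u}" for t
    using g(2)[OF that] by (simp add: G_def exp_add exp_diff)
  show ?thesis
  proof (rule that[of "G ` {0..<u}"])
    show "connected (G ` {0..<u})"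
      unfolding G_def by (intro connected_continuous_image continuous_intros g(1)) simp
    show "\<zeta> \<in> G ` {0..<u}" using u0 by (intro image_eqI[of _ _ 0]) (auto simp: G_def)
    show "(\<lambda>\<zeta>. a + exp \<zeta>) ` G ` {0..<u} \<subseteq> path_image \<pi>'"
      using expG u0 by (auto simp: path_image_def)
    show "\<not> bounded (G ` {0..<u})"
    proof
      assume "bounded (G ` {0..<u})"
      then obtain M where M: "\<And>t. t \<in> {0..<u} \<Longrightarrow> norm (G t) \<le> M" unfolding bounded_iff by blast
      have "exp (- M) \<le> norm (\<pi>' t - a)" if "t \<in> {0..<u}" for t
      proof -
        have "- M \<le> Re (G t)" using M[OF that] abs_Re_le_cmod[of "G t"] by linarith
        then show ?thesis using expG[OF that] by (metis exp_le_cancel_iff norm_exp_eq_Re)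
      qed
      moreover have "((\<lambda>t. norm (\<pi>' t - a)) \<longlongrightarrow> norm (\<pi>' u - a)) (at u within {0..<u})"
      proof -
        have "(\<pi>' \<longlongrightarrow> \<pi>' u) (at u within {0..1})"
          using cont u(1) unfolding continuous_on_def by blast
        then have "(\<pi>' \<longlongrightarrow> \<pi>' u) (at u within {0..<u})"
          using u0 by (elim tendsto_within_subset) auto
        then show ?thesis by (intro tendsto_intros)
      qed
      moreover have "at u within {0..<u} \<noteq> bot"
        using u0 by (simp add: trivial_limit_within islimpt_Ico)
      ultimately have "exp (- M) \<le> norm (\<pi>' u - a)"
        by (intro tendsto_lowerbound[of "\<lambda>t. norm (\<pi>' t - a)" _ "at u within {0..<u}"])
          (auto simp: eventually_at_filter)
      then show False using u0 by simp
    qed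
  qed
qed

text \<open>Lifts with a common start also have a common end, as the winding numbers agree, and so
  lie in one component of the preimage of D - E under the exponential. That component is simply
  connected: from a point over \<open>E\<close> one runs to infinity along the lift of a path in
  \<open>E\<close> to \<open>a\<close>; from a point over the complement of \<open>D\<close> the
  horizontal ray to the right stays there, because \<open>D\<close> is star-shaped about
  \<open>a\<close>.\<close>

theorem homotopic_paths_around_continuum:
  fixes D E :: "complex set"
  assumes D: "open D" "convex D" and E: "compact E" "path_connected E" "E \<subseteq> D" "a \<in> E"
    and p: "path p" "path_image p \<subseteq> D - E" and q: "path q" "path_image q \<subseteq> D - E"
    and pq: "pathstart p = pathstart q" "pathfinish p = pathfinish q" "winding_number p a = winding_number q a"
  shows "homotopic_paths (D - E) p q"
proof -
  define e where "e = (\<lambda>\<zeta>. a + exp \<zeta>)"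
  define W where "W = e -` (D - E)"
  have ce: "continuous_on A e" for A unfolding e_def by (intro continuous_intros)
  have "open (D - E)" using D(1) E(1) by (intro open_Diff compact_imp_closed)
  then have W: "open W" unfolding W_def using ce by (intro open_vimage)
  have compl: "\<exists>F. connected F \<and> z \<in> F \<and> \<not> bounded F \<and> F \<inter> W = {}" if "z \<notin> W" for z
  proof (cases "e z \<in> E")
    case True
    then obtain \<pi>' where \<pi>': "path \<pi>'" "path_image \<pi>' \<subseteq> E" "pathstart \<pi>' = e z" "pathfinish \<pi>' = a"
      using E(2,4) unfolding path_connected_def by blast
    then obtain F where F: "connected F" "z \<in> F" "\<not> bounded F" "(\<lambda>\<zeta>. a + exp \<zeta>) ` F \<subseteq> path_image \<pi>'"
      using exp_preimage_unbounded[of \<pi>' a z] unfolding e_def by metis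
    then have "F \<inter> W = {}" using \<pi>'(2) by (auto simp: W_def e_def)
    then show ?thesis using F by blast
  next
    case False
    then have nD: "e z \<notin> D" using that by (auto simp: W_def)
    define F where "F = (\<lambda>s. z + of_real s) ` {0::real..}"
    have "connected F" unfolding F_def by (intro connected_continuous_image continuous_intros) simp
    moreover have "z \<in> F" unfolding F_def by (intro image_eqI[of _ _ 0]) auto
    moreover have "\<not> bounded F"
    proof
      assume "bounded F"
      then obtain M where M: "\<And>x. x \<in> F \<Longrightarrow> norm x \<le> M" by (auto simp: bounded_iff)
      define s where "s = \<bar>M\<bar> + norm z + 1"
      have "z + of_real s \<in> F" unfolding F_def s_def by (intro imageI) auto
      then have "norm (z + of_real s) \<le> M" using M by blast
      moreover have "s - norm z \<le> norm (z + of_real s)"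
      proof -
        have "0 \<le> s" by (simp add: s_def)
        then have "norm (complex_of_real s) = s" by simp
        then show ?thesis using norm_triangle_ineq4[of "z + of_real s" z] by simp
      qed
      ultimately show False by (simp add: s_def)
    qed
    moreover have "F \<inter> W = {}"
    proof -
      have False if s: "0 \<le> s" and "e (z + of_real s) \<in> D" for s :: real
      proof -
        have "a \<in> D" using E by blast
        \<comment> \<open>The point a + exp z divides the segment from \<open>a\<close> to a + exp
          (z + s) in the ratio given by exp (- s), so convexity of \<open>D\<close> would put it
          into \<open>D\<close>.\<close>
        have "(1 - exp (- s)) *\<^sub>R a + exp (- s) *\<^sub>R e (z + of_real s) \<in> D"
          using s \<open>a \<in> D\<close> that(2) by (intro convexD[OF D(2)]) auto
        moreover have "(1 - exp (- s)) *\<^sub>R a + exp (- s) *\<^sub>R e (z + of_real s) = e z"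
          by (simp add: e_def scaleR_conv_of_real exp_add algebra_simps exp_minus flip: exp_of_real)
        ultimately show False using nD by simp
      qed
      then show ?thesis by (auto simp: F_def W_def)
    qed
    ultimately show ?thesis by blast
  qed
  have ap: "a \<notin> path_image p" "a \<notin> path_image q" using p(2) q(2) E(4) by auto
  obtain P where P: "path P" "pathfinish P - pathstart P = 2 * of_real pi * \<i> * winding_number p a"
    "\<And>t. t \<in> {0..1} \<Longrightarrow> p t = a + exp (P t)"
    using winding_number_as_continuous_log[OF p(1) ap(1)] by blast
  obtain Q where Q: "path Q" "pathfinish Q - pathstart Q = 2 * of_real pi * \<i> * winding_number q a"
    "\<And>t. t \<in> {0..1} \<Longrightarrow> q t = a + exp (Q t)"
    using winding_number_as_continuous_log[OF q(1) ap(2)] by blast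
  define Q' where "Q' = (\<lambda>t. Q t + (P 0 - Q 0))"
  have pathQ': "path Q'" using Q(1) unfolding Q'_def path_def by (intro continuous_intros)
  have "exp (P 0) = exp (Q 0)" using P(3)[of 0] Q(3)[of 0] pq(1) by (simp add: pathstart_def)
  then have Q'q: "q t = a + exp (Q' t)" if "t \<in> {0..1}" for t
    using Q(3)[OF that] by (simp add: Q'_def exp_add exp_diff)
  have starts: "Q' 0 = P 0" "Q' 1 = P 1"
    using P(2) Q(2) pq(3) by (simp_all add: Q'_def pathstart_def pathfinish_def algebra_simps)
  have PW: "path_image P \<subseteq> W" and QW: "path_image Q' \<subseteq> W"
    using p(2) q(2) P(3) Q'q by (auto simp: path_image_def W_def e_def image_subset_iff)
  define C where "C = connected_component_set W (P 0)"
  have P0: "P 0 \<in> W" using PW by (auto simp: path_image_def)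
  have C: "C \<in> components W" unfolding C_def using P0 by (auto simp: components_def)
  have PC: "path_image P \<subseteq> C" unfolding C_def
    using PW P(1) by (intro connected_component_maximal connected_path_image) (auto simp: path_image_def)
  have QC: "path_image Q' \<subseteq> C" unfolding C_def
    using QW pathQ' starts(1) by (intro connected_component_maximal connected_path_image) (force simp: path_image_def)+
  have "simply_connected C" by (rule simply_connected_componentI[OF W compl C])
  then have "homotopic_paths C P Q'"
    unfolding simply_connected_eq_homotopic_paths using P(1) PC pathQ' QC starts
    by (auto simp: pathstart_def pathfinish_def)
  then have "homotopic_paths (D - E) (e \<circ> P) (e \<circ> Q')"
    by (rule homotopic_paths_continuous_image) (use ce in_components_subset[OF C] in \<open>auto simp: W_def\<close>)
  moreover have "homotopic_paths (D - E) p (e \<circ> P)"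
    using p P(3) by (intro homotopic_paths_eq) (auto simp: e_def)
  moreover have "homotopic_paths (D - E) q (e \<circ> Q')"
    using q Q'q by (intro homotopic_paths_eq) (auto simp: e_def)
  ultimately show ?thesis using homotopic_paths_trans homotopic_paths_sym by blast
qed

text \<open>f z - f a = (z - a) * k z, where \<open>k\<close> has no zeros by injectivity, not even
  at \<open>a\<close>, where its value is the derivative. On the simply connected \<open>U\<close>
  it has a continuous logarithm, whose change along a closed path is 0.\<close>

lemma winding_number_injective_image:
  assumes U: "open U" "simply_connected U" and f: "f holomorphic_on U" "inj_on f U"
    and \<gamma>: "path \<gamma>" "pathfinish \<gamma> = pathstart \<gamma>" "path_image \<gamma> \<subseteq> U - {a}" and a: "a \<in> U"
  shows "winding_number (f \<circ> \<gamma>) (f a) = winding_number \<gamma> a"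
proof -
  define k where "k = (\<lambda>z. if z = a then deriv f a else (f z - f a) / (z - a))"
  have "continuous_on U k"
  proof (rule continuous_at_imp_continuous_on, rule ballI)
    fix z assume z: "z \<in> U"
    show "isCont k z"
    proof (cases "z = a")
      case True
      have "((\<lambda>z. (f z - f a) / (z - a)) \<longlongrightarrow> deriv f a) (at a)"
        using holomorphic_derivI[OF f(1) U(1) a] by (simp add: has_field_derivative_iff)
      then have "(k \<longlongrightarrow> deriv f a) (at a)"
        by (rule Lim_transform_eventually) (auto simp: eventually_at_filter k_def)
      then show ?thesis unfolding True isCont_def by (simp add: k_def)
    next
      case False
      have "isCont f z" using f(1) U(1) z holomorphic_on_imp_continuous_on continuous_on_eq_continuous_at by blast
      then have "isCont (\<lambda>z. (f z - f a) / (z - a)) z"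
        using False by (intro continuous_intros) auto
      moreover have "\<forall>\<^sub>F w in nhds z. k w = (f w - f a) / (w - a)"
        using t1_space_nhds[OF False] by (rule eventually_mono) (simp add: k_def)
      ultimately show ?thesis using isCont_cong[of k "\<lambda>z. (f z - f a) / (z - a)" z] by simp
    qed
  qed
  moreover have "k z \<noteq> 0" if "z \<in> U" for z
    using that a f(2) holomorphic_injective_imp_regular[OF f(1) U(1) f(2) a]
    by (auto simp: k_def dest: inj_onD)
  ultimately obtain h where h: "continuous_on U h" "\<And>z. z \<in> U \<Longrightarrow> k z = exp (h z)"
    using continuous_logarithm_on_simply_connected[OF _ U(2) open_imp_locally_path_connected[OF U(1)]] by metis
  have "a \<notin> path_image \<gamma>" using \<gamma>(3) by auto
  then obtain q where q: "path q" "pathfinish q - pathstart q = 2 * of_real pi * \<i> * winding_number \<gamma> a"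
    "\<And>t. t \<in> {0..1} \<Longrightarrow> \<gamma> t = a + exp (q t)"
    using winding_number_as_continuous_log[OF \<gamma>(1)] by blast
  define Q where "Q = (\<lambda>t. q t + h (\<gamma> t))"
  have im: "\<gamma> t \<in> U" "\<gamma> t \<noteq> a" if "t \<in> {0..1}" for t
    using \<gamma>(3) that unfolding path_image_def by blast+
  have pQ: "path Q"
    unfolding Q_def path_def using q(1) \<gamma>(1) im
    by (intro continuous_intros continuous_on_compose2[OF h(1)]) (auto simp: path_def)
  have "winding_number (f \<circ> \<gamma>) (f a) = winding_number (\<lambda>t. (f \<circ> \<gamma>) t - f a) 0"
    by (rule winding_number_offset)
  also have "\<dots> = winding_number (exp \<circ> Q) 0"
  proof (rule winding_number_cong)
    fix t :: real assume "0 \<le> t" "t \<le> 1"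
    then have t: "t \<in> {0..1}" by simp
    have "(exp \<circ> Q) t = (\<gamma> t - a) * k (\<gamma> t)"
      using q(3)[OF t] h(2)[OF im(1)[OF t]] by (simp add: Q_def exp_add)
    then show "(f \<circ> \<gamma>) t - f a = (exp \<circ> Q) t"
      using im(2)[OF t] by (simp add: k_def)
  qed
  also have "\<dots> = (pathfinish Q - pathstart Q) / (2 * of_real pi * \<i>)"
    by (rule winding_number_compose_exp[OF pQ])
  also have "pathfinish Q - pathstart Q = pathfinish q - pathstart q"
    using \<gamma>(2) by (simp add: Q_def pathstart_def pathfinish_def)
  finally show ?thesis unfolding q(2) by (simp add: o_def)
qed

text \<open>Measured by the angle from \<open>q1\<close>, the arcs are images of two open intervals,
  separated by the angle \<beta> of \<open>q2\<close>. The points may coincide: then \<beta> = 0 and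
  the first arc is empty.\<close>

lemma sphere_minus_two_points:
  fixes x0 q1 q2 :: complex
  assumes r: "0 < r" and q: "q1 \<in> sphere x0 r" "q2 \<in> sphere x0 r"
  obtains S1 S2 where "path_connected S1" "path_connected S2" "sphere x0 r - {q1, q2} = S1 \<union> S2"
proof -
  define g where "g = (\<lambda>s. x0 + (q1 - x0) * exp (\<i> * of_real s))"
  define u where "u = (\<lambda>x. Arg2pi ((x - x0) / (q1 - x0)))"
  have nz: "q1 - x0 \<noteq> 0" "norm (q1 - x0) = r" using r q(1) by (auto simp: dist_norm norm_minus_commute)
  have gu: "x = g (u x)" if "x \<in> sphere x0 r" for x
  proof -
    have "norm ((x - x0) / (q1 - x0)) = 1"
      using that nz r by (simp add: norm_divide dist_norm norm_minus_commute)
    then have "(x - x0) / (q1 - x0) = exp (\<i> * of_real (u x))"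
      using Arg2pi_eq[of "(x - x0) / (q1 - x0)"] by (simp add: u_def)
    then show ?thesis using nz by (simp add: g_def field_simps)
  qed
  have u: "0 \<le> u x" "u x < 2 * pi" for x by (simp_all add: u_def Arg2pi)
  have inj: "s = s'" if "g s = g s'" "\<bar>s - s'\<bar> < 2 * pi" for s s'
  proof -
    have "(q1 - x0) * exp (\<i> * of_real s) = (q1 - x0) * exp (\<i> * of_real s')"
      using that(1) by (simp add: g_def)
    then have "exp (\<i> * of_real s) = exp (\<i> * of_real s')" using nz by simp
    then have "exp (\<i> * of_real (s - s')) = 1"
      by (simp add: right_diff_distrib exp_diff)
    then obtain n :: int where "s - s' = of_int (2 * n) * pi" by (auto simp: exp_eq_1)
    then have "\<bar>real_of_int n\<bar> * (2 * pi) < 1 * (2 * pi)" using that(2) by (simp add: abs_mult)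
    then have "\<bar>real_of_int n\<bar> < 1" by (simp only: mult_less_cancel_right_pos[OF pi_gt_zero] mult_less_cancel_right) auto
    then have "n = 0" by linarith
    then show ?thesis using \<open>s - s' = _\<close> by simp
  qed
  have gs: "g s \<in> sphere x0 r" for s
    using nz by (simp add: g_def dist_norm norm_mult)
  have g0: "g 0 = q1" by (simp add: g_def)
  define \<beta> where "\<beta> = u q2"
  have g\<beta>: "g \<beta> = q2" using gu[OF q(2)] by (simp add: \<beta>_def)
  have "continuous_on A g" for A unfolding g_def by (intro continuous_intros)
  then have pc: "path_connected (g ` {c<..<d})" for c d :: real
    by (intro path_connected_continuous_image convex_imp_path_connected) auto
  have "sphere x0 r - {q1, q2} = g ` {0<..<\<beta>} \<union> g ` {\<beta><..<2 * pi}"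
  proof
    show "sphere x0 r - {q1, q2} \<subseteq> g ` {0<..<\<beta>} \<union> g ` {\<beta><..<2 * pi}"
    proof
      fix x assume x: "x \<in> sphere x0 r - {q1, q2}"
      then have "x = g (u x)" using gu by blast
      moreover from this x have "u x \<noteq> 0" "u x \<noteq> \<beta>" using g0 g\<beta> by (metis DiffD2 insertCI)+
      ultimately show "x \<in> g ` {0<..<\<beta>} \<union> g ` {\<beta><..<2 * pi}"
        using u[of x] by (cases "u x < \<beta>") auto
    qed
    have n1: "g s \<noteq> q1" if "0 < s" "s < 2 * pi" for s
      using inj[of s 0] that g0 by auto
    have n2: "g s \<noteq> q2" if "0 < s" "s < 2 * pi" "s \<noteq> \<beta>" for s
    proof -
      have "\<bar>s - \<beta>\<bar> < 2 * pi" using that u[of q2] unfolding \<beta>_def by linarith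
      then show ?thesis using inj[of s \<beta>] that(3) g\<beta> by metis
    qed
    show "g ` {0<..<\<beta>} \<union> g ` {\<beta><..<2 * pi} \<subseteq> sphere x0 r - {q1, q2}"
    proof
      fix x assume "x \<in> g ` {0<..<\<beta>} \<union> g ` {\<beta><..<2 * pi}"
      then obtain s where s: "x = g s" "s \<in> {0<..<\<beta>} \<union> {\<beta><..<2 * pi}" by blast
      then have "0 < s" "s < 2 * pi" "s \<noteq> \<beta>" using u[of q2] by (auto simp: \<beta>_def)
      then show "x \<in> sphere x0 r - {q1, q2}"
        using gs[of s] n1[of s] n2[of s] unfolding s(1) by blast
    qed
  qed
  then show ?thesis using that[OF pc pc] by blast
qed

text \<open>Every small circle about the base point cuts off the two ends of the loop. The ends of
  length \<open>h\<close> stay in the given ball; on the remaining middle part the distance to the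
  base point has a positive minimum because the loop is simple. For a radius below this minimum,
  \<open>s1\<close> is the last time in the first half and \<open>s2\<close> the first time in the
  second half at which the loop is within that radius.\<close>

lemma simple_loop_exit:
  assumes \<sigma>: "simple_path \<sigma>" "pathstart \<sigma> = x0" "pathfinish \<sigma> = x0" and e: "0 < e"
  obtains r0 where "0 < r0"
    "\<And>r. \<lbrakk>0 < r; r < r0\<rbrakk> \<Longrightarrow> \<exists>s1 s2. 0 < s1 \<and> s1 < s2 \<and> s2 < 1 \<and> dist x0 (\<sigma> s1) = r \<and> dist x0 (\<sigma> s2) = r \<and>
        (\<forall>s\<in>{s1..s2}. r \<le> dist x0 (\<sigma> s)) \<and> \<sigma> ` {0..s1} \<subseteq> ball x0 e \<and> \<sigma> ` {s2..1} \<subseteq> ball x0 e"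
proof -
  have p: "continuous_on {0..1} \<sigma>" using \<sigma>(1) simple_path_imp_path by (auto simp: path_def)
  have ends: "\<sigma> 0 = x0" "\<sigma> 1 = x0" using \<sigma> by (auto simp: pathstart_def pathfinish_def)
  define f where "f = (\<lambda>s. dist x0 (\<sigma> s))"
  have cf: "continuous_on {0..1} f" unfolding f_def by (intro continuous_intros p)
  have "uniformly_continuous_on {0..1} f" using cf by (intro compact_uniformly_continuous) auto
  then obtain d where d: "0 < d" "\<And>s s'. \<lbrakk>s \<in> {0..1}; s' \<in> {0..1}; dist s' s < d\<rbrakk> \<Longrightarrow> dist (f s') (f s) < e"
    unfolding uniformly_continuous_on_def using e by meson
  define h where "h = min d 1 / 2"
  have h: "0 < h" "h \<le> 1 / 2" "h < d" using d(1) by (auto simp: h_def)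
  have near: "f s < e" if "s \<in> {0..h} \<union> {1 - h..1}" for s
  proof (cases "s \<le> h")
    case True
    then show ?thesis using d(2)[of 0 s] that h ends by (auto simp: f_def dist_real_def split: if_splits)
  next
    case False
    then show ?thesis using d(2)[of 1 s] that h ends by (auto simp: f_def dist_real_def split: if_splits)
  qed
  have "continuous_on {h..1 - h} f" by (rule continuous_on_subset[OF cf]) (use h in auto)
  then obtain m where m: "m \<in> {h..1 - h}" "\<And>s. s \<in> {h..1 - h} \<Longrightarrow> f m \<le> f s"
    using continuous_attains_inf[of "{h..1 - h}" f] h by auto
  have "f m > 0"
  proof -
    have "\<sigma> m \<noteq> \<sigma> 0"
    proof
      assume "\<sigma> m = \<sigma> 0"
      then have "m = 0 \<or> m = 0 \<and> 0 = 1 \<or> m = 1 \<and> 0 = (0::real)"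
        using \<sigma>(1) m(1) h unfolding simple_path_def loop_free_def by fastforce
      then show False using m(1) h by auto
    qed
    then show ?thesis using ends by (simp add: f_def)
  qed
  show ?thesis
  proof (rule that[OF \<open>f m > 0\<close>])
    fix r assume r: "0 < r" "r < f m"
    define T1 where "T1 = {s \<in> {0..1/2}. f s \<in> {..r}}"
    define T2 where "T2 = {s \<in> {1/2..1}. f s \<in> {..r}}"
    have c1: "continuous_on {0..1/2} f" "continuous_on {1/2..1} f"
      by (rule continuous_on_subset[OF cf]; auto)+
    have "closed T1" "closed T2"
      unfolding T1_def T2_def using continuous_closed_preimage[OF c1(1), of "{..r}"] continuous_closed_preimage[OF c1(2), of "{..r}"]
      by (auto simp: vimage_def Int_def)
    moreover have "bounded T1" "bounded T2"
      by (rule bounded_subset[of "{0..1}"]; auto simp: T1_def T2_def)+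
    ultimately have comp: "compact T1" "compact T2" by (simp_all add: compact_eq_bounded_closed)
    have ne: "0 \<in> T1" "1 \<in> T2" using ends r by (auto simp: T1_def T2_def f_def)
    obtain s1 where s1: "s1 \<in> T1" "\<And>s. s \<in> T1 \<Longrightarrow> s \<le> s1" using compact_attains_sup[OF comp(1)] ne by blast
    obtain s2 where s2: "s2 \<in> T2" "\<And>s. s \<in> T2 \<Longrightarrow> s2 \<le> s" using compact_attains_inf[OF comp(2)] ne by blast
    have s1h: "s1 < h" "s2 > 1 - h"
      using s1(1) s2(1) m(2)[of s1] m(2)[of s2] r h unfolding T1_def T2_def atomize_conj
      by (smt (verit, best) atLeastAtMost_iff atMost_iff mem_Collect_eq field_sum_of_halves)
    have fs1: "f s1 = r"
    proof (rule ccontr)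
      assume "f s1 \<noteq> r"
      then have lt: "f s1 \<le> r" "r \<le> f (1/2)" using s1(1) m(2)[of "1/2"] h r by (auto simp: T1_def)
      have "\<exists>x\<ge>s1. x \<le> 1/2 \<and> f x = r"
        by (rule IVT') (use lt s1(1) in \<open>auto simp: T1_def intro: continuous_on_subset[OF cf]\<close>)
      then obtain x where "s1 \<le> x" "x \<le> 1/2" "f x = r" by blast
      then have "x \<in> T1" using s1(1) by (auto simp: T1_def)
      then show False using s1(2)[of x] \<open>s1 \<le> x\<close> \<open>f x = r\<close> \<open>f s1 \<noteq> r\<close> by auto
    qed
    have fs2: "f s2 = r"
    proof (rule ccontr)
      assume "f s2 \<noteq> r"
      then have lt: "f s2 \<le> r" "r \<le> f (1/2)" using s2(1) m(2)[of "1/2"] h r by (auto simp: T2_def)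
      have "\<exists>x\<ge>1/2. x \<le> s2 \<and> f x = r"
        by (rule IVT2') (use lt s2(1) in \<open>auto simp: T2_def intro: continuous_on_subset[OF cf]\<close>)
      then obtain x where "1/2 \<le> x" "x \<le> s2" "f x = r" by blast
      then have "x \<in> T2" using s2(1) by (auto simp: T2_def)
      then show False using s2(2)[of x] \<open>x \<le> s2\<close> \<open>f x = r\<close> \<open>f s2 \<noteq> r\<close> by auto
    qed
    have "s1 \<noteq> 0" "s2 \<noteq> 1" using fs1 fs2 r ends by (auto simp: f_def)
    then have ord: "0 < s1" "s1 < s2" "s2 < 1" using s1(1) s2(1) s1h h by (auto simp: T1_def T2_def)
    have mid: "r \<le> f s" if "s \<in> {s1..s2}" for s
    proof (rule ccontr)
      assume "\<not> r \<le> f s"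
      then have "s \<in> T1 \<or> s \<in> T2" using that ord by (cases "s \<le> 1/2") (auto simp: T1_def T2_def)
      then have "s \<le> s1 \<or> s2 \<le> s" using s1(2) s2(2) by blast
      then have "s = s1 \<or> s = s2" using that by auto
      then show False using fs1 fs2 \<open>\<not> r \<le> f s\<close> by auto
    qed
    have "\<sigma> ` {0..s1} \<subseteq> ball x0 e" "\<sigma> ` {s2..1} \<subseteq> ball x0 e"
      using near s1h by (auto simp: f_def)
    then show "\<exists>s1 s2. 0 < s1 \<and> s1 < s2 \<and> s2 < 1 \<and> dist x0 (\<sigma> s1) = r \<and> dist x0 (\<sigma> s2) = r \<and>
        (\<forall>s\<in>{s1..s2}. r \<le> dist x0 (\<sigma> s)) \<and> \<sigma> ` {0..s1} \<subseteq> ball x0 e \<and> \<sigma> ` {s2..1} \<subseteq> ball x0 e"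
      using ord fs1 fs2 mid unfolding f_def by blast
  qed
qed

text \<open>If the second curve entered the inside of the first, all of it except \<open>x0\<close>
  would lie there by connectedness. Then the outside of the first curve together with the curve
  itself, minus \<open>x0\<close>, is connected, unbounded and disjoint from the second curve, and
  puts \<open>b\<close> outside the second one.\<close>

lemma touching_loops_outside:
  fixes \<sigma> \<tau> :: "real \<Rightarrow> complex"
  assumes \<sigma>: "simple_path \<sigma>" "pathstart \<sigma> = x0" "pathfinish \<sigma> = x0"
    and \<tau>: "simple_path \<tau>" "pathstart \<tau> = x0" "pathfinish \<tau> = x0"
    and int: "path_image \<sigma> \<inter> path_image \<tau> = {x0}"
    and b: "b \<in> inside (path_image \<tau>)" "b \<in> outside (path_image \<sigma>)"
  shows "path_image \<tau> \<inter> inside (path_image \<sigma>) = {}"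
proof (rule ccontr)
  let ?K = "path_image \<sigma>" and ?L = "path_image \<tau>"
  assume "?L \<inter> inside ?K \<noteq> {}"
  then obtain w where w: "w \<in> ?L" "w \<in> inside ?K" by blast
  have J: "connected (outside ?K)" "open (inside ?K)" "open (outside ?K)" "\<not> bounded (outside ?K)"
    "inside ?K \<inter> outside ?K = {}" "frontier (outside ?K) = ?K" "inside ?K \<union> outside ?K = - ?K"
    using Jordan_inside_outside[OF \<sigma>(1)] \<sigma>(2,3) by simp_all
  have J': "inside ?L \<inter> outside ?L = {}"
    using Jordan_inside_outside[OF \<tau>(1)] \<tau>(2,3) by simp
  have conn: "connected (?L - {x0})"
    using connected_simple_path_endless[OF \<tau>(1)] \<tau>(2,3) by simp
  have "x0 \<in> ?K" using int by blast
  have wx: "w \<in> ?L - {x0}" using w \<open>x0 \<in> ?K\<close> inside_no_overlap[of ?K] by blast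
  have Lin: "?L - {x0} \<subseteq> inside ?K"
  proof (rule ccontr)
    assume "\<not> ?L - {x0} \<subseteq> inside ?K"
    then have "outside ?K \<inter> (?L - {x0}) \<noteq> {}"
      using J int inside_Un_outside[of ?K] by blast
    then show False
      using connectedD[OF conn, of "inside ?K" "outside ?K"] J int wx w(2) by blast
  qed
  let ?O = "outside ?K \<union> (?K - {x0})"
  have "connected ?O"
  proof (rule connected_intermediate_closure[of "outside ?K"])
    show "?O \<subseteq> closure (outside ?K)" using J closure_Un_frontier[of "outside ?K"] by auto
  qed (use J in auto)
  moreover have "?O \<inter> ?L = {}" using Lin int J outside_no_overlap[of ?K] \<open>x0 \<in> ?K\<close> by blast
  moreover have "\<not> bounded ?O" using J by (simp add: bounded_Un)
  ultimately have "b \<in> outside ?L" using b(2) by (intro in_outsideI[of ?O]) auto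
  then show False using b(1) J' by blast
qed

section \<open>Two loops meeting at the base point\<close>

lemma homotopic_paths_convex:
  fixes B :: "'a::real_normed_vector set"
  assumes "convex B" "path p" "path_image p \<subseteq> B" "path q" "path_image q \<subseteq> B"
    "pathstart p = pathstart q" "pathfinish p = pathfinish q"
  shows "homotopic_paths B p q"
  using convex_imp_simply_connected[OF assms(1)] assms(2-)
  unfolding simply_connected_eq_homotopic_paths by metis

lemma transport_subpath:
  assumes "finite S" "S \<noteq> {}" "path g" "path_image g \<inter> S = {}" "u \<in> {0..1}" "v \<in> {0..1}" "w \<in> {0..1}"
  shows "transport S R (subpath v w g) ** transport S R (subpath u v g) = transport S R (subpath u w g)"
proof -
  have sub: "path_image g \<subseteq> - S" using assms(4) by blast
  have im: "path_image (subpath s t g) \<inter> S = {}" if "s \<in> {0..1}" "t \<in> {0..1}" for s t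
    using path_image_subpath_subset[of s t g] that sub by auto
  have "transport S R (subpath v w g) ** transport S R (subpath u v g) = transport S R (subpath u v g +++ subpath v w g)"
    using assms im by (intro transport_join[symmetric]) auto
  also have "\<dots> = transport S R (subpath u w g)"
    using assms sub by (intro transport_homotopic homotopic_join_subpaths) auto
  finally show ?thesis .
qed

locale two_loops =
  fixes a b c x0 :: complex and \<sigma> \<tau> :: "real \<Rightarrow> complex"
  assumes distinct: "a \<noteq> b" "a \<noteq> c" "b \<noteq> c"
    and \<sigma>: "simple_loop_around {a, b, c} x0 a \<sigma>" and \<tau>: "simple_loop_around {a, b, c} x0 b \<tau>"
    and touch: "path_image \<sigma> \<inter> path_image \<tau> = {x0}"
begin

abbreviation "S \<equiv> {a, b, c}"

lemma \<sigma>_simple: "simple_path \<sigma>" "pathstart \<sigma> = x0" "pathfinish \<sigma> = x0" "path \<sigma>"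
    "path_image \<sigma> \<inter> S = {}"
  and \<tau>_simple: "simple_path \<tau>" "pathstart \<tau> = x0" "pathfinish \<tau> = x0" "path \<tau>"
    "path_image \<tau> \<inter> S = {}"
  and winding: "winding_number \<sigma> a = 1" "winding_number \<sigma> b = 0" "winding_number \<sigma> c = 0"
    "winding_number \<tau> a = 0" "winding_number \<tau> b = 1" "winding_number \<tau> c = 0"
  using \<sigma> \<tau> distinct simple_path_imp_path unfolding simple_loop_around_def by auto

lemma in_outside_if_winding_zero:
  assumes "simple_path \<gamma>" "z \<notin> path_image \<gamma>" "winding_number \<gamma> z = 0"
  shows "z \<in> outside (path_image \<gamma>)"
  using simple_closed_path_norm_winding_number_inside[OF assms(1), of z] assms(2,3)
    inside_Un_outside[of "path_image \<gamma>"] by fastforce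

lemma in_inside_if_winding_one:
  assumes "path \<gamma>" "pathfinish \<gamma> = pathstart \<gamma>" "z \<notin> path_image \<gamma>" "winding_number \<gamma> z = 1"
  shows "z \<in> inside (path_image \<gamma>)"
  using winding_number_zero_in_outside[OF assms(1,2), of z] assms(3,4)
    inside_Un_outside[of "path_image \<gamma>"] by fastforce

lemma sides: "a \<in> inside (path_image \<sigma>)" "b \<in> outside (path_image \<sigma>)" "c \<in> outside (path_image \<sigma>)"
    "a \<in> outside (path_image \<tau>)" "b \<in> inside (path_image \<tau>)" "c \<in> outside (path_image \<tau>)"
  using \<sigma>_simple \<tau>_simple winding
  by (auto intro!: in_outside_if_winding_zero in_inside_if_winding_one)

lemma disjoint_insides:
  "path_image \<tau> \<inter> inside (path_image \<sigma>) = {}" "path_image \<sigma> \<inter> inside (path_image \<tau>) = {}"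
  using touching_loops_outside[OF \<sigma>_simple(1-3) \<tau>_simple(1-3) touch sides(5,2)]
    touching_loops_outside[OF \<tau>_simple(1-3) \<sigma>_simple(1-3) _ sides(1,4)] touch
  by (auto simp: Int_commute)

text \<open>Neither loop separates \<open>c\<close> from a far point, and the loops meet in a single
  point; by Janiszewski's theorem their union does not separate the two points either.
  \<open>Z\<close> consists of a path from \<open>c\<close> to the far region and the complement of
  a large ball. Cutting the plane along \<open>Z\<close> will leave a simply connected domain
  without \<open>c\<close>.\<close>

lemma escape_path:
  obtains R Z where "0 < R" "path_image \<sigma> \<union> path_image \<tau> \<union> inside (path_image \<sigma>) \<union> inside (path_image \<tau>) \<subseteq> ball 0 R"
    "connected Z" "closed Z" "\<not> bounded Z" "c \<in> Z" "Z \<inter> (path_image \<sigma> \<union> path_image \<tau>) = {}"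
    "Z \<inter> (inside (path_image \<sigma>) \<union> inside (path_image \<tau>)) = {}"
proof -
  let ?K = "path_image \<sigma>" and ?L = "path_image \<tau>"
  have bK: "bounded ?K" "bounded ?L" "compact ?K" "compact ?L"
    using \<sigma>_simple(4) \<tau>_simple(4) by (simp_all add: bounded_path_image compact_path_image)
  have J: "bounded (inside ?K)" "bounded (inside ?L)" "connected (outside ?K)" "connected (outside ?L)"
    "inside ?K \<inter> outside ?K = {}" "inside ?L \<inter> outside ?L = {}"
    using Jordan_inside_outside[OF \<sigma>_simple(1)] Jordan_inside_outside[OF \<tau>_simple(1)]
      \<sigma>_simple(2,3) \<tau>_simple(2,3) by simp_all
  have "bounded (?K \<union> ?L \<union> inside ?K \<union> inside ?L)" using bK J by simp
  then obtain R where R: "0 < R" "?K \<union> ?L \<union> inside ?K \<union> inside ?L \<subseteq> ball 0 R"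
    using bounded_subset_ballD by blast
  define w :: complex where "w = of_real R"
  have w: "w \<notin> ball 0 R" using R(1) by (simp add: w_def)
  have wout: "w \<in> outside ?K" "w \<in> outside ?L"
    using w R(2) inside_Un_outside[of ?K] inside_Un_outside[of ?L] by blast+
  have "connected_component (- (?K \<union> ?L)) c w"
  proof (rule Janiszewski)
    show "connected_component (- ?K) c w"
      using J(3) wout(1) sides(3) outside_no_overlap[of ?K] unfolding connected_component_def by blast
    show "connected_component (- ?L) c w"
      using J(4) wout(2) sides(6) outside_no_overlap[of ?L] unfolding connected_component_def by blast
  qed (use bK touch compact_imp_closed in auto)
  moreover have "open (- (?K \<union> ?L))" using bK by (intro open_Compl closed_Un compact_imp_closed)
  ultimately have "path_component (- (?K \<union> ?L)) c w" by (simp add: open_path_connected_component)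
  then obtain g where g: "path g" "path_image g \<subseteq> - (?K \<union> ?L)" "pathstart g = c" "pathfinish g = w"
    by (auto simp: path_component_def)
  define Z where "Z = path_image g \<union> - ball 0 R"
  have cb: "connected (- ball (0::complex) R)"
    using R(1) by (intro connected_complement_bounded_convex) auto
  have wg: "w \<in> path_image g" "c \<in> path_image g" using g(3,4) by auto
  have out: "path_image g \<subseteq> outside ?K" "path_image g \<subseteq> outside ?L"
  proof -
    have "connected_component (- ?K) c z" "connected_component (- ?L) c z" if "z \<in> path_image g" for z
      using g wg that connected_path_image[OF g(1)] unfolding connected_component_def by blast+
    then show "path_image g \<subseteq> outside ?K" "path_image g \<subseteq> outside ?L"
      using outside_same_component sides(3,6) by blast+
  qed
  show ?thesis
  proof (rule that[OF R])
    show "connected Z" unfolding Z_def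
      using cb wg w g(1) by (intro connected_Un connected_path_image) auto
    show "closed Z" unfolding Z_def using g(1) by (intro closed_Un closed_path_image) (auto simp: closed_Compl)
    show "\<not> bounded Z" unfolding Z_def
      using cobounded_imp_unbounded[of "- ball (0::complex) R"] by simp
    show "c \<in> Z" using wg by (simp add: Z_def)
    show "Z \<inter> (?K \<union> ?L) = {}" using g(2) R(2) unfolding Z_def by blast
    show "Z \<inter> (inside ?K \<union> inside ?L) = {}" using out J(5,6) R(2) unfolding Z_def by blast
  qed
qed

end

text \<open>The base point is a boundary point of the inside, so a path within the inside leads from
  \<open>p\<close> into any disc about it. Cut at the first meeting with the disc, it becomes one
  half of a spine that joins the two punctures.\<close>

lemma inside_access:
  fixes \<gamma> :: "real \<Rightarrow> complex"
  assumes \<gamma>: "simple_path \<gamma>" "pathstart \<gamma> = x0" "pathfinish \<gamma> = x0"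
    and p: "p \<in> inside (path_image \<gamma>)" "p \<notin> cball x0 r" "0 < r"
  obtains h where "path h" "pathstart h = p" "path_image h \<subseteq> inside (path_image \<gamma>)"
    "dist x0 (pathfinish h) = r" "path_image h \<inter> cball x0 r = {pathfinish h}"
proof -
  let ?I = "inside (path_image \<gamma>)"
  have J: "open ?I" "connected ?I" "frontier ?I = path_image \<gamma>"
    using Jordan_inside_outside[OF \<gamma>(1)] \<gamma>(2,3) by simp_all
  have "x0 \<in> closure ?I"
    using J(3) \<gamma>(2) pathstart_in_path_image[of \<gamma>] by (auto simp: frontier_def)
  then obtain z where z: "z \<in> ?I" "dist z x0 < r" using p(3) closure_approachable by blast
  have "path_connected ?I" using J connected_open_path_connected by blast
  then obtain g where g: "path g" "path_image g \<subseteq> ?I" "pathstart g = p" "pathfinish g = z"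
    using p(1) z(1) unfolding path_connected_def by blast
  obtain h where h: "path h" "pathstart h = pathstart g" "path_image h \<subseteq> path_image g"
      "path_image h - {pathfinish h} \<subseteq> interior (- cball x0 r)" "pathfinish h \<in> frontier (- cball x0 r)"
  proof (rule exists_path_subpath_to_frontier[OF g(1)])
    show "pathstart g \<in> closure (- cball x0 r)" using g(3) p(2) closure_subset[of "- cball x0 r"] by blast
    show "pathfinish g \<notin> - cball x0 r" using g(4) z(2) by (simp add: dist_commute)
  qed
  have fin: "dist x0 (pathfinish h) = r" using h(5) p(3) by (simp add: frontier_complement)
  have "path_image h - {pathfinish h} \<subseteq> - cball x0 r" using h(4) interior_subset by blast
  then have "path_image h \<inter> cball x0 r = {pathfinish h}" using fin pathfinish_in_path_image[of h] by auto
  then show ?thesis using that[of h] h g fin by auto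
qed

lemma closed_segment_dist:
  fixes x0 :: "'a::real_normed_vector"
  assumes "x \<in> closed_segment q x0" "dist x0 q = r" "0 < r"
  shows "dist x0 x \<le> r" "dist x0 x = r \<Longrightarrow> x = q"
proof -
  obtain u where u: "0 \<le> u" "u \<le> 1" "x = (1 - u) *\<^sub>R q + u *\<^sub>R x0"
    using assms(1) unfolding closed_segment_def by blast
  have "x0 - x = (1 - u) *\<^sub>R (x0 - q)" using u by (simp add: algebra_simps)
  then have "norm (x0 - x) = (1 - u) * norm (x0 - q)" using u(2) by simp
  then have d: "dist x0 x = (1 - u) * r" using assms(2) by (simp only: dist_norm)
  show "dist x0 x \<le> r" using d u assms(3) by (simp add: mult_left_le_one_le)
  show "x = q" if "dist x0 x = r" using d that assms(3) u by simp
qed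

context two_loops
begin

text \<open>The spine \<open>E\<close> runs from \<open>a\<close> inside the first loop to a small
  circle, radially through \<open>x0\<close>, and inside the second loop on to \<open>b\<close>. The
  loops are cut off at the circle and their ends are joined by circular arcs that avoid
  \<open>E\<close>; the result \<Gamma> encircles \<open>E\<close> and differs from the product of
  the loops by a short path from \<Gamma> to \<open>x0\<close>. Which ends an arc can join is
  decided by winding numbers and not by an orientation argument.\<close>

theorem pushed_loop:
  obtains \<Gamma> E U where "path \<Gamma>" "pathfinish \<Gamma> = pathstart \<Gamma>" "path_image \<Gamma> \<subseteq> U - E" "compact E" "path_connected E"
    "a \<in> E" "b \<in> E" "E \<subseteq> U" "open U" "simply_connected U" "c \<notin> U" "winding_number \<Gamma> a = 1"
    "\<And>R :: complex \<Rightarrow> complex^2^2. \<exists>K. det K \<noteq> 0 \<and>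
       (transport S R \<sigma> ** transport S R \<tau>) ** K = K ** transport S R \<Gamma>"
proof -
  let ?K = "path_image \<sigma>" and ?L = "path_image \<tau>"
  obtain Z where Z: "connected Z" "closed Z" "\<not> bounded Z" "c \<in> Z" "Z \<inter> (?K \<union> ?L) = {}"
    "Z \<inter> (inside ?K \<union> inside ?L) = {}"
    using escape_path by metis
  have x0K: "x0 \<in> ?K" "x0 \<in> ?L" using touch by auto
  then have "x0 \<in> - (S \<union> Z)" using \<sigma>_simple(5) Z(5) by blast
  moreover have "open (- (S \<union> Z))" using Z(2) by (intro open_Compl closed_Un) auto
  ultimately obtain \<epsilon> where \<epsilon>: "0 < \<epsilon>" "ball x0 \<epsilon> \<subseteq> - (S \<union> Z)" using openE by blast
  define B where "B = ball x0 \<epsilon>"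
  have B: "convex B" "B \<inter> S = {}" "B \<inter> Z = {}" "x0 \<in> B" using \<epsilon> by (auto simp: B_def)
  obtain r1 where r1: "0 < r1" "\<And>r. \<lbrakk>0 < r; r < r1\<rbrakk> \<Longrightarrow> \<exists>s1 s2. 0 < s1 \<and> s1 < s2 \<and> s2 < 1 \<and> dist x0 (\<sigma> s1) = r \<and> dist x0 (\<sigma> s2) = r \<and>
        (\<forall>s\<in>{s1..s2}. r \<le> dist x0 (\<sigma> s)) \<and> \<sigma> ` {0..s1} \<subseteq> ball x0 \<epsilon> \<and> \<sigma> ` {s2..1} \<subseteq> ball x0 \<epsilon>"
    using simple_loop_exit[OF \<sigma>_simple(1-3) \<epsilon>(1)] by blast
  obtain r2 where r2: "0 < r2" "\<And>r. \<lbrakk>0 < r; r < r2\<rbrakk> \<Longrightarrow> \<exists>s1 s2. 0 < s1 \<and> s1 < s2 \<and> s2 < 1 \<and> dist x0 (\<tau> s1) = r \<and> dist x0 (\<tau> s2) = r \<and>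
        (\<forall>s\<in>{s1..s2}. r \<le> dist x0 (\<tau> s)) \<and> \<tau> ` {0..s1} \<subseteq> ball x0 \<epsilon> \<and> \<tau> ` {s2..1} \<subseteq> ball x0 \<epsilon>"
    using simple_loop_exit[OF \<tau>_simple(1-3) \<epsilon>(1)] by blast
  define r where "r = min (min r1 r2) \<epsilon> / 2"
  have r: "0 < r" "r < r1" "r < r2" "r < \<epsilon>" using r1(1) r2(1) \<epsilon>(1) by (auto simp: r_def)
  obtain s1 s2 where s: "0 < s1" "s1 < s2" "s2 < 1" "dist x0 (\<sigma> s1) = r" "dist x0 (\<sigma> s2) = r"
        "\<forall>s\<in>{s1..s2}. r \<le> dist x0 (\<sigma> s)" "\<sigma> ` {0..s1} \<subseteq> B" "\<sigma> ` {s2..1} \<subseteq> B"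
    using r1(2)[OF r(1,2)] unfolding B_def by blast
  obtain t1 t2 where t: "0 < t1" "t1 < t2" "t2 < 1" "dist x0 (\<tau> t1) = r" "dist x0 (\<tau> t2) = r"
        "\<forall>s\<in>{t1..t2}. r \<le> dist x0 (\<tau> s)" "\<tau> ` {0..t1} \<subseteq> B" "\<tau> ` {t2..1} \<subseteq> B"
    using r2(2)[OF r(1,3)] unfolding B_def by blast
  define A1 where "A1 = \<sigma> s1" define A2 where "A2 = \<sigma> s2"
  define B1 where "B1 = \<tau> t1" define B2 where "B2 = \<tau> t2"
  define \<alpha> where "\<alpha> = subpath s1 s2 \<sigma>" define \<beta> where "\<beta> = subpath t1 t2 \<tau>"
  have \<alpha>: "path \<alpha>" "pathstart \<alpha> = A1" "pathfinish \<alpha> = A2" "path_image \<alpha> \<subseteq> ?K" "path_image \<alpha> \<inter> ball x0 r = {}"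
  proof -
    have im: "path_image \<alpha> = \<sigma> ` {s1..s2}" using s(2) unfolding \<alpha>_def by (simp add: path_image_subpath)
    show "path_image \<alpha> \<inter> ball x0 r = {}" unfolding im using s(6) by force
    show "path_image \<alpha> \<subseteq> ?K" unfolding im path_image_def[of \<sigma>] using s(1,3) by (intro image_mono) auto
  qed (use s \<sigma>_simple(4) in \<open>auto simp: \<alpha>_def A1_def A2_def\<close>)
  have \<beta>: "path \<beta>" "pathstart \<beta> = B1" "pathfinish \<beta> = B2" "path_image \<beta> \<subseteq> ?L" "path_image \<beta> \<inter> ball x0 r = {}"
  proof -
    have im: "path_image \<beta> = \<tau> ` {t1..t2}" using t(2) unfolding \<beta>_def by (simp add: path_image_subpath)
    show "path_image \<beta> \<inter> ball x0 r = {}" unfolding im using t(6) by force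
    show "path_image \<beta> \<subseteq> ?L" unfolding im path_image_def[of \<tau>] using t(1,3) by (intro image_mono) auto
  qed (use t \<tau>_simple(4) in \<open>auto simp: \<beta>_def B1_def B2_def\<close>)
  have AB: "A1 \<in> ?K" "A2 \<in> ?K" "B1 \<in> ?L" "B2 \<in> ?L"
    using s t unfolding A1_def A2_def B1_def B2_def path_image_def by auto
  have AB_sphere: "A1 \<in> sphere x0 r" "A2 \<in> sphere x0 r" "B1 \<in> sphere x0 r" "B2 \<in> sphere x0 r"
    using s t by (auto simp: A1_def A2_def B1_def B2_def)
  have rB: "cball x0 r \<subseteq> B" "sphere x0 r \<subseteq> B" using r by (auto simp: B_def)
  then have AB_B: "A1 \<in> B" "A2 \<in> B" "B1 \<in> B" "B2 \<in> B" using AB_sphere by blast+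
  have nS: "a \<notin> cball x0 r" "b \<notin> cball x0 r" using B(2) rB(1) by blast+
  obtain ha where ha: "path ha" "pathstart ha = a" "path_image ha \<subseteq> inside ?K"
    "dist x0 (pathfinish ha) = r" "path_image ha \<inter> cball x0 r = {pathfinish ha}"
    using inside_access[OF \<sigma>_simple(1-3) sides(1) nS(1) r(1)] by blast
  obtain hb where hb: "path hb" "pathstart hb = b" "path_image hb \<subseteq> inside ?L"
    "dist x0 (pathfinish hb) = r" "path_image hb \<inter> cball x0 r = {pathfinish hb}"
    using inside_access[OF \<tau>_simple(1-3) sides(5) nS(2) r(1)] by blast
  define qa where "qa = pathfinish ha" define qb where "qb = pathfinish hb"
  have q: "qa \<in> inside ?K" "qb \<in> inside ?L" "qa \<in> sphere x0 r" "qb \<in> sphere x0 r"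
    "dist x0 qa = r" "dist x0 qb = r" "qa \<in> path_image ha" "qb \<in> path_image hb"
    using ha hb unfolding qa_def qb_def by auto
  define E where "E = (path_image ha \<union> closed_segment qa x0) \<union> (closed_segment qb x0 \<union> path_image hb)"
  have E1: "compact E" unfolding E_def using ha hb by (intro compact_Un compact_path_image) auto
  have E2: "path_connected E" unfolding E_def
    using ha(1) hb(1) q(7,8) by (intro path_connected_Un path_connected_path_image path_connected_segment) auto
  have E3: "a \<in> E" "b \<in> E" "x0 \<in> E"
    using ha(2) hb(2) pathstart_in_path_image[of ha] pathstart_in_path_image[of hb] by (auto simp: E_def)
  have noK: "inside ?K \<inter> ?K = {}" "inside ?L \<inter> ?L = {}" "?L \<inter> inside ?K = {}" "?K \<inter> inside ?L = {}"
    using inside_no_overlap disjoint_insides by blast+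
  have E_far: "z \<in> inside ?K \<union> inside ?L" if "z \<in> E" "z \<notin> ball x0 r" for z
  proof -
    have "r \<le> dist x0 z" using that(2) by simp
    then have "z = qa" if "z \<in> closed_segment qa x0"
      using closed_segment_dist[OF that q(5) r(1)] by auto
    moreover have "z = qb" if "z \<in> closed_segment qb x0"
      using closed_segment_dist[OF that q(6) r(1)] \<open>r \<le> dist x0 z\<close> by auto
    ultimately show ?thesis using that(1) ha(3) hb(3) q(1,2) unfolding E_def by blast
  qed
  have E_sphere: "E \<inter> sphere x0 r \<subseteq> {qa, qb}"
  proof
    fix z assume z: "z \<in> E \<inter> sphere x0 r"
    then have "dist x0 z = r" "z \<in> cball x0 r" by auto
    then have "z = qa" if "z \<in> closed_segment qa x0"
      using closed_segment_dist[OF that q(5) r(1)] by auto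
    moreover have "z = qb" if "z \<in> closed_segment qb x0"
      using closed_segment_dist[OF that q(6) r(1)] \<open>dist x0 z = r\<close> by auto
    ultimately show "z \<in> {qa, qb}"
      using z \<open>z \<in> cball x0 r\<close> ha(5) hb(5) unfolding E_def qa_def qb_def by blast
  qed
  have E\<alpha>: "E \<inter> path_image \<alpha> = {}" and E\<beta>: "E \<inter> path_image \<beta> = {}"
  proof -
    have "z \<in> inside ?K \<union> inside ?L" if "z \<in> E" "z \<in> path_image \<alpha> \<union> path_image \<beta>" for z
      using that \<alpha>(5) \<beta>(5) by (intro E_far) blast+
    moreover have "z \<in> ?K \<union> ?L" if "z \<in> path_image \<alpha> \<union> path_image \<beta>" for z
      using that \<alpha>(4) \<beta>(4) by blast
    ultimately show "E \<inter> path_image \<alpha> = {}" "E \<inter> path_image \<beta> = {}" using noK by blast+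
  qed
  have E_Z: "E \<inter> Z = {}"
  proof -
    have "z \<notin> Z" if z: "z \<in> E" for z
    proof (cases "z \<in> ball x0 r")
      case True
      then show ?thesis using rB(1) ball_subset_cball[of x0 r] B(3) by blast
    next
      case False
      then show ?thesis using E_far[OF z] Z(6) by blast
    qed
    then show ?thesis by blast
  qed
  obtain S1 S2 where arcs: "path_connected S1" "path_connected S2" "sphere x0 r - {qa, qb} = S1 \<union> S2"
    using sphere_minus_two_points[OF r(1) q(3,4)] by blast
  have arcs_E: "(S1 \<union> S2) \<inter> E = {}" "S1 \<union> S2 \<subseteq> B" using arcs(3) E_sphere rB(2) by blast+
  have AB_arcs: "A1 \<in> S1 \<union> S2" "A2 \<in> S1 \<union> S2" "B1 \<in> S1 \<union> S2" "B2 \<in> S1 \<union> S2"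
    unfolding arcs(3)[symmetric] using AB AB_sphere q(1,2) noK by blast+
  define same where "same = (\<lambda>X Y. X \<in> S1 \<and> Y \<in> S1 \<or> X \<in> S2 \<and> Y \<in> S2)"
  have arc: "\<exists>\<zeta>. path \<zeta> \<and> pathstart \<zeta> = X \<and> pathfinish \<zeta> = Y \<and> path_image \<zeta> \<subseteq> S1 \<union> S2"
    if "same X Y" for X Y
  proof -
    from that consider "X \<in> S1" "Y \<in> S1" | "X \<in> S2" "Y \<in> S2" unfolding same_def by blast
    then show ?thesis
    proof cases
      case 1
      then obtain g where "path g" "path_image g \<subseteq> S1" "pathstart g = X" "pathfinish g = Y"
        using arcs(1) unfolding path_connected_def by blast
      then show ?thesis by (intro exI[of _ g]) auto
    next
      case 2
      then obtain g where "path g" "path_image g \<subseteq> S2" "pathstart g = X" "pathfinish g = Y"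
        using arcs(2) unfolding path_connected_def by blast
      then show ?thesis by (intro exI[of _ g]) auto
    qed
  qed

  have ends\<sigma>: "path (subpath 0 s1 \<sigma>)" "path_image (subpath 0 s1 \<sigma>) \<subseteq> B"
    "pathstart (subpath 0 s1 \<sigma>) = x0" "pathfinish (subpath 0 s1 \<sigma>) = A1"
    "path (subpath s2 1 \<sigma>)" "path_image (subpath s2 1 \<sigma>) \<subseteq> B"
    "pathstart (subpath s2 1 \<sigma>) = A2" "pathfinish (subpath s2 1 \<sigma>) = x0"
    using s(1-3,7,8) \<sigma>_simple(2-4) unfolding A1_def A2_def
    by (simp_all add: path_image_subpath, simp_all add: pathstart_def pathfinish_def)
  have ends\<tau>: "path (subpath 0 t1 \<tau>)" "path_image (subpath 0 t1 \<tau>) \<subseteq> B"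
    "pathstart (subpath 0 t1 \<tau>) = x0" "pathfinish (subpath 0 t1 \<tau>) = B1"
    "path (subpath t2 1 \<tau>)" "path_image (subpath t2 1 \<tau>) \<subseteq> B"
    "pathstart (subpath t2 1 \<tau>) = B2" "pathfinish (subpath t2 1 \<tau>) = x0"
    using t(1-3,7,8) \<tau>_simple(2-4) unfolding B1_def B2_def
    by (simp_all add: path_image_subpath, simp_all add: pathstart_def pathfinish_def)
  \<comment> \<open>The disc \<open>B\<close> contains no puncture, so the contribution of a path in
    it to a winding number depends on its end points only. These contributions add up like
    differences of a potential.\<close>
  define w where "w = (\<lambda>p X Y. winding_number (linepath X Y) p)"
  have seg: "path_image (linepath X Y) \<subseteq> B" if "X \<in> B" "Y \<in> B" for X Y
    using that B(1) by (simp add: closed_segment_subset)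
  have w\<zeta>: "winding_number \<zeta> p = w p (pathstart \<zeta>) (pathfinish \<zeta>)"
    if "path \<zeta>" "path_image \<zeta> \<subseteq> B" "p \<in> S" for \<zeta> p
  proof -
    have e: "pathstart \<zeta> \<in> B" "pathfinish \<zeta> \<in> B" using that(2) by auto
    have "homotopic_paths B \<zeta> (linepath (pathstart \<zeta>) (pathfinish \<zeta>))"
      using that e by (intro homotopic_paths_convex B(1) seg) auto
    then have "homotopic_paths (- {p}) \<zeta> (linepath (pathstart \<zeta>) (pathfinish \<zeta>))"
      by (rule homotopic_paths_subset) (use that(3) B(2) in blast)
    then show ?thesis unfolding w_def by (rule winding_number_homotopic_paths)
  qed
  have ww: "w p X Y + w p Y X' = w p X X'" if "p \<in> S" "X \<in> B" "Y \<in> B" "X' \<in> B" for p X Y X'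
  proof -
    have np: "p \<notin> path_image (linepath X Y)" "p \<notin> path_image (linepath Y X')"
      using seg[of X Y] seg[of Y X'] that B(2) by blast+
    have "w p X Y + w p Y X' = winding_number (linepath X Y +++ linepath Y X') p"
      unfolding w_def using np by (intro winding_number_join[symmetric]) auto
    also have "\<dots> = w p X X'"
      using w\<zeta>[of "linepath X Y +++ linepath Y X'" p] seg[of X Y] seg[of Y X'] that
      by (simp add: path_image_join)
    finally show ?thesis .
  qed
  have w0: "w p X X = 0" if "p \<in> S" "X \<in> B" for p X
    using ww[of p X X X] that by simp
  have w\<sigma>: "winding_number \<sigma> p = w p x0 A1 + winding_number \<alpha> p + w p A2 x0" if p: "p \<in> S" for p
  proof -
    have np: "p \<notin> path_image \<sigma>" using p \<sigma>_simple(5) by blast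
    have "winding_number (subpath 0 s1 \<sigma>) p = w p x0 A1" "winding_number (subpath s2 1 \<sigma>) p = w p A2 x0"
      using w\<zeta>[OF ends\<sigma>(1,2) p] w\<zeta>[OF ends\<sigma>(5,6) p] unfolding ends\<sigma> by simp_all
    then show ?thesis
      using winding_number_subpath_combine[OF \<sigma>_simple(4) np, of 0 s1 s2]
        winding_number_subpath_combine[OF \<sigma>_simple(4) np, of 0 s2 1] s by (simp add: \<alpha>_def)
  qed
  have w\<tau>: "winding_number \<tau> p = w p x0 B1 + winding_number \<beta> p + w p B2 x0" if p: "p \<in> S" for p
  proof -
    have np: "p \<notin> path_image \<tau>" using p \<tau>_simple(5) by blast
    have "winding_number (subpath 0 t1 \<tau>) p = w p x0 B1" "winding_number (subpath t2 1 \<tau>) p = w p B2 x0"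
      using w\<zeta>[OF ends\<tau>(1,2) p] w\<zeta>[OF ends\<tau>(5,6) p] unfolding ends\<tau> by simp_all
    then show ?thesis
      using winding_number_subpath_combine[OF \<tau>_simple(4) np, of 0 t1 t2]
        winding_number_subpath_combine[OF \<tau>_simple(4) np, of 0 t2 1] t by (simp add: \<beta>_def)
  qed
  have noS: "path_image \<alpha> \<inter> S = {}" "path_image \<beta> \<inter> S = {}" "(S1 \<union> S2) \<inter> S = {}"
    using \<alpha>(4) \<beta>(4) \<sigma>_simple(5) \<tau>_simple(5) arcs_E(2) B(2) by blast+
  have balance: "winding_number g a = winding_number g b"
    if "path g" "pathfinish g = pathstart g" "E \<inter> path_image g = {}" for g
    using winding_number_eq[OF that(1,2) E3(1,2) path_connected_imp_connected[OF E2] that(3)] .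

  text \<open>The set \<open>E\<close> joins the two punctures, so a loop that avoids it has equal winding numbers.
    This decides on which arcs the four end points lie.\<close>
  have not_same_B: "\<not> same B2 B1"
  proof
    assume "same B2 B1"
    then obtain \<zeta> where \<zeta>: "path \<zeta>" "pathstart \<zeta> = B2" "pathfinish \<zeta> = B1" "path_image \<zeta> \<subseteq> S1 \<union> S2"
      using arc by blast
    have "winding_number (\<beta> +++ \<zeta>) p = winding_number \<tau> p" if p: "p \<in> S" for p
    proof -
      have "winding_number (\<beta> +++ \<zeta>) p = winding_number \<beta> p + winding_number \<zeta> p"
        using \<beta> \<zeta> noS p by (intro winding_number_join) auto
      also have "winding_number \<zeta> p = w p B2 B1" using w\<zeta>[of \<zeta> p] \<zeta> arcs_E(2) p by auto
      finally show ?thesis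
        using w\<tau>[OF p] ww[of p B2 x0 B1] p AB_B B(4) by (simp add: algebra_simps)
    qed
    moreover have "winding_number (\<beta> +++ \<zeta>) a = winding_number (\<beta> +++ \<zeta>) b"
      using \<beta> \<zeta> E\<beta> arcs_E(1) by (intro balance) (auto simp: path_image_join)
    ultimately show False using winding by simp
  qed
  have not_same_A: "\<not> same A2 A1"
  proof
    assume "same A2 A1"
    then obtain \<zeta> where \<zeta>: "path \<zeta>" "pathstart \<zeta> = A2" "pathfinish \<zeta> = A1" "path_image \<zeta> \<subseteq> S1 \<union> S2"
      using arc by blast
    have "winding_number (\<alpha> +++ \<zeta>) p = winding_number \<sigma> p" if p: "p \<in> S" for p
    proof -
      have "winding_number (\<alpha> +++ \<zeta>) p = winding_number \<alpha> p + winding_number \<zeta> p"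
        using \<alpha> \<zeta> noS p by (intro winding_number_join) auto
      also have "winding_number \<zeta> p = w p A2 A1" using w\<zeta>[of \<zeta> p] \<zeta> arcs_E(2) p by auto
      finally show ?thesis
        using w\<sigma>[OF p] ww[of p A2 x0 A1] p AB_B B(4) by (simp add: algebra_simps)
    qed
    moreover have "winding_number (\<alpha> +++ \<zeta>) a = winding_number (\<alpha> +++ \<zeta>) b"
      using \<alpha> \<zeta> E\<alpha> arcs_E(1) by (intro balance) (auto simp: path_image_join)
    ultimately show False using winding by simp
  qed
  \<comment> \<open>The crossed pairing would close the second loop up with the reversed first one.
    The resulting curve has winding number -1 around \<open>a\<close> and 1 around \<open>b\<close>,
    although it avoids \<open>E\<close>.\<close>
  have not_crossed: "\<not> (same B2 A2 \<and> same A1 B1)"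
  proof
    assume *: "same B2 A2 \<and> same A1 B1"
    obtain \<zeta> where \<zeta>: "path \<zeta>" "pathstart \<zeta> = B2" "pathfinish \<zeta> = A2" "path_image \<zeta> \<subseteq> S1 \<union> S2"
      using arc * by blast
    obtain \<xi> where \<xi>: "path \<xi>" "pathstart \<xi> = A1" "pathfinish \<xi> = B1" "path_image \<xi> \<subseteq> S1 \<union> S2"
      using arc * by blast
    let ?g = "(\<beta> +++ \<zeta>) +++ (reversepath \<alpha> +++ \<xi>)"
    have "winding_number ?g p = winding_number \<tau> p - winding_number \<sigma> p" if p: "p \<in> S" for p
    proof -
      have n: "p \<notin> path_image \<alpha>" "p \<notin> path_image \<beta>" "p \<notin> path_image \<zeta>" "p \<notin> path_image \<xi>"
        using noS p \<zeta> \<xi> by blast+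
      have "winding_number ?g p = winding_number (\<beta> +++ \<zeta>) p + winding_number (reversepath \<alpha> +++ \<xi>) p"
        using \<alpha> \<beta> \<zeta> \<xi> n by (intro winding_number_join) (auto simp: path_image_join)
      also have "winding_number (\<beta> +++ \<zeta>) p = winding_number \<beta> p + winding_number \<zeta> p"
        using \<beta> \<zeta> n by (intro winding_number_join) auto
      also have "winding_number (reversepath \<alpha> +++ \<xi>) p = winding_number (reversepath \<alpha>) p + winding_number \<xi> p"
        using \<alpha> \<xi> n by (intro winding_number_join) auto
      also have "winding_number (reversepath \<alpha>) p = - winding_number \<alpha> p"
        using \<alpha> n by (intro winding_number_reversepath) auto
      also have "winding_number \<zeta> p = w p B2 A2" using w\<zeta>[of \<zeta> p] \<zeta> arcs_E(2) p by auto
      also have "winding_number \<xi> p = w p A1 B1" using w\<zeta>[of \<xi> p] \<xi> arcs_E(2) p by auto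
      finally show ?thesis
        using w\<sigma>[OF p] w\<tau>[OF p] ww[OF p AB_B(4) B(4) AB_B(2)] ww[OF p AB_B(1) B(4) AB_B(3)]
          ww[OF p B(4) AB_B(1) B(4)] ww[OF p B(4) AB_B(2) B(4)] w0[OF p B(4)] by algebra
    qed
    moreover have "winding_number ?g a = winding_number ?g b"
      using \<alpha> \<beta> \<zeta> \<xi> E\<alpha> E\<beta> arcs_E(1) by (intro balance) (auto simp: path_image_join)
    ultimately show False using winding by simp
  qed
  \<comment> \<open>There are two arcs; the ends of each loop lie on different ones, and of the two
    pairings that this leaves the crossed one is excluded.\<close>
  have "same B2 A1" "same A2 B1"
    using not_same_A not_same_B not_crossed AB_arcs unfolding same_def by blast+
  then obtain \<zeta> \<xi> where \<zeta>: "path \<zeta>" "pathstart \<zeta> = B2" "pathfinish \<zeta> = A1" "path_image \<zeta> \<subseteq> S1 \<union> S2"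
    and \<xi>: "path \<xi>" "pathstart \<xi> = A2" "pathfinish \<xi> = B1" "path_image \<xi> \<subseteq> S1 \<union> S2"
    using arc by metis
  \<comment> \<open>The second loop comes before the first because transport along a join multiplies
    from the left; the order of the matrix product is thereby the required one.\<close>
  define \<Gamma> where "\<Gamma> = (\<beta> +++ \<zeta>) +++ (\<alpha> +++ \<xi>)"
  have \<Gamma>: "path \<Gamma>" "pathfinish \<Gamma> = pathstart \<Gamma>" "pathstart \<Gamma> = B1"
      "path_image \<Gamma> = path_image \<beta> \<union> path_image \<zeta> \<union> path_image \<alpha> \<union> path_image \<xi>"
    using \<alpha> \<beta> \<zeta> \<xi> unfolding \<Gamma>_def by (auto simp: path_image_join)
  have \<Gamma>E: "path_image \<Gamma> \<inter> E = {}" using \<Gamma>(4) \<zeta> \<xi> E\<alpha> E\<beta> arcs_E(1) by blast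
  have \<Gamma>Z: "path_image \<Gamma> \<inter> Z = {}" using \<Gamma>(4) \<zeta>(4) \<xi>(4) \<alpha>(4) \<beta>(4) Z(5) arcs_E(2) B(3) by blast
  have "winding_number \<Gamma> a = winding_number \<tau> a + winding_number \<sigma> a"
  proof -
    have p: "a \<in> S" by simp
    have n: "a \<notin> path_image \<alpha>" "a \<notin> path_image \<beta>" "a \<notin> path_image \<zeta>" "a \<notin> path_image \<xi>"
      using noS p \<zeta> \<xi> by blast+
    have "winding_number \<Gamma> a = winding_number (\<beta> +++ \<zeta>) a + winding_number (\<alpha> +++ \<xi>) a"
      unfolding \<Gamma>_def using \<alpha> \<beta> \<zeta> \<xi> n by (intro winding_number_join) (auto simp: path_image_join)
    also have "winding_number (\<beta> +++ \<zeta>) a = winding_number \<beta> a + winding_number \<zeta> a"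
      using \<beta> \<zeta> n by (intro winding_number_join) auto
    also have "winding_number (\<alpha> +++ \<xi>) a = winding_number \<alpha> a + winding_number \<xi> a"
      using \<alpha> \<xi> n by (intro winding_number_join) auto
    also have "winding_number \<zeta> a = w a B2 A1" using w\<zeta>[of \<zeta> a] \<zeta> arcs_E(2) p by auto
    also have "winding_number \<xi> a = w a A2 B1" using w\<zeta>[of \<xi> a] \<xi> arcs_E(2) p by auto
    finally show ?thesis
      using w\<sigma>[OF p] w\<tau>[OF p] ww[OF p AB_B(4) B(4) AB_B(1)] ww[OF p AB_B(2) B(4) AB_B(3)] by algebra
  qed
  then have \<Gamma>a: "winding_number \<Gamma> a = 1" using winding by simp

  have trans: "\<exists>K. det K \<noteq> 0 \<and> (transport S R \<sigma> ** transport S R \<tau>) ** K = K ** transport S R \<Gamma>"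
    for R :: "complex \<Rightarrow> complex^2^2"
  proof -
    have fS: "finite S" "S \<noteq> {}" by auto
    let ?T = "transport S R"
    define h where "h = (\<lambda>X Y. ?T (linepath X Y))"
    have h\<zeta>: "?T g = h (pathstart g) (pathfinish g)" if "path g" "path_image g \<subseteq> B" for g
    proof -
      have e: "pathstart g \<in> B" "pathfinish g \<in> B" using that(2) by auto
      have "homotopic_paths B g (linepath (pathstart g) (pathfinish g))"
        using that e by (intro homotopic_paths_convex B(1) seg) auto
      then have "homotopic_paths (- S) g (linepath (pathstart g) (pathfinish g))"
        by (rule homotopic_paths_subset) (use B(2) in blast)
      then show ?thesis unfolding h_def by (rule transport_homotopic[OF fS])
    qed
    have hh: "h Y X' ** h X Y = h X X'" if "X \<in> B" "Y \<in> B" "X' \<in> B" for X Y X'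
    proof -
      have np: "path_image (linepath X Y) \<inter> S = {}" "path_image (linepath Y X') \<inter> S = {}"
        using seg[of X Y] seg[of Y X'] that B(2) by blast+
      have "h Y X' ** h X Y = ?T (linepath X Y +++ linepath Y X')"
        unfolding h_def using np by (intro transport_join[OF fS, symmetric]) auto
      also have "\<dots> = h X X'"
        using h\<zeta>[of "linepath X Y +++ linepath Y X'"] seg[of X Y] seg[of Y X'] that
        by (simp add: path_image_join)
      finally show ?thesis .
    qed
    have T\<sigma>: "?T \<sigma> = h A2 x0 ** (?T \<alpha> ** h x0 A1)"
    proof -
      have "?T (subpath 0 s1 \<sigma>) = h x0 A1" "?T (subpath s2 1 \<sigma>) = h A2 x0"
        using h\<zeta>[OF ends\<sigma>(1,2)] h\<zeta>[OF ends\<sigma>(5,6)] unfolding ends\<sigma> by simp_all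
      then show ?thesis
        using transport_subpath[OF fS \<sigma>_simple(4,5), of 0 s1 s2 R]
          transport_subpath[OF fS \<sigma>_simple(4,5), of 0 s2 1 R] s by (simp add: \<alpha>_def)
    qed
    have T\<tau>: "?T \<tau> = h B2 x0 ** (?T \<beta> ** h x0 B1)"
    proof -
      have "?T (subpath 0 t1 \<tau>) = h x0 B1" "?T (subpath t2 1 \<tau>) = h B2 x0"
        using h\<zeta>[OF ends\<tau>(1,2)] h\<zeta>[OF ends\<tau>(5,6)] unfolding ends\<tau> by simp_all
      then show ?thesis
        using transport_subpath[OF fS \<tau>_simple(4,5), of 0 t1 t2 R]
          transport_subpath[OF fS \<tau>_simple(4,5), of 0 t2 1 R] t by (simp add: \<beta>_def)
    qed
    have im: "path_image \<zeta> \<inter> S = {}" "path_image \<xi> \<inter> S = {}" using \<zeta>(4) \<xi>(4) noS(3) by blast+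
    have "?T \<Gamma> = ?T (\<alpha> +++ \<xi>) ** ?T (\<beta> +++ \<zeta>)"
      unfolding \<Gamma>_def using \<alpha> \<beta> \<zeta> \<xi> noS im by (intro transport_join[OF fS]) (auto simp: path_image_join)
    also have "?T (\<alpha> +++ \<xi>) = ?T \<xi> ** ?T \<alpha>"
      using \<alpha> \<xi> noS im by (intro transport_join[OF fS]) auto
    also have "?T (\<beta> +++ \<zeta>) = ?T \<zeta> ** ?T \<beta>"
      using \<beta> \<zeta> noS im by (intro transport_join[OF fS]) auto
    also have "?T \<zeta> = h B2 A1" using h\<zeta>[of \<zeta>] \<zeta> arcs_E(2) by auto
    also have "?T \<xi> = h A2 B1" using h\<zeta>[of \<xi>] \<xi> arcs_E(2) by auto
    finally have T\<Gamma>: "?T \<Gamma> = h A2 B1 ** ?T \<alpha> ** (h B2 A1 ** ?T \<beta>)" .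
    have hid: "h X X = mat 1" if "X \<in> B" for X
    proof -
      have "0 < infdist X S" using that B(2) by (intro infdist_pos_notin[OF fS]) blast
      then have "path_image (linepath X X) \<subseteq> ball (linepath X X 0) (infdist (linepath X X 0) S)"
        by (simp add: linepath_def path_image_def)
      then have "?T (linepath X X) = fund S R (linepath X X 0) (linepath X X 1)"
        by (intro transport_in_ball[OF fS path_linepath])
      then show ?thesis unfolding h_def by (simp add: linepath_def)
    qed
    have "(?T \<sigma> ** ?T \<tau>) ** h B1 x0 = h A2 x0 ** ?T \<alpha> ** (h x0 A1 ** h B2 x0) ** ?T \<beta> ** (h x0 B1 ** h B1 x0)"
      unfolding T\<sigma> T\<tau> by (simp add: matrix_mul_assoc)
    also have "\<dots> = h A2 x0 ** ?T \<alpha> ** h B2 A1 ** ?T \<beta>"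
      using hh AB_B B(4) hid by (simp add: matrix_mul_rid)
    also have "h A2 x0 = h B1 x0 ** h A2 B1" using hh AB_B B(4) by simp
    finally have "(?T \<sigma> ** ?T \<tau>) ** h B1 x0 = h B1 x0 ** ?T \<Gamma>"
      unfolding T\<Gamma> by (simp add: matrix_mul_assoc)
    moreover have "det (h B1 x0) \<noteq> 0"
    proof -
      have "h B1 x0 ** h x0 B1 = mat 1" using hh AB_B B(4) hid by simp
      then have "det (h B1 x0) * det (h x0 B1) = 1" by (metis det_I det_mul)
      then show ?thesis by auto
    qed
    ultimately show ?thesis by blast
  qed

  \<comment> \<open>\<open>Z\<close> is connected and unbounded, so the components of its complement
    are simply connected. The spine, the small disc and \<Gamma> hang together and so lie in one of
    them.\<close>
  define U where "U = connected_component_set (- Z) a"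
  have oZ: "open (- Z)" using Z(2) by (simp add: open_Compl)
  have aZ: "a \<in> - Z" using E3(1) E_Z by blast
  have U: "U \<in> components (- Z)" unfolding U_def using aZ by (auto simp: components_def)
  have "connected (E \<union> (B \<union> path_image \<Gamma>))"
  proof (intro connected_Un path_connected_imp_connected[OF E2] connected_path_image[OF \<Gamma>(1)] convex_connected[OF B(1)])
    have "B1 \<in> path_image \<Gamma>" using \<Gamma>(3) pathstart_in_path_image by metis
    then show "B \<inter> path_image \<Gamma> \<noteq> {}" using AB_B by blast
    show "E \<inter> (B \<union> path_image \<Gamma>) \<noteq> {}" using E3(3) B(4) by blast
  qed
  moreover have "E \<union> (B \<union> path_image \<Gamma>) \<subseteq> - Z" using E_Z B(3) \<Gamma>Z by blast
  ultimately have sub: "E \<union> (B \<union> path_image \<Gamma>) \<subseteq> U"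
    unfolding U_def using E3(1) by (intro connected_component_maximal) auto
  have "simply_connected U"
  proof (rule simply_connected_componentI[OF oZ _ U])
    fix z assume "z \<notin> - Z"
    then show "\<exists>E. connected E \<and> z \<in> E \<and> \<not> bounded E \<and> E \<inter> - Z = {}" using Z(1,3) by blast
  qed
  moreover have "open U" using open_components[OF oZ U] .
  moreover have "c \<notin> U" using Z(4) in_components_subset[OF U] by blast
  ultimately show ?thesis
    using \<Gamma>(1,2) \<Gamma>E sub E1 E2 E3 \<Gamma>a trans by (intro that[of \<Gamma> U E]) blast+
qed

end

section \<open>The product of the loops as the image of a circle\<close>

context two_loops
begin

text \<open>The Riemann map of \<open>U\<close> carries the spine and \<Gamma> into the unit disc.
  There the image of \<Gamma> is homotopic, off the image of the spine, to a circle that encloses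
  both, conjugated by a connecting path \<open>m\<close>: winding number 1 is the only invariant.
  Conjugation changes transport by a similarity only.\<close>

theorem conformal_circle:
  obtains \<phi> r where "\<phi> holomorphic_on ball 0 1" "inj_on \<phi> (ball 0 1)" "0 < r" "r < 1"
    "a \<in> \<phi> ` ball 0 r" "b \<in> \<phi> ` ball 0 r" "c \<notin> \<phi> ` ball 0 1"
    "\<And>R :: complex \<Rightarrow> complex^2^2. \<exists>K. det K \<noteq> 0 \<and>
       (transport S R \<sigma> ** transport S R \<tau>) ** K = K ** transport S R (\<phi> \<circ> circlepath 0 r)"
proof -
  obtain \<Gamma> E U where \<Gamma>: "path \<Gamma>" "pathfinish \<Gamma> = pathstart \<Gamma>" "path_image \<Gamma> \<subseteq> U - E"
    and E: "compact E" "path_connected E" "a \<in> E" "b \<in> E" "E \<subseteq> U"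
    and U: "open U" "simply_connected U" "c \<notin> U" and wa: "winding_number \<Gamma> a = 1"
    and T: "\<And>R :: complex \<Rightarrow> complex^2^2. \<exists>K. det K \<noteq> 0 \<and>
       (transport S R \<sigma> ** transport S R \<tau>) ** K = K ** transport S R \<Gamma>"
    using pushed_loop by metis
  have "U \<noteq> {}" "U \<noteq> UNIV" using E(3,5) U(3) by auto
  then obtain f \<phi> where f: "f holomorphic_on U" and \<phi>: "\<phi> holomorphic_on ball 0 1"
    and f\<phi>: "\<forall>z\<in>U. f z \<in> ball 0 1 \<and> \<phi> (f z) = z" and \<phi>f: "\<forall>z\<in>ball 0 1. \<phi> z \<in> U \<and> f (\<phi> z) = z"
    using simply_connected_eq_biholomorphic_to_disc[OF U(1)] U(2) by blast
  have inj_\<phi>: "inj_on \<phi> (ball 0 1)" using \<phi>f by (metis inj_onI)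
  have inj_f: "inj_on f U" using f\<phi> by (metis inj_onI)
  have cf: "continuous_on U f" using f by (rule holomorphic_on_imp_continuous_on)
  have c\<phi>: "continuous_on (ball 0 1) \<phi>" using \<phi> by (rule holomorphic_on_imp_continuous_on)
  define a' where "a' = f a"
  define E' where "E' = f ` E"
  define g where "g = f \<circ> \<Gamma>"
  have E': "compact E'" "path_connected E'" "E' \<subseteq> ball 0 1" "a' \<in> E'"
    using E f\<phi> unfolding E'_def a'_def
    by (auto intro!: compact_continuous_image path_connected_continuous_image continuous_on_subset[OF cf] imageI simp del: mem_ball)
  have g: "path g" "pathfinish g = pathstart g" "path_image g \<subseteq> ball 0 1 - E'"
  proof -
    show "path g" unfolding g_def using \<Gamma> by (intro path_continuous_image continuous_on_subset[OF cf]) auto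
    show "pathfinish g = pathstart g" using \<Gamma>(2) by (simp add: g_def pathstart_compose pathfinish_compose)
    show "path_image g \<subseteq> ball 0 1 - E'"
    proof
      fix x assume "x \<in> path_image g"
      then obtain y where y: "x = f y" "y \<in> U" "y \<notin> E" using \<Gamma>(3) unfolding g_def path_image_compose by blast
      then have "x \<notin> E'" using inj_f E(5) unfolding E'_def by (auto dest: inj_onD)
      then show "x \<in> ball 0 1 - E'" using f\<phi> y by blast
    qed
  qed
  have wg: "winding_number g a' = 1"
  proof -
    have "path_image \<Gamma> \<subseteq> U - {a}" using \<Gamma>(3) E(3) by blast
    then show ?thesis unfolding g_def a'_def wa[symmetric]
      using E(3,5) by (intro winding_number_injective_image[OF U(1,2) f inj_f \<Gamma>(1,2)]) blast+
  qed
  have "compact (E' \<union> path_image g)" using E'(1) g(1) by (intro compact_Un compact_path_image)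
  moreover have "E' \<union> path_image g \<subseteq> ball 0 1" using E'(3) g(3) by blast
  ultimately obtain \<rho> where \<rho>: "\<rho> < 1" "\<And>x. x \<in> E' \<union> path_image g \<Longrightarrow> norm x \<le> \<rho>"
  proof -
    have "\<exists>x\<in>E' \<union> path_image g. \<forall>y\<in>E' \<union> path_image g. norm y \<le> norm x"
      using \<open>compact (E' \<union> path_image g)\<close> E'(4) by (intro continuous_attains_sup continuous_intros) auto
    then obtain x where "x \<in> E' \<union> path_image g" "\<And>y. y \<in> E' \<union> path_image g \<Longrightarrow> norm y \<le> norm x" by blast
    moreover from this have "norm x < 1" using \<open>E' \<union> path_image g \<subseteq> ball 0 1\<close> by (metis in_mono mem_ball_0)
    ultimately show ?thesis using that[of "norm x"] by blast
  qed
  have "0 \<le> \<rho>" using \<rho>(2)[of a'] E'(4) order_trans[OF norm_ge_zero[of a']] by simp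
  define r where "r = (\<rho> + 1) / 2"
  have r: "0 < r" "r < 1" "\<rho> < r" using \<rho>(1) \<open>0 \<le> \<rho>\<close> by (auto simp: r_def)
  have inr: "E' \<subseteq> ball 0 r" "path_image g \<subseteq> ball 0 r" using \<rho>(2) r(3) by fastforce+
  have sph: "sphere 0 r \<subseteq> ball 0 1 - E'" using r inr(1) by auto

  text \<open>The component of the complement of \<open>E'\<close> that contains \<open>g\<close> is the unbounded one, since
    \<open>g\<close> winds around the connected set \<open>E'\<close>.\<close>
  define H where "H = connected_component_set (- E') (pathstart g)"
  have oE: "open (- E')" using E'(1) by (simp add: compact_imp_closed open_Compl)
  have gE: "path_image g \<subseteq> - E'" using g(3) by blast
  have gs: "pathstart g \<in> path_image g" by (rule pathstart_in_path_image)
  have gH: "path_image g \<subseteq> H" unfolding H_def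
    using gE gs g(1) by (intro connected_component_maximal connected_path_image)
  have H: "H \<in> components (- E')" unfolding H_def using gE gs by (auto simp: components_def)
  have "\<not> bounded H"
  proof
    assume "bounded H"
    have "connected (- H)"
      using component_complement_connected[OF path_connected_imp_connected[OF E'(2)] H] .
    moreover have "\<not> bounded (- H)"
      using \<open>bounded H\<close> cobounded_imp_unbounded[of "- H"] by simp
    moreover have "a' \<in> - H" using E'(4) in_components_subset[OF H] by blast
    ultimately have "a' \<in> outside (path_image g)"
      using gH by (intro in_outsideI[of "- H"]) blast+
    then show False using winding_number_zero_in_outside[OF g(1,2)] wg by simp
  qed
  then obtain y where y: "y \<in> H" "r < norm y" unfolding bounded_iff by (meson not_le)
  have "open H" "connected H" using open_components[OF oE H] in_components_connected[OF H] by auto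
  then have "path_connected H" using connected_open_path_connected by blast
  then obtain k where k: "path k" "path_image k \<subseteq> H" "pathstart k = pathstart g" "pathfinish k = y"
    using gH gs y(1) unfolding path_connected_def by blast
  \<comment> \<open>\<open>k\<close> avoids the image of the spine but may leave the unit disc, so
    it is cut where it first meets the circle of radius \<open>r\<close>.\<close>
  obtain h where h: "path h" "pathstart h = pathstart k" "path_image h \<subseteq> path_image k"
      "path_image h - {pathfinish h} \<subseteq> interior (ball 0 r)" "pathfinish h \<in> frontier (ball 0 r)"
  proof (rule exists_path_subpath_to_frontier[OF k(1)])
    show "pathstart k \<in> closure (ball 0 r)"
      unfolding k(3) using inr(2) gs closure_subset[of "ball (0::complex) r"] by blast
    show "pathfinish k \<notin> ball 0 r" using y(2) k(4) by simp
  qed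
  have hfin: "pathfinish h \<in> sphere 0 r" using h(5) r(1) by (simp add: frontier_ball)
  have hE: "path_image h \<inter> E' = {}" using h(3) k(2) in_components_subset[OF H] by blast
  have "path_image h \<subseteq> ball 0 r \<union> sphere 0 r" using h(4) hfin by auto
  then have hD: "path_image h \<subseteq> ball 0 1 - E'" using hE r(2) by auto
  have "path_connected (sphere (0::complex) r)" by (intro path_connected_sphere) simp
  moreover have "of_real r \<in> sphere (0::complex) r" using r(1) by simp
  ultimately obtain l where l: "path l" "path_image l \<subseteq> sphere 0 r" "pathstart l = pathfinish h" "pathfinish l = of_real r"
    using hfin unfolding path_connected_def by blast
  define m where "m = h +++ l"
  let ?C = "circlepath 0 r"
  have m: "path m" "pathstart m = pathstart g" "pathfinish m = pathstart ?C" "path_image m \<subseteq> ball 0 1 - E'"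
    using h l k(3) hD sph unfolding m_def by (auto simp: path_image_join)
  have C: "path ?C" "path_image ?C \<subseteq> ball 0 1 - E'" "pathfinish ?C = pathstart ?C"
    using sph r(1) by auto
  have notin: "a' \<notin> path_image m" "a' \<notin> path_image ?C" using m(4) C(2) E'(4) by blast+
  have loop: "path (m +++ (?C +++ reversepath m))" "path_image (m +++ (?C +++ reversepath m)) \<subseteq> ball 0 1 - E'"
    "pathstart (m +++ (?C +++ reversepath m)) = pathstart g" "pathfinish (m +++ (?C +++ reversepath m)) = pathstart g"
    using m C by (auto simp: path_image_join)
  \<comment> \<open>The contributions of \<open>m\<close> and its reverse cancel, and the circle
    contributes 1, as much as \<open>g\<close>.\<close>
  have "winding_number (m +++ (?C +++ reversepath m)) a' = winding_number m a' + winding_number (?C +++ reversepath m) a'"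
    using m C notin by (intro winding_number_join) (auto simp: path_image_join)
  also have "winding_number (?C +++ reversepath m) a' = winding_number ?C a' + winding_number (reversepath m) a'"
    using m C notin by (intro winding_number_join) auto
  also have "winding_number (reversepath m) a' = - winding_number m a'"
    using m notin by (intro winding_number_reversepath)
  also have "winding_number ?C a' = 1"
    using inr(1) E'(4) by (intro winding_number_circlepath) auto
  finally have "winding_number (m +++ (?C +++ reversepath m)) a' = winding_number g a'" using wg by simp
  then have "homotopic_paths (ball 0 1 - E') g (m +++ (?C +++ reversepath m))"
    using loop g by (intro homotopic_paths_around_continuum[where a = a'] E') auto
  then have hom: "homotopic_paths (U - E) (\<phi> \<circ> g) (\<phi> \<circ> (m +++ (?C +++ reversepath m)))"
  proof (rule homotopic_paths_continuous_image)
    show "continuous_on (ball 0 1 - E') \<phi>" by (rule continuous_on_subset[OF c\<phi>]) auto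
    show "\<phi> \<in> (ball 0 1 - E') \<rightarrow> U - E"
      using \<phi>f unfolding E'_def by force
  qed
  have UE: "U - E \<subseteq> - S" using E(3,4) U(3) by blast
  have \<phi>D: "\<phi> ` (ball 0 1 - E') \<subseteq> - S"
    using \<phi>f E(3,4) U(3) unfolding E'_def by force
  have "homotopic_paths (U - E) \<Gamma> (\<phi> \<circ> g)"
  proof (rule homotopic_paths_eq[OF \<Gamma>(1,3)])
    fix t :: real assume "t \<in> {0..1}"
    then have "\<Gamma> t \<in> U" using \<Gamma>(3) unfolding path_image_def by blast
    then show "\<Gamma> t = (\<phi> \<circ> g) t" using f\<phi> by (simp add: g_def)
  qed
  then have "homotopic_paths (U - E) \<Gamma> (\<phi> \<circ> (m +++ (?C +++ reversepath m)))"
    using hom homotopic_paths_trans by blast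
  then have hS: "homotopic_paths (- S) \<Gamma> (\<phi> \<circ> (m +++ (?C +++ reversepath m)))"
    using UE by (rule homotopic_paths_subset)
  have fS: "finite S" "S \<noteq> {}" by auto
  have p\<phi>: "path (\<phi> \<circ> p)" "path_image (\<phi> \<circ> p) \<inter> S = {}"
    if "path p" "path_image p \<subseteq> ball 0 1 - E'" for p
  proof -
    show "path (\<phi> \<circ> p)" using that by (intro path_continuous_image continuous_on_subset[OF c\<phi>]) auto
    show "path_image (\<phi> \<circ> p) \<inter> S = {}" using \<phi>D that(2) unfolding path_image_compose by blast
  qed
  show ?thesis
  proof (rule that[OF \<phi> inj_\<phi> r(1,2)])
    have "a = \<phi> (f a)" "b = \<phi> (f b)" "f a \<in> E'" "f b \<in> E'"
      using f\<phi> E(3-5) unfolding E'_def by auto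
    then show "a \<in> \<phi> ` ball 0 r" "b \<in> \<phi> ` ball 0 r" using inr(1) by blast+
    show "c \<notin> \<phi> ` ball 0 1" using \<phi>f U(3) by auto
    fix R :: "complex \<Rightarrow> complex^2^2"
    let ?T = "transport S R"
    obtain K where K: "det K \<noteq> 0" "(?T \<sigma> ** ?T \<tau>) ** K = K ** ?T \<Gamma>" using T by blast
    have mr: "path (reversepath m)" "path_image (reversepath m) \<subseteq> ball 0 1 - E'" using m by auto
    have Cm: "path (?C +++ reversepath m)" "path_image (?C +++ reversepath m) \<subseteq> ball 0 1 - E'"
      using m C by (auto simp: path_image_join)
    have "?T \<Gamma> = ?T ((\<phi> \<circ> m) +++ ((\<phi> \<circ> ?C) +++ reversepath (\<phi> \<circ> m)))"
      using transport_homotopic[OF fS hS] by (simp add: path_compose_join path_compose_reversepath)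
    also have "\<dots> = ?T ((\<phi> \<circ> ?C) +++ reversepath (\<phi> \<circ> m)) ** ?T (\<phi> \<circ> m)"
      using p\<phi>[OF m(1,4)] p\<phi>[OF Cm] m(3) C(3)
      by (intro transport_join[OF fS]) (auto simp: path_compose_join path_compose_reversepath pathstart_compose pathfinish_compose)
    also have "?T ((\<phi> \<circ> ?C) +++ reversepath (\<phi> \<circ> m)) = ?T (reversepath (\<phi> \<circ> m)) ** ?T (\<phi> \<circ> ?C)"
      using p\<phi>[OF m(1,4)] p\<phi>[OF C(1,2)] m(3) C(3)
      by (intro transport_join[OF fS]) (auto simp: pathstart_compose pathfinish_compose)
    finally have T\<Gamma>: "?T \<Gamma> = ?T (reversepath (\<phi> \<circ> m)) ** ?T (\<phi> \<circ> ?C) ** ?T (\<phi> \<circ> m)" .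
    have inv: "?T (reversepath (\<phi> \<circ> m)) ** ?T (\<phi> \<circ> m) = mat 1" "?T (\<phi> \<circ> m) ** ?T (reversepath (\<phi> \<circ> m)) = mat 1"
      using transport_reversepath[OF fS p\<phi>[OF m(1,4)]] transport_inverse[OF fS p\<phi>[OF m(1,4)]] by auto
    define K' where "K' = K ** ?T (reversepath (\<phi> \<circ> m))"
    have "(?T \<sigma> ** ?T \<tau>) ** K' = K ** ?T \<Gamma> ** ?T (reversepath (\<phi> \<circ> m))"
      unfolding K'_def using K(2) by (simp add: matrix_mul_assoc)
    also have "\<dots> = K ** ?T (reversepath (\<phi> \<circ> m)) ** ?T (\<phi> \<circ> ?C) ** (?T (\<phi> \<circ> m) ** ?T (reversepath (\<phi> \<circ> m)))"
      unfolding T\<Gamma> by (simp add: matrix_mul_assoc)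
    also have "\<dots> = K' ** ?T (\<phi> \<circ> ?C)" unfolding inv K'_def by (simp add: matrix_mul_rid)
    finally have eq: "(?T \<sigma> ** ?T \<tau>) ** K' = K' ** ?T (\<phi> \<circ> ?C)" .
    have "det (?T (reversepath (\<phi> \<circ> m))) * det (?T (\<phi> \<circ> m)) = 1" using inv(1) by (metis det_I det_mul)
    then have "det K' \<noteq> 0" unfolding K'_def det_mul using K(1) by auto
    then show "\<exists>K. det K \<noteq> 0 \<and> (?T \<sigma> ** ?T \<tau>) ** K = K ** ?T (\<phi> \<circ> ?C)" using eq by blast
  qed
qed

end

section \<open>The Euler kernel on an annulus\<close>

text \<open>Locally a continuous branch \<open>W\<close> of the logarithm of \<open>q\<close> must
  be W x + Ln (q y / q x), which is differentiable by the chain rule. The general domain covers both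
  the complex variable \<open>X\<close> and the real variable \<open>u\<close> of the
  kernel.\<close>

lemma has_derivative_continuous_log:
  fixes q W :: "'a::real_normed_vector \<Rightarrow> complex"
  assumes q: "(q has_derivative q') (at x)" and W: "isCont W x" and e: "\<forall>\<^sub>F y in nhds x. exp (W y) = q y"
  shows "(W has_derivative (\<lambda>h. q' h / q x)) (at x)"
proof -
  have qx: "exp (W x) = q x" using e by (rule eventually_nhds_x_imp_x)
  then have nz: "q x \<noteq> 0" by (metis exp_not_eq_zero)
  have "((\<lambda>y. q y / q x) has_derivative (\<lambda>h. q' h / q x)) (at x)"
    by (rule bounded_linear.has_derivative[OF bounded_linear_divide q])
  moreover have "(Ln has_derivative (*) (inverse (q x / q x))) (at (q x / q x))"
    using has_field_derivative_Ln[of "q x / q x"] nz by (simp add: has_field_derivative_def)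
  ultimately have "((\<lambda>y. Ln (q y / q x)) has_derivative (\<lambda>h. inverse (q x / q x) * (q' h / q x))) (at x)"
    by (rule has_derivative_compose)
  then have D: "((\<lambda>y. W x + Ln (q y / q x)) has_derivative (\<lambda>h. q' h / q x)) (at x)"
    using nz by (auto intro!: derivative_eq_intros)
  have "\<forall>\<^sub>F y in nhds x. dist (W y) (W x) < pi"
    using W[unfolded continuous_at tendsto_at_iff_tendsto_nhds] pi_gt_zero by (rule tendstoD)
  with e have "\<forall>\<^sub>F y in nhds x. W x + Ln (q y / q x) = W y"
  proof eventually_elim
    case (elim y)
    have "q y / q x = exp (W y - W x)" using elim(1) qx by (simp add: exp_diff)
    moreover have "\<bar>Im (W y - W x)\<bar> < pi"
      using elim(2) abs_Im_le_cmod[of "W y - W x"] by (simp add: dist_norm)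
    ultimately show ?case by (auto intro!: Ln_exp)
  qed
  then have "\<forall>\<^sub>F y in at x. W x + Ln (q y / q x) = W y" by (simp add: eventually_nhds_conv_at)
  then show ?thesis
    using has_derivative_transform_eventually[OF D] nz qx by simp
qed

text \<open>The kernel \<open>(z(X) - z(X + \<i>u))\<^sup>\<kappa>\<close> for a conformal parametrization \<open>z(X) = \<phi>(exp X)\<close>
  of an annulus, and the convolution of a function \<open>h\<close> on the universal cover with it, the path of
  integration going once around the annulus from \<open>X\<close> to \<open>X + 2\<pi>\<i>\<close>.\<close>

locale annulus =
  fixes \<phi> :: "complex \<Rightarrow> complex" and \<rho> :: real
  assumes hol: "\<phi> holomorphic_on ball 0 1" and inj: "inj_on \<phi> (ball 0 1)"
    and \<rho>: "0 < \<rho>" "\<rho> < 1"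
begin

definition strip :: "complex set" where "strip = {X. ln \<rho> < Re X \<and> Re X < 0}"
definition z :: "complex \<Rightarrow> complex" where "z X = \<phi> (exp X)"
definition dz :: "complex \<Rightarrow> complex" where "dz X = deriv \<phi> (exp X) * exp X"

text \<open>The divided difference (\<phi> x - \<phi> y) / (x - y), written as an integral so that
  it extends continuously to the diagonal. Injectivity of \<phi> keeps it from vanishing, so it has
  a logarithm on the contractible product of the discs.\<close>

definition kquot :: "complex \<times> complex \<Rightarrow> complex" where
  "kquot w = integral {0..1} (\<lambda>t. deriv \<phi> (snd w + of_real t * (fst w - snd w)))"

lemma strip: "open strip" "convex strip" "X \<in> strip \<Longrightarrow> X + \<i> * of_real u \<in> strip"
  "X \<in> strip \<Longrightarrow> X + 2 * of_real pi * \<i> \<in> strip"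
proof -
  have "strip = {X. ln \<rho> < Re X} \<inter> {X. Re X < 0}" by (auto simp: strip_def)
  then show "open strip" "convex strip"
    by (simp_all add: open_Int open_halfspace_Re_gt open_halfspace_Re_lt convex_Int
        convex_halfspace_Re_gt convex_halfspace_Re_lt)
qed (auto simp: strip_def)

lemma exp_in_disc: "X \<in> strip \<Longrightarrow> exp X \<in> ball 0 1"
  by (simp add: strip_def norm_exp_eq_Re)

lemma exp_norm_gt: "X \<in> strip \<Longrightarrow> \<rho> < norm (exp X)"
  using \<rho> by (simp add: strip_def norm_exp_eq_Re) (metis exp_less_cancel_iff exp_ln)

lemma DERIV_z: "X \<in> strip \<Longrightarrow> (z has_field_derivative dz X) (at X)"
  unfolding z_def dz_def
  using holomorphic_derivI[OF hol open_ball exp_in_disc]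
  by (auto intro!: DERIV_chain2[of \<phi> _ exp])

lemma dz_nonzero: "X \<in> strip \<Longrightarrow> dz X \<noteq> 0"
  using holomorphic_injective_imp_regular[OF hol open_ball inj exp_in_disc] by (simp add: dz_def)

lemma dz_holomorphic: "dz holomorphic_on strip"
  unfolding dz_def using exp_in_disc
  by (intro holomorphic_intros holomorphic_on_compose_gen[OF _ holomorphic_deriv[OF hol open_ball], unfolded o_def]) auto

lemma z_periodic: "z (X + 2 * of_real pi * \<i>) = z X" "dz (X + 2 * of_real pi * \<i>) = dz X"
  by (simp_all add: z_def dz_def exp_add exp_two_pi_i')

lemma kquot_eq:
  assumes "x \<in> ball 0 1" "y \<in> ball 0 1"
  shows "kquot (x, y) * (x - y) = \<phi> x - \<phi> y" and "kquot (x, x) = deriv \<phi> x"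
proof -
  have seg: "y + of_real t * (x - y) \<in> ball 0 1" if "t \<in> {0..1}" for t :: real
  proof -
    have "(1 - t) *\<^sub>R y + t *\<^sub>R x \<in> ball 0 1"
      using assms that by (intro convexD[OF convex_ball]) auto
    then show ?thesis by (simp add: scaleR_conv_of_real algebra_simps)
  qed
  have "((\<lambda>t. deriv \<phi> (y + of_real t * (x - y)) * (x - y)) has_integral
      \<phi> (y + of_real 1 * (x - y)) - \<phi> (y + of_real 0 * (x - y))) {0..1}"
  proof (rule fundamental_theorem_of_calculus)
    fix t :: real assume t: "t \<in> {0..1}"
    have "((\<lambda>t. y + t * (x - y)) has_field_derivative (x - y)) (at (of_real t))"
      by (auto intro!: derivative_eq_intros)
    then have "((\<lambda>t. \<phi> (y + t * (x - y))) has_field_derivative deriv \<phi> (y + of_real t * (x - y)) * (x - y)) (at (of_real t))"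
      by (rule DERIV_chain2[where f = \<phi> and g = "\<lambda>t. y + t * (x - y)", OF holomorphic_derivI[OF hol open_ball seg[OF t]]])
    then show "((\<lambda>t. \<phi> (y + of_real t * (x - y))) has_vector_derivative deriv \<phi> (y + of_real t * (x - y)) * (x - y)) (at t within {0..1})"
      by (rule has_vector_derivative_real_field)
  qed simp
  from integral_unique[OF this]
  have "integral {0..1} (\<lambda>t. deriv \<phi> (y + of_real t * (x - y)) * (x - y)) = \<phi> x - \<phi> y"
    by simp
  then show "kquot (x, y) * (x - y) = \<phi> x - \<phi> y" by (simp add: kquot_def)
  show "kquot (x, x) = deriv \<phi> x" by (simp add: kquot_def)
qed

lemma kquot_nonzero: "w \<in> ball 0 1 \<times> ball 0 1 \<Longrightarrow> kquot w \<noteq> 0"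
proof -
  assume "w \<in> ball 0 1 \<times> ball 0 1"
  then obtain x y where w: "w = (x, y)" "x \<in> ball 0 1" "y \<in> ball 0 1" by blast
  show ?thesis
  proof (cases "x = y")
    case True
    then show ?thesis
      using w kquot_eq(2)[of x x] holomorphic_injective_imp_regular[OF hol open_ball inj, of x] by simp
  next
    case False
    then have "\<phi> x - \<phi> y \<noteq> 0" using w inj by (auto dest: inj_onD)
    then show ?thesis using w kquot_eq(1)[of x y] by auto
  qed
qed

lemma continuous_on_kquot: "continuous_on (ball 0 1 \<times> ball 0 1) kquot"
proof -
  define P where "P = (\<lambda>p::(complex \<times> complex) \<times> real. snd (fst p) + of_real (snd p) * (fst (fst p) - snd (fst p)))"
  have c: "continuous_on ((ball 0 1 \<times> ball 0 1) \<times> cbox 0 1) P"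
    unfolding P_def by (intro continuous_intros)
  have im: "P ` ((ball 0 1 \<times> ball 0 1) \<times> cbox 0 1) \<subseteq> ball 0 1"
  proof clarify
    fix x y :: complex and t :: real assume *: "x \<in> ball 0 1" "y \<in> ball 0 1" "t \<in> cbox 0 1"
    have "(1 - t) *\<^sub>R y + t *\<^sub>R x \<in> ball 0 1"
      using * by (intro convexD[OF convex_ball]) auto
    then show "P ((x, y), t) \<in> ball 0 1"
      by (simp add: P_def scaleR_conv_of_real algebra_simps)
  qed
  have "continuous_on ((ball 0 1 \<times> ball 0 1) \<times> cbox 0 1) (\<lambda>p. deriv \<phi> (P p))"
    by (rule continuous_on_compose2[OF holomorphic_on_imp_continuous_on[OF holomorphic_deriv[OF hol open_ball]] c im])
  then have "continuous_on ((ball 0 1 \<times> ball 0 1) \<times> cbox 0 1) (\<lambda>(w, t). deriv \<phi> (snd w + of_real t * (fst w - snd w)))"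
    by (simp add: P_def case_prod_beta')
  from integral_continuous_on_param[OF this]
  show ?thesis unfolding kquot_def[abs_def] by simp
qed

definition klog :: "complex \<times> complex \<Rightarrow> complex" where
  "klog = (SOME g. continuous_on (ball 0 1 \<times> ball 0 1) g \<and> (\<forall>w\<in>ball 0 1 \<times> ball 0 1. kquot w = exp (g w)))"

lemma klog: "continuous_on (ball 0 1 \<times> ball 0 1) klog"
  "w \<in> ball 0 1 \<times> ball 0 1 \<Longrightarrow> kquot w = exp (klog w)"
proof -
  have "contractible (ball (0::complex) 1 \<times> ball (0::complex) 1)"
    by (intro convex_imp_contractible convex_Times convex_ball)
  then obtain g where "continuous_on (ball 0 1 \<times> ball 0 1) g" "\<And>w. w \<in> ball 0 1 \<times> ball 0 1 \<Longrightarrow> kquot w = exp (g w)"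
    using continuous_logarithm_on_contractible[OF continuous_on_kquot _ kquot_nonzero] by metis
  then have "\<exists>g. continuous_on (ball 0 1 \<times> ball 0 1) g \<and> (\<forall>w\<in>ball 0 1 \<times> ball 0 1. kquot w = exp (g w))"
    by (intro exI[of _ g]) blast
  then have "continuous_on (ball 0 1 \<times> ball 0 1) klog \<and> (\<forall>w\<in>ball 0 1 \<times> ball 0 1. kquot w = exp (klog w))"
    unfolding klog_def by (rule someI_ex)
  then show "continuous_on (ball 0 1 \<times> ball 0 1) klog"
    "w \<in> ball 0 1 \<times> ball 0 1 \<Longrightarrow> kquot w = exp (klog w)" by blast+
qed

text \<open>In z X - z (X + \<i> u) = exp X * rot u * kquot, the zeros at u = 0 and u = 2 \<pi>
  belong to \<open>rot\<close> alone. Its real part is nonnegative, so the principal power can be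
  used; the other two factors have the global logarithm \<open>kexp\<close>.\<close>

definition rot :: "real \<Rightarrow> complex" where "rot u = 1 - exp (\<i> * of_real u)"

definition kexp :: "complex \<Rightarrow> real \<Rightarrow> complex" where
  "kexp X u = X + klog (exp X, exp (X + \<i> * of_real u))"

definition kern :: "complex \<Rightarrow> complex \<Rightarrow> real \<Rightarrow> complex" where
  "kern \<kappa> X u = rot u powr \<kappa> * exp (\<kappa> * kexp X u)"

lemma rot_ends [simp]: "rot 0 = 0" "rot (2 * pi) = 0"
  using exp_two_pi_i by (simp_all add: rot_def mult.commute)

lemma rot_interior:
  assumes "0 < u" "u < 2 * pi" shows "0 < Re (rot u)"
proof -
  have "cos u \<noteq> 1"
  proof
    assume "cos u = 1"
    then obtain n :: int where n: "u = real_of_int n * 2 * pi" by (auto simp: cos_one_2pi_int)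
    then have "0 < real_of_int n" "real_of_int n < 1" using assms by (auto simp: zero_less_mult_iff)
    then have "0 < n" "n < 1" by simp_all
    then show False by simp
  qed
  then have "cos u < 1" using cos_le_one[of u] by linarith
  then show ?thesis by (simp add: rot_def Re_exp)
qed

lemma exp_pair_in_disc: "X \<in> strip \<Longrightarrow> (exp X, exp (X + \<i> * of_real u)) \<in> ball 0 1 \<times> ball 0 1"
  using exp_in_disc strip(3) by blast

lemma exp_kexp:
  assumes "X \<in> strip"
  shows "rot u * exp (kexp X u) = z X - z (X + \<i> * of_real u)"
proof -
  have "rot u * exp (kexp X u) = (exp X - exp (X + \<i> * of_real u)) * kquot (exp X, exp (X + \<i> * of_real u))"
    using klog(2)[OF exp_pair_in_disc[OF assms, of u]] by (simp add: rot_def kexp_def exp_add algebra_simps)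
  also have "\<dots> = z X - z (X + \<i> * of_real u)"
    using kquot_eq(1)[of "exp X" "exp (X + \<i> * of_real u)"] exp_pair_in_disc[OF assms, of u]
    by (simp add: z_def mult.commute)
  finally show ?thesis .
qed

lemma kern_Suc:
  assumes "X \<in> strip"
  shows "kern (\<kappa> + 1) X u = kern \<kappa> X u * (z X - z (X + \<i> * of_real u))"
proof -
  have "rot u powr (\<kappa> + 1) = rot u powr \<kappa> * rot u" by (simp add: powr_def exp_add distrib_right)
  moreover have "exp ((\<kappa> + 1) * kexp X u) = exp (\<kappa> * kexp X u) * exp (kexp X u)"
    by (simp add: distrib_right exp_add)
  ultimately show ?thesis unfolding kern_def exp_kexp[OF assms, symmetric] by simp
qed

lemma kern_ends [simp]: "kern \<kappa> X 0 = 0" "kern \<kappa> X (2 * pi) = 0"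
  by (simp_all add: kern_def)

text \<open>exp X does not change, and of the two summands of \<open>kexp\<close> only
  \<open>X\<close> increases, by one period. This is the origin of the factor in the trace
  formula.\<close>

lemma kern_shift: "kern \<kappa> (X + 2 * of_real pi * \<i>) u = exp (2 * of_real pi * \<i> * \<kappa>) * kern \<kappa> X u"
proof -
  have e: "exp (X + 2 * of_real pi * \<i>) = exp X" "exp (X + 2 * of_real pi * \<i> + \<i> * of_real u) = exp (X + \<i> * of_real u)"
    by (simp_all add: exp_add)
  have "kexp (X + 2 * of_real pi * \<i>) u = 2 * of_real pi * \<i> + kexp X u"
    unfolding kexp_def e by simp
  then show ?thesis by (simp add: kern_def distrib_left exp_add mult_ac)
qed

lemma continuous_on_kexp: "continuous_on (strip \<times> UNIV) (\<lambda>(X, u). kexp X u)"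
  unfolding kexp_def case_prod_beta'
  by (intro continuous_intros continuous_on_compose2[OF klog(1)]) (use exp_pair_in_disc in auto)

text \<open>At both ends the base of the power is 0. The principal power is continuous there since
  the base stays in the closed right half plane and the exponent has positive real part.\<close>

lemma continuous_on_kern:
  "continuous_on ({\<kappa>. 0 < Re \<kappa>} \<times> strip \<times> {0..2 * pi}) (\<lambda>(\<kappa>, X, u). kern \<kappa> X u)"
  unfolding kern_def case_prod_beta'
proof (intro continuous_on_mult continuous_on_exp continuous_on_powr_complex)
  let ?A = "{\<kappa>. 0 < Re \<kappa>} \<times> strip \<times> {0..2 * pi}"
  show "?A \<subseteq> {x. 0 \<le> Re (rot (snd (snd x))) \<or> Im (rot (snd (snd x))) \<noteq> 0}"
    by (auto simp: rot_def Re_exp)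
  show "continuous_on ?A (\<lambda>x. rot (snd (snd x)))"
    unfolding rot_def by (intro continuous_intros)
  show "continuous_on ?A (\<lambda>x. kexp (fst (snd x)) (snd (snd x)))"
    by (rule continuous_on_compose2[OF continuous_on_kexp[unfolded case_prod_beta'], of _ snd]) (auto intro: continuous_intros)
qed (auto intro!: continuous_intros)

lemma kern_interior:
  assumes "0 < u" "u < 2 * pi"
  shows "kern \<kappa> X u = exp (\<kappa> * (Ln (rot u) + kexp X u))"
proof -
  have "rot u \<noteq> 0" using rot_interior[OF assms] by auto
  then show ?thesis by (simp add: kern_def powr_def exp_add distrib_left)
qed

lemma kern_log_exp:
  assumes "X \<in> strip" "0 < u" "u < 2 * pi"
  shows "exp (Ln (rot u) + kexp X u) = z X - z (X + \<i> * of_real u)"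
proof -
  have "rot u \<noteq> 0" using rot_interior[OF assms(2,3)] by auto
  then show ?thesis using exp_kexp[OF assms(1), of u] by (simp add: exp_add)
qed

lemma DERIV_kern:
  assumes X: "X \<in> strip" and u: "u \<in> {0..2 * pi}"
  shows "((\<lambda>X. kern \<kappa> X u) has_field_derivative \<kappa> * kern (\<kappa> - 1) X u * (dz X - dz (X + \<i> * of_real u))) (at X)"
proof (cases "u = 0 \<or> u = 2 * pi")
  case True
  \<comment> \<open>Here \<open>rot\<close> is 0 and \<open>powr\<close> gives 0 for every exponent,
    so both sides vanish.\<close>
  then show ?thesis by auto
next
  case False
  then have u: "0 < u" "u < 2 * pi" using u by auto
  let ?V = "\<lambda>X. Ln (rot u) + kexp X u" and ?d = "\<lambda>X. z X - z (X + \<i> * of_real u)"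
  have d: "(?d has_field_derivative dz X - dz (X + \<i> * of_real u)) (at X)"
    using DERIV_z[OF X] DERIV_z[OF strip(3)[OF X, of u]]
    by (auto intro!: derivative_eq_intros DERIV_chain2[of z _ "\<lambda>X. X + \<i> * of_real u"])
  have "continuous_on strip (\<lambda>X. kexp X u)"
    by (rule continuous_on_compose2[OF continuous_on_kexp[unfolded case_prod_beta'], of _ "\<lambda>X. (X, u)", simplified])
      (auto intro: continuous_intros)
  then have "isCont (\<lambda>X. kexp X u) X" using strip(1) X continuous_on_eq_continuous_at by blast
  then have c: "isCont ?V X" by (intro continuous_intros)
  have "\<forall>\<^sub>F Y in nhds X. Y \<in> strip" using strip(1) X by (intro eventually_nhds_in_open)
  then have e: "\<forall>\<^sub>F Y in nhds X. exp (?V Y) = ?d Y"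
    by (rule eventually_mono) (use kern_log_exp u in blast)
  have V: "(?V has_field_derivative (dz X - dz (X + \<i> * of_real u)) / ?d X) (at X)"
  proof -
    have "(\<lambda>h. (dz X - dz (X + \<i> * of_real u)) * h / ?d X) = (*) ((dz X - dz (X + \<i> * of_real u)) / ?d X)"
      by (simp add: fun_eq_iff)
    then show ?thesis
      using has_derivative_continuous_log[OF d[unfolded has_field_derivative_def] c e]
      unfolding has_field_derivative_def by simp
  qed
  have dX: "?d X = exp (?V X)" using kern_log_exp[OF X u] by simp
  have "((\<lambda>X. exp (\<kappa> * ?V X)) has_field_derivative exp (\<kappa> * ?V X) * (\<kappa> * ((dz X - dz (X + \<i> * of_real u)) / ?d X))) (at X)"
  proof -
    have "((\<lambda>w. exp (\<kappa> * w)) has_field_derivative exp (\<kappa> * ?V X) * \<kappa>) (at (?V X))"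
      by (auto intro!: derivative_eq_intros)
    from DERIV_chain2[where g = ?V, OF this V] show ?thesis by (simp only: mult.assoc)
  qed
  moreover have "exp (\<kappa> * ?V X) * (\<kappa> * ((dz X - dz (X + \<i> * of_real u)) / ?d X)) =
      \<kappa> * kern (\<kappa> - 1) X u * (dz X - dz (X + \<i> * of_real u))"
  proof -
    have "exp (\<kappa> * ?V X) = kern (\<kappa> - 1) X u * ?d X"
      unfolding kern_interior[OF u] dX by (simp add: left_diff_distrib flip: exp_add)
    moreover have "?d X \<noteq> 0" using dX by simp
    ultimately show ?thesis by simp
  qed
  ultimately show ?thesis by (simp add: kern_interior[OF u])
qed

lemma has_vector_derivative_kern:
  assumes X: "X \<in> strip" and u: "0 < u" "u < 2 * pi"
  shows "((\<lambda>u. kern \<kappa> X u) has_vector_derivative - \<i> * \<kappa> * kern (\<kappa> - 1) X u * dz (X + \<i> * of_real u)) (at u)"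
proof -
  let ?V = "\<lambda>u. Ln (rot u) + kexp X u" and ?d = "\<lambda>u. z X - z (X + \<i> * of_real u)"
  have ev: "\<forall>\<^sub>F v in nhds u. 0 < v \<and> v < 2 * pi"
    using eventually_nhds_in_open[of "{0<..<2 * pi}" u] u by auto
  have "((\<lambda>w. z X - z (X + \<i> * w)) has_field_derivative - (dz (X + \<i> * of_real u) * \<i>)) (at (of_real u))"
    using DERIV_z[OF strip(3)[OF X, of u]]
    by (auto intro!: derivative_eq_intros DERIV_chain2[of z _ "\<lambda>w. X + \<i> * w"])
  then have d: "(?d has_vector_derivative - (dz (X + \<i> * of_real u) * \<i>)) (at u)"
    by (rule has_vector_derivative_real_field)
  have "continuous_on UNIV (\<lambda>u. kexp X u)"
    by (rule continuous_on_compose2[OF continuous_on_kexp[unfolded case_prod_beta'], of _ "\<lambda>u. (X, u)", simplified])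
      (use X in \<open>auto intro: continuous_intros\<close>)
  then have c1: "isCont (\<lambda>u. kexp X u) u" by (simp add: continuous_on_eq_continuous_at)
  have "isCont (\<lambda>u. rot u) u" unfolding rot_def by (intro continuous_intros)
  moreover have "rot u \<notin> \<real>\<^sub>\<le>\<^sub>0" using rot_interior[OF u] by (auto simp: complex_nonpos_Reals_iff)
  ultimately have c: "isCont ?V u" using c1 by (intro continuous_intros) auto
  have e: "\<forall>\<^sub>F v in nhds u. exp (?V v) = ?d v"
    using ev by (rule eventually_mono) (use kern_log_exp X in blast)
  have dX: "?d u = exp (?V u)" using kern_log_exp[OF X u] by simp
  have "(?V has_derivative (\<lambda>h. (h *\<^sub>R - (dz (X + \<i> * of_real u) * \<i>)) / ?d u)) (at u)"
    by (rule has_derivative_continuous_log[OF d[unfolded has_vector_derivative_def] c e])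
  then have V: "(?V has_vector_derivative - (dz (X + \<i> * of_real u) * \<i>) / ?d u) (at u)"
    unfolding has_vector_derivative_def by (simp add: scaleR_conv_of_real)
  have "((\<lambda>w. exp (\<kappa> * w)) has_field_derivative exp (\<kappa> * ?V u) * \<kappa>) (at (?V u))"
    by (auto intro!: derivative_eq_intros)
  from field_vector_diff_chain_at[OF V this]
  have "((\<lambda>u. exp (\<kappa> * ?V u)) has_vector_derivative - (dz (X + \<i> * of_real u) * \<i>) / ?d u * (exp (\<kappa> * ?V u) * \<kappa>)) (at u)"
    by (simp add: o_def)
  moreover have "- (dz (X + \<i> * of_real u) * \<i>) / ?d u * (exp (\<kappa> * ?V u) * \<kappa>) = - \<i> * \<kappa> * kern (\<kappa> - 1) X u * dz (X + \<i> * of_real u)"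
  proof -
    have "exp (\<kappa> * ?V u) = kern (\<kappa> - 1) X u * ?d u"
      unfolding kern_interior[OF u] dX by (simp add: left_diff_distrib flip: exp_add)
    moreover have "?d u \<noteq> 0" using dX by simp
    ultimately show ?thesis by simp
  qed
  ultimately have "((\<lambda>u. exp (\<kappa> * ?V u)) has_vector_derivative - \<i> * \<kappa> * kern (\<kappa> - 1) X u * dz (X + \<i> * of_real u)) (at u)"
    by simp
  then show ?thesis
  proof (rule has_vector_derivative_transform_within_open[where S = "{0<..<2 * pi}"])
    fix v assume "v \<in> {0<..<2 * pi}"
    then show "exp (\<kappa> * ?V v) = kern \<kappa> X v" using kern_interior[of v \<kappa> X] by simp
  qed (use u in auto)
qed

end

section \<open>Calculus of the Euler transform\<close>

context annulus
begin

definition conv :: "complex \<Rightarrow> (complex \<Rightarrow> complex) \<Rightarrow> complex \<Rightarrow> complex" where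
  "conv \<kappa> h X = integral {0..2 * pi} (\<lambda>u. h (X + \<i> * of_real u) * dz (X + \<i> * of_real u) * \<i> * kern \<kappa> X u)"

lemma continuous_on_translate:
  assumes "continuous_on strip h"
  shows "continuous_on (strip \<times> {0..2 * pi}) (\<lambda>x. h (fst x + \<i> * of_real (snd x)))"
  by (rule continuous_on_compose2[OF assms]) (auto intro!: continuous_intros strip(3))

lemma continuous_on_translate1:
  assumes "continuous_on strip h" "X \<in> strip"
  shows "continuous_on A (\<lambda>u. h (X + \<i> * of_real u))"
  by (rule continuous_on_compose2[OF assms(1)]) (auto intro!: continuous_intros strip(3) assms(2))

lemma continuous_on_kern_pair:
  assumes "0 < Re \<kappa>"
  shows "continuous_on (strip \<times> {0..2 * pi}) (\<lambda>x. kern \<kappa> (fst x) (snd x))"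
  by (rule continuous_on_compose2[OF continuous_on_kern[unfolded case_prod_beta'], of _ "\<lambda>x. (\<kappa>, x)", simplified])
    (use assms in \<open>auto intro!: continuous_intros\<close>)

lemma continuous_on_kern1:
  assumes "0 < Re \<kappa>" "X \<in> strip"
  shows "continuous_on {0..2 * pi} (kern \<kappa> X)"
  by (rule continuous_on_compose2[OF continuous_on_kern_pair[OF assms(1)], of _ "\<lambda>u. (X, u)", simplified])
    (use assms in \<open>auto intro!: continuous_intros\<close>)

lemma continuous_on_dz: "continuous_on strip dz"
  by (rule holomorphic_on_imp_continuous_on[OF dz_holomorphic])

lemma conv_integrable:
  assumes "continuous_on strip h" "X \<in> strip" "0 < Re \<kappa>"
  shows "(\<lambda>u. h (X + \<i> * of_real u) * dz (X + \<i> * of_real u) * \<i> * kern \<kappa> X u) integrable_on {0..2 * pi}"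
  by (intro integrable_continuous_real continuous_on_mult continuous_on_const continuous_on_kern1
      continuous_on_translate1 continuous_on_dz assms)

lemma conv_cong:
  assumes "\<And>X. X \<in> strip \<Longrightarrow> h X = g X" "X \<in> strip"
  shows "conv \<kappa> h X = conv \<kappa> g X"
  unfolding conv_def using assms strip(3) by (intro integral_cong) simp

lemma conv_sum:
  assumes "finite A" "\<And>i. i \<in> A \<Longrightarrow> continuous_on strip (h i)" "X \<in> strip" "0 < Re \<kappa>"
  shows "conv \<kappa> (\<lambda>X. \<Sum>i\<in>A. k i * h i X) X = (\<Sum>i\<in>A. k i * conv \<kappa> (h i) X)"
proof -
  have "conv \<kappa> (\<lambda>X. \<Sum>i\<in>A. k i * h i X) X = integral {0..2 * pi} (\<lambda>u. \<Sum>i\<in>A. k i * (h i (X + \<i> * of_real u) * dz (X + \<i> * of_real u) * \<i> * kern \<kappa> X u))"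
    unfolding conv_def by (intro integral_cong) (simp add: sum_distrib_right mult.assoc)
  also have "\<dots> = (\<Sum>i\<in>A. integral {0..2 * pi} (\<lambda>u. k i * (h i (X + \<i> * of_real u) * dz (X + \<i> * of_real u) * \<i> * kern \<kappa> X u)))"
    using assms by (intro integral_sum integrable_on_mult_right conv_integrable)
  also have "\<dots> = (\<Sum>i\<in>A. k i * conv \<kappa> (h i) X)"
    unfolding conv_def by simp
  finally show ?thesis .
qed

lemma conv_shift:
  "conv \<kappa> h (X + 2 * of_real pi * \<i>) = exp (2 * of_real pi * \<i> * \<kappa>) * conv \<kappa> (\<lambda>X. h (X + 2 * of_real pi * \<i>)) X"
proof -
  have e: "X + 2 * of_real pi * \<i> + \<i> * of_real u = (X + \<i> * of_real u) + 2 * of_real pi * \<i>" for u by simp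
  have "conv \<kappa> h (X + 2 * of_real pi * \<i>) = integral {0..2 * pi} (\<lambda>u. exp (2 * of_real pi * \<i> * \<kappa>) *
      (h ((X + \<i> * of_real u) + 2 * of_real pi * \<i>) * dz (X + \<i> * of_real u) * \<i> * kern \<kappa> X u))"
    unfolding conv_def e z_periodic kern_shift by (intro integral_cong) simp
  then show ?thesis by (simp add: conv_def)
qed

text \<open>z - p = (w - p) + (z - w), and the factor z - w raises the exponent of the kernel by
  one.\<close>

lemma conv_mult_z:
  assumes "continuous_on strip h" "X \<in> strip" "0 < Re \<kappa>"
  shows "(z X - p) * conv \<kappa> h X = conv \<kappa> (\<lambda>X. (z X - p) * h X) X + conv (\<kappa> + 1) h X"
proof -
  have zc: "continuous_on strip z"
    using DERIV_z strip(1) by (meson DERIV_isCont continuous_at_imp_continuous_on)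
  have "(z X - p) * conv \<kappa> h X = integral {0..2 * pi} (\<lambda>u. (z X - p) * (h (X + \<i> * of_real u) * dz (X + \<i> * of_real u) * \<i> * kern \<kappa> X u))"
    by (simp add: conv_def)
  also have "\<dots> = integral {0..2 * pi} (\<lambda>u.
      ((z (X + \<i> * of_real u) - p) * h (X + \<i> * of_real u)) * dz (X + \<i> * of_real u) * \<i> * kern \<kappa> X u
      + h (X + \<i> * of_real u) * dz (X + \<i> * of_real u) * \<i> * kern (\<kappa> + 1) X u)"
    unfolding kern_Suc[OF assms(2)] by (intro integral_cong) (simp add: algebra_simps)
  also have "\<dots> = conv \<kappa> (\<lambda>X. (z X - p) * h X) X + conv (\<kappa> + 1) h X"
    unfolding conv_def using assms
    by (intro integral_add conv_integrable[of "\<lambda>X. (z X - p) * h X"] conv_integrable[of h] continuous_intros zc) auto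
  finally show ?thesis .
qed

text \<open>The integrand is the derivative of h times the kernel along one turn. \<open>h\<close>
  need not be periodic: the boundary terms disappear because the kernel vanishes at both
  ends.\<close>

lemma boundary_integral:
  assumes h: "h holomorphic_on strip" and X: "X \<in> strip" and \<kappa>: "1 < Re \<kappa>"
  shows "((\<lambda>u. \<i> * deriv h (X + \<i> * of_real u) * kern \<kappa> X u
      - \<i> * \<kappa> * (h (X + \<i> * of_real u) * kern (\<kappa> - 1) X u * dz (X + \<i> * of_real u))) has_integral 0) {0..2 * pi}"
proof -
  have "((\<lambda>u. \<i> * deriv h (X + \<i> * of_real u) * kern \<kappa> X u
      - \<i> * \<kappa> * (h (X + \<i> * of_real u) * kern (\<kappa> - 1) X u * dz (X + \<i> * of_real u)))
    has_integral (h (X + \<i> * of_real (2 * pi)) * kern \<kappa> X (2 * pi) - h (X + \<i> * of_real 0) * kern \<kappa> X 0)) {0..2 * pi}"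
  proof (rule fundamental_theorem_of_calculus_interior)
    show "continuous_on {0..2 * pi} (\<lambda>u. h (X + \<i> * of_real u) * kern \<kappa> X u)"
      using \<kappa> by (intro continuous_on_mult continuous_on_translate1 continuous_on_kern1
          holomorphic_on_imp_continuous_on[OF h] X) auto
    fix u assume "u \<in> {0<..<2 * pi}"
    then have u: "0 < u" "u < 2 * pi" by auto
    have "((\<lambda>w. h (X + \<i> * w)) has_field_derivative deriv h (X + \<i> * of_real u) * \<i>) (at (of_real u))"
      using holomorphic_derivI[OF h strip(1) strip(3)[OF X, of u]]
      by (auto intro!: derivative_eq_intros DERIV_chain2[of h _ "\<lambda>w. X + \<i> * w"])
    then have "((\<lambda>u. h (X + \<i> * of_real u)) has_vector_derivative deriv h (X + \<i> * of_real u) * \<i>) (at u)"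
      by (rule has_vector_derivative_real_field)
    from has_vector_derivative_mult[OF this has_vector_derivative_kern[OF X u, of \<kappa>]]
    show "((\<lambda>u. h (X + \<i> * of_real u) * kern \<kappa> X u) has_vector_derivative
        \<i> * deriv h (X + \<i> * of_real u) * kern \<kappa> X u
      - \<i> * \<kappa> * (h (X + \<i> * of_real u) * kern (\<kappa> - 1) X u * dz (X + \<i> * of_real u))) (at u)"
      by (simp add: algebra_simps)
  qed simp
  then show ?thesis by simp
qed

lemma conv_derivative:
  assumes h: "\<And>X. X \<in> strip \<Longrightarrow> (h has_field_derivative dz X * g X) (at X)"
    and X: "X \<in> strip" and \<kappa>: "1 < Re \<kappa>"
  shows "conv \<kappa> g X = \<kappa> * conv (\<kappa> - 1) h X"
proof -
  have hol: "h holomorphic_on strip"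
    using h by (auto simp: holomorphic_on_def field_differentiable_def intro: has_field_derivative_at_within)
  have d: "deriv h Y = dz Y * g Y" if "Y \<in> strip" for Y using DERIV_imp_deriv[OF h[OF that]] .
  have ch: "continuous_on strip h" by (rule holomorphic_on_imp_continuous_on[OF hol])
  have "continuous_on strip (\<lambda>Y. deriv h Y / dz Y)"
    by (intro continuous_on_divide holomorphic_on_imp_continuous_on[OF holomorphic_deriv[OF hol strip(1)]]
        continuous_on_dz) (use dz_nonzero in auto)
  then have cg: "continuous_on strip g"
    by (rule continuous_on_eq) (use d dz_nonzero in auto)
  have "0 = integral {0..2 * pi} (\<lambda>u. \<i> * deriv h (X + \<i> * of_real u) * kern \<kappa> X u
      - \<i> * \<kappa> * (h (X + \<i> * of_real u) * kern (\<kappa> - 1) X u * dz (X + \<i> * of_real u)))"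
    using integral_unique[OF boundary_integral[OF hol X \<kappa>]] by simp
  also have "\<dots> = integral {0..2 * pi} (\<lambda>u. g (X + \<i> * of_real u) * dz (X + \<i> * of_real u) * \<i> * kern \<kappa> X u
      - \<kappa> * (h (X + \<i> * of_real u) * dz (X + \<i> * of_real u) * \<i> * kern (\<kappa> - 1) X u))"
    using d[OF strip(3)[OF X]] by (intro integral_cong) (simp add: mult_ac)
  also have "\<dots> = conv \<kappa> g X - \<kappa> * conv (\<kappa> - 1) h X"
    unfolding conv_def using \<kappa> cg ch X
    by (subst integral_diff) (auto intro!: conv_integrable integrable_on_mult_right)
  finally show ?thesis by simp
qed

text \<open>Differentiation under the integral produces the factor dz X - dz (X + \<i> u), as the
  path of integration moves along. The part with dz (X + \<i> u) combines with the derivative of the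
  translated integrand to a total derivative in \<open>u\<close> and integrates to 0; the rest is
  what a fixed path would give. For 1 < Re \<kappa> the kernel with exponent \<kappa> - 1 is still
  continuous up to the ends.\<close>

lemma DERIV_conv:
  assumes h: "h holomorphic_on strip" and X: "X \<in> strip" and \<kappa>: "1 < Re \<kappa>"
  shows "(conv \<kappa> h has_field_derivative \<kappa> * dz X * conv (\<kappa> - 1) h X) (at X)"
proof -
  define H where "H = (\<lambda>X. h X * dz X)"
  have H: "H holomorphic_on strip" unfolding H_def by (intro holomorphic_intros h dz_holomorphic)
  have cH: "continuous_on strip H" "continuous_on strip (deriv H)"
    by (intro holomorphic_on_imp_continuous_on H holomorphic_deriv strip(1))+
  define F where "F = (\<lambda>X u. deriv H (X + \<i> * of_real u) * \<i> * kern \<kappa> X u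
     + H (X + \<i> * of_real u) * \<i> * (\<kappa> * kern (\<kappa> - 1) X u * (dz X - dz (X + \<i> * of_real u))))"
  have "((\<lambda>X. integral (cbox 0 (2 * pi)) (\<lambda>u. H (X + \<i> * of_real u) * \<i> * kern \<kappa> X u)) has_field_derivative
      integral (cbox 0 (2 * pi)) (F X)) (at X within strip)"
  proof (rule leibniz_rule_field_derivative)
    fix Y and u :: real assume Y: "Y \<in> strip" and u: "u \<in> cbox 0 (2 * pi)"
    have "((\<lambda>Y. H (Y + \<i> * of_real u)) has_field_derivative deriv H (Y + \<i> * of_real u)) (at Y)"
      using DERIV_shift[of H "deriv H (Y + \<i> * of_real u)" Y "\<i> * of_real u"]
        holomorphic_derivI[OF H strip(1) strip(3)[OF Y, of u], of UNIV] by simp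
    then have 1: "((\<lambda>Y. H (Y + \<i> * of_real u) * \<i>) has_field_derivative deriv H (Y + \<i> * of_real u) * \<i>) (at Y)"
      by (rule DERIV_cmult_right)
    have 2: "((\<lambda>X. kern \<kappa> X u) has_field_derivative \<kappa> * kern (\<kappa> - 1) Y u * (dz Y - dz (Y + \<i> * of_real u))) (at Y)"
      using u by (intro DERIV_kern Y) auto
    have "((\<lambda>X. H (X + \<i> * of_real u) * \<i> * kern \<kappa> X u) has_field_derivative F Y u) (at Y)"
      using DERIV_mult[OF 1 2] by (simp add: F_def mult_ac add.commute)
    then show "((\<lambda>X. H (X + \<i> * of_real u) * \<i> * kern \<kappa> X u) has_field_derivative F Y u) (at Y within strip)"
      by (rule has_field_derivative_at_within)
  next
    fix Y assume Y: "Y \<in> strip"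
    have "(\<lambda>u. h (Y + \<i> * of_real u) * dz (Y + \<i> * of_real u) * \<i> * kern \<kappa> Y u) integrable_on {0..2 * pi}"
      using \<kappa> by (intro conv_integrable Y holomorphic_on_imp_continuous_on h) auto
    then show "(\<lambda>u. H (Y + \<i> * of_real u) * \<i> * kern \<kappa> Y u) integrable_on cbox 0 (2 * pi)"
      by (simp add: H_def)
  next
    have dX: "continuous_on (strip \<times> {0..2 * pi}) (\<lambda>x. dz (fst x))"
      by (rule continuous_on_compose2[OF continuous_on_dz]) (auto intro: continuous_intros)
    have "continuous_on (strip \<times> {0..2 * pi}) (\<lambda>x. F (fst x) (snd x))"
      unfolding F_def using \<kappa>
      by (intro continuous_intros continuous_on_translate[OF cH(1)] continuous_on_translate[OF cH(2)]
          continuous_on_translate[OF continuous_on_dz] continuous_on_kern_pair dX) auto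
    then show "continuous_on (strip \<times> cbox 0 (2 * pi)) (\<lambda>(x, t). F x t)" by (simp add: case_prod_beta')
  qed (use X strip(2) in auto)
  then have D: "(conv \<kappa> h has_field_derivative integral {0..2 * pi} (F X)) (at X)"
    unfolding at_within_open[OF X strip(1)] cbox_interval conv_def[abs_def] H_def .
  have "integral {0..2 * pi} (F X) = integral {0..2 * pi} (\<lambda>u.
      (\<i> * deriv H (X + \<i> * of_real u) * kern \<kappa> X u
       - \<i> * \<kappa> * (H (X + \<i> * of_real u) * kern (\<kappa> - 1) X u * dz (X + \<i> * of_real u)))
      + \<kappa> * dz X * (h (X + \<i> * of_real u) * dz (X + \<i> * of_real u) * \<i> * kern (\<kappa> - 1) X u))"
    unfolding F_def by (intro integral_cong) (simp add: H_def algebra_simps)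
  also have "\<dots> = 0 + \<kappa> * dz X * conv (\<kappa> - 1) h X"
    unfolding conv_def integral_unique[OF boundary_integral[OF H X \<kappa>], symmetric]
    using \<kappa> by (subst integral_add)
      (auto intro!: integrable_on_mult_right conv_integrable X holomorphic_on_imp_continuous_on h
        has_integral_integrable[OF boundary_integral[OF H X \<kappa>]])
  finally show ?thesis using D by simp
qed

text \<open>For \<open>\<kappa> = 2\<close> the kernel is a polynomial and the convolution is an iterated primitive.\<close>

lemma periodic_if_conv_2_constant:
  assumes h: "h holomorphic_on strip" and const: "\<And>X. X \<in> strip \<Longrightarrow> (conv 2 h has_field_derivative 0) (at X)"
    and X: "X \<in> strip"
  shows "h (X + 2 * of_real pi * \<i>) = h X"
proof -
  let ?p = "2 * of_real pi * \<i> :: complex"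
  have conv1: "conv 1 h X = 0" if X: "X \<in> strip" for X
    using DERIV_unique[OF DERIV_conv[OF h X, of 2] const[OF X]] dz_nonzero[OF X] by simp
  have zh: "z holomorphic_on strip"
    using DERIV_z by (auto simp: holomorphic_on_def field_differentiable_def intro: has_field_derivative_at_within)
  have prim: "\<exists>G. \<forall>X\<in>strip. (G has_field_derivative g X) (at X)" if g: "g holomorphic_on strip" for g
  proof -
    obtain G where G: "\<And>X. X \<in> strip \<Longrightarrow> (G has_field_derivative g X) (at X within strip)"
      using holomorphic_convex_primitive'[OF strip(2,1) g] by blast
    have "(G has_field_derivative g X) (at X)" if "X \<in> strip" for X
      using G[OF that] unfolding at_within_open[OF that strip(1)] .
    then show ?thesis by blast
  qed
  obtain H where H: "\<And>X. X \<in> strip \<Longrightarrow> (H has_field_derivative h X * dz X) (at X)"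
    using prim[OF holomorphic_on_mult[OF h dz_holomorphic]] by blast
  obtain K where K: "\<And>X. X \<in> strip \<Longrightarrow> (K has_field_derivative h X * dz X * z X) (at X)"
    using prim[OF holomorphic_on_mult[OF holomorphic_on_mult[OF h dz_holomorphic] zh]] by blast
  have ftc: "((\<lambda>u. g (X + \<i> * of_real u) * \<i>) has_integral G (X + ?p) - G X) {0..2 * pi}"
    if X: "X \<in> strip" and G: "\<And>X. X \<in> strip \<Longrightarrow> (G has_field_derivative g X) (at X)" for X g G
  proof -
    have "((\<lambda>u. g (X + \<i> * of_real u) * \<i>) has_integral G (X + \<i> * of_real (2 * pi)) - G (X + \<i> * of_real 0)) {0..2 * pi}"
    proof (rule fundamental_theorem_of_calculus)
      fix u :: real assume "u \<in> {0..2 * pi}"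
      have "((\<lambda>w. G (X + \<i> * w)) has_field_derivative g (X + \<i> * of_real u) * \<i>) (at (of_real u))"
        using G[OF strip(3)[OF X, of u]]
        by (auto intro!: derivative_eq_intros DERIV_chain2[of G _ "\<lambda>w. X + \<i> * w"])
      then have "((\<lambda>u. G (X + \<i> * of_real u)) has_vector_derivative g (X + \<i> * of_real u) * \<i>) (at u)"
        by (rule has_vector_derivative_real_field)
      then show "((\<lambda>u. G (X + \<i> * of_real u)) has_vector_derivative g (X + \<i> * of_real u) * \<i>) (at u within {0..2 * pi})"
        by (rule has_vector_derivative_at_within)
    qed simp
    then show ?thesis by (simp add: mult_ac)
  qed
  have c1: "conv 1 h X = z X * (H (X + ?p) - H X) - (K (X + ?p) - K X)" if X: "X \<in> strip" for X
  proof -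
    have "((\<lambda>u. z X * (h (X + \<i> * of_real u) * dz (X + \<i> * of_real u) * \<i>)
          - h (X + \<i> * of_real u) * dz (X + \<i> * of_real u) * z (X + \<i> * of_real u) * \<i>)
        has_integral z X * (H (X + ?p) - H X) - (K (X + ?p) - K X)) {0..2 * pi}"
      by (intro has_integral_diff has_integral_mult_right ftc X H K)
    then have I: "integral {0..2 * pi} (\<lambda>u. z X * (h (X + \<i> * of_real u) * dz (X + \<i> * of_real u) * \<i>)
          - h (X + \<i> * of_real u) * dz (X + \<i> * of_real u) * z (X + \<i> * of_real u) * \<i>)
        = z X * (H (X + ?p) - H X) - (K (X + ?p) - K X)" by (rule integral_unique)
    have k: "kern 1 X u = z X - z (X + \<i> * of_real u)" for u
    proof -
      have "rot u powr 1 = rot u" by (simp add: powr_def)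
      then show ?thesis using exp_kexp[OF X, of u] by (simp add: kern_def)
    qed
    show ?thesis
      unfolding conv_def k I[symmetric] by (intro integral_cong) (simp add: algebra_simps)
  qed
  have shift: "((\<lambda>X. G (X + ?p)) has_field_derivative g (X + ?p)) (at X)"
    if X: "X \<in> strip" and G: "\<And>X. X \<in> strip \<Longrightarrow> (G has_field_derivative g X) (at X)" for X g G
    using DERIV_shift[of G "g (X + ?p)" X ?p] G[OF strip(4)[OF X]] by simp
  have dH: "H (X + ?p) - H X = 0" if X: "X \<in> strip" for X
  proof -
    \<comment> \<open>Since z and dz are periodic, the increment of K over a period has z times the
      derivative of the increment of H as its derivative. Only dz times the increment of H survives,
      and one more differentiation passes from H to h.\<close>
    have D1: "((\<lambda>X. z X * (H (X + ?p) - H X) - (K (X + ?p) - K X)) has_field_derivative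
        (dz X * (H (X + ?p) - H X) + (h (X + ?p) * dz (X + ?p) - h X * dz X) * z X)
          - (h (X + ?p) * dz (X + ?p) * z (X + ?p) - h X * dz X * z X)) (at X)"
      by (intro DERIV_diff DERIV_mult DERIV_z shift X H K)
    have D2: "((\<lambda>X. z X * (H (X + ?p) - H X) - (K (X + ?p) - K X)) has_field_derivative 0) (at X)"
      by (rule has_field_derivative_transform_within_open[of "\<lambda>_. 0" 0 X strip]) (use strip(1) X c1 conv1 in auto)
    have "dz X * (H (X + ?p) - H X) = 0"
      using DERIV_unique[OF D1 D2] unfolding z_periodic by (simp add: algebra_simps)
    then show ?thesis using dz_nonzero[OF X] by simp
  qed
  have "((\<lambda>X. H (X + ?p) - H X) has_field_derivative h (X + ?p) * dz (X + ?p) - h X * dz X) (at X)"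
    by (intro DERIV_diff shift X H)
  moreover have "((\<lambda>X. H (X + ?p) - H X) has_field_derivative 0) (at X)"
    by (rule has_field_derivative_transform_within_open[of "\<lambda>_. 0" 0 X strip]) (use strip(1) X dH in auto)
  ultimately have "h (X + ?p) * dz (X + ?p) - h X * dz X = 0" using DERIV_unique by blast
  then show ?thesis using dz_nonzero[OF X] unfolding z_periodic by simp
qed

end

section \<open>Middle convolution on an annulus\<close>

text \<open>A^2 C = C B^2; Cayley-Hamilton on both sides and equality of the determinants leave (tr
  A - tr B) C B = 0. As B is invertible, C B is nonzero with C, so C itself may well be
  singular.\<close>

lemma trace_intertwined:
  fixes A B C :: "complex^2^2"
  assumes AC: "A ** C = C ** B" and "C \<noteq> 0" and det: "det A = det B" "det B \<noteq> 0"
  shows "trace A = trace B"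
proof -
  have ch: "(A ** (A ** C)) $ i $ j = trace A * (A ** C) $ i $ j - det A * C $ i $ j"
    "((C ** B) ** B) $ i $ j = trace B * (C ** B) $ i $ j - det B * C $ i $ j" for A B C :: "complex^2^2" and i j
    using exhaust_2[of i] exhaust_2[of j]
    by (auto simp: trace_def det_2 sum_2 matrix_matrix_mult_def algebra_simps)
  have "A ** (A ** C) = (C ** B) ** B" unfolding AC by (simp only: matrix_mul_assoc AC)
  then have "trace A * (C ** B) $ i $ j = trace B * (C ** B) $ i $ j" for i j
    using ch(1)[of A C i j] ch(2)[of C B i j] det(1) unfolding AC by auto
  moreover have "C ** B \<noteq> 0"
  proof
    assume "C ** B = 0"
    then have "C ** (B ** matrix_inv B) = 0" by (simp add: matrix_mul_assoc)
    then show False using matrix_inv_nonsingular[OF det(2)] \<open>C \<noteq> 0\<close> by (simp add: matrix_mul_rid)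
  qed
  then obtain i j where "(C ** B) $ i $ j \<noteq> 0" by (metis vec_eq_iff zero_index)
  ultimately show ?thesis by (metis mult_cancel_right)
qed

text \<open>The hypothesis says that G - 1 has square 0; a nilpotent matrix of size two has trace
  and determinant 0.\<close>

lemma det_eq_one_if_unipotent:
  fixes G :: "complex^2^2"
  assumes "G ** (G - mat 1) = G - mat 1"
  shows "det G = 1"
proof -
  have e: "(G ** (G - mat 1)) $ i $ j = (G - mat 1) $ i $ j" for i j using assms by simp
  let ?a = "G $ 1 $ 1 - 1" and ?b = "G $ 1 $ 2" and ?c = "G $ 2 $ 1" and ?d = "G $ 2 $ 2 - 1"
  have "?a * ?a + ?b * ?c = 0" "?a * ?b + ?b * ?d = 0" "?c * ?a + ?d * ?c = 0" "?c * ?b + ?d * ?d = 0"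
    using e[of 1 1] e[of 1 2] e[of 2 1] e[of 2 2]
    by (simp_all add: matrix_matrix_mult_def sum_2 mat_def algebra_simps)
  then have "(?a + ?d) ^ 3 = 0" "?a * ?d - ?b * ?c = 0 \<or> ?a + ?d \<noteq> 0"
    by algebra+
  then have "?a + ?d = 0" "?a * ?d - ?b * ?c = 0" by auto
  then show ?thesis unfolding det_2 by algebra
qed

locale annulus_system = annulus +
  fixes S :: "complex set" and X0 :: complex
  assumes S: "finite S" "S \<noteq> {}" and avoid: "X \<in> strip \<Longrightarrow> z X \<notin> S" and X0: "X0 \<in> strip"
begin

text \<open>The strip is the universal cover of the annulus and is convex: transport along segments
  gives a single-valued solution there, and the monodromy around the annulus is its value one period
  above \<open>X0\<close>.\<close>

definition sol :: "(complex \<Rightarrow> complex^'n^'n) \<Rightarrow> complex \<Rightarrow> complex^'n^'n" where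
  "sol R X = transport S R (z \<circ> linepath X0 X)"

lemma continuous_on_z: "continuous_on strip z"
  using DERIV_z strip(1) by (meson DERIV_isCont continuous_at_imp_continuous_on)

lemma segment_in_strip: "X \<in> strip \<Longrightarrow> X' \<in> strip \<Longrightarrow> closed_segment X X' \<subseteq> strip"
  using strip(2) by (simp add: closed_segment_subset)

lemma z_path:
  assumes "X \<in> strip" "X' \<in> strip"
  shows "path (z \<circ> linepath X X')" "path_image (z \<circ> linepath X X') \<inter> S = {}"
proof -
  show "path (z \<circ> linepath X X')"
    using continuous_on_subset[OF continuous_on_z segment_in_strip[OF assms]]
    by (intro path_continuous_image) auto
  show "path_image (z \<circ> linepath X X') \<inter> S = {}"
    using segment_in_strip[OF assms] avoid by (auto simp: path_image_compose)
qed

lemma transport_triangle: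
  assumes "X \<in> strip" "X' \<in> strip" "X'' \<in> strip"
  shows "transport S R (z \<circ> linepath X X'') = transport S R (z \<circ> linepath X' X'') ** transport S R (z \<circ> linepath X X')"
proof -
  have "homotopic_paths strip (linepath X X'') (linepath X X' +++ linepath X' X'')"
    using segment_in_strip assms by (intro homotopic_paths_convex strip(2)) (auto simp: path_image_join)
  then have "homotopic_paths (- S) (z \<circ> linepath X X'') (z \<circ> (linepath X X' +++ linepath X' X''))"
    by (rule homotopic_paths_continuous_image) (use continuous_on_z avoid in auto)
  then have "transport S R (z \<circ> linepath X X'') = transport S R ((z \<circ> linepath X X') +++ (z \<circ> linepath X' X''))"
    unfolding path_compose_join by (rule transport_homotopic[OF S])
  also have "\<dots> = transport S R (z \<circ> linepath X' X'') ** transport S R (z \<circ> linepath X X')"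
    by (rule transport_join[OF S]) (use z_path assms in \<open>auto simp: pathfinish_compose pathstart_compose\<close>)
  finally show ?thesis .
qed

lemma sol_base [simp]: "sol R X0 = mat 1"
proof -
  have "z \<circ> linepath X0 X0 = (\<lambda>_. z X0)" by (auto simp: linepath_refl)
  moreover have "transport S R (\<lambda>_. z X0) = fund S R (z X0) (z X0)"
    using infdist_pos_notin[OF S avoid[OF X0]] transport_in_ball[OF S, of "\<lambda>_. z X0" R]
    by (simp add: path_image_def path_def)
  ultimately show ?thesis by (simp add: sol_def)
qed

lemma sol_local:
  assumes X: "X \<in> strip"
  shows "\<exists>d>0. ball X d \<subseteq> strip \<and> (\<forall>X'\<in>ball X d. dist (z X) (z X') < infdist (z X) S \<and>
    (\<forall>R :: complex \<Rightarrow> complex^'n^'n. sol R X' = fund S R (z X) (z X') ** sol R X))"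
proof -
  have "open (strip \<inter> z -` ball (z X) (infdist (z X) S))"
    by (intro continuous_open_preimage continuous_on_z strip(1) open_ball)
  moreover have "X \<in> strip \<inter> z -` ball (z X) (infdist (z X) S)"
    using X infdist_pos_notin[OF S avoid[OF X]] by auto
  ultimately obtain d where d: "0 < d" "ball X d \<subseteq> strip \<inter> z -` ball (z X) (infdist (z X) S)"
    by (meson open_contains_ball)
  show ?thesis
  proof (intro exI[of _ d] conjI ballI allI d(1))
    show sub: "ball X d \<subseteq> strip" using d by blast
    fix X' assume X': "X' \<in> ball X d"
    then show "dist (z X) (z X') < infdist (z X) S" using d by auto
    fix R :: "complex \<Rightarrow> complex^'n^'n"
    have "closed_segment X X' \<subseteq> ball X d" using X' d(1) by (simp add: closed_segment_subset)
    then have "path_image (z \<circ> linepath X X') \<subseteq> ball (z X) (infdist (z X) S)"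
      using d by (auto simp: path_image_compose)
    then have "transport S R (z \<circ> linepath X X') = fund S R (z X) (z X')"
      using transport_in_ball[OF S, of "z \<circ> linepath X X'" R] z_path X sub X' by (auto simp: linepath_def)
    then show "sol R X' = fund S R (z X) (z X') ** sol R X"
      unfolding sol_def using transport_triangle[OF X0 X, of X' R] sub X' by auto
  qed
qed

lemma DERIV_sol:
  fixes R :: "complex \<Rightarrow> complex^'n^'n"
  assumes X: "X \<in> strip"
  shows "((\<lambda>X. sol R X $ i $ j) has_field_derivative dz X * (fuchs S R (z X) ** sol R X) $ i $ j) (at X)"
proof -
  obtain d where d: "0 < d" "ball X d \<subseteq> strip" "\<And>X'. X' \<in> ball X d \<Longrightarrow> dist (z X) (z X') < infdist (z X) S"
    "\<And>X' (R :: complex \<Rightarrow> complex^'n^'n). X' \<in> ball X d \<Longrightarrow> sol R X' = fund S R (z X) (z X') ** sol R X"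
    using sol_local[OF X] by blast
  have "fuchs_sol S R (ball (z X) (infdist (z X) S)) (\<lambda>w. fund S R (z X) w ** sol R X)"
    by (intro fuchs_sol_mult_const fuchs_sol_fund[OF S(1) ball_infdist_finite])
  moreover have "z X \<in> ball (z X) (infdist (z X) S)" using infdist_pos_notin[OF S avoid[OF X]] by simp
  ultimately have "((\<lambda>w. (fund S R (z X) w ** sol R X) $ i $ j) has_field_derivative
      (fuchs S R (z X) ** (fund S R (z X) (z X) ** sol R X)) $ i $ j) (at (z X))"
    unfolding fuchs_sol_def by blast
  from DERIV_chain2[OF this DERIV_z[OF X]]
  have "((\<lambda>X'. (fund S R (z X) (z X') ** sol R X) $ i $ j) has_field_derivative
      dz X * (fuchs S R (z X) ** sol R X) $ i $ j) (at X)" by (simp add: mult.commute)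
  then show ?thesis
    by (rule has_field_derivative_transform_within_open[of _ _ _ "ball X d"]) (simp_all add: d(1) flip: d(4))
qed

lemma holomorphic_sol: "(\<lambda>X. sol R X $ i $ j) holomorphic_on strip"
  unfolding holomorphic_on_def field_differentiable_def using DERIV_sol has_field_derivative_at_within by blast

lemma continuous_on_sol:
  fixes R :: "complex \<Rightarrow> complex \<Rightarrow> complex^'n^'n"
  assumes R: "holo_res S R"
  shows "continuous_on (UNIV \<times> strip) (\<lambda>x. sol (R (fst x)) (snd x) $ i $ j)"
proof (rule continuous_at_imp_continuous_on, rule ballI)
  fix x :: "complex \<times> complex" assume x: "x \<in> UNIV \<times> strip"
  define X where "X = snd x"
  then have X: "X \<in> strip" using x by auto
  obtain d where d: "0 < d" "ball X d \<subseteq> strip" "\<And>X'. X' \<in> ball X d \<Longrightarrow> dist (z X) (z X') < infdist (z X) S"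
    "\<And>X' (R :: complex \<Rightarrow> complex^'n^'n). X' \<in> ball X d \<Longrightarrow> sol R X' = fund S R (z X) (z X') ** sol R X"
    using sol_local[OF X] by blast
  have zc: "continuous_on (UNIV \<times> ball X d) (\<lambda>x::complex \<times> complex. z (snd x))"
  proof (rule continuous_on_compose2[OF continuous_on_z continuous_on_snd[OF continuous_on_id]])
    show "snd ` (UNIV \<times> ball X d) \<subseteq> strip" using d(2) by fastforce
  qed
  have "continuous_on (UNIV \<times> ball X d) (\<lambda>x::complex \<times> complex. (fst x, z (snd x)))"
    by (intro continuous_intros zc)
  from continuous_on_compose2[OF continuous_on_fund[OF S(1) R, of "z X"] this]
  have 1: "continuous_on (UNIV \<times> ball X d) (\<lambda>x. fund S (R (fst x)) (z X) (z (snd x)) $ i $ k)" for i k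
    using d(3) by (simp add: image_subset_iff)
  have "continuous_on UNIV (\<lambda>\<tau>. sol (R \<tau>) X $ k $ j)" for k
    unfolding sol_def
    by (intro holomorphic_on_imp_continuous_on holomorphic_transport S R z_path X X0)
  then have 2: "continuous_on (UNIV \<times> ball X d) (\<lambda>x. sol (R (fst x)) X $ k $ j)" for k
    by (rule continuous_on_compose2) (auto intro: continuous_intros)
  have "continuous_on (UNIV \<times> ball X d) (\<lambda>x. \<Sum>k\<in>UNIV. fund S (R (fst x)) (z X) (z (snd x)) $ i $ k * sol (R (fst x)) X $ k $ j)"
    by (intro continuous_on_sum continuous_on_mult 1 2)
  then have "continuous_on (UNIV \<times> ball X d) (\<lambda>x. sol (R (fst x)) (snd x) $ i $ j)"
  proof (rule continuous_on_eq)
    fix x :: "complex \<times> complex" assume "x \<in> UNIV \<times> ball X d"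
    then have "sol (R (fst x)) (snd x) = fund S (R (fst x)) (z X) (z (snd x)) ** sol (R (fst x)) X"
      by (intro d(4)) auto
    then show "(\<Sum>k\<in>UNIV. fund S (R (fst x)) (z X) (z (snd x)) $ i $ k * sol (R (fst x)) X $ k $ j) = sol (R (fst x)) (snd x) $ i $ j"
      by (simp only: matrix_matrix_mult_def vec_lambda_beta)
  qed
  moreover have "x \<in> UNIV \<times> ball X d" using d(1) by (cases x) (simp add: X_def)
  ultimately show "isCont (\<lambda>x. sol (R (fst x)) (snd x) $ i $ j) x"
    using continuous_on_eq_continuous_at[OF open_Times[OF open_UNIV open_ball]] by blast
qed

abbreviation "per \<equiv> 2 * of_real pi * \<i> :: complex"

text \<open>The segment from X0 + per to X + per has the same image under z as the one from X0 to X,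
  so the monodromy enters as a constant factor on the right.\<close>

lemma sol_period:
  assumes X: "X \<in> strip"
  shows "sol R (X + per) = sol R X ** sol R (X0 + per)"
proof -
  have "z \<circ> linepath (X0 + per) (X + per) = z \<circ> linepath X0 X"
  proof
    fix s
    have "linepath (X0 + per) (X + per) s = linepath X0 X s + per"
      by (simp add: linepath_def scaleR_conv_of_real algebra_simps)
    then show "(z \<circ> linepath (X0 + per) (X + per)) s = (z \<circ> linepath X0 X) s"
      by (simp add: z_periodic)
  qed
  then show ?thesis
    unfolding sol_def using transport_triangle[OF X0 strip(4)[OF X0] strip(4)[OF X], of R] by simp
qed

lemma sol_circle:
  assumes "exp X0 = of_real r"
  shows "sol R (X0 + per) = transport S R (\<phi> \<circ> circlepath 0 r)"
proof -
  have "linepath X0 (X0 + per) s = X0 + 2 * of_real pi * \<i> * of_real s" for s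
    by (simp add: linepath_def scaleR_conv_of_real algebra_simps)
  then have "z \<circ> linepath X0 (X0 + per) = \<phi> \<circ> circlepath 0 r"
    using assms by (auto simp: z_def circlepath exp_add fun_eq_iff)
  then show ?thesis by (simp add: sol_def)
qed

lemma sol_unique:
  fixes R W :: "complex \<Rightarrow> complex^'n^'n"
  assumes W: "\<And>X i j. X \<in> strip \<Longrightarrow> ((\<lambda>X. W X $ i $ j) has_field_derivative dz X * (fuchs S R (z X) ** W X) $ i $ j) (at X)"
    and X: "X \<in> strip"
  shows "W X = sol R X ** W X0"
proof -
  define Q where "Q = (\<lambda>p. - transpose (R p))"
  define A where "A = (\<lambda>X. \<chi> i j. dz X * fuchs S R (z X) $ i $ j)"
  have A: "dz X * (fuchs S R (z X) ** W) $ i $ j = (A X ** W) $ i $ j" for X i j and W :: "complex^'n^'n"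
    by (simp add: A_def matrix_matrix_mult_def sum_distrib_left mult.assoc)
  show ?thesis
  proof (rule linear_ode_unique[OF strip(2) X0 X, where P = "\<lambda>X. transpose (sol Q X)" and A = A and Y = "sol R" and X = W])
    fix X i j assume X: "X \<in> strip"
    have "dz X * (fuchs S Q (z X) ** sol Q X) $ j $ i = - (transpose (sol Q X) ** A X) $ i $ j"
      by (simp add: matrix_matrix_mult_def A_def fuchs_def Q_def transpose_def sum_negf mult_ac sum_distrib_left sum_distrib_right)
    then show "((\<lambda>X. transpose (sol Q X) $ i $ j) has_field_derivative - (transpose (sol Q X) ** A X) $ i $ j) (at X)"
      using DERIV_sol[OF X, of Q j i] by (simp add: transpose_def)
    show "((\<lambda>X. sol R X $ i $ j) has_field_derivative (A X ** sol R X) $ i $ j) (at X)"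
      using DERIV_sol[OF X, of R i j] by (simp add: A)
    show "((\<lambda>X. W X $ i $ j) has_field_derivative (A X ** W X) $ i $ j) (at X)"
      using W[OF X, of i j] by (simp add: A)
  qed (simp_all add: transpose_mat)
qed

end

section \<open>Residues of rank one and the transformed system\<close>

definition rank1 :: "(complex \<Rightarrow> complex^2) \<Rightarrow> (complex \<Rightarrow> complex^2) \<Rightarrow> complex \<Rightarrow> complex^2^2" where
  "rank1 b c p = (\<chi> i j. b p $ i * c p $ j)"

context annulus_system
begin

lemma fuchs_rank1:
  "(fuchs S (rank1 b c) w ** W) $ i $ k = (\<Sum>p\<in>S. b p $ i * ((\<Sum>j\<in>UNIV. c p $ j * W $ j $ k) / (w - p)))"
  by (simp add: fuchs_def rank1_def matrix_matrix_mult_def sum_2 sum.distrib sum_distrib_left sum_distrib_right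
      sum_divide_distrib add_divide_distrib distrib_left mult_ac)

text \<open>For residues of rank one, Y' is the sum of \<open>b p\<close> times the scalars f_p =
  c_p . Y / (z - p). These satisfy ((z - p) f_p)' = sum over q of (c_p . b_q) f_q, a system of Okubo
  type; the Euler transform acts on them, and \<open>middle\<close> reassembles a vector from the
  results.\<close>

definition ratio :: "(complex \<Rightarrow> complex^2) \<Rightarrow> (complex \<Rightarrow> complex^2) \<Rightarrow> complex \<Rightarrow> 2 \<Rightarrow> complex \<Rightarrow> complex" where
  "ratio b c p k X = (\<Sum>j\<in>UNIV. c p $ j * sol (rank1 b c) X $ j $ k) / (z X - p)"

definition middle :: "complex \<Rightarrow> (complex \<Rightarrow> complex^2) \<Rightarrow> (complex \<Rightarrow> complex^2) \<Rightarrow> (complex \<Rightarrow> complex^2) \<Rightarrow> complex \<Rightarrow> complex^2^2" where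
  "middle \<kappa> b c bt X = (\<chi> i k. \<Sum>p\<in>S. bt p $ i * conv \<kappa> (ratio b c p k) X)"

lemma holomorphic_ratio: "p \<in> S \<Longrightarrow> ratio b c p k holomorphic_on strip"
  unfolding ratio_def
  by (intro holomorphic_intros holomorphic_sol)
    (use avoid DERIV_z in \<open>auto simp: holomorphic_on_def field_differentiable_def intro: has_field_derivative_at_within\<close>)

lemma continuous_on_ratio: "p \<in> S \<Longrightarrow> continuous_on strip (ratio b c p k)"
  by (intro holomorphic_on_imp_continuous_on holomorphic_ratio)

lemma DERIV_numerator:
  assumes X: "X \<in> strip" and p: "p \<in> S"
  shows "((\<lambda>X. (z X - p) * ratio b c p k X) has_field_derivative
      dz X * (\<Sum>q\<in>S. (\<Sum>j\<in>UNIV. c p $ j * b q $ j) * ratio b c q k X)) (at X)"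
proof -
  let ?Y = "sol (rank1 b c)"
  have "((\<lambda>X. \<Sum>j\<in>UNIV. c p $ j * ?Y X $ j $ k) has_field_derivative
      (\<Sum>j\<in>UNIV. c p $ j * (dz X * (fuchs S (rank1 b c) (z X) ** ?Y X) $ j $ k))) (at X)"
    by (intro DERIV_sum DERIV_cmult DERIV_sol X)
  moreover have "(\<Sum>j\<in>UNIV. c p $ j * (dz X * (fuchs S (rank1 b c) (z X) ** ?Y X) $ j $ k)) =
      dz X * (\<Sum>q\<in>S. (\<Sum>j\<in>UNIV. c p $ j * b q $ j) * ratio b c q k X)"
    unfolding fuchs_rank1 ratio_def[symmetric]
    by (simp add: sum_2 sum.distrib sum_distrib_left distrib_left distrib_right mult_ac)
  ultimately have D: "((\<lambda>X. \<Sum>j\<in>UNIV. c p $ j * ?Y X $ j $ k) has_field_derivative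
      dz X * (\<Sum>q\<in>S. (\<Sum>j\<in>UNIV. c p $ j * b q $ j) * ratio b c q k X)) (at X)" by simp
  show ?thesis
    by (rule has_field_derivative_transform_within_open[OF D strip(1) X])
      (use avoid p in \<open>auto simp: ratio_def\<close>)
qed

text \<open>The derivative of the transform of f_p, multiplied by z - p, splits according to z - p =
  (w - p) + (z - w). Integration by parts turns the first part into the matrix c_p . b_q, and the
  second contributes \<kappa> on the diagonal. This is where the condition \<open>dot\<close> on the
  two sets of data comes from: it factors the sum through \<open>middle\<close>.\<close>

lemma DERIV_conv_ratio:
  assumes dot: "\<And>p q. \<lbrakk>p \<in> S; q \<in> S\<rbrakk> \<Longrightarrow>
      (\<Sum>j\<in>UNIV. ct p $ j * bt q $ j) = (\<Sum>j\<in>UNIV. c p $ j * b q $ j) + (if p = q then \<kappa> else 0)"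
    and \<kappa>: "1 < Re \<kappa>" and X: "X \<in> strip" and p: "p \<in> S"
  shows "(conv \<kappa> (ratio b c p k) has_field_derivative
      dz X * ((\<Sum>j\<in>UNIV. ct p $ j * middle \<kappa> b c bt X $ j $ k) / (z X - p))) (at X)"
proof -
  let ?f = "\<lambda>q. ratio b c q k"
  have "(\<Sum>q\<in>S. (\<Sum>j\<in>UNIV. c p $ j * b q $ j) * conv \<kappa> (?f q) X)
      = conv \<kappa> (\<lambda>X. \<Sum>q\<in>S. (\<Sum>j\<in>UNIV. c p $ j * b q $ j) * ?f q X) X"
    using \<kappa> by (intro conv_sum[symmetric] S X continuous_on_ratio) auto
  also have "\<dots> = \<kappa> * conv (\<kappa> - 1) (\<lambda>X. (z X - p) * ?f p X) X"
    by (rule conv_derivative[OF DERIV_numerator[OF _ p] X \<kappa>])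
  finally have 1: "\<kappa> * conv (\<kappa> - 1) (\<lambda>X. (z X - p) * ?f p X) X
      = (\<Sum>q\<in>S. (\<Sum>j\<in>UNIV. c p $ j * b q $ j) * conv \<kappa> (?f q) X)" ..
  have "(z X - p) * conv (\<kappa> - 1) (?f p) X = conv (\<kappa> - 1) (\<lambda>X. (z X - p) * ?f p X) X + conv (\<kappa> - 1 + 1) (?f p) X"
    using \<kappa> by (intro conv_mult_z continuous_on_ratio p X) auto
  then have "(z X - p) * (\<kappa> * conv (\<kappa> - 1) (?f p) X)
      = \<kappa> * conv (\<kappa> - 1) (\<lambda>X. (z X - p) * ?f p X) X + \<kappa> * conv \<kappa> (?f p) X"
    by (simp add: algebra_simps)
  also have "\<dots> = (\<Sum>q\<in>S. (\<Sum>j\<in>UNIV. c p $ j * b q $ j) * conv \<kappa> (?f q) X) + (\<Sum>q\<in>S. (if p = q then \<kappa> else 0) * conv \<kappa> (?f q) X)"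
    using S p unfolding 1 by (simp add: if_distrib[of "\<lambda>x. x * _"] cong: if_cong)
  also have "\<dots> = (\<Sum>q\<in>S. (\<Sum>j\<in>UNIV. ct p $ j * bt q $ j) * conv \<kappa> (?f q) X)"
    unfolding sum.distrib[symmetric] by (intro sum.cong refl) (simp add: dot p distrib_right)
  also have "\<dots> = (\<Sum>j\<in>UNIV. ct p $ j * middle \<kappa> b c bt X $ j $ k)"
    by (simp add: middle_def sum_2 sum_distrib_left sum.distrib distrib_left mult_ac)
  finally have "(\<Sum>j\<in>UNIV. ct p $ j * middle \<kappa> b c bt X $ j $ k) / (z X - p) = \<kappa> * conv (\<kappa> - 1) (?f p) X"
    using avoid[OF X] p by (subst divide_eq_eq) (auto simp: mult_ac)
  then show ?thesis
    using DERIV_conv[OF holomorphic_ratio[OF p] X \<kappa>, of b c k] by (simp add: mult_ac)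
qed

lemma DERIV_middle:
  assumes dot: "\<And>p q. \<lbrakk>p \<in> S; q \<in> S\<rbrakk> \<Longrightarrow>
      (\<Sum>j\<in>UNIV. ct p $ j * bt q $ j) = (\<Sum>j\<in>UNIV. c p $ j * b q $ j) + (if p = q then \<kappa> else 0)"
    and \<kappa>: "1 < Re \<kappa>" and X: "X \<in> strip"
  shows "((\<lambda>X. middle \<kappa> b c bt X $ i $ k) has_field_derivative
      dz X * (fuchs S (rank1 bt ct) (z X) ** middle \<kappa> b c bt X) $ i $ k) (at X)"
proof -
  have "((\<lambda>X. \<Sum>p\<in>S. bt p $ i * conv \<kappa> (ratio b c p k) X) has_field_derivative
      (\<Sum>p\<in>S. bt p $ i * (dz X * ((\<Sum>j\<in>UNIV. ct p $ j * middle \<kappa> b c bt X $ j $ k) / (z X - p))))) (at X)"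
    by (intro DERIV_sum DERIV_cmult DERIV_conv_ratio dot \<kappa> X)
  then show ?thesis
    unfolding fuchs_rank1 by (simp add: middle_def sum_distrib_left mult_ac)
qed

lemma middle_period:
  assumes \<kappa>: "0 < Re \<kappa>" and X: "X \<in> strip"
  shows "middle \<kappa> b c bt (X + per) $ i $ k = exp (per * \<kappa>) * (middle \<kappa> b c bt X ** sol (rank1 b c) (X0 + per)) $ i $ k"
proof -
  let ?G = "sol (rank1 b c) (X0 + per)"
  have u: "conv \<kappa> (ratio b c p k) (X + per) = exp (per * \<kappa>) * (\<Sum>l\<in>UNIV. ?G $ l $ k * conv \<kappa> (ratio b c p l) X)" if p: "p \<in> S" for p
  proof -
    have "ratio b c p k (X + per) = (\<Sum>l\<in>UNIV. ?G $ l $ k * ratio b c p l X)" if "X \<in> strip" for X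
      unfolding ratio_def sol_period[OF that] z_periodic
      by (simp add: matrix_matrix_mult_def sum_2 add_divide_distrib distrib_left mult_ac)
    then have "conv \<kappa> (\<lambda>X. ratio b c p k (X + per)) X = conv \<kappa> (\<lambda>X. \<Sum>l\<in>UNIV. ?G $ l $ k * ratio b c p l X) X"
      by (rule conv_cong[OF _ X])
    also have "\<dots> = (\<Sum>l\<in>UNIV. ?G $ l $ k * conv \<kappa> (ratio b c p l) X)"
      by (intro conv_sum continuous_on_ratio p X \<kappa>) simp
    finally show ?thesis unfolding conv_shift by simp
  qed
  have "middle \<kappa> b c bt (X + per) $ i $ k = (\<Sum>p\<in>S. bt p $ i * (exp (per * \<kappa>) * (\<Sum>l\<in>UNIV. ?G $ l $ k * conv \<kappa> (ratio b c p l) X)))"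
    by (simp add: middle_def u)
  also have "\<dots> = exp (per * \<kappa>) * (middle \<kappa> b c bt X ** ?G) $ i $ k"
    by (simp add: middle_def matrix_matrix_mult_def sum_2 sum.distrib sum_distrib_left sum_distrib_right distrib_left mult_ac)
  finally show ?thesis .
qed

text \<open>The value of \<open>middle\<close> one period above \<open>X0\<close> is computed twice:
  as a solution of the second system it acquires the monodromy of that system on the left, as an
  integral it acquires the scalar factor and the monodromy of the first system on the right.\<close>

lemma trace_middle:
  assumes dot: "\<And>p q. \<lbrakk>p \<in> S; q \<in> S\<rbrakk> \<Longrightarrow>
      (\<Sum>j\<in>UNIV. ct p $ j * bt q $ j) = (\<Sum>j\<in>UNIV. c p $ j * b q $ j) + (if p = q then \<kappa> else 0)"
    and \<kappa>: "1 < Re \<kappa>" and nz: "middle \<kappa> b c bt X0 \<noteq> 0"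
    and det: "det (sol (rank1 bt ct) (X0 + per)) = exp (per * \<kappa>) ^ 2 * det (sol (rank1 b c) (X0 + per))"
      "det (sol (rank1 b c) (X0 + per)) \<noteq> 0"
  shows "trace (sol (rank1 bt ct) (X0 + per)) = exp (per * \<kappa>) * trace (sol (rank1 b c) (X0 + per))"
proof -
  let ?M = "middle \<kappa> b c bt" and ?G = "sol (rank1 b c) (X0 + per)" and ?Gt = "sol (rank1 bt ct) (X0 + per)"
  define B where "B = (\<chi> i j. exp (per * \<kappa>) * ?G $ i $ j)"
  have M: "?M X = sol (rank1 bt ct) X ** ?M X0" if "X \<in> strip" for X
    by (rule sol_unique[OF DERIV_middle[OF dot \<kappa>] that])
  have "?Gt ** ?M X0 = ?M X0 ** B"
  proof (simp only: vec_eq_iff, intro allI)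
    fix i k
    have "(?Gt ** ?M X0) $ i $ k = ?M (X0 + per) $ i $ k" using M[OF strip(4)[OF X0]] by simp
    also have "\<dots> = (?M X0 ** B) $ i $ k"
      using middle_period[OF _ X0, of \<kappa>] \<kappa> by (simp add: B_def matrix_matrix_mult_def sum_2 distrib_left mult_ac)
    finally show "(?Gt ** ?M X0) $ i $ k = (?M X0 ** B) $ i $ k" .
  qed
  moreover have "det B = exp (per * \<kappa>) ^ 2 * det ?G" "trace B = exp (per * \<kappa>) * trace ?G"
    by (simp_all add: B_def det_2 trace_def sum_2 power2_eq_square algebra_simps)
  ultimately show ?thesis using trace_intertwined[of ?Gt "?M X0" B] nz det by simp
qed

text \<open>If the transform vanishes at \<open>X0\<close>, it vanishes throughout, so the
  transforms of all f_p are constant and the f_p are periodic. Then c_p annihilates Y(X + per) -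
  Y(X) = Y(X) (G - 1) for every p. A solution annihilated by all c_p is constant, and comparison of
  its values at \<open>X0\<close> and one period later gives G (G - 1) = G - 1, which the
  determinant forbids.\<close>

lemma middle_2_nonzero:
  assumes dot: "\<And>p q. \<lbrakk>p \<in> S; q \<in> S\<rbrakk> \<Longrightarrow>
      (\<Sum>j\<in>UNIV. ct p $ j * bt q $ j) = (\<Sum>j\<in>UNIV. c p $ j * b q $ j) + (if p = q then 2 else 0)"
    and det: "det (sol (rank1 b c) (X0 + per)) \<noteq> 1"
  shows "middle 2 b c bt X0 \<noteq> 0"
proof
  have two: "1 < Re 2" by simp
  let ?M = "middle 2 b c bt" and ?Y = "sol (rank1 b c)"
  let ?G = "?Y (X0 + per)"
  assume "?M X0 = 0"
  then have M: "?M X = 0" if "X \<in> strip" for X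
    using sol_unique[OF DERIV_middle[OF dot two] that] by simp
  have ratio: "ratio b c p k (X + per) = ratio b c p k X" if "X \<in> strip" "p \<in> S" for X p k
  proof (rule periodic_if_conv_2_constant[OF holomorphic_ratio[OF that(2)] _ that(1)])
    fix X assume X: "X \<in> strip"
    show "(conv 2 (ratio b c p k) has_field_derivative 0) (at X)"
      using DERIV_conv_ratio[OF dot _ X that(2), of k] M[OF X] by simp
  qed
  define D where "D = ?G - mat 1"
  define W where "W = (\<lambda>X. ?Y X ** D)"
  have cW: "(\<Sum>j\<in>UNIV. c p $ j * W X $ j $ k) = 0" if X: "X \<in> strip" and p: "p \<in> S" for X p k
  proof -
    have "A ** (B - mat 1) = A ** B - A" for A B :: "complex^2^2"
      by (simp add: vec_eq_iff matrix_matrix_mult_def mat_def sum_2 forall_2 algebra_simps)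
    then have "W X = ?Y (X + per) - ?Y X"
      unfolding W_def D_def sol_period[OF X] .
    moreover have "z X - p \<noteq> 0" using avoid[OF X] p by auto
    then have "(\<Sum>j\<in>UNIV. c p $ j * ?Y (X + per) $ j $ k) = (\<Sum>j\<in>UNIV. c p $ j * ?Y X $ j $ k)"
      using ratio[OF X p, of k] unfolding ratio_def z_periodic by simp
    ultimately show ?thesis by (simp add: right_diff_distrib sum_subtractf)
  qed
  have W0: "((\<lambda>X. W X $ i $ j) has_field_derivative 0) (at X)" if X: "X \<in> strip" for X i j
  proof -
    have "((\<lambda>X. \<Sum>k\<in>UNIV. ?Y X $ i $ k * D $ k $ j) has_field_derivative
      (\<Sum>k\<in>UNIV. dz X * (fuchs S (rank1 b c) (z X) ** ?Y X) $ i $ k * D $ k $ j)) (at X)"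
      by (intro DERIV_sum DERIV_cmult_right DERIV_sol X)
    moreover have "(\<Sum>k\<in>UNIV. dz X * (fuchs S (rank1 b c) (z X) ** ?Y X) $ i $ k * D $ k $ j)
        = dz X * (fuchs S (rank1 b c) (z X) ** W X) $ i $ j"
      unfolding W_def matrix_mul_assoc
      by (simp add: matrix_matrix_mult_def[of _ D] sum_distrib_left mult.assoc)
    moreover have "\<dots> = 0" unfolding fuchs_rank1 by (simp add: cW X)
    moreover have "(\<Sum>k\<in>UNIV. ?Y X $ i $ k * D $ k $ j) = W X $ i $ j" for X
      by (simp add: W_def matrix_matrix_mult_def)
    ultimately show ?thesis by simp
  qed
  have "W (X0 + per) $ i $ j = W X0 $ i $ j" for i j
  proof -
    have "\<exists>w. \<forall>X\<in>strip. W X $ i $ j = w"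
      by (rule has_field_derivative_zero_constant[OF strip(2)]) (rule has_field_derivative_at_within[OF W0])
    then obtain w where w: "\<forall>X\<in>strip. W X $ i $ j = w" by (rule exE)
    show ?thesis using bspec[OF w X0] bspec[OF w strip(4)[OF X0]] by (rule trans[OF _ sym, rotated])
  qed
  then have "W (X0 + per) = W X0" by (simp add: vec_eq_iff)
  then have "?G ** (?G - mat 1) = ?G - mat 1" by (simp add: W_def D_def)
  then show False using det_eq_one_if_unipotent det by blast
qed

text \<open>Continuity in the parameter is enough here: its purpose is to extend nonvanishing from
  one parameter to an open set of them.\<close>

lemma continuous_on_middle:
  assumes b: "\<And>p i. p \<in> S \<Longrightarrow> (\<lambda>\<tau>. b \<tau> p $ i) holomorphic_on UNIV"
    and c: "\<And>p i. p \<in> S \<Longrightarrow> (\<lambda>\<tau>. c \<tau> p $ i) holomorphic_on UNIV"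
    and bt: "\<And>p i. p \<in> S \<Longrightarrow> (\<lambda>\<tau>. bt \<tau> p $ i) holomorphic_on UNIV"
    and \<kappa>: "\<kappa> holomorphic_on UNIV"
  shows "continuous_on {\<tau>. 0 < Re (\<kappa> \<tau>)} (\<lambda>\<tau>. middle (\<kappa> \<tau>) (b \<tau>) (c \<tau>) (bt \<tau>) X0 $ i $ k)"
proof -
  let ?T = "{\<tau>. 0 < Re (\<kappa> \<tau>)}"
  have co: "continuous_on A f" if "f holomorphic_on UNIV" for f :: "complex \<Rightarrow> complex" and A
    using holomorphic_on_imp_continuous_on[OF that] continuous_on_subset by blast
  have R: "holo_res S (\<lambda>\<tau>. rank1 (b \<tau>) (c \<tau>))"
    unfolding holo_res_def rank1_def using b c by (auto intro!: holomorphic_intros)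
  have conv: "continuous_on ?T (\<lambda>\<tau>. conv (\<kappa> \<tau>) (ratio (b \<tau>) (c \<tau>) p k) X0)" if p: "p \<in> S" for p
  proof -
    let ?X = "\<lambda>x::complex \<times> real. X0 + \<i> * of_real (snd x)"
    have X: "continuous_on (?T \<times> {0..2 * pi}) ?X" by (intro continuous_intros)
    have fst: "continuous_on (?T \<times> {0..2 * pi}) (\<lambda>x. g (fst x))" if "continuous_on ?T g" for g :: "complex \<Rightarrow> complex"
      by (rule continuous_on_compose2[OF that]) (auto intro: continuous_intros)
    have sol: "continuous_on (?T \<times> {0..2 * pi}) (\<lambda>x. sol (rank1 (b (fst x)) (c (fst x))) (?X x) $ j $ k)" for j
      by (rule continuous_on_compose2[OF continuous_on_sol[OF R], of _ "\<lambda>x. (fst x, ?X x)", simplified])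
        (auto intro!: continuous_intros strip(3) X0)
    have zX: "continuous_on (?T \<times> {0..2 * pi}) (\<lambda>x. z (?X x))"
      by (rule continuous_on_compose2[OF continuous_on_z X]) (auto intro!: strip(3) X0)
    have dzX: "continuous_on (?T \<times> {0..2 * pi}) (\<lambda>x. dz (?X x))"
      by (rule continuous_on_compose2[OF continuous_on_dz X]) (auto intro!: strip(3) X0)
    have kern: "continuous_on (?T \<times> {0..2 * pi}) (\<lambda>x. kern (\<kappa> (fst x)) X0 (snd x))"
      by (rule continuous_on_compose2[OF continuous_on_kern[unfolded case_prod_beta'], of _ "\<lambda>x. (\<kappa> (fst x), X0, snd x)", simplified])
        (auto intro!: continuous_intros X0 fst co \<kappa>)
    have "continuous_on (?T \<times> {0..2 * pi}) (\<lambda>x. ratio (b (fst x)) (c (fst x)) p k (?X x) * dz (?X x) * \<i> * kern (\<kappa> (fst x)) X0 (snd x))"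
      unfolding ratio_def
      by (intro continuous_intros sol zX dzX kern fst co c p) (use avoid[OF strip(3)[OF X0]] p in auto)
    then have "continuous_on (?T \<times> cbox 0 (2 * pi)) (\<lambda>(\<tau>, u). ratio (b \<tau>) (c \<tau>) p k (X0 + \<i> * of_real u) * dz (X0 + \<i> * of_real u) * \<i> * kern (\<kappa> \<tau>) X0 u)"
      by (simp add: case_prod_beta')
    from integral_continuous_on_param[OF this] show ?thesis by (simp add: conv_def)
  qed
  show ?thesis
    unfolding middle_def vec_lambda_beta by (intro continuous_intros conv co bt)
qed

end

section \<open>Traces under middle convolution\<close>

context two_loops
begin

definition product_monodromy :: "(complex \<Rightarrow> complex^2^2) \<Rightarrow> complex^2^2" where
  "product_monodromy R = transport S R \<sigma> ** transport S R \<tau>"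

lemma det_product_monodromy:
  "det (product_monodromy R) = exp (2 * of_real pi * \<i> * (trace (R a) + trace (R b)))"
  using det_transport[of S \<sigma> R] det_transport[of S \<tau> R] \<sigma>_simple \<tau>_simple winding distinct
  by (simp add: product_monodromy_def det_mul exp_add distrib_left)

lemma holomorphic_product_monodromy:
  assumes "holo_res S R"
  shows "(\<lambda>s. trace (product_monodromy (R s))) holomorphic_on UNIV"
proof -
  have "(\<lambda>s. transport S (R s) \<sigma> $ i $ j) holomorphic_on UNIV" "(\<lambda>s. transport S (R s) \<tau> $ i $ j) holomorphic_on UNIV" for i j
    using assms \<sigma>_simple \<tau>_simple by (intro holomorphic_transport; simp)+
  then show ?thesis
    unfolding product_monodromy_def trace_def matrix_matrix_mult_def by (auto intro!: holomorphic_intros)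
qed

text \<open>Both sides are entire in \<open>s\<close>, because transport is entire in the residues'
  parameter. The transform proves the identity only where 1 < Re \<kappa> and it does not vanish, an
  open set around \<open>s1\<close>; the identity theorem carries it to the whole plane. The
  determinants are explicit for every \<open>s\<close>.\<close>

theorem trace_middle_convolution:
  fixes B C Bt Ct :: "complex \<Rightarrow> complex \<Rightarrow> complex^2" and \<kappa> :: "complex \<Rightarrow> complex"
  assumes B: "\<And>p i. p \<in> S \<Longrightarrow> (\<lambda>s. B s p $ i) holomorphic_on UNIV"
    and C: "\<And>p i. p \<in> S \<Longrightarrow> (\<lambda>s. C s p $ i) holomorphic_on UNIV"
    and Bt: "\<And>p i. p \<in> S \<Longrightarrow> (\<lambda>s. Bt s p $ i) holomorphic_on UNIV"
    and Ct: "\<And>p i. p \<in> S \<Longrightarrow> (\<lambda>s. Ct s p $ i) holomorphic_on UNIV"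
    and \<kappa>: "\<kappa> holomorphic_on UNIV"
    and dot: "\<And>s p q. \<lbrakk>p \<in> S; q \<in> S\<rbrakk> \<Longrightarrow>
      (\<Sum>j\<in>UNIV. Ct s p $ j * Bt s q $ j) = (\<Sum>j\<in>UNIV. C s p $ j * B s q $ j) + (if p = q then \<kappa> s else 0)"
    and s1: "\<kappa> s1 = 2" "exp (2 * of_real pi * \<i> * (trace (rank1 (B s1) (C s1) a) + trace (rank1 (B s1) (C s1) b))) \<noteq> 1"
  shows "trace (product_monodromy (rank1 (Bt s) (Ct s)))
      = exp (2 * of_real pi * \<i> * \<kappa> s) * trace (product_monodromy (rank1 (B s) (C s)))" (is ?tr)
    and "det (product_monodromy (rank1 (Bt s) (Ct s)))
      = exp (2 * of_real pi * \<i> * \<kappa> s) ^ 2 * det (product_monodromy (rank1 (B s) (C s)))" (is ?det)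
proof -
  have tr: "trace (rank1 b c p) = (\<Sum>j\<in>UNIV. c p $ j * b p $ j)" for b c p
    by (simp add: trace_def rank1_def mult.commute)
  have det: "det (product_monodromy (rank1 (Bt s) (Ct s)))
      = exp (2 * of_real pi * \<i> * \<kappa> s) ^ 2 * det (product_monodromy (rank1 (B s) (C s)))" for s
    unfolding det_product_monodromy tr power2_eq_square exp_add[symmetric]
    using dot[of a a s] dot[of b b s] by (simp add: algebra_simps)
  then show ?det .
  obtain \<phi> r where \<phi>: "\<phi> holomorphic_on ball 0 1" "inj_on \<phi> (ball 0 1)" and r: "0 < r" "r < 1"
    and ab: "a \<in> \<phi> ` ball 0 r" "b \<in> \<phi> ` ball 0 r" "c \<notin> \<phi> ` ball 0 1"
    and K: "\<And>R :: complex \<Rightarrow> complex^2^2. \<exists>K. det K \<noteq> 0 \<and>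
       (transport S R \<sigma> ** transport S R \<tau>) ** K = K ** transport S R (\<phi> \<circ> circlepath 0 r)"
    by (rule conformal_circle) blast
  obtain a' b' where a': "\<phi> a' = a" "norm a' < r" and b': "\<phi> b' = b" "norm b' < r"
    using ab by auto
  \<comment> \<open>The annulus \<rho> < |x| < 1 excludes the preimages of \<open>a\<close> and
    \<open>b\<close> and contains the circle of radius \<open>r\<close>. As the two preimages
    differ, \<rho> is positive.\<close>
  define \<rho> where "\<rho> = max (norm a') (norm b')"
  have "a' \<noteq> b'" using a' b' distinct by auto
  then have "0 < norm a' \<or> 0 < norm b'" by auto
  then have rho: "0 < \<rho>" "\<rho> < r" "norm a' \<le> \<rho>" "norm b' \<le> \<rho>"
    using a' b' by (auto simp: \<rho>_def less_max_iff_disj)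
  interpret annulus \<phi> \<rho> by unfold_locales (use \<phi> rho r in auto)
  have avoid: "z X \<notin> S" if X: "X \<in> strip" for X
  proof -
    have n: "\<rho> < norm (exp X)" "exp X \<in> ball 0 1" using exp_norm_gt[OF X] exp_in_disc[OF X] by auto
    have "a' \<in> ball 0 1" "b' \<in> ball 0 1" "exp X \<noteq> a'" "exp X \<noteq> b'" using a' b' r rho n by auto
    then have "\<phi> (exp X) \<noteq> a" "\<phi> (exp X) \<noteq> b"
      using \<phi>(2) a' b' n(2) by (metis inj_onD)+
    moreover have "\<phi> (exp X) \<noteq> c" using ab(3) n(2) by blast
    ultimately show ?thesis by (simp add: z_def)
  qed
  \<comment> \<open>exp X0 = r, so the segment of one period above \<open>X0\<close> covers the
    circle of radius \<open>r\<close> once.\<close>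
  define X0 where "X0 = complex_of_real (ln r)"
  interpret annulus_system \<phi> \<rho> S X0
    by unfold_locales (use avoid rho r in \<open>auto simp: X0_def strip_def\<close>)
  have X0r: "exp X0 = of_real r" using r by (simp only: X0_def exp_of_real exp_ln)
  have sim: "trace (product_monodromy R) = trace (sol R (X0 + per))" "det (product_monodromy R) = det (sol R (X0 + per))" for R
  proof -
    obtain k where "det k \<noteq> 0" "product_monodromy R ** k = k ** sol R (X0 + per)"
      using K[of R] unfolding sol_circle[OF X0r] product_monodromy_def by blast
    then show "trace (product_monodromy R) = trace (sol R (X0 + per))" "det (product_monodromy R) = det (sol R (X0 + per))"
      using trace_det_similar by blast+
  qed
  have nz: "det (product_monodromy R) \<noteq> 0" for R by (simp add: det_product_monodromy)
  have "middle 2 (B s1) (C s1) (Bt s1) X0 \<noteq> 0"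
  proof (rule middle_2_nonzero)
    show "(\<Sum>j\<in>UNIV. Ct s1 p $ j * Bt s1 q $ j) = (\<Sum>j\<in>UNIV. C s1 p $ j * B s1 q $ j) + (if p = q then 2 else 0)"
      if "p \<in> S" "q \<in> S" for p q using dot[OF that, of s1] s1(1) by simp
    show "det (sol (rank1 (B s1) (C s1)) (X0 + per)) \<noteq> 1"
      using s1(2) by (simp only: sim(2)[symmetric] det_product_monodromy not_False_eq_True)
  qed
  then obtain i k where ik: "middle 2 (B s1) (C s1) (Bt s1) X0 $ i $ k \<noteq> 0"
    by (auto simp: vec_eq_iff)
  define m where "m = (\<lambda>s. middle (\<kappa> s) (B s) (C s) (Bt s) X0 $ i $ k)"
  have c\<kappa>: "continuous_on UNIV \<kappa>" using \<kappa> by (rule holomorphic_on_imp_continuous_on)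
  have op: "open {s. d < Re (\<kappa> s)}" for d by (intro open_Collect_less continuous_intros c\<kappa>)
  have "continuous_on {s. 0 < Re (\<kappa> s)} m"
    unfolding m_def by (rule continuous_on_middle[OF B C Bt \<kappa>])
  then have "open ({s. 0 < Re (\<kappa> s)} \<inter> m -` (- {0}))"
    by (rule continuous_open_preimage[OF _ op]) auto
  then have "open ({s. 1 < Re (\<kappa> s)} \<inter> ({s. 0 < Re (\<kappa> s)} \<inter> m -` (- {0})))" (is "open ?U")
    by (rule open_Int[OF op])
  moreover have "s1 \<in> ?U" using ik s1(1) by (simp add: m_def)
  ultimately have U: "open ?U" "?U \<noteq> {}" by blast+
  have on_U: "trace (product_monodromy (rank1 (Bt s) (Ct s)))
      = exp (2 * of_real pi * \<i> * \<kappa> s) * trace (product_monodromy (rank1 (B s) (C s)))" if "s \<in> ?U" for s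
    unfolding sim
  proof (rule trace_middle[where bt = "Bt s" and ct = "Ct s"])
    show "1 < Re (\<kappa> s)" using that by auto
    show "middle (\<kappa> s) (B s) (C s) (Bt s) X0 \<noteq> 0" using that by (auto simp: m_def)
    show "det (sol (rank1 (B s) (C s)) (X0 + per)) \<noteq> 0" using nz unfolding sim(2) .
    show "det (sol (rank1 (Bt s) (Ct s)) (X0 + per)) = exp (per * \<kappa> s) ^ 2 * det (sol (rank1 (B s) (C s)) (X0 + per))"
      using det[of s] unfolding sim(2) .
  qed (rule dot)
  have R: "holo_res S (\<lambda>s. rank1 (B s) (C s))" "holo_res S (\<lambda>s. rank1 (Bt s) (Ct s))"
    unfolding holo_res_def rank1_def using B C Bt Ct by (auto intro!: holomorphic_intros)
  show ?tr
    by (rule analytic_continuation_open[OF U(1) open_UNIV U(2) connected_UNIV _ _ _ on_U UNIV_I])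
      (use \<kappa> in \<open>auto intro!: holomorphic_intros holomorphic_product_monodromy R\<close>)
qed

end

section \<open>The equation with an apparent singularity\<close>

text \<open>The residue of \<open>(z - l) / (z * (z - 1) * (z - t))\<close> at \<open>p\<close>: the apparent singularity is the zero of
  the upper right entry of the system.\<close>

definition apparent_weight :: "complex \<Rightarrow> complex \<Rightarrow> complex \<Rightarrow> complex" where
  "apparent_weight t l p = (if p = 0 then - l / t else if p = 1 then (1 - l) / (1 - t) else (t - l) / (t * (t - 1)))"

text \<open>This is \<mu>, obtained by solving the definition of the new position \<open>l'\<close>
  for it. With shifted \<open>h\<close>, with - k and with \<open>l\<close>, \<open>l'\<close>
  interchanged, the same formula gives the \<mu> of the second equation.\<close>

definition apparent_slope :: "complex \<Rightarrow> (complex \<Rightarrow> complex) \<Rightarrow> complex \<Rightarrow> complex \<Rightarrow> complex \<Rightarrow> complex" where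
  "apparent_slope t h k l l' = h 0 / l + h 1 / (l - 1) + h t / (l - t) + k / (l - l')"

text \<open>Upper left entries r_p of the residues. They are fixed by the sum of the r_p being -
  \<open>k1\<close> and the sum of r_p / (l - p) being \<open>m\<close>, together with the
  normalization r_t = 0. The second condition expresses y' = \<mu> y at the zero of the upper right
  entry.\<close>

definition apparent_diag :: "complex \<Rightarrow> (complex \<Rightarrow> complex) \<Rightarrow> complex \<Rightarrow> complex \<Rightarrow> complex \<Rightarrow> complex \<Rightarrow> complex" where
  "apparent_diag t h k l l' p =
     (let k1 = - k - h 0 - h 1 - h t; m = apparent_slope t h k l l' in
      if p = 0 then - l * (k1 + m * (l - 1)) else if p = 1 then (l - 1) * (k1 + m * l) else 0)"

definition apparent_row :: "complex \<Rightarrow> (complex \<Rightarrow> complex) \<Rightarrow> complex \<Rightarrow> complex \<Rightarrow> complex \<Rightarrow> complex \<Rightarrow> complex^2" where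
  "apparent_row t h k l l' p = vector [apparent_diag t h k l l' p, apparent_weight t l p]"

text \<open>The first entry is normalized to 1; the second is the one for which the residue at
  \<open>p\<close> has trace \<open>h p\<close>.\<close>

definition apparent_column :: "complex \<Rightarrow> (complex \<Rightarrow> complex) \<Rightarrow> complex \<Rightarrow> complex \<Rightarrow> complex \<Rightarrow> complex \<Rightarrow> complex^2" where
  "apparent_column t h k l l' p = vector [1, (h p - apparent_diag t h k l l' p) / apparent_weight t l p]"

lemma apparent_weight_nonzero:
  "t \<noteq> 0 \<Longrightarrow> t \<noteq> 1 \<Longrightarrow> l \<notin> {0, 1, t} \<Longrightarrow> p \<in> {0, 1, t} \<Longrightarrow> apparent_weight t l p \<noteq> 0"
  by (auto simp: apparent_weight_def)

text \<open>A closed form in which \<open>r\<close> is the third puncture: it shows how the product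
  depends on the pair of positions, and the comparison of the two systems becomes an identity in p,
  r, l, l'.\<close>

lemma apparent_dot_offdiag:
  assumes t: "t \<noteq> 0" "t \<noteq> 1" and l: "l \<notin> {0, 1, t}" "l \<noteq> l'"
    and pqr: "p \<in> {0, 1, t}" "q \<in> {0, 1, t}" "r \<in> {0, 1, t}" "p \<noteq> q" "q \<noteq> r" "r \<noteq> p"
  shows "(\<Sum>j\<in>UNIV. apparent_row t h k l l' p $ j * apparent_column t h k l l' q $ j)
    = h p + k * (p - l) * (r - l') / ((l - l') * (p - r))"
proof -
  have n: "l - 1 \<noteq> 0" "l - t \<noteq> 0" "l \<noteq> 0" "l - l' \<noteq> 0" "t - 1 \<noteq> 0" "1 - t \<noteq> 0" "1 - l \<noteq> 0" "t - l \<noteq> 0" using l t by auto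
  \<comment> \<open>Quotients as new variables clear the denominators: the slope becomes their sum,
    and everything else is polynomial in them.\<close>
  define x y w v where "x = h 0 / l" and "y = h 1 / (l - 1)" and "w = h t / (l - t)" and "v = k / (l - l')"
  then have h: "h 0 = x * l" "h 1 = y * (l - 1)" "h t = w * (l - t)" "k = v * (l - l')"
    using n by simp_all
  have m: "apparent_slope t h k l l' = x + y + w + v"
    using n unfolding apparent_slope_def h by simp
  have cases: "(p, q, r) \<in> {(0, 1, t), (0, t, 1), (1, 0, t), (1, t, 0), (t, 0, 1), (t, 1, 0)}"
    using pqr t by auto
  have rhs: "k * (p - l) * (r - l') / ((l - l') * (p - r)) = v * (p - l) * (r - l') / (p - r)"
    using n by (simp add: h)
  show ?thesis
    using cases unfolding rhs apparent_row_def apparent_column_def sum_2 vector_2 apparent_diag_def m Let_def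
    using t n by (auto simp: apparent_weight_def h divide_simps) (simp_all add: algebra_simps)
qed

lemma apparent_dot_diag:
  assumes "t \<noteq> 0" "t \<noteq> 1" "l \<notin> {0, 1, t}" "p \<in> {0, 1, t}"
  shows "(\<Sum>j\<in>UNIV. apparent_row t h k l l' p $ j * apparent_column t h k l l' p $ j) = h p"
  using apparent_weight_nonzero[OF assms] by (simp add: apparent_row_def apparent_column_def sum_2)

text \<open>On the diagonal the products are the traces, which are shifted by \<open>k\<close>. Off
  the diagonal the equality is (p - l)(r - l') - (p - l')(r - l) = (p - r)(l - l'): the shift of
  \<open>h p\<close> is absorbed by the exchange of the positions.\<close>

lemma apparent_dot_shift:
  assumes t: "t \<noteq> 0" "t \<noteq> 1" and l: "l \<notin> {0, 1, t}" "l' \<notin> {0, 1, t}" "l \<noteq> l'"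
    and pq: "p \<in> {0, 1, t}" "q \<in> {0, 1, t}"
  shows "(\<Sum>j\<in>UNIV. apparent_row t (\<lambda>p. h p + k) (- k) l' l p $ j * apparent_column t (\<lambda>p. h p + k) (- k) l' l q $ j)
    = (\<Sum>j\<in>UNIV. apparent_row t h k l l' p $ j * apparent_column t h k l l' q $ j) + (if p = q then k else 0)"
proof (cases "p = q")
  case True
  show ?thesis
    unfolding True using apparent_dot_diag[OF t l(1) pq(2)] apparent_dot_diag[OF t l(2) pq(2)] by (simp only: simp_thms if_True)
next
  case False
  have "\<not> {0, 1, t} \<subseteq> {p, q}"
  proof
    assume "{0, 1, t} \<subseteq> {p, q}"
    then have "card {0, 1, t} \<le> card {p, q}" by (intro card_mono) auto
    then show False using t False by simp
  qed
  then obtain r where r: "r \<in> {0, 1, t}" "q \<noteq> r" "r \<noteq> p" by blast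
  have "l' - l \<noteq> 0" "l - l' \<noteq> 0" "p - r \<noteq> 0" using l r by auto
  then have "h p + k + - k * (p - l') * (r - l) / ((l' - l) * (p - r)) = h p + k * (p - l) * (r - l') / ((l - l') * (p - r))"
    by (simp add: divide_simps) (simp add: algebra_simps)
  then show ?thesis
    using False apparent_dot_offdiag[OF t l(1,3) pq r(1) False r(2,3), of h k]
      apparent_dot_offdiag[OF t l(2) l(3)[symmetric] pq r(1) False r(2,3), of "\<lambda>p. h p + k" "- k"]
    by (simp only: if_False add_0_right)
qed

text \<open>The formulas for elimination of the second component at a single point, multiplied by
  the upper right entry.\<close>

definition scalar_reduction ::
    "complex set \<Rightarrow> (complex \<Rightarrow> complex^2^2) \<Rightarrow> (complex \<Rightarrow> complex) \<Rightarrow> (complex \<Rightarrow> complex) \<Rightarrow> complex \<Rightarrow> bool" where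
  "scalar_reduction S R P Q z \<longleftrightarrow> fuchs S R z $ 1 $ 2 \<noteq> 0
     \<and> P z * fuchs S R z $ 1 $ 2 = - trace (fuchs S R z) * fuchs S R z $ 1 $ 2 + (\<Sum>p\<in>S. R p $ 1 $ 2 / (z - p)\<^sup>2)
     \<and> Q z * fuchs S R z $ 1 $ 2 = det (fuchs S R z) * fuchs S R z $ 1 $ 2
         + (\<Sum>p\<in>S. R p $ 1 $ 1 / (z - p)\<^sup>2) * fuchs S R z $ 1 $ 2
         - fuchs S R z $ 1 $ 1 * (\<Sum>p\<in>S. R p $ 1 $ 2 / (z - p)\<^sup>2)"

text \<open>The weights make the upper right entry (z - l) / (z (z - 1) (z - t)). Minus its
  logarithmic derivative adds 1 to the exponent term at each puncture and contributes the term - 1 /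
  (z - l) of the equation, at a point where the system itself is regular.\<close>

lemma apparent_reduction:
  assumes t: "t \<noteq> 0" "t \<noteq> 1" and l: "l \<notin> {0, 1, t}" and z: "z \<notin> {0, 1, t}" "z \<noteq> l"
    and k: "k = kappa2 (h 0) (h 1) (h t) hi" and m: "m = apparent_slope t h k l l'"
  shows "scalar_reduction {0, 1, t} (rank1 (apparent_column t h k l l') (apparent_row t h k l l'))
    (Dy1_P t (h 0) (h 1) (h t) l) (Dy1_Q t (h 0) (h 1) (h t) hi l m) z"
proof -
  define k1 where "k1 = - k - h 0 - h 1 - h t"
  have k1: "kappa1 (h 0) (h 1) (h t) hi = k1" by (simp add: k1_def k kappa1_def kappa2_def field_simps)
  let ?e = "apparent_weight t l" and ?r = "apparent_diag t h k l l'"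
  let ?A = "fuchs {0, 1, t} (rank1 (apparent_column t h k l l') (apparent_row t h k l l')) z"
  define u v where "u = k1 + m * (l - 1)" and "v = k1 + m * l"
  have r: "?r 0 = - l * u" "?r 1 = (l - 1) * v" "?r t = 0"
    using t by (simp_all add: apparent_diag_def Let_def u_def v_def k1_def m)
  have nz: "z \<noteq> 0" "z - 1 \<noteq> 0" "z - t \<noteq> 0" "z - l \<noteq> 0" "t - 1 \<noteq> 0" "1 - t \<noteq> 0" "l - 1 \<noteq> 0" "1 - l \<noteq> 0" "l \<noteq> 0" "t - l \<noteq> 0"
    using z t l by auto
  have sum3: "(\<Sum>p\<in>{0, 1, t}. f p) = f 0 + f 1 + f t" for f :: "complex \<Rightarrow> complex" using t by simp
  have re: "?r 0 / ?e 0 = t * u" "?r 1 / ?e 1 = (t - 1) * v" "?r t / ?e t = 0"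
    using t nz by (simp_all add: r apparent_weight_def divide_simps) (simp add: algebra_simps)
  have a11: "?A $ 1 $ 1 = - l * u / z + (l - 1) * v / (z - 1)"
    by (simp add: fuchs_def sum3 rank1_def apparent_row_def apparent_column_def r)
  have a12: "?A $ 1 $ 2 = (z - l) / (z * (z - 1) * (z - t))"
  proof -
    have "?A $ 1 $ 2 = - l / t / z + (1 - l) / (1 - t) / (z - 1) + (t - l) / (t * (t - 1)) / (z - t)"
      using t by (simp add: fuchs_def sum3 rank1_def apparent_row_def apparent_column_def apparent_weight_def)
    also have "\<dots> = (z - l) / (z * (z - 1) * (z - t))"
      using t nz by (simp add: divide_simps) (simp add: algebra_simps)
    finally show ?thesis .
  qed
  have b12: "(\<Sum>p\<in>{0, 1, t}. rank1 (apparent_column t h k l l') (apparent_row t h k l l') p $ 1 $ 2 / (z - p)\<^sup>2)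
      = (1 / z + 1 / (z - 1) + 1 / (z - t) - 1 / (z - l)) * ?A $ 1 $ 2"
  proof -
    have "(\<Sum>p\<in>{0, 1, t}. rank1 (apparent_column t h k l l') (apparent_row t h k l l') p $ 1 $ 2 / (z - p)\<^sup>2)
      = - l / t / z\<^sup>2 + (1 - l) / (1 - t) / (z - 1)\<^sup>2 + (t - l) / (t * (t - 1)) / (z - t)\<^sup>2"
      using t by (simp add: sum3 rank1_def apparent_row_def apparent_column_def apparent_weight_def)
    also have "\<dots> = (1 / z + 1 / (z - 1) + 1 / (z - t) - 1 / (z - l)) * ((z - l) / (z * (z - 1) * (z - t)))"
      using t nz by (simp add: divide_simps power2_eq_square) (simp add: algebra_simps)
    finally show ?thesis unfolding a12 .
  qed
  have b11: "(\<Sum>p\<in>{0, 1, t}. rank1 (apparent_column t h k l l') (apparent_row t h k l l') p $ 1 $ 1 / (z - p)\<^sup>2)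
      = - l * u / z\<^sup>2 + (l - 1) * v / (z - 1)\<^sup>2"
    by (simp add: sum3 rank1_def apparent_row_def apparent_column_def r)
  have a22: "?A $ 2 $ 2 = (h 0 + l * u) / z + (h 1 - (l - 1) * v) / (z - 1) + h t / (z - t)"
    using apparent_weight_nonzero[OF t l, of 0] apparent_weight_nonzero[OF t l, of 1] apparent_weight_nonzero[OF t l, of t]
    by (simp add: fuchs_def sum3 rank1_def apparent_row_def apparent_column_def r)
  have a21: "?A $ 2 $ 1 = t * u * (h 0 + l * u) / z + (t - 1) * v * (h 1 - (l - 1) * v) / (z - 1)"
  proof -
    have "?A $ 2 $ 1 = (?r 0 / ?e 0) * (h 0 - ?r 0) / z + (?r 1 / ?e 1) * (h 1 - ?r 1) / (z - 1) + (?r t / ?e t) * (h t - ?r t) / (z - t)"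
      by (simp add: fuchs_def sum3 rank1_def apparent_row_def apparent_column_def mult_ac)
    then show ?thesis unfolding re unfolding r by simp
  qed
  have P: "Dy1_P t (h 0) (h 1) (h t) l z = - trace ?A + (1 / z + 1 / (z - 1) + 1 / (z - t) - 1 / (z - l))"
    unfolding Dy1_P_def trace_def sum_2 a11 a22 by (simp add: diff_divide_distrib add_divide_distrib)
  have Q: "Dy1_Q t (h 0) (h 1) (h t) hi l m z = det ?A + (- l * u / z\<^sup>2 + (l - 1) * v / (z - 1)\<^sup>2)
      - ?A $ 1 $ 1 * (1 / z + 1 / (z - 1) + 1 / (z - t) - 1 / (z - l))"
  proof -
    have k: "kappa2 (h 0) (h 1) (h t) hi = - k1 - h 0 - h 1 - h t" using k by (simp add: k1_def)
    have H: "t * (t - 1) * Dy1_H t (h 0) (h 1) (h t) hi l m =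
      l * (l - 1) * (l - t) * m\<^sup>2 - (h 0 * (l - 1) * (l - t) + h 1 * l * (l - t) + (h t - 1) * l * (l - 1)) * m
        + k1 * (- k1 - h 0 - h 1 - h t + 1) * (l - t)"
      using t nz by (simp add: Dy1_H_def k1 k)
    show ?thesis
      unfolding Dy1_Q_def H k1 k det_2 a11 a12 a21 a22 u_def v_def using nz
      by (simp add: divide_simps power2_eq_square) (simp add: algebra_simps)
  qed
  have "?A $ 1 $ 2 \<noteq> 0" unfolding a12 using nz by simp
  then show ?thesis
    unfolding scalar_reduction_def b12 b11 P Q by (simp only: left_diff_distrib distrib_right mult.assoc simp_thms)
qed

section \<open>Heun's equation\<close>

text \<open>Lower left entry of the residue at \<open>t\<close>, the only place where the accessory
  parameter enters. Its value is forced by the numerator \<alpha> \<beta> z - q.\<close>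

definition heun_corner :: "complex \<Rightarrow> complex \<Rightarrow> complex \<Rightarrow> complex \<Rightarrow> complex \<Rightarrow> complex \<Rightarrow> complex" where
  "heun_corner t e0 e1 et \<beta> q = q - (e0 + e1 + et - 1 - \<beta>) * \<beta> * t + et * \<beta> * (t - 1)"

text \<open>The upper right entries -1, 1, 0 of the residues give A12 = 1 / (z (z - 1)), without
  zeros, hence no apparent singularity. The price is an asymmetry: the elimination adds 1 / z and 1
  / (z - 1) but nothing at \<open>t\<close>, so the traces are 1 - e0, 1 - e1 and - et.\<close>

definition heun_row :: "complex \<Rightarrow> complex \<Rightarrow> complex \<Rightarrow> complex \<Rightarrow> complex \<Rightarrow> complex \<Rightarrow> complex \<Rightarrow> complex^2" where
  "heun_row t e0 e1 et \<beta> q p = (if p = 0 then vector [- \<beta>, - 1] else if p = 1 then vector [0, 1]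
     else vector [heun_corner t e0 e1 et \<beta> q, - et])"

definition heun_column :: "complex \<Rightarrow> complex \<Rightarrow> complex \<Rightarrow> complex \<Rightarrow> complex^2" where
  "heun_column e0 e1 \<beta> p = (if p = 0 then vector [1, e0 - 1 - \<beta>] else if p = 1 then vector [1, 1 - e1] else vector [0, 1])"

text \<open>The row at \<open>t\<close> meets the columns at 0 and 1 in two conditions on the change
  of the corner entry. They are compatible exactly for this \<beta>, that is, when the companion
  parameter e0 + e1 + et - 1 - \<beta> is 1 - \<kappa>; the change of the accessory parameter
  follows. The shift leads from the primed data to the unprimed ones.\<close>

lemma heun_dot_shift:
  assumes t: "t \<noteq> 0" "t \<noteq> 1" and pq: "p \<in> {0, 1, t}" "q \<in> {0, 1, t}" and \<beta>: "\<beta> = e0 + e1 + et - 2 + \<kappa>"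
    and s': "s' = s + \<kappa> * (et + e1 * t + (e0 - 1 + \<kappa>) * (t + 1))"
  shows "(\<Sum>j\<in>UNIV. heun_row t e0 e1 et \<beta> s p $ j * heun_column e0 e1 \<beta> q $ j)
    = (\<Sum>j\<in>UNIV. heun_row t (e0 + \<kappa>) (e1 + \<kappa>) (et + \<kappa>) (\<beta> + \<kappa>) s' p $ j * heun_column (e0 + \<kappa>) (e1 + \<kappa>) (\<beta> + \<kappa>) q $ j)
      + (if p = q then \<kappa> else 0)"
proof -
  have "p = 0 \<or> p = 1 \<or> p = t" "q = 0 \<or> q = 1 \<or> q = t" using pq by auto
  then show ?thesis
    using t unfolding heun_row_def heun_column_def sum_2
    by (elim disjE) (simp_all add: heun_corner_def \<beta> s' algebra_simps)
qed

lemma trace_heun: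
  assumes "t \<noteq> 0" "t \<noteq> 1"
  shows "trace (rank1 (heun_column e0 e1 \<beta>) (heun_row t e0 e1 et \<beta> q) 0) = 1 - e0"
    "trace (rank1 (heun_column e0 e1 \<beta>) (heun_row t e0 e1 et \<beta> q) 1) = 1 - e1"
    "trace (rank1 (heun_column e0 e1 \<beta>) (heun_row t e0 e1 et \<beta> q) t) = - et"
  using assms by (simp_all add: trace_def sum_2 rank1_def heun_row_def heun_column_def)

lemma heun_reduction:
  assumes t: "t \<noteq> 0" "t \<noteq> 1" and z: "z \<notin> {0, 1, t}" and \<alpha>: "\<alpha>' * \<beta>' = (e0 + e1 + et - 1 - \<beta>) * \<beta>"
  shows "scalar_reduction {0, 1, t} (rank1 (heun_column e0 e1 \<beta>) (heun_row t e0 e1 et \<beta> q))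
    (Heun_P t e0 e1 et) (Heun_Q t \<alpha>' \<beta>' q) z"
proof -
  let ?R = "rank1 (heun_column e0 e1 \<beta>) (heun_row t e0 e1 et \<beta> q)"
  let ?A = "fuchs {0, 1, t} ?R z"
  have nz: "z \<noteq> 0" "z - 1 \<noteq> 0" "z - t \<noteq> 0" using z by auto
  have sum3: "(\<Sum>p\<in>{0, 1, t}. f p) = f 0 + f 1 + f t" for f :: "complex \<Rightarrow> complex" using t by simp
  have a11: "?A $ 1 $ 1 = - \<beta> / z" and a12: "?A $ 1 $ 2 = - 1 / z + 1 / (z - 1)"
    and a21: "?A $ 2 $ 1 = - \<beta> * (e0 - 1 - \<beta>) / z + heun_corner t e0 e1 et \<beta> q / (z - t)"
    and a22: "?A $ 2 $ 2 = - (e0 - 1 - \<beta>) / z + (1 - e1) / (z - 1) - et / (z - t)"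
    using t by (simp_all add: fuchs_def sum3 rank1_def heun_row_def heun_column_def)
  have a12': "?A $ 1 $ 2 = 1 / (z * (z - 1))" unfolding a12 using nz by (simp add: field_simps)
  have b11: "(\<Sum>p\<in>{0, 1, t}. ?R p $ 1 $ 1 / (z - p)\<^sup>2) = - \<beta> / z\<^sup>2"
    using t by (simp add: sum3 rank1_def heun_row_def heun_column_def)
  have b12: "(\<Sum>p\<in>{0, 1, t}. ?R p $ 1 $ 2 / (z - p)\<^sup>2) = (1 / z + 1 / (z - 1)) * ?A $ 1 $ 2"
  proof -
    have "(\<Sum>p\<in>{0, 1, t}. ?R p $ 1 $ 2 / (z - p)\<^sup>2) = - 1 / z\<^sup>2 + 1 / (z - 1)\<^sup>2"
      using t by (simp add: sum3 rank1_def heun_row_def heun_column_def)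
    also have "\<dots> = (1 / z + 1 / (z - 1)) * (- 1 / z + 1 / (z - 1))"
      by (simp add: algebra_simps power2_eq_square)
    finally show ?thesis unfolding a12 .
  qed
  have P: "Heun_P t e0 e1 et z = - trace ?A + (1 / z + 1 / (z - 1))"
    unfolding Heun_P_def trace_def sum_2 a11 a22 by (simp add: diff_divide_distrib add_divide_distrib)
  have Q: "Heun_Q t \<alpha>' \<beta>' q z = det ?A + - \<beta> / z\<^sup>2 - ?A $ 1 $ 1 * (1 / z + 1 / (z - 1))"
    unfolding Heun_Q_def \<alpha> det_2 a11 a12 a21 a22 heun_corner_def using nz
    by (simp add: divide_simps power2_eq_square) (simp add: algebra_simps)
  have "?A $ 1 $ 2 \<noteq> 0" unfolding a12' using nz by simp
  then show ?thesis
    unfolding scalar_reduction_def b12 b11 P Q by (simp only: left_diff_distrib distrib_right mult.assoc simp_thms)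
qed

section \<open>From monodromy matrices to the trace formula\<close>

context two_loops
begin

text \<open>One change of basis \<open>C\<close> at \<open>x0\<close> conjugates the transports
  along both loops, hence also their product. Homotopy allows the given loops to be replaced by the
  simple ones.\<close>

lemma monodromy_matrix_product:
  fixes R :: "complex \<Rightarrow> complex^2^2"
  assumes x0: "x0 \<notin> S" and red: "\<forall>\<^sub>F z in nhds x0. scalar_reduction S R P Q z"
    and basis: "ode_basis_at P Q x0 y1 y2"
    and \<gamma>: "homotopic_paths (- S) \<gamma>a \<sigma>" "homotopic_paths (- S) \<gamma>b \<tau>"
    and M: "monodromy_matrix \<gamma>a y1 y2 Ma" "monodromy_matrix \<gamma>b y1 y2 Mb"
  shows "trace (Ma ** Mb) = trace (product_monodromy R)" "det (Ma ** Mb) = det (product_monodromy R)"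
proof -
  have S: "finite S" "S \<noteq> {}" by auto
  have path: "path \<gamma>a" "path \<gamma>b" using \<gamma> homotopic_paths_imp_path by blast+
  have im: "path_image \<gamma>a \<inter> S = {}" "path_image \<gamma>b \<inter> S = {}"
    using \<gamma> homotopic_paths_imp_subset by blast+
  have ends: "pathstart \<gamma>a = x0" "pathfinish \<gamma>a = x0" "pathstart \<gamma>b = x0" "pathfinish \<gamma>b = x0"
    using homotopic_paths_imp_pathstart[OF \<gamma>(1)] homotopic_paths_imp_pathfinish[OF \<gamma>(1)]
      homotopic_paths_imp_pathstart[OF \<gamma>(2)] homotopic_paths_imp_pathfinish[OF \<gamma>(2)] \<sigma>_simple \<tau>_simple by simp_all
  have nz: "\<forall>\<^sub>F z in nhds x0. fuchs S R z $ 1 $ 2 \<noteq> 0"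
    using red unfolding scalar_reduction_def by (rule eventually_mono) (elim conjE)
  have P: "\<forall>\<^sub>F z in nhds x0. P z * fuchs S R z $ 1 $ 2 =
       - trace (fuchs S R z) * fuchs S R z $ 1 $ 2 + (\<Sum>p\<in>S. R p $ 1 $ 2 / (z - p)\<^sup>2)"
    using red unfolding scalar_reduction_def by (rule eventually_mono) (elim conjE)
  have Q: "\<forall>\<^sub>F z in nhds x0. Q z * fuchs S R z $ 1 $ 2 =
       det (fuchs S R z) * fuchs S R z $ 1 $ 2
         + (\<Sum>p\<in>S. R p $ 1 $ 1 / (z - p)\<^sup>2) * fuchs S R z $ 1 $ 2
         - fuchs S R z $ 1 $ 1 * (\<Sum>p\<in>S. R p $ 1 $ 2 / (z - p)\<^sup>2)"
    using red unfolding scalar_reduction_def by (rule eventually_mono) (elim conjE)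
  obtain C where C: "det C \<noteq> 0" "\<And>\<gamma> M. \<lbrakk>path \<gamma>; path_image \<gamma> \<inter> S = {}; pathstart \<gamma> = x0; pathfinish \<gamma> = x0;
        monodromy_matrix \<gamma> y1 y2 M\<rbrakk> \<Longrightarrow> transport S R \<gamma> ** C = C ** M"
  proof (rule monodromy_matrix_transport[OF S x0 nz P Q basis])
    fix C assume C: "det C \<noteq> 0" "\<And>\<gamma> M. \<lbrakk>path \<gamma>; path_image \<gamma> \<inter> S = {}; pathstart \<gamma> = x0; pathfinish \<gamma> = x0;
        monodromy_matrix \<gamma> y1 y2 M\<rbrakk> \<Longrightarrow> transport S R \<gamma> ** C = C ** M"
    show thesis by (rule that[OF C])
  qed
  have a: "transport S R \<sigma> ** C = C ** Ma"
    using C(2)[OF path(1) im(1) ends(1,2) M(1)] unfolding transport_homotopic[OF S \<gamma>(1)] .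
  have b: "transport S R \<tau> ** C = C ** Mb"
    using C(2)[OF path(2) im(2) ends(3,4) M(2)] unfolding transport_homotopic[OF S \<gamma>(2)] .
  have "product_monodromy R ** C = C ** (Ma ** Mb)"
    unfolding product_monodromy_def matrix_mul_assoc[symmetric] b
    by (simp only: matrix_mul_assoc a)
  then show "trace (Ma ** Mb) = trace (product_monodromy R)" "det (Ma ** Mb) = det (product_monodromy R)"
    using trace_det_similar[OF _ C(1)] by metis+
qed

text \<open>The parameter runs from the given pair at 0 to the reference point at 1. There every
  residue of the first system has trace 1/4, so for any two of the punctures the product has
  determinant exp (\<pi> \<i>) = -1, which differs from 1.\<close>

theorem trace_power_middle_convolution:
  fixes B C Bt Ct :: "complex \<Rightarrow> complex \<Rightarrow> complex^2" and \<kappa> :: "complex \<Rightarrow> complex"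
  assumes "\<And>p i. p \<in> S \<Longrightarrow> (\<lambda>s. B s p $ i) holomorphic_on UNIV"
    and "\<And>p i. p \<in> S \<Longrightarrow> (\<lambda>s. C s p $ i) holomorphic_on UNIV"
    and "\<And>p i. p \<in> S \<Longrightarrow> (\<lambda>s. Bt s p $ i) holomorphic_on UNIV"
    and "\<And>p i. p \<in> S \<Longrightarrow> (\<lambda>s. Ct s p $ i) holomorphic_on UNIV"
    and "\<kappa> holomorphic_on UNIV"
    and "\<And>s p q. \<lbrakk>p \<in> S; q \<in> S\<rbrakk> \<Longrightarrow>
      (\<Sum>j\<in>UNIV. Ct s p $ j * Bt s q $ j) = (\<Sum>j\<in>UNIV. C s p $ j * B s q $ j) + (if p = q then \<kappa> s else 0)"
    and "\<kappa> 1 = 2" "\<And>p. p \<in> S \<Longrightarrow> trace (rank1 (B 1) (C 1) p) = 1 / 4"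
    and x0: "x0 \<notin> S"
    and red: "\<forall>\<^sub>F z in nhds x0. scalar_reduction S (rank1 (B 0) (C 0)) P' Q' z"
      "\<forall>\<^sub>F z in nhds x0. scalar_reduction S (rank1 (Bt 0) (Ct 0)) P Q z"
    and basis: "ode_basis_at P' Q' x0 v1 v2" "ode_basis_at P Q x0 y1 y2"
    and \<gamma>: "homotopic_paths (- S) \<gamma>a \<sigma>" "homotopic_paths (- S) \<gamma>b \<tau>"
    and M: "monodromy_matrix \<gamma>a v1 v2 Ma'" "monodromy_matrix \<gamma>b v1 v2 Mb'"
      "monodromy_matrix \<gamma>a y1 y2 Ma" "monodromy_matrix \<gamma>b y1 y2 Mb"
  shows "trace (matrix_power_int (Ma ** Mb) n)
    = exp (of_int n * (2 * of_real pi * \<i> * \<kappa> 0)) * trace (matrix_power_int (Ma' ** Mb') n)"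
proof (rule trace_matrix_power_int)
  have "2 * of_real pi * \<i> * (1 / 4 + 1 / 4) = of_real pi * \<i>" by simp
  then have "exp (2 * of_real pi * \<i> * (1 / 4 + 1 / 4)) = - 1" by (simp only: exp_pi_i)
  then have "exp (2 * of_real pi * \<i> * (trace (rank1 (B 1) (C 1) a) + trace (rank1 (B 1) (C 1) b))) \<noteq> 1"
    using assms(8)[of a] assms(8)[of b] by (simp only: insert_iff simp_thms) simp
  note * = trace_middle_convolution[OF assms(1-7) this, of 0]
  note M' = monodromy_matrix_product[OF x0 red(1) basis(1) \<gamma> M(1,2)]
    and M = monodromy_matrix_product[OF x0 red(2) basis(2) \<gamma> M(3,4)]
  show "trace (Ma ** Mb) = exp (2 * of_real pi * \<i> * \<kappa> 0) * trace (Ma' ** Mb')" unfolding M M' by (rule *)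
  show "det (Ma ** Mb) = exp (2 * of_real pi * \<i> * \<kappa> 0) ^ 2 * det (Ma' ** Mb')" unfolding M M' by (rule *)
  show "det (Ma' ** Mb') \<noteq> 0" unfolding M' det_product_monodromy by simp
qed

end

section \<open>Lines of parameters for the two kinds of equations\<close>

lemma holomorphic_apparent:
  assumes h: "\<And>p. (\<lambda>s. h s p) holomorphic_on UNIV" and k: "k holomorphic_on UNIV"
    and t: "t \<noteq> 0" "t \<noteq> 1" and l: "l \<notin> {0, 1, t}" "l \<noteq> l'" and p: "p \<in> {0, 1, t}"
  shows "(\<lambda>s. apparent_row t (h s) (k s) l l' p $ i) holomorphic_on UNIV"
    and "(\<lambda>s. apparent_column t (h s) (k s) l l' p $ i) holomorphic_on UNIV"
proof -
  have "l \<noteq> 0" "l - 1 \<noteq> 0" "l - t \<noteq> 0" "l - l' \<noteq> 0" using l by auto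
  then have m: "(\<lambda>s. apparent_slope t (h s) (k s) l l') holomorphic_on UNIV"
    unfolding apparent_slope_def by (intro holomorphic_intros h k) auto
  have r: "(\<lambda>s. apparent_diag t (h s) (k s) l l' p) holomorphic_on UNIV"
    unfolding apparent_diag_def Let_def
    by (cases "p = 0"; cases "p = 1"; simp) (intro holomorphic_intros h k m)+
  have i: "i = 1 \<or> i = 2" using exhaust_2 by blast
  show "(\<lambda>s. apparent_row t (h s) (k s) l l' p $ i) holomorphic_on UNIV"
    using i r unfolding apparent_row_def by auto
  have "(\<lambda>s. (h s p - apparent_diag t (h s) (k s) l l' p) / apparent_weight t l p) holomorphic_on UNIV"
    by (intro holomorphic_intros h r) (use apparent_weight_nonzero[OF t l(1) p] in auto)
  then show "(\<lambda>s. apparent_column t (h s) (k s) l l' p $ i) holomorphic_on UNIV"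
    using i unfolding apparent_column_def by auto
qed

lemma holomorphic_heun:
  assumes e: "e0 holomorphic_on UNIV" "e1 holomorphic_on UNIV" "et holomorphic_on UNIV"
    and \<beta>: "\<beta> holomorphic_on UNIV" and q: "q holomorphic_on UNIV"
  shows "(\<lambda>s. heun_row t (e0 s) (e1 s) (et s) (\<beta> s) (q s) p $ i) holomorphic_on UNIV"
    and "(\<lambda>s. heun_column (e0 s) (e1 s) (\<beta> s) p $ i) holomorphic_on UNIV"
proof -
  have i: "i = 1 \<or> i = 2" using exhaust_2 by blast
  have "(\<lambda>s. heun_corner t (e0 s) (e1 s) (et s) (\<beta> s) (q s)) holomorphic_on UNIV"
    unfolding heun_corner_def by (intro holomorphic_intros e \<beta> q)
  then show "(\<lambda>s. heun_row t (e0 s) (e1 s) (et s) (\<beta> s) (q s) p $ i) holomorphic_on UNIV"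
    using i e \<beta> unfolding heun_row_def by (cases "p = 0"; cases "p = 1") (auto intro!: holomorphic_intros)
  show "(\<lambda>s. heun_column (e0 s) (e1 s) (\<beta> s) p $ i) holomorphic_on UNIV"
    using i e \<beta> unfolding heun_column_def by (cases "p = 0"; cases "p = 1") (auto intro!: holomorphic_intros)
qed

lemma eventually_notin_finite:
  fixes x :: "'a::t1_space"
  assumes "finite F" "x \<notin> F" shows "\<forall>\<^sub>F z in nhds x. z \<notin> F"
  using eventually_nhds_in_open[OF open_Compl[OF finite_imp_closed[OF assms(1)]], of x] assms(2) by simp

context two_loops
begin

lemma Dy1_trace:
  assumes S01: "{a, b, c} = {0, 1, t}" and t: "t \<noteq> 0" "t \<noteq> 1" and x0: "x0 \<notin> {0, 1, t}" "x0 \<noteq> l" "x0 \<noteq> l'"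
    and l: "l \<notin> {0, 1, t}" "l' \<notin> {0, 1, t}" "l' \<noteq> l"
    and k2: "k2 = kappa2 h0 h1 ht hi"
    and m: "m = h0 / l + h1 / (l - 1) + ht / (l - t) + k2 / (l - l')"
    and m': "m' = (k2 + h0) / l' + (k2 + h1) / (l' - 1) + (k2 + ht) / (l' - t) + k2 / (l - l')"
    and basis: "Dy1_basis_at t h0 h1 ht hi l m x0 v1 v2"
      "Dy1_basis_at t (k2 + h0) (k2 + h1) (k2 + ht) (k2 + hi) l' m' x0 y1 y2"
    and \<gamma>: "homotopic_paths (- S) \<gamma>a \<sigma>" "homotopic_paths (- S) \<gamma>b \<tau>"
    and M: "monodromy_matrix \<gamma>a v1 v2 Ma'" "monodromy_matrix \<gamma>b v1 v2 Mb'"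
      "monodromy_matrix \<gamma>a y1 y2 Ma" "monodromy_matrix \<gamma>b y1 y2 Mb"
  shows "trace (matrix_power_int (Ma ** Mb) n)
    = exp (of_int n * (2 * of_real pi * \<i> * k2)) * trace (matrix_power_int (Ma' ** Mb') n)"
proof -
  define h where "h = (\<lambda>p::complex. if p = 0 then h0 else if p = 1 then h1 else ht)"
  have h: "h 0 = h0" "h 1 = h1" "h t = ht" using t by (simp_all add: h_def)
  text \<open>A line of parameters from the given equation to one with \<open>\<kappa> = 2\<close> and all traces \<open>1 / 4\<close>.\<close>
  define g where "g = (\<lambda>s p. h p + s * (1 / 4 - h p))"
  define k where "k = (\<lambda>s. k2 + s * (2 - k2))"
  have g: "(\<lambda>s. g s p) holomorphic_on UNIV" and k: "k holomorphic_on UNIV" for p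
    unfolding g_def k_def by (intro holomorphic_intros)+
  have gk: "(\<lambda>s. g s p + k s) holomorphic_on UNIV" "(\<lambda>s. - k s) holomorphic_on UNIV" for p
    by (intro holomorphic_intros g k)+
  have g0: "g 0 = h" "k 0 = k2" "k 1 = 2" "g 1 = (\<lambda>_. 1 / 4)" by (simp_all add: g_def k_def)
  have ev: "\<forall>\<^sub>F z in nhds x0. z \<notin> {0, 1, t, l, l'}" using x0 by (intro eventually_notin_finite) auto
  \<comment> \<open>Both the residue parameter and the difference of positions change sign, which
    identifies the given \<open>m'\<close> with the slope of the second system.\<close>
  have "- k2 / (l' - l) = k2 / (l - l')" using l by (simp add: divide_simps) (simp add: algebra_simps)
  then have m'': "m' = apparent_slope t (\<lambda>p. h p + k2) (- k2) l' l"
    by (simp add: apparent_slope_def h m' add.commute)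
  have k2': "- k2 = kappa2 (h 0 + k2) (h 1 + k2) (h t + k2) (k2 + hi)"
    by (simp add: h k2 kappa2_def field_simps)
  have "trace (matrix_power_int (Ma ** Mb) n)
    = exp (of_int n * (2 * of_real pi * \<i> * k 0)) * trace (matrix_power_int (Ma' ** Mb') n)"
  proof (rule trace_power_middle_convolution[OF _ _ _ _ k _ _ _ _ _ _ _ _ \<gamma> M])
    fix p i assume "p \<in> S"
    then have p: "p \<in> {0, 1, t}" unfolding S01 .
    show "(\<lambda>s. apparent_column t (g s) (k s) l l' p $ i) holomorphic_on UNIV"
      "(\<lambda>s. apparent_row t (g s) (k s) l l' p $ i) holomorphic_on UNIV"
      using holomorphic_apparent[where h = g, OF g k t l(1) l(3)[symmetric] p] by blast+
    show "(\<lambda>s. apparent_column t (\<lambda>p. g s p + k s) (- k s) l' l p $ i) holomorphic_on UNIV"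
      "(\<lambda>s. apparent_row t (\<lambda>p. g s p + k s) (- k s) l' l p $ i) holomorphic_on UNIV"
      using holomorphic_apparent[where h = "\<lambda>s p. g s p + k s", OF gk t l(2) l(3) p] by blast+
  next
    fix s p q assume "p \<in> S" "q \<in> S"
    then show "(\<Sum>j\<in>UNIV. apparent_row t (\<lambda>p. g s p + k s) (- k s) l' l p $ j * apparent_column t (\<lambda>p. g s p + k s) (- k s) l' l q $ j)
      = (\<Sum>j\<in>UNIV. apparent_row t (g s) (k s) l l' p $ j * apparent_column t (g s) (k s) l l' q $ j) + (if p = q then k s else 0)"
      unfolding S01 by (rule apparent_dot_shift[OF t l(1,2) l(3)[symmetric]])
  next
    fix p assume "p \<in> S"
    then have "(\<Sum>j\<in>UNIV. apparent_row t (g 1) (k 1) l l' p $ j * apparent_column t (g 1) (k 1) l l' p $ j) = g 1 p"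
      unfolding S01 by (rule apparent_dot_diag[OF t l(1)])
    then show "trace (rank1 (apparent_column t (g 1) (k 1) l l') (apparent_row t (g 1) (k 1) l l') p) = 1 / 4"
      by (simp add: trace_def rank1_def g0 mult.commute)
  next
    show "\<forall>\<^sub>F z in nhds x0. scalar_reduction S (rank1 (apparent_column t (g 0) (k 0) l l') (apparent_row t (g 0) (k 0) l l'))
      (Dy1_P t h0 h1 ht l) (Dy1_Q t h0 h1 ht hi l m) z"
      using ev unfolding S01 g0
    proof eventually_elim
      case (elim z)
      then show ?case
        using apparent_reduction[OF t l(1), of z k2 h hi m l'] k2 m by (simp add: h apparent_slope_def)
    qed
    show "\<forall>\<^sub>F z in nhds x0. scalar_reduction S (rank1 (apparent_column t (\<lambda>p. g 0 p + k 0) (- k 0) l' l) (apparent_row t (\<lambda>p. g 0 p + k 0) (- k 0) l' l))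
      (Dy1_P t (k2 + h0) (k2 + h1) (k2 + ht) l') (Dy1_Q t (k2 + h0) (k2 + h1) (k2 + ht) (k2 + hi) l' m') z"
      using ev unfolding S01 g0
    proof eventually_elim
      case (elim z)
      then show ?case
        using apparent_reduction[OF t l(2), of z "- k2" "\<lambda>p. h p + k2" "k2 + hi" m' l] k2' m''
        by (simp add: h add.commute)
    qed
  qed (use x0 S01 basis in \<open>auto simp: g0 Dy1_basis_at_def\<close>)
  then show ?thesis unfolding g0 .
qed

lemma Heun_trace:
  assumes S01: "{a, b, c} = {0, 1, t}" and t: "t \<noteq> 0" "t \<noteq> 1" and x0: "x0 \<notin> {0, 1, t}"
    and \<kappa>: "e0 + e1 + et = 2 + \<beta> - \<kappa>"
    and \<alpha>: "A * A' = (1 - \<kappa>) * \<beta>" "C * C' = (1 + \<kappa>) * (\<beta> + \<kappa>)"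
    and q': "q' = q + \<kappa> * (et + e1 * t + (e0 - 1 + \<kappa>) * (t + 1))"
    and basis: "Heun_basis_at t (e0 + \<kappa>) (e1 + \<kappa>) (et + \<kappa>) C C' q' x0 v1 v2"
      "Heun_basis_at t e0 e1 et A A' q x0 y1 y2"
    and \<gamma>: "homotopic_paths (- S) \<gamma>a \<sigma>" "homotopic_paths (- S) \<gamma>b \<tau>"
    and M: "monodromy_matrix \<gamma>a v1 v2 Ma'" "monodromy_matrix \<gamma>b v1 v2 Mb'"
      "monodromy_matrix \<gamma>a y1 y2 Ma" "monodromy_matrix \<gamma>b y1 y2 Mb"
  shows "trace (matrix_power_int (Ma ** Mb) n)
    = exp (of_int n * (2 * of_real pi * \<i> * \<kappa>)) * trace (matrix_power_int (Ma' ** Mb') n)"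
proof -
  define k where "k = (\<lambda>s. \<kappa> + s * (2 - \<kappa>))"
  \<comment> \<open>At s = 1 the shifted exponents have to be 3/4, 3/4, -1/4 in order that 1 - e0',
    1 - e1' and - et' be 1/4. As \<kappa> = 2 there, the unshifted ones are smaller by 2.\<close>
  define f0 f1 ft where "f0 = (\<lambda>s. e0 + s * (- 5 / 4 - e0))" and "f1 = (\<lambda>s. e1 + s * (- 5 / 4 - e1))"
    and "ft = (\<lambda>s. et + s * (- 9 / 4 - et))"
  \<comment> \<open>Along the line the accessory parameter of the unprimed equation stays fixed; the
    second exponent and the primed accessory parameter are then forced by the conditions of
    \<open>heun_dot_shift\<close>.\<close>
  define g where "g = (\<lambda>s. f0 s + f1 s + ft s - 2 + k s)"
  define q'' where "q'' = (\<lambda>s. q + k s * (ft s + f1 s * t + (f0 s - 1 + k s) * (t + 1)))"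
  have hol: "f0 holomorphic_on UNIV" "f1 holomorphic_on UNIV" "ft holomorphic_on UNIV" "k holomorphic_on UNIV"
    unfolding f0_def f1_def ft_def k_def by (intro holomorphic_intros)+
  have hol': "g holomorphic_on UNIV" "q'' holomorphic_on UNIV" "(\<lambda>s. f0 s + k s) holomorphic_on UNIV"
    "(\<lambda>s. f1 s + k s) holomorphic_on UNIV" "(\<lambda>s. ft s + k s) holomorphic_on UNIV"
    "(\<lambda>_. q) holomorphic_on (UNIV :: complex set)"
    unfolding g_def q''_def by (intro holomorphic_intros hol)+
  have hol'': "(\<lambda>s. g s + k s) holomorphic_on UNIV" by (intro holomorphic_intros hol hol')
  have at0: "f0 0 = e0" "f1 0 = e1" "ft 0 = et" "k 0 = \<kappa>" "q'' 0 = q'" "g 0 = \<beta>"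
    using \<kappa> by (simp_all add: f0_def f1_def ft_def k_def g_def q''_def q' algebra_simps)
  have at1: "f0 1 + k 1 = 3 / 4" "f1 1 + k 1 = 3 / 4" "ft 1 + k 1 = - 1 / 4" "k 1 = 2"
    by (simp_all add: f0_def f1_def ft_def k_def)
  have ev: "\<forall>\<^sub>F z in nhds x0. z \<notin> {0, 1, t}" using x0 by (intro eventually_notin_finite) auto
  have "trace (matrix_power_int (Ma ** Mb) n)
    = exp (of_int n * (2 * of_real pi * \<i> * k 0)) * trace (matrix_power_int (Ma' ** Mb') n)"
  proof (rule trace_power_middle_convolution[OF _ _ _ _ hol(4) _ _ _ _ _ _ _ _ \<gamma> M])
    fix p i
    show "(\<lambda>s. heun_column (f0 s + k s) (f1 s + k s) (g s + k s) p $ i) holomorphic_on UNIV"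
      "(\<lambda>s. heun_row t (f0 s + k s) (f1 s + k s) (ft s + k s) (g s + k s) (q'' s) p $ i) holomorphic_on UNIV"
      using holomorphic_heun[OF hol'(3-5) hol'' hol'(2)] by blast+
    show "(\<lambda>s. heun_column (f0 s) (f1 s) (g s) p $ i) holomorphic_on UNIV"
      "(\<lambda>s. heun_row t (f0 s) (f1 s) (ft s) (g s) q p $ i) holomorphic_on UNIV"
      using holomorphic_heun[OF hol(1-3) hol'(1,6)] by blast+
  next
    fix s p r assume "p \<in> S" "r \<in> S"
    then show "(\<Sum>j\<in>UNIV. heun_row t (f0 s) (f1 s) (ft s) (g s) q p $ j * heun_column (f0 s) (f1 s) (g s) r $ j)
      = (\<Sum>j\<in>UNIV. heun_row t (f0 s + k s) (f1 s + k s) (ft s + k s) (g s + k s) (q'' s) p $ j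
            * heun_column (f0 s + k s) (f1 s + k s) (g s + k s) r $ j) + (if p = r then k s else 0)"
      unfolding S01 by (rule heun_dot_shift[OF t _ _ g_def[THEN fun_cong] q''_def[THEN fun_cong]])
  next
    fix p assume "p \<in> S"
    then have "p = 0 \<or> p = 1 \<or> p = t" unfolding S01 by simp
    then show "trace (rank1 (heun_column (f0 1 + k 1) (f1 1 + k 1) (g 1 + k 1))
        (heun_row t (f0 1 + k 1) (f1 1 + k 1) (ft 1 + k 1) (g 1 + k 1) (q'' 1)) p) = 1 / 4"
      by (elim disjE) (simp_all only: trace_heun[OF t] at1(1-3), simp_all)
  next
    show "\<forall>\<^sub>F z in nhds x0. scalar_reduction S (rank1 (heun_column (f0 0 + k 0) (f1 0 + k 0) (g 0 + k 0))
        (heun_row t (f0 0 + k 0) (f1 0 + k 0) (ft 0 + k 0) (g 0 + k 0) (q'' 0)))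
      (Heun_P t (e0 + \<kappa>) (e1 + \<kappa>) (et + \<kappa>)) (Heun_Q t C C' q') z"
      using ev unfolding S01 at0
    proof eventually_elim
      case (elim z)
      have "e0 + \<kappa> + (e1 + \<kappa>) + (et + \<kappa>) - 1 - (\<beta> + \<kappa>) = 1 + \<kappa>" using \<kappa> by algebra
      then show ?case by (intro heun_reduction[OF t elim]) (simp only: \<alpha>)
    qed
    show "\<forall>\<^sub>F z in nhds x0. scalar_reduction S (rank1 (heun_column (f0 0) (f1 0) (g 0))
        (heun_row t (f0 0) (f1 0) (ft 0) (g 0) q)) (Heun_P t e0 e1 et) (Heun_Q t A A' q) z"
      using ev unfolding S01 at0
    proof eventually_elim
      case (elim z)
      have "e0 + e1 + et - 1 - \<beta> = 1 - \<kappa>" using \<kappa> by algebra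
      then show ?case by (intro heun_reduction[OF t elim]) (simp only: \<alpha>)
    qed
  qed (use x0 S01 basis at1 in \<open>auto simp: at0 Heun_basis_at_def\<close>)
  then show ?thesis unfolding at0 .
qed

end

section \<open>The trace identities for both pairs of equations\<close>

theorem theorem3p4:
  fixes t a b x0 :: complex and \<gamma> :: "complex \<Rightarrow> real \<Rightarrow> complex"
  assumes "t \<noteq> 0" and "t \<noteq> 1"
    and "a \<in> {0, 1, t}" and "b \<in> {0, 1, t}" and "a \<noteq> b"
    and "loop_system {0, 1, t} {a, b} x0 \<gamma>"
  shows
    "(\<forall>h0 h1 ht hi l m k2 l' m' :: complex.
        \<forall>y1 y2 v1 v2 :: complex \<Rightarrow> complex. \<forall>M M' :: complex \<Rightarrow> complex^2^2.
        l \<notin> {0, 1, t} \<longrightarrow>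
        k2 = kappa2 h0 h1 ht hi \<longrightarrow>
        m - h0 / l - h1 / (l - 1) - ht / (l - t) \<noteq> 0 \<longrightarrow>
        l' = l - k2 / (m - h0 / l - h1 / (l - 1) - ht / (l - t)) \<longrightarrow>
        l' \<notin> {0, 1, t} \<longrightarrow> l' \<noteq> l \<longrightarrow>
        m' = (k2 + h0) / l' + (k2 + h1) / (l' - 1) + (k2 + ht) / (l' - t) + k2 / (l - l') \<longrightarrow>
        (\<forall>p\<in>{a, b}. l \<notin> path_image (\<gamma> p) \<and> l' \<notin> path_image (\<gamma> p)) \<longrightarrow>
        Dy1_basis_at t h0 h1 ht hi l m x0 v1 v2 \<longrightarrow>
        (\<forall>p\<in>{a, b}. monodromy_matrix (\<gamma> p) v1 v2 (M' p)) \<longrightarrow>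
        Dy1_basis_at t (k2 + h0) (k2 + h1) (k2 + ht) (k2 + hi) l' m' x0 y1 y2 \<longrightarrow>
        (\<forall>p\<in>{a, b}. monodromy_matrix (\<gamma> p) y1 y2 (M p)) \<longrightarrow>
        (\<forall>n :: int. trace (matrix_power_int (M a ** M b) n)
           = exp (2 * of_real pi * \<i> * of_int n * k2)
             * trace (matrix_power_int (M' a ** M' b) n)))
   \<and>
     (\<forall>\<alpha> \<beta> e0 e1 et q \<eta> \<alpha>' \<beta>' e0' e1' et' q' :: complex.
        \<forall>y1 y2 v1 v2 :: complex \<Rightarrow> complex. \<forall>M M' :: complex \<Rightarrow> complex^2^2.
        e0 + e1 + et = \<alpha> + \<beta> + 1 \<longrightarrow>
        \<eta> \<in> {\<alpha>, \<beta>} \<longrightarrow>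
        e0' = e0 - \<eta> + 1 \<longrightarrow> e1' = e1 - \<eta> + 1 \<longrightarrow> et' = et - \<eta> + 1 \<longrightarrow>
        {\<alpha>', \<beta>'} = {2 - \<eta>, \<alpha> + \<beta> - 2 * \<eta> + 1} \<longrightarrow>
        q' = q + (1 - \<eta>) * (et + e1 * t + (e0 - \<eta>) * (t + 1)) \<longrightarrow>
        Heun_basis_at t e0' e1' et' \<alpha>' \<beta>' q' x0 v1 v2 \<longrightarrow>
        (\<forall>p\<in>{a, b}. monodromy_matrix (\<gamma> p) v1 v2 (M' p)) \<longrightarrow>
        Heun_basis_at t e0 e1 et \<alpha> \<beta> q x0 y1 y2 \<longrightarrow>
        (\<forall>p\<in>{a, b}. monodromy_matrix (\<gamma> p) y1 y2 (M p)) \<longrightarrow>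
        (\<forall>n :: int. trace (matrix_power_int (M a ** M b) n)
           = exp (- 2 * of_real pi * \<i> * of_int n * \<eta>)
             * trace (matrix_power_int (M' a ** M' b) n)))"
proof -
  have "\<not> {0, 1, t} \<subseteq> {a, b}"
  proof
    assume "{0, 1, t} \<subseteq> {a, b}"
    then have "card {0, 1, t} \<le> card {a, b}" by (intro card_mono) auto
    then show False using assms(1,2,5) by simp
  qed
  then obtain c where c: "c \<in> {0, 1, t}" "c \<noteq> a" "c \<noteq> b" by blast
  have S01: "{a, b, c} = {0, 1, t}"
    by (rule card_subset_eq) (use assms(1-5) c in auto)
  obtain \<sigma> where loops: "\<And>p. p \<in> {a, b} \<Longrightarrow> simple_loop_around {0, 1, t} x0 p (\<sigma> p)"
    "\<And>p. p \<in> {a, b} \<Longrightarrow> homotopic_paths (- {0, 1, t}) (\<gamma> p) (\<sigma> p)"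
    and touch: "path_image (\<sigma> a) \<inter> path_image (\<sigma> b) = {x0}"
    using assms(5,6) unfolding loop_system_def by blast
  interpret two_loops a b c x0 "\<sigma> a" "\<sigma> b"
    by unfold_locales (use assms(5) c loops touch in \<open>auto simp: S01\<close>)
  have x0: "x0 \<in> path_image (\<gamma> a)" "x0 \<notin> {0, 1, t}"
  proof -
    have "pathstart (\<gamma> a) = x0"
      using homotopic_paths_imp_pathstart[OF loops(2), of a] \<sigma>_simple by simp
    then show "x0 \<in> path_image (\<gamma> a)" by (metis pathstart_in_path_image)
    have "x0 \<in> path_image (\<sigma> a)" using touch by blast
    then show "x0 \<notin> {0, 1, t}" using \<sigma>_simple(5) unfolding S01 by blast
  qed
  have hom: "homotopic_paths (- {a, b, c}) (\<gamma> a) (\<sigma> a)" "homotopic_paths (- {a, b, c}) (\<gamma> b) (\<sigma> b)"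
    unfolding S01 by (rule loops(2), simp)+
  note Dy1 = Dy1_trace[OF S01 assms(1,2) x0(2) _ _ _ _ _ _ _ _ _ _ hom]
    and Heun = Heun_trace[OF S01 assms(1,2) x0(2) _ _ _ _ _ _ hom]
  show ?thesis
  proof (intro conjI allI impI)
    fix h0 h1 ht hi l m k2 l' m' :: complex and y1 y2 v1 v2 :: "complex \<Rightarrow> complex"
      and M M' :: "complex \<Rightarrow> complex^2^2" and n :: int
    assume *: "l \<notin> {0, 1, t}" "k2 = kappa2 h0 h1 ht hi"
      "m - h0 / l - h1 / (l - 1) - ht / (l - t) \<noteq> 0"
      "l' = l - k2 / (m - h0 / l - h1 / (l - 1) - ht / (l - t))" "l' \<notin> {0, 1, t}" "l' \<noteq> l"
      "m' = (k2 + h0) / l' + (k2 + h1) / (l' - 1) + (k2 + ht) / (l' - t) + k2 / (l - l')"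
      and avoid: "\<forall>p\<in>{a, b}. l \<notin> path_image (\<gamma> p) \<and> l' \<notin> path_image (\<gamma> p)"
      and v: "Dy1_basis_at t h0 h1 ht hi l m x0 v1 v2" "\<forall>p\<in>{a, b}. monodromy_matrix (\<gamma> p) v1 v2 (M' p)"
      and y: "Dy1_basis_at t (k2 + h0) (k2 + h1) (k2 + ht) (k2 + hi) l' m' x0 y1 y2"
        "\<forall>p\<in>{a, b}. monodromy_matrix (\<gamma> p) y1 y2 (M p)"
    let ?d = "m - h0 / l - h1 / (l - 1) - ht / (l - t)"
    \<comment> \<open>The two positions differ, so \<open>k2\<close> is not 0 and the definition of
      \<open>l'\<close> can be solved for \<open>m\<close>.\<close>
    have "k2 \<noteq> 0" using *(4,6) by auto
    moreover have "l - l' = k2 / ?d" using *(4) by simp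
    ultimately have "k2 / (l - l') = ?d" using *(3) by simp
    then have m: "m = h0 / l + h1 / (l - 1) + ht / (l - t) + k2 / (l - l')" by simp
    have "trace (matrix_power_int (M a ** M b) n)
      = exp (of_int n * (2 * of_real pi * \<i> * k2)) * trace (matrix_power_int (M' a ** M' b) n)"
      by (rule Dy1[OF _ _ *(1,5,6,2) m *(7) v(1) y(1)]) (use x0(1) avoid v(2) y(2) in auto)
    then show "trace (matrix_power_int (M a ** M b) n)
      = exp (2 * of_real pi * \<i> * of_int n * k2) * trace (matrix_power_int (M' a ** M' b) n)"
      by (simp add: mult_ac)
  next
    fix \<alpha> \<beta> e0 e1 et q \<eta> \<alpha>' \<beta>' e0' e1' et' q' :: complex and y1 y2 v1 v2 :: "complex \<Rightarrow> complex"
      and M M' :: "complex \<Rightarrow> complex^2^2" and n :: int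
    assume e: "e0 + e1 + et = \<alpha> + \<beta> + 1" and \<eta>: "\<eta> \<in> {\<alpha>, \<beta>}"
      and e': "e0' = e0 - \<eta> + 1" "e1' = e1 - \<eta> + 1" "et' = et - \<eta> + 1"
      and \<alpha>': "{\<alpha>', \<beta>'} = {2 - \<eta>, \<alpha> + \<beta> - 2 * \<eta> + 1}"
      and q': "q' = q + (1 - \<eta>) * (et + e1 * t + (e0 - \<eta>) * (t + 1))"
      and v: "Heun_basis_at t e0' e1' et' \<alpha>' \<beta>' q' x0 v1 v2" "\<forall>p\<in>{a, b}. monodromy_matrix (\<gamma> p) v1 v2 (M' p)"
      and y: "Heun_basis_at t e0 e1 et \<alpha> \<beta> q x0 y1 y2" "\<forall>p\<in>{a, b}. monodromy_matrix (\<gamma> p) y1 y2 (M p)"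
    define \<kappa> where "\<kappa> = 1 - \<eta>"
    \<comment> \<open>The other one of \<alpha> and \<beta>; it is the parameter called \<beta> in
      the system for Heun's equation.\<close>
    define \<xi> where "\<xi> = \<alpha> + \<beta> - \<eta>"
    have \<kappa>: "e0 + e1 + et = 2 + \<xi> - \<kappa>" unfolding \<kappa>_def \<xi>_def e by simp
    have p: "\<alpha> * \<beta> = (1 - \<kappa>) * \<xi>" using \<eta> by (auto simp: \<kappa>_def \<xi>_def)
    have "\<alpha>' * \<beta>' = (2 - \<eta>) * (\<alpha> + \<beta> - 2 * \<eta> + 1)"
      using \<alpha>' by (auto simp: doubleton_eq_iff)
    then have p': "\<alpha>' * \<beta>' = (1 + \<kappa>) * (\<xi> + \<kappa>)" by (simp add: \<kappa>_def \<xi>_def algebra_simps)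
    have q: "q' = q + \<kappa> * (et + e1 * t + (e0 - 1 + \<kappa>) * (t + 1))" unfolding q' \<kappa>_def by simp
    have e'': "e0' = e0 + \<kappa>" "e1' = e1 + \<kappa>" "et' = et + \<kappa>" by (simp_all add: e' \<kappa>_def)
    have "trace (matrix_power_int (M a ** M b) n)
      = exp (of_int n * (2 * of_real pi * \<i> * \<kappa>)) * trace (matrix_power_int (M' a ** M' b) n)"
      by (rule Heun[OF \<kappa> p p' q v(1)[unfolded e''] y(1)]) (use v(2) y(2) in auto)
    \<comment> \<open>The factor has the exponent \<kappa> = 1 - \<eta>, and the summand 1
      contributes exp (2 \<pi> \<i> n) = 1.\<close>
    moreover have "exp (of_int n * (2 * of_real pi * \<i> * \<kappa>)) = exp (- 2 * of_real pi * \<i> * of_int n * \<eta>)"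
    proof -
      have "of_int n * (2 * of_real pi * \<i> * \<kappa>) = 2 * of_int n * of_real pi * \<i> + - 2 * of_real pi * \<i> * of_int n * \<eta>"
        by (simp add: \<kappa>_def algebra_simps)
      moreover have "exp (2 * of_int n * of_real pi * \<i> :: complex) = 1"
        using exp_integer_2pi[of "of_int n"] by simp
      ultimately show ?thesis by (simp only: exp_add mult_1)
    qed
    ultimately show "trace (matrix_power_int (M a ** M b) n)
      = exp (- 2 * of_real pi * \<i> * of_int n * \<eta>) * trace (matrix_power_int (M' a ** M' b) n)" by simp
  qed
qed


end
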